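(* Let $(J^s)_{s\in(1/2,1)}$ satisfy Hypothesis (H1) below with constant $\delta>0$, let $0\le k<m<1$ and $\theta=\frac{m-k}{m+d/2}$. Let $u_0,v_0\in L^1_k$ be probability densities, let $u^s_\varepsilon$ be the solution of $\partial_tu=\varepsilon^{-2s}(J^s_\varepsilon*u-u)+\mathrm{div}(xu)$ with $u(0)=u_0$, and $v^s$ the solution of $\partial_tv=-(-\Delta)^sv+\mathrm{div}(xv)$ with $v(0)=v_0$. Then for all $\varepsilon\in(0,1]$ there exists $T>0$ such that for all $t\ge T$ $$\|u^s_\varepsilon(t)-v^s(t)\|_{L^1_k}\le C\varepsilon^{\theta\delta},$$ with a constant $C$ independent of $s$.
   Context: $\langle x\rangle=(1+|x|^2)^{1/2}$; $\|f\|_{L^1_k}=\int\langle x\rangle^k|f|$; $(-\Delta)^s$ the Fourier multiplier with symbol $|\xi|^{2s}$; $\hat f(\xi)=\int e^{-ix\cdot\xi}f$; $J^s_\varepsilon(x)=\varepsilon^{-d}J^s(x/\varepsilon)$; solutions are mild solutions in $C([0,\infty);L^1_k)$. Hypothesis (H1): $(J^s)_{s\in(1/2,1)}$ is a family of probability densities on $\mathbb{R}^d$ with $J^s\in L^1\cap L^p$ for some $p\in(1,\infty]$, such that (i) $\int\min\{1,|y|^2\}J^s<\infty$; (ii) there exist $\delta,C_0>0$ independent of $s$ with $\hat J^s(\xi)=1-|\xi|^{2s}+R_s(\xi)$, $|R_s(\xi)|\le C_0|\xi|^{2s+\delta}$ for $|\xi|\le1$; (iii) there exist $C,R>0$, $\Psi$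 with $\int(1+|x|^2)|\Psi|<\infty$, $\int x\Psi=0$, independent of $s$, with $J^s(x)\le C(1-s)|x|^{-d-2s}+\Psi(x)$ for $|x|\ge R$. *)

theory Defs
  imports "HOL-Analysis.Analysis"
begin

definition jbr :: "'a::euclidean_space \<Rightarrow> real" where
  "jbr x = sqrt (1 + (norm x)\<^sup>2)"

definition L1k_norm :: "real \<Rightarrow> ('a::euclidean_space \<Rightarrow> real) \<Rightarrow> real" where
  "L1k_norm k f = (LINT x|lborel. jbr x powr k * \<bar>f x\<bar>)"

definition in_L1k :: "real \<Rightarrow> ('a::euclidean_space \<Rightarrow> real) \<Rightarrow> bool" where
  "in_L1k k f \<longleftrightarrow> f \<in> borel_measurable lborel \<and>
      integrable lborel (\<lambda>x. jbr x powr k * f x)"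

definition prob_density :: "('a::euclidean_space \<Rightarrow> real) \<Rightarrow> bool" where
  "prob_density f \<longleftrightarrow> f \<in> borel_measurable lborel \<and> (\<forall>x. 0 \<le> f x) \<and>
      integrable lborel f \<and> (LINT x|lborel. f x) = 1"

definition fourier :: "('a::euclidean_space \<Rightarrow> real) \<Rightarrow> 'a \<Rightarrow> complex" where
  "fourier f \<xi> = (LINT x|lborel. exp (- \<i> * complex_of_real (x \<bullet> \<xi>)) * complex_of_real (f x))"

definition rescale :: "('a::euclidean_space \<Rightarrow> real) \<Rightarrow> real \<Rightarrow> 'a \<Rightarrow> real" where
  "rescale J \<epsilon> x = \<epsilon> powr (- real DIM('a)) * J ((1 / \<epsilon>) *\<^sub>R x)"

primrec Ck :: "nat \<Rightarrow> ('a::euclidean_space \<Rightarrow> real) \<Rightarrow> bool" where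
  "Ck 0 f = continuous_on UNIV f"
| "Ck (Suc n) f = (continuous_on UNIV f \<and>
     (\<forall>i\<in>Basis. \<exists>g. (\<forall>x. ((\<lambda>h. f (x + h *\<^sub>R i)) has_real_derivative g x) (at 0)) \<and> Ck n g))"

definition test_fun :: "('a::euclidean_space \<Rightarrow> real) \<Rightarrow> bool" where
  "test_fun \<phi> \<longleftrightarrow> (\<forall>n. Ck n \<phi>) \<and> bounded {x. \<phi> x \<noteq> 0}"

definition is_frac_lap :: "real \<Rightarrow> ('a::euclidean_space \<Rightarrow> real) \<Rightarrow> ('a \<Rightarrow> real) \<Rightarrow> bool" where
  "is_frac_lap s \<phi> g \<longleftrightarrow> g \<in> borel_measurable lborel \<and> integrable lborel g \<and>
     continuous_on UNIV g \<and> bounded (range g) \<and>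
     (\<forall>\<xi>. fourier g \<xi> = complex_of_real (norm \<xi> powr (2 * s)) * fourier \<phi> \<xi>)"

definition H1 :: "(real \<Rightarrow> 'a::euclidean_space \<Rightarrow> real) \<Rightarrow> real \<Rightarrow> bool" where
  "H1 J \<delta> \<longleftrightarrow> 0 < \<delta> \<and>
    (\<forall>s\<in>{1/2<..<1}. prob_density (J s) \<and>
       ((\<exists>p>1. integrable lborel (\<lambda>x. \<bar>J s x\<bar> powr p)) \<or>
        (\<exists>B. AE x in lborel. \<bar>J s x\<bar> \<le> B)) \<and>
       integrable lborel (\<lambda>y. min 1 ((norm y)\<^sup>2) * J s y)) \<and>
    (\<exists>C0>0. \<forall>s\<in>{1/2<..<1}. \<forall>\<xi>::'a. norm \<xi> \<le> 1 \<longrightarrow>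
       cmod (fourier (J s) \<xi> - complex_of_real (1 - norm \<xi> powr (2 * s)))
         \<le> C0 * norm \<xi> powr (2 * s + \<delta>)) \<and>
    (\<exists>C>0. \<exists>R>0. \<exists>\<Psi>::'a \<Rightarrow> real. \<Psi> \<in> borel_measurable lborel \<and>
       integrable lborel (\<lambda>x. (1 + (norm x)\<^sup>2) * \<bar>\<Psi> x\<bar>) \<and>
       (LINT x|lborel. \<Psi> x *\<^sub>R x) = 0 \<and>
       (\<forall>s\<in>{1/2<..<1}. \<forall>x. norm x \<ge> R \<longrightarrow>
          J s x \<le> C * (1 - s) * norm x powr (- real DIM('a) - 2 * s) + \<Psi> x))"

definition L1k_curve :: "real \<Rightarrow> ('a::euclidean_space \<Rightarrow> real) \<Rightarrow> (real \<Rightarrow> 'a \<Rightarrow> real) \<Rightarrow> bool" where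
  "L1k_curve k u0 u \<longleftrightarrow> (\<forall>t\<ge>0. in_L1k k (u t)) \<and>
     (\<forall>t0\<ge>0. ((\<lambda>t. L1k_norm k (\<lambda>x. u t x - u t0 x)) \<longlongrightarrow> 0) (at t0 within {0..})) \<and>
     L1k_norm k (\<lambda>x. u 0 x - u0 x) = 0"

text \<open>Solution of  d_t u = eps^{-2s} (J^s_eps * u - u) + div(x u),  u(0) = u0
  (in the weak/distributional sense, tested against C_c^infinity functions)\<close>
definition nonlocal_sol ::
  "(real \<Rightarrow> 'a::euclidean_space \<Rightarrow> real) \<Rightarrow> real \<Rightarrow> real \<Rightarrow> real \<Rightarrow> ('a \<Rightarrow> real) \<Rightarrow> (real \<Rightarrow> 'a \<Rightarrow> real) \<Rightarrow> bool" where
  "nonlocal_sol J s \<epsilon> k u0 u \<longleftrightarrow> L1k_curve k u0 u \<and>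
     (\<forall>\<phi>. test_fun \<phi> \<longrightarrow> (\<forall>t\<ge>0.
        (LINT x|lborel. u t x * \<phi> x) =
        (LINT x|lborel. u0 x * \<phi> x) +
        (LBINT \<tau>=0..t. (LINT y|lborel. u \<tau> y *
           (\<epsilon> powr (- 2 * s) * ((LINT z|lborel. rescale (J s) \<epsilon> z * \<phi> (y + z)) - \<phi> y)
            - frechet_derivative \<phi> (at y) y)))))"

text \<open>Solution of  d_t v = -(-Delta)^s v + div(x v),  v(0) = v0 (weak sense)\<close>
definition frac_sol :: "real \<Rightarrow> real \<Rightarrow> ('a::euclidean_space \<Rightarrow> real) \<Rightarrow> (real \<Rightarrow> 'a \<Rightarrow> real) \<Rightarrow> bool" where
  "frac_sol s k v0 v \<longleftrightarrow> L1k_curve k v0 v \<and>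
     (\<forall>\<phi> g. test_fun \<phi> \<longrightarrow> is_frac_lap s \<phi> g \<longrightarrow> (\<forall>t\<ge>0.
        (LINT x|lborel. v t x * \<phi> x) =
        (LINT x|lborel. v0 x * \<phi> x) +
        (LBINT \<tau>=0..t. (LINT y|lborel. v \<tau> y *
           (- g y - frechet_derivative \<phi> (at y) y)))))"

end

theory Submission
  imports Defs "HOL-Probability.Probability" "HOL-Real_Asymp.Real_Asymp"
begin

text \<open>On the Fourier side both equations are transport equations along the rays \<open>e\<^sup>t \<xi>\<close>, so a solution
  has the transform \<open>fourier u0 (e\<^sup>-\<^sup>t \<xi>) * E t \<xi>\<close> with an explicit infinitely divisible \<open>E\<close>. It therefore
  converges in the weighted norm to a stationary density \<open>F\<close> (nonlocal) or \<open>G\<close> (stable): a small atom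
  aside, \<open>E t\<close> contains a fixed integrable density, which gives convergence in \<open>L\<^sup>1\<close>, and the fractional
  moments are read off the transform. By the expansion of the kernel at the origin and
  the decay of \<open>fourier F\<close>, uniform in \<open>s\<close> for small \<open>\<epsilon>\<close>, the transforms of \<open>F\<close> and \<open>G\<close> differ by \<open>O(\<epsilon>\<^sup>\<delta>)\<close>
  in \<open>L\<^sup>2\<close>; interpolation with uniform moments of order \<open>m\<close> yields the exponent \<open>\<theta> \<delta>\<close>. For \<open>\<epsilon>\<close> bounded
  below uniform moment bounds suffice.\<close>

section \<open>Changes of variables and continuity of translations\<close>

text \<open>A solution is only a continuous curve obeying a weak equation; its positivity, unit mass
  and uniqueness are all read off the explicit transform, so the weak equation is converted
  completely before any estimate. Uniformity in s rests on 1 < 2 s < 2: near the origin |\<xi>|^(2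
  s) lies between |\<xi>|^2 and |\<xi>|, the upper bound giving moments of all orders below 1, the
  lower one decay, while the kernel enters the constants through \<delta> and C0 only. The obstacle
  is high frequency, where the transform of the kernel is not kept away from 1 uniformly in s. Yet
  the exponent of F integrates \<open>1 - fourier j\<close> along a ray and so grows like log
  |\<eta>|; multiplied by \<epsilon>^(-2 s) >= 1 / \<epsilon> it makes the transform of F decay with
  a power proportional to 1 / \<epsilon>. Below a fixed threshold on \<epsilon> this power suffices
  for integrability, whence the two ranges of \<epsilon>. The exponent \<theta> balances a ball of
  radius R, where the L2 bound costs R^(k + d/2) \<epsilon>^\<delta>, against its complement, where
  the m-th moment gains R^(k - m).\<close>

lemma nn_integral_lborel_affine:
  fixes f :: "'a::euclidean_space \<Rightarrow> ennreal"
  assumes [measurable]: "f \<in> borel_measurable borel" and c: "c \<noteq> 0"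
  shows "(\<integral>\<^sup>+x. f x \<partial>lborel) = ennreal (\<bar>c\<bar>^DIM('a)) * (\<integral>\<^sup>+x. f (t + c *\<^sub>R x) \<partial>lborel)"
  by (subst lborel_affine[OF c, of t])
     (simp add: nn_integral_density nn_integral_distr nn_integral_cmult)

lemma integrable_lborel_affine:
  fixes f :: "'a::euclidean_space \<Rightarrow> 'b :: {banach, second_countable_topology}"
  assumes f: "integrable lborel f" and c: "c \<noteq> 0"
  shows "integrable lborel (\<lambda>x. f (t + c *\<^sub>R x))"
proof -
  have m[measurable]: "f \<in> borel_measurable borel" using f by auto
  have "(\<integral>\<^sup>+x. norm (f x) \<partial>lborel) < \<infinity>" using f by (auto simp: integrable_iff_bounded)
  then have "ennreal (\<bar>c\<bar>^DIM('a)) * (\<integral>\<^sup>+x. norm (f (t + c *\<^sub>R x)) \<partial>lborel) < \<infinity>"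
    by (subst (asm) nn_integral_lborel_affine[OF _ c, of _ t]) auto
  then have "(\<integral>\<^sup>+x. norm (f (t + c *\<^sub>R x)) \<partial>lborel) < \<infinity>"
    using c by (auto simp: ennreal_mult_less_top ennreal_power)
  then show ?thesis by (auto simp: integrable_iff_bounded)
qed

lemma integral_lborel_affine:
  fixes f :: "'a::euclidean_space \<Rightarrow> 'b :: {banach, second_countable_topology}"
  assumes f: "integrable lborel f" and c: "c \<noteq> 0"
  shows "(LINT x|lborel. f x) = \<bar>c\<bar>^DIM('a) *\<^sub>R (LINT x|lborel. f (t + c *\<^sub>R x))"
proof -
  have m[measurable]: "f \<in> borel_measurable borel" using f by auto
  show ?thesis
    by (subst lborel_affine[OF c, of t])
       (use integrable_lborel_affine[OF f c, of t] in \<open>simp add: integral_density integral_distr\<close>)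
qed

lemma integrable_translate:
  fixes f :: "'a::euclidean_space \<Rightarrow> 'b :: {banach, second_countable_topology}"
  assumes "integrable lborel f"
  shows "integrable lborel (\<lambda>x. f (x + t))" "integrable lborel (\<lambda>x. f (x - t))"
    "integrable lborel (\<lambda>x. f (t - x))"
  using integrable_lborel_affine[OF assms, of 1 t] integrable_lborel_affine[OF assms, of 1 "-t"]
    integrable_lborel_affine[OF assms, of "-1" t]
  by (simp_all add: add.commute)

lemma integral_translate:
  fixes f :: "'a::euclidean_space \<Rightarrow> 'b :: {banach, second_countable_topology}"
  assumes "integrable lborel f"
  shows "(LINT x|lborel. f (x + t)) = (LINT x|lborel. f x)"
    "(LINT x|lborel. f (x - t)) = (LINT x|lborel. f x)"
    "(LINT x|lborel. f (t - x)) = (LINT x|lborel. f x)"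
  using integral_lborel_affine[OF assms, of 1 t] integral_lborel_affine[OF assms, of 1 "-t"]
    integral_lborel_affine[OF assms, of "-1" t]
  by (simp_all add: add.commute)

text \<open>For an open set the translates only have to be controlled from below, because the
  integral of the difference vanishes; outer regularity then covers all Borel sets.\<close>

lemma L1_translation_continuous:
  fixes f :: "'a::euclidean_space \<Rightarrow> real" and Y :: "nat \<Rightarrow> 'a"
  assumes f: "integrable lborel f" and Y: "Y \<longlonglongrightarrow> 0"
  shows "(\<lambda>n. LINT x|lborel. \<bar>f (x - Y n) - f x\<bar>) \<longlonglongrightarrow> 0"
  using f
proof (induct rule: integrable_induct)
  case (base A c)
  have open_case: "(\<lambda>n. LINT x|lborel. \<bar>indicator U (x - Y n) - indicator U x :: real\<bar>) \<longlonglongrightarrow> 0"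
    if U: "open U" "emeasure lborel U < \<infinity>" for U :: "'a set"
  proof -
    have [measurable]: "U \<in> sets borel" using U by auto
    have i: "integrable lborel (indicator U :: 'a \<Rightarrow> real)" using U by (intro integrable_real_indicator) auto
    note it = integrable_translate(2)[OF i]
    have e: "(LINT x|lborel. \<bar>indicator U (x - Y n) - indicator U x :: real\<bar>) =
       2 * (LINT x|lborel. max 0 (indicator U x - indicator U (x - Y n)))" for n
    proof -
      have "(LINT x|lborel. \<bar>indicator U (x - Y n) - indicator U x :: real\<bar>) =
        (LINT x|lborel. (indicator U (x - Y n) - indicator U x) + 2 * max 0 (indicator U x - indicator U (x - Y n)))"
        by (intro Bochner_Integration.integral_cong) (auto simp: indicator_def)
      also have "\<dots> = 2 * (LINT x|lborel. max 0 (indicator U x - indicator U (x - Y n)))"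
        using integral_translate(2)[OF i, of "Y n"] i it[of "Y n"] by (simp add: Bochner_Integration.integral_diff)
      finally show ?thesis .
    qed
    have "(\<lambda>n. LINT x|lborel. max 0 (indicator U x - indicator U (x - Y n))) \<longlonglongrightarrow> (LINT x|(lborel :: 'a measure). (0::real))"
    proof (rule integral_dominated_convergence[where w="indicator U"])
      show "AE x in lborel. (\<lambda>n. max 0 (indicator U x - indicator U (x - Y n))) \<longlonglongrightarrow> (0::real)"
      proof (rule AE_I2)
        fix x :: 'a
        have "(\<lambda>n. x - Y n) \<longlonglongrightarrow> x" using tendsto_diff[OF tendsto_const Y, of x] by simp
        then have "x \<in> U \<Longrightarrow> eventually (\<lambda>n. x - Y n \<in> U) sequentially"
          using U(1) by (auto dest!: topological_tendstoD)
        then have "eventually (\<lambda>n. max 0 (indicator U x - indicator U (x - Y n)) = (0::real)) sequentially"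
          by (cases "x \<in> U") (auto elim!: eventually_mono)
        then show "(\<lambda>n. max 0 (indicator U x - indicator U (x - Y n))) \<longlonglongrightarrow> (0::real)"
          by (rule tendsto_eventually)
      qed
    qed (auto simp: i indicator_def)
    then show ?thesis unfolding e by (auto intro: tendsto_mult_right_zero)
  qed
  have A[measurable]: "A \<in> sets borel" using base by simp
  have ind: "(\<lambda>n. LINT x|lborel. \<bar>indicator A (x - Y n) - indicator A x :: real\<bar>) \<longlonglongrightarrow> 0"
  proof (rule LIMSEQ_I)
    fix r :: real assume r: "0 < r"
    obtain U where U: "open U" "A \<subseteq> U" "emeasure lborel (U - A) < ennreal (r/4)"
      using outer_regular_lborel[OF A, of "r/4"] r by auto
    have [measurable]: "U \<in> sets borel" using U by auto
    have UA: "emeasure lborel (U - A) < \<infinity>" using U(3) by (auto simp: less_top[symmetric] top_unique)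
    have "emeasure lborel U \<le> emeasure lborel A + emeasure lborel (U - A)"
      using U(2) by (subst plus_emeasure) (auto simp: Un_absorb1)
    also have "\<dots> < \<infinity>" using UA base by simp
    finally have Uf: "emeasure lborel U < \<infinity>" .
    have iU: "integrable lborel (indicator U :: 'a \<Rightarrow> real)" using Uf by (intro integrable_real_indicator) auto
    have iA: "integrable lborel (indicator A :: 'a \<Rightarrow> real)" using base by (intro integrable_real_indicator) auto
    have iUA: "integrable lborel (indicator (U - A) :: 'a \<Rightarrow> real)" using UA by (intro integrable_real_indicator) auto
    have mUA: "(LINT x|lborel. indicator (U - A) x) < r/4"
      using U(3) r UA by (simp add: measure_def enn2real_less_iff del: times_divide_eq_left less_divide_eq_numeral1)
    obtain N where N: "\<And>n. n \<ge> N \<Longrightarrow> \<bar>LINT x|lborel. \<bar>indicator U (x - Y n) - indicator U x :: real\<bar>\<bar> < r/2"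
      using LIMSEQ_D[OF open_case[OF U(1) Uf], of "r/2"] r by auto
    have "\<bar>LINT x|lborel. \<bar>indicator A (x - Y n) - indicator A x :: real\<bar>\<bar> < r" if n: "n \<ge> N" for n
    proof -
      have "(LINT x|lborel. \<bar>indicator A (x - Y n) - indicator A x :: real\<bar>) \<le>
        (LINT x|lborel. \<bar>indicator U (x - Y n) - indicator U x\<bar> + (indicator (U - A) (x - Y n) + indicator (U - A) x))"
      proof (rule integral_mono)
        show "integrable lborel (\<lambda>x. \<bar>indicator A (x - Y n) - indicator A x :: real\<bar>)"
          by (intro integrable_abs Bochner_Integration.integrable_diff integrable_translate(2) iA)
        show "integrable lborel (\<lambda>x. \<bar>indicator U (x - Y n) - indicator U x\<bar> + (indicator (U - A) (x - Y n) + indicator (U - A) x) :: real)"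
          by (intro Bochner_Integration.integrable_add integrable_abs Bochner_Integration.integrable_diff integrable_translate(2) iU iUA)
      qed (use U(2) in \<open>auto simp: indicator_def\<close>)
      also have "\<dots> = (LINT x|lborel. \<bar>indicator U (x - Y n) - indicator U x\<bar>) + ((LINT x|lborel. indicator (U - A) (x - Y n)) + (LINT x|lborel. indicator (U - A) x))"
        using integrable_translate(2)[OF iU, of "Y n"] iU integrable_translate(2)[OF iUA, of "Y n"] iUA
        by (simp add: Bochner_Integration.integral_add)
      also have "\<dots> < r/2 + (r/4 + r/4)"
        using N[OF n] mUA integral_translate(2)[OF iUA, of "Y n"] by linarith
      finally show ?thesis by simp
    qed
    then show "\<exists>no. \<forall>n\<ge>no. norm ((LINT x|lborel. \<bar>indicator A (x - Y n) - indicator A x :: real\<bar>) - 0) < r"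
      by auto
  qed
  have "(LINT x|lborel. \<bar>indicator A (x - Y n) *\<^sub>R c - indicator A x *\<^sub>R c\<bar>) = \<bar>c\<bar> * (LINT x|lborel. \<bar>indicator A (x - Y n) - indicator A x\<bar>)" for n
    by (subst integral_mult_right_zero[symmetric], rule Bochner_Integration.integral_cong) (auto simp: indicator_def)
  with tendsto_mult_right_zero[OF ind, of "\<bar>c\<bar>"] show ?case by simp
next
  case (add f g)
  note i = integrable_translate(2)[OF add(1)] integrable_translate(2)[OF add(3)] add(1,3)
  show ?case
  proof (rule tendsto_sandwich[OF _ _ tendsto_const tendsto_add_zero[OF add(2,4)]])
    have "(LINT x|lborel. \<bar>f (x - Y n) + g (x - Y n) - (f x + g x)\<bar>) \<le>
      (LINT x|lborel. \<bar>f (x - Y n) - f x\<bar> + \<bar>g (x - Y n) - g x\<bar>)" for n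
      using i by (intro integral_mono) auto
    moreover have "(LINT x|lborel. \<bar>f (x - Y n) - f x\<bar> + \<bar>g (x - Y n) - g x\<bar>) =
      (LINT x|lborel. \<bar>f (x - Y n) - f x\<bar>) + (LINT x|lborel. \<bar>g (x - Y n) - g x\<bar>)" for n
      using i by (intro Bochner_Integration.integral_add) auto
    ultimately show "\<forall>\<^sub>F n in sequentially. (LINT x|lborel. \<bar>f (x - Y n) + g (x - Y n) - (f x + g x)\<bar>) \<le>
      (LINT x|lborel. \<bar>f (x - Y n) - f x\<bar>) + (LINT x|lborel. \<bar>g (x - Y n) - g x\<bar>)"
      by (intro always_eventually allI) simp
  qed auto
next
  case (lim f s)
  have si: "integrable lborel (s i)" and s: "(\<lambda>n. LINT x|lborel. \<bar>s i (x - Y n) - s i x\<bar>) \<longlonglongrightarrow> 0" for i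
    using lim(1,2) by auto
  \<comment> \<open>The simple approximations satisfy |s i| <= 2 |f|, whence the factor 3 in the
    dominating function.\<close>
  have "(\<lambda>i. LINT x|lborel. \<bar>s i x - f x\<bar>) \<longlonglongrightarrow> (LINT x|(lborel :: 'a measure). (0::real))"
  proof (rule integral_dominated_convergence[where w="\<lambda>x. 3 * \<bar>f x\<bar>"])
    show "AE x in lborel. (\<lambda>i. \<bar>s i x - f x\<bar>) \<longlonglongrightarrow> 0"
      using lim(3) by (auto intro!: tendsto_rabs_zero LIM_zero)
    show "AE x in lborel. norm \<bar>s i x - f x\<bar> \<le> 3 * \<bar>f x\<bar>" for i
      using lim(4)[of _ i] by (auto intro!: AE_I2 abs_triangle_ineq4[THEN order_trans])
  qed (use lim si in auto)
  then have sf: "(\<lambda>i. LINT x|lborel. \<bar>s i x - f x\<bar>) \<longlonglongrightarrow> 0" by simp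
  show ?case
  proof (rule LIMSEQ_I)
    fix r :: real assume r: "0 < r"
    obtain i where i: "(LINT x|lborel. \<bar>s i x - f x\<bar>) < r/4"
      using LIMSEQ_D[OF sf, of "r/4"] r by auto
    obtain N where N: "\<And>n. n \<ge> N \<Longrightarrow> \<bar>LINT x|lborel. \<bar>s i (x - Y n) - s i x\<bar>\<bar> < r/2"
      using LIMSEQ_D[OF s[of i], of "r/2"] r by auto
    have isf: "integrable lborel (\<lambda>x. \<bar>s i x - f x\<bar>)" using si lim by auto
    have "\<bar>LINT x|lborel. \<bar>f (x - Y n) - f x\<bar>\<bar> < r" if n: "n \<ge> N" for n
    proof -
      note ii = integrable_translate(2)[OF si[of i], of "Y n"] si[of i] integrable_translate(2)[OF lim(5), of "Y n"] lim(5)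
      have "(LINT x|lborel. \<bar>f (x - Y n) - f x\<bar>) \<le>
        (LINT x|lborel. \<bar>s i (x - Y n) - s i x\<bar> + (\<bar>s i (x - Y n) - f (x - Y n)\<bar> + \<bar>s i x - f x\<bar>))"
        using ii by (intro integral_mono) auto
      also have "\<dots> = (LINT x|lborel. \<bar>s i (x - Y n) - s i x\<bar>) + ((LINT x|lborel. \<bar>s i (x - Y n) - f (x - Y n)\<bar>) + (LINT x|lborel. \<bar>s i x - f x\<bar>))"
        using ii by (simp add: Bochner_Integration.integral_add)
      also have "\<dots> < r/2 + (r/4 + r/4)"
        using N[OF n] i integral_translate(2)[OF isf, of "Y n"] by linarith
      finally show ?thesis by simp
    qed
    then show "\<exists>no. \<forall>n\<ge>no. norm ((LINT x|lborel. \<bar>f (x - Y n) - f x\<bar>) - 0) < r" by auto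
  qed
qed

section \<open>Fourier transforms of integrable functions\<close>

lemma fourier_cis: "fourier f \<xi> = (LINT x|lborel. f x *\<^sub>R cis (-(x \<bullet> \<xi>)))"
  unfolding fourier_def by (simp add: cis_conv_exp scaleR_conv_of_real mult.commute)

lemma integrable_cis_mult:
  fixes f :: "'a::euclidean_space \<Rightarrow> real" and g :: "'a \<Rightarrow> real"
  assumes [measurable]: "integrable lborel f" "g \<in> borel_measurable borel"
  shows "integrable lborel (\<lambda>x. f x *\<^sub>R cis (g x))"
proof (rule Bochner_Integration.integrable_bound[of _ f])
  have "cis \<in> borel_measurable borel" by (intro borel_measurable_continuous_onI continuous_intros)
  note [measurable] = measurable_compose[OF _ this]
  show "(\<lambda>x. f x *\<^sub>R cis (g x)) \<in> borel_measurable lborel" by simp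
qed (use assms in auto)

lemma cis_measurable[measurable]:
  "g \<in> borel_measurable M \<Longrightarrow> (\<lambda>x. cis (g x)) \<in> borel_measurable M"
  by (rule measurable_compose[where N=borel], assumption)
     (intro borel_measurable_continuous_onI continuous_intros)

lemma integrable_cis_mult_complex:
  fixes \<kappa> :: "'a::euclidean_space \<Rightarrow> complex" and g :: "'a \<Rightarrow> real"
  assumes [measurable]: "integrable lborel \<kappa>" "g \<in> borel_measurable borel"
  shows "integrable lborel (\<lambda>x. cis (g x) * \<kappa> x)"
  by (rule Bochner_Integration.integrable_bound[of _ \<kappa>]) (use assms in \<open>auto simp: norm_mult\<close>)

lemma fourier_norm_le: "cmod (fourier f \<xi>) \<le> (LINT x|lborel. \<bar>f x\<bar>)"
  unfolding fourier_cis by (rule order_trans[OF integral_norm_bound]) simp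

lemma fourier_0 [simp]: "fourier f 0 = of_real (LINT x|lborel. f x)"
  unfolding fourier_cis by (simp add: scaleR_conv_of_real)

lemma continuous_fourier:
  fixes f :: "'a::euclidean_space \<Rightarrow> real"
  assumes f: "integrable lborel f"
  shows "continuous_on UNIV (fourier f)"
proof -
  have "(\<lambda>n. fourier f (Y n)) \<longlonglongrightarrow> fourier f y" if Y: "Y \<longlonglongrightarrow> y" for Y y
    unfolding fourier_cis
  proof (rule integral_dominated_convergence[where w="\<lambda>x. \<bar>f x\<bar>"])
    show "AE x in lborel. (\<lambda>n. f x *\<^sub>R cis (- (x \<bullet> Y n))) \<longlonglongrightarrow> f x *\<^sub>R cis (- (x \<bullet> y))"
      by (intro AE_I2 tendsto_intros Y)
  qed (use f in \<open>auto intro!: integrable_cis_mult[THEN borel_measurable_integrable]\<close>)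
  then show ?thesis by (auto simp: continuous_on_sequentially comp_def)
qed

lemma fourier_measurable[measurable]:
  "integrable lborel f \<Longrightarrow> fourier f \<in> borel_measurable borel"
  by (intro borel_measurable_continuous_onI continuous_fourier)

lemma fourier_scale:
  fixes f :: "'a::euclidean_space \<Rightarrow> real"
  assumes "integrable lborel f" "a \<noteq> 0"
  shows "fourier (\<lambda>x. f (a *\<^sub>R x)) \<xi> = fourier f ((1/a) *\<^sub>R \<xi>) / of_real (\<bar>a\<bar>^DIM('a))"
  unfolding fourier_cis
  using integral_lborel_affine[OF integrable_cis_mult[OF assms(1), of "\<lambda>x. - (x \<bullet> ((1/a) *\<^sub>R \<xi>))"] assms(2), of 0] assms(2)
  by (simp add: scaleR_conv_of_real field_simps)

lemma fourier_diff:
  assumes "integrable lborel f" "integrable lborel g"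
  shows "fourier (\<lambda>x. f x - g x) \<xi> = fourier f \<xi> - fourier g \<xi>"
  unfolding fourier_cis using assms
  by (simp add: scaleR_diff_left integrable_cis_mult Bochner_Integration.integral_diff)

text \<open>Convolution with an inverse transform is the inverse transform of a product; since
  \<open>\<kappa>\<close> is integrable, Fubini applies to every integrable \<open>f\<close>.
  Inversion, the multiplier bound and Plancherel all reduce to this one exchange of
  integrals.\<close>

lemma fubini_cis:
  fixes f :: "'a::euclidean_space \<Rightarrow> real" and \<kappa> :: "'a \<Rightarrow> complex"
  assumes f: "integrable lborel f" and k: "integrable lborel \<kappa>"
  shows "(LINT y|lborel. f y *\<^sub>R (LINT \<xi>|lborel. cis ((x - y) \<bullet> \<xi>) * \<kappa> \<xi>)) =
    (LINT \<xi>|lborel. cis (x \<bullet> \<xi>) * (\<kappa> \<xi> * fourier f \<xi>))"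
    "integrable lborel (\<lambda>y. f y *\<^sub>R (LINT \<xi>|lborel. cis ((x - y) \<bullet> \<xi>) * \<kappa> \<xi>))"
proof -
  have [measurable]: "f \<in> borel_measurable borel" "\<kappa> \<in> borel_measurable borel"
    using f k by auto
  let ?h = "\<lambda>y \<xi>. f y *\<^sub>R (cis ((x - y) \<bullet> \<xi>) * \<kappa> \<xi>)"
  have int: "integrable (lborel \<Otimes>\<^sub>M lborel) (\<lambda>(y, \<xi>). ?h y \<xi>)"
  proof (rule lborel_pair.Fubini_integrable)
    show "integrable lborel (\<lambda>y. LINT \<xi>|lborel. norm (case (y, \<xi>) of (y, \<xi>) \<Rightarrow> ?h y \<xi>))"
      using f by (simp add: norm_mult)
    show "AE y in lborel. integrable lborel (\<lambda>\<xi>. case (y, \<xi>) of (y, \<xi>) \<Rightarrow> ?h y \<xi>)"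
      using k by (auto intro!: AE_I2 integrable_scaleR_right integrable_cis_mult_complex simp del: scaleR_conv_of_real)
  qed measurable
  have "(LINT y|lborel. f y *\<^sub>R (LINT \<xi>|lborel. cis ((x - y) \<bullet> \<xi>) * \<kappa> \<xi>)) = (LINT y|lborel. LINT \<xi>|lborel. ?h y \<xi>)"
    by (simp add: integrable_cis_mult_complex k)
  also have "\<dots> = (LINT \<xi>|lborel. LINT y|lborel. ?h y \<xi>)"
    by (rule lborel_pair.Fubini_integral[OF int, symmetric])
  also have "\<dots> = (LINT \<xi>|lborel. cis (x \<bullet> \<xi>) * (\<kappa> \<xi> * fourier f \<xi>))"
  proof (rule Bochner_Integration.integral_cong[OF refl])
    fix \<xi> :: 'a
    have "?h y \<xi> = (cis (x \<bullet> \<xi>) * \<kappa> \<xi>) * (f y *\<^sub>R cis (- (y \<bullet> \<xi>)))" for y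
      using cis_mult[of "x \<bullet> \<xi>" "- (y \<bullet> \<xi>)", symmetric] by (simp add: inner_diff_left scaleR_conv_of_real)
    then have "(LINT y|lborel. ?h y \<xi>) = (LINT y|lborel. (cis (x \<bullet> \<xi>) * \<kappa> \<xi>) * (f y *\<^sub>R cis (- (y \<bullet> \<xi>))))"
      by presburger
    also have "\<dots> = (cis (x \<bullet> \<xi>) * \<kappa> \<xi>) * fourier f \<xi>"
      unfolding fourier_cis by (rule integral_mult_right_zero)
    finally show "(LINT y|lborel. ?h y \<xi>) = cis (x \<bullet> \<xi>) * (\<kappa> \<xi> * fourier f \<xi>)"
      by (simp add: mult.assoc)
  qed
  finally show "(LINT y|lborel. f y *\<^sub>R (LINT \<xi>|lborel. cis ((x - y) \<bullet> \<xi>) * \<kappa> \<xi>)) =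
    (LINT \<xi>|lborel. cis (x \<bullet> \<xi>) * (\<kappa> \<xi> * fourier f \<xi>))" .
  show "integrable lborel (\<lambda>y. f y *\<^sub>R (LINT \<xi>|lborel. cis ((x - y) \<bullet> \<xi>) * \<kappa> \<xi>))"
    using lborel_pair.integrable_fst[OF int] by (simp add: integrable_cis_mult_complex k)
qed

section \<open>Convolution with a dilated function\<close>

text \<open>If Y has density \<open>w\<close>, this is the law of a Y convolved with
  \<open>g\<close>. Written against \<open>w\<close> it needs no Jacobian and stays meaningful at
  \<open>a = 0\<close>, where it is \<open>g\<close> times the integral of \<open>w\<close>.\<close>

definition cs :: "real \<Rightarrow> ('a::euclidean_space \<Rightarrow> real) \<Rightarrow> ('a \<Rightarrow> real) \<Rightarrow> 'a \<Rightarrow> real" where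
  "cs a w g x = (LINT y|lborel. w y * g (x - a *\<^sub>R y))"

lemma cs_pair_integrable:
  fixes w g :: "'a::euclidean_space \<Rightarrow> real"
  assumes w: "integrable lborel w" and g: "integrable lborel g"
  shows "integrable (lborel \<Otimes>\<^sub>M lborel) (\<lambda>(y, x). w y * g (x - a *\<^sub>R y))"
proof -
  have [measurable]: "w \<in> borel_measurable borel" "g \<in> borel_measurable borel"
    using w g by auto
  show ?thesis
  proof (rule lborel_pair.Fubini_integrable)
    have "(LINT x|lborel. norm (case (y, x) of (y, x) \<Rightarrow> w y * g (x - a *\<^sub>R y))) = \<bar>w y\<bar> * (LINT x|lborel. \<bar>g x\<bar>)" for y
      using integral_translate(2)[of "\<lambda>x. \<bar>g x\<bar>" "a *\<^sub>R y"] g by (simp add: abs_mult)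
    then show "integrable lborel (\<lambda>y. LINT x|lborel. norm (case (y, x) of (y, x) \<Rightarrow> w y * g (x - a *\<^sub>R y)))"
      using w by simp
    show "AE y in lborel. integrable lborel (\<lambda>x. case (y, x) of (y, x) \<Rightarrow> w y * g (x - a *\<^sub>R y))"
      using integrable_translate(2)[OF g] by simp
  qed measurable
qed

lemma cs_integrable:
  assumes w: "integrable lborel w" and g: "integrable lborel g"
  shows "integrable lborel (cs a w g)"
  using lborel_pair.integrable_snd[OF cs_pair_integrable[OF assms, of a]] by (simp add: cs_def[abs_def])

lemma cs_norm_le:
  assumes w: "integrable lborel w" and g: "integrable lborel g"
  shows "(LINT x|lborel. \<bar>cs a w g x\<bar>) \<le> (LINT x|lborel. \<bar>w x\<bar>) * (LINT x|lborel. \<bar>g x\<bar>)"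
proof -
  have i: "integrable lborel (\<lambda>x. \<bar>w x\<bar>)" "integrable lborel (\<lambda>x. \<bar>g x\<bar>)" using assms by auto
  have "(LINT x|lborel. \<bar>cs a w g x\<bar>) \<le> (LINT x|lborel. cs a (\<lambda>x. \<bar>w x\<bar>) (\<lambda>x. \<bar>g x\<bar>) x)"
  proof (rule integral_mono)
    show "\<bar>cs a w g x\<bar> \<le> cs a (\<lambda>x. \<bar>w x\<bar>) (\<lambda>x. \<bar>g x\<bar>) x" for x
      unfolding cs_def abs_mult[symmetric] by (rule integral_abs_bound)
  qed (use cs_integrable[OF assms] cs_integrable[OF i] in auto)
  also have "\<dots> = (LINT y|lborel. LINT x|lborel. \<bar>w y\<bar> * \<bar>g (x - a *\<^sub>R y)\<bar>)"
    unfolding cs_def by (rule lborel_pair.Fubini_integral[OF cs_pair_integrable[OF i]])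
  also have "\<dots> = (LINT x|lborel. \<bar>w x\<bar>) * (LINT x|lborel. \<bar>g x\<bar>)"
    using integral_translate(2)[OF i(2)] by simp
  finally show ?thesis .
qed

lemma fourier_cs:
  fixes w g :: "'a::euclidean_space \<Rightarrow> real"
  assumes w: "integrable lborel w" and g: "integrable lborel g"
  shows "fourier (cs a w g) \<xi> = fourier w (a *\<^sub>R \<xi>) * fourier g \<xi>"
proof -
  have [measurable]: "w \<in> borel_measurable borel" "g \<in> borel_measurable borel"
    using w g by auto
  let ?h = "\<lambda>y x. (w y * g (x - a *\<^sub>R y)) *\<^sub>R cis (- (x \<bullet> \<xi>))"
  have int: "integrable (lborel \<Otimes>\<^sub>M lborel) (\<lambda>(y, x). ?h y x)"
    by (rule Bochner_Integration.integrable_bound[OF cs_pair_integrable[OF assms, of a]]) (measurable, auto)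
  have "fourier (cs a w g) \<xi> = (LINT x|lborel. LINT y|lborel. ?h y x)"
    unfolding fourier_cis cs_def
  proof (rule integral_cong_AE)
    have "AE x in lborel. integrable lborel (\<lambda>y. w y * g (x - a *\<^sub>R y))"
      using lborel_pair.AE_integrable_snd[OF cs_pair_integrable[OF assms, of a]] by simp
    then show "AE x in lborel. (LINT y|lborel. w y * g (x - a *\<^sub>R y)) *\<^sub>R cis (- (x \<bullet> \<xi>)) = (LINT y|lborel. ?h y x)"
      by eventually_elim simp
    show "(\<lambda>x. (LINT y|lborel. w y * g (x - a *\<^sub>R y)) *\<^sub>R cis (- (x \<bullet> \<xi>))) \<in> borel_measurable lborel"
      by measurable
    show "(\<lambda>x. (LINT y|lborel. ?h y x)) \<in> borel_measurable lborel"
      by measurable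
  qed
  also have "\<dots> = (LINT y|lborel. LINT x|lborel. ?h y x)"
    by (rule lborel_pair.Fubini_integral[OF int])
  also have "\<dots> = (LINT y|lborel. (w y *\<^sub>R cis (- (y \<bullet> (a *\<^sub>R \<xi>)))) * fourier g \<xi>)"
  proof (rule Bochner_Integration.integral_cong[OF refl])
    fix y :: 'a
    have "(LINT x|lborel. ?h y x) = (LINT x|lborel. (w y *\<^sub>R cis (- (y \<bullet> (a *\<^sub>R \<xi>)))) * (g (x - a *\<^sub>R y) *\<^sub>R cis (- ((x - a *\<^sub>R y) \<bullet> \<xi>))))"
      by (rule Bochner_Integration.integral_cong[OF refl])
        (simp add: inner_diff_left scaleR_conv_of_real cis_mult mult_ac)
    also have "\<dots> = (w y *\<^sub>R cis (- (y \<bullet> (a *\<^sub>R \<xi>)))) * (LINT x|lborel. g (x - a *\<^sub>R y) *\<^sub>R cis (- ((x - a *\<^sub>R y) \<bullet> \<xi>)))"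
      by (rule integral_mult_right_zero)
    also have "\<dots> = (w y *\<^sub>R cis (- (y \<bullet> (a *\<^sub>R \<xi>)))) * fourier g \<xi>"
      unfolding fourier_cis
      by (subst integral_translate(2)[OF integrable_cis_mult[OF g, of "\<lambda>x. - (x \<bullet> \<xi>)"]]) auto
    finally show "(LINT x|lborel. ?h y x) = (w y *\<^sub>R cis (- (y \<bullet> (a *\<^sub>R \<xi>)))) * fourier g \<xi>" .
  qed
  also have "\<dots> = fourier w (a *\<^sub>R \<xi>) * fourier g \<xi>"
    unfolding fourier_cis[of w] by (rule integral_mult_left_zero)
  finally show ?thesis .
qed

text \<open>The difference is at most the integral of |w y| times the L1 distance between
  \<open>g\<close> and its translate by \<open>a n *\<^sub>R y\<close>, an integrand dominated by 2
  |w| times the norm of \<open>g\<close>. It serves twice: with \<open>w = nd\<close> to remove a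
  Gaussian regularisation, and with \<open>w\<close> of integral zero, where the convolution itself
  vanishes in the limit.\<close>

lemma cs_approx_identity:
  fixes w g :: "'a::euclidean_space \<Rightarrow> real"
  assumes w: "integrable lborel w" and g: "integrable lborel g" and a: "a \<longlonglongrightarrow> 0"
  shows "(\<lambda>n. LINT x|lborel. \<bar>cs (a n) w g x - (LINT y|lborel. w y) * g x\<bar>) \<longlonglongrightarrow> 0"
proof -
  have [measurable]: "w \<in> borel_measurable borel" "g \<in> borel_measurable borel"
    using w g by auto
  let ?T = "\<lambda>z. LINT x|lborel. \<bar>g (x - z) - g x\<bar>"
  have ig: "integrable lborel (\<lambda>x. \<bar>g (x - z) - g x\<bar>)" for z
    using integrable_translate(2)[OF g] g by auto
  have T2: "?T z \<le> 2 * (LINT x|lborel. \<bar>g x\<bar>)" for z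
  proof -
    have "?T z \<le> (LINT x|lborel. \<bar>g (x - z)\<bar> + \<bar>g x\<bar>)"
      using ig integrable_translate(2)[OF g] g by (intro integral_mono) auto
    also have "\<dots> = 2 * (LINT x|lborel. \<bar>g x\<bar>)"
      using integrable_translate(2)[OF g] g integral_translate(2)[of "\<lambda>x. \<bar>g x\<bar>" z]
      by (subst Bochner_Integration.integral_add) auto
    finally show ?thesis .
  qed
  have T0: "0 \<le> ?T z" for z by simp
  have mT: "(\<lambda>y. ?T (c *\<^sub>R y)) \<in> borel_measurable borel" for c by measurable
  have iT: "integrable lborel (\<lambda>y. \<bar>w y\<bar> * ?T (c *\<^sub>R y))" for c
    by (rule Bochner_Integration.integrable_bound[of _ "\<lambda>y. (2 * (LINT x|lborel. \<bar>g x\<bar>)) * w y"])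
       (use w mT T2 T0 in \<open>auto simp: abs_mult mult.commute[of "\<bar>w _\<bar>"] intro!: mult_right_mono\<close>)
  have bound: "(LINT x|lborel. \<bar>cs c w g x - (LINT y|lborel. w y) * g x\<bar>) \<le> (LINT y|lborel. \<bar>w y\<bar> * ?T (c *\<^sub>R y))" for c
  proof -
    let ?h = "\<lambda>y x. w y * (g (x - c *\<^sub>R y) - g x)"
    \<comment> \<open>The subtracted term is the same pair integrand with dilation factor 0.\<close>
    have int: "integrable (lborel \<Otimes>\<^sub>M lborel) (\<lambda>(y, x). ?h y x)"
      using Bochner_Integration.integrable_diff[OF cs_pair_integrable[OF w g, of c] cs_pair_integrable[OF w g, of 0]]
      by (simp add: case_prod_unfold algebra_simps)
    then have inta: "integrable (lborel \<Otimes>\<^sub>M lborel) (\<lambda>(y, x). \<bar>?h y x\<bar>)"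
      by (subst (asm) integrable_norm_iff[symmetric]) (auto simp: case_prod_unfold)
    have "(LINT x|lborel. \<bar>cs c w g x - (LINT y|lborel. w y) * g x\<bar>) \<le> (LINT x|lborel. LINT y|lborel. \<bar>?h y x\<bar>)"
    proof (rule integral_mono_AE)
      have "AE x in lborel. integrable lborel (\<lambda>y. w y * g (x - c *\<^sub>R y))"
        using lborel_pair.AE_integrable_snd[OF cs_pair_integrable[OF w g, of c]] by simp
      then show "AE x in lborel. \<bar>cs c w g x - (LINT y|lborel. w y) * g x\<bar> \<le> (LINT y|lborel. \<bar>?h y x\<bar>)"
      proof eventually_elim
        fix x assume i: "integrable lborel (\<lambda>y. w y * g (x - c *\<^sub>R y))"
        have "cs c w g x - (LINT y|lborel. w y) * g x = (LINT y|lborel. ?h y x)"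
          unfolding cs_def using i w by (simp add: right_diff_distrib Bochner_Integration.integral_diff)
        then show "\<bar>cs c w g x - (LINT y|lborel. w y) * g x\<bar> \<le> (LINT y|lborel. \<bar>?h y x\<bar>)"
          by (simp add: integral_abs_bound)
      qed
      show "integrable lborel (\<lambda>x. LINT y|lborel. \<bar>?h y x\<bar>)"
        by (rule lborel_pair.integrable_snd[OF inta])
    qed (use cs_integrable[OF w g] g in auto)
    also have "\<dots> = (LINT y|lborel. LINT x|lborel. \<bar>?h y x\<bar>)"
      by (rule lborel_pair.Fubini_integral[OF inta])
    also have "\<dots> = (LINT y|lborel. \<bar>w y\<bar> * ?T (c *\<^sub>R y))"
      by (simp add: abs_mult)
    finally show ?thesis .
  qed
  have "(\<lambda>n. LINT y|lborel. \<bar>w y\<bar> * ?T (a n *\<^sub>R y)) \<longlonglongrightarrow> (LINT y|(lborel :: 'a measure). (0::real))"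
  proof (rule integral_dominated_convergence[where w="\<lambda>y. (2 * (LINT x|lborel. \<bar>g x\<bar>)) * \<bar>w y\<bar>"])
    show "AE y in lborel. (\<lambda>n. \<bar>w y\<bar> * ?T (a n *\<^sub>R y)) \<longlonglongrightarrow> 0"
    proof (rule AE_I2)
      fix y :: 'a
      have "(\<lambda>n. a n *\<^sub>R y) \<longlonglongrightarrow> 0" using tendsto_scaleR[OF a tendsto_const, of y] by simp
      from tendsto_mult_right_zero[OF L1_translation_continuous[OF g this]]
      show "(\<lambda>n. \<bar>w y\<bar> * ?T (a n *\<^sub>R y)) \<longlonglongrightarrow> 0" .
    qed
    show "AE y in lborel. norm (\<bar>w y\<bar> * ?T (a n *\<^sub>R y)) \<le> (2 * (LINT x|lborel. \<bar>g x\<bar>)) * \<bar>w y\<bar>" for n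
      using T2 T0 by (auto simp: abs_mult mult.commute[of "\<bar>w _\<bar>"] intro!: mult_right_mono AE_I2)
  qed (use w iT in auto)
  then have "(\<lambda>n. LINT y|lborel. \<bar>w y\<bar> * ?T (a n *\<^sub>R y)) \<longlonglongrightarrow> 0" by simp
  then show ?thesis
    by (rule tendsto_sandwich[OF _ _ tendsto_const, rotated 2]) (use bound in auto)
qed

section \<open>Gaussians\<close>

lemma
  fixes f :: "'a::euclidean_space \<Rightarrow> real \<Rightarrow> 'b::{real_normed_field, banach, second_countable_topology}"
  assumes f: "\<And>b. b \<in> Basis \<Longrightarrow> integrable lborel (f b)"
  shows integrable_lborel_prod: "integrable lborel (\<lambda>x::'a. \<Prod>b\<in>Basis. f b (x \<bullet> b))"
    and integral_lborel_prod: "(LINT x|lborel. (\<Prod>b\<in>Basis. f b (x \<bullet> (b::'a)))) = (\<Prod>b\<in>(Basis::'a set). (LINT t|lborel. f b t))"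
proof -
  interpret product_sigma_finite "\<lambda>_::'a. lborel :: real measure" by standard
  have [measurable]: "f b \<in> borel_measurable borel" if "b \<in> Basis" for b using f[OF that] by auto
  have m: "(\<lambda>x::'a. \<Prod>b\<in>Basis. f b (x \<bullet> b)) \<in> borel_measurable borel" by measurable
  have T: "(\<lambda>f. \<Sum>b\<in>Basis. f b *\<^sub>R b) \<in> (\<Pi>\<^sub>M b\<in>(Basis::'a set). lborel) \<rightarrow>\<^sub>M borel" by measurable
  have e: "(\<Prod>b\<in>Basis. f b ((\<Sum>b\<in>Basis. g b *\<^sub>R b) \<bullet> b)) = (\<Prod>b\<in>Basis. f b (g b))" for g :: "'a \<Rightarrow> real"
    by (intro prod.cong) auto
  show "integrable lborel (\<lambda>x::'a. \<Prod>b\<in>Basis. f b (x \<bullet> b))"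
    by (subst lborel_eq[where 'a='a], subst integrable_distr_eq[OF T m]) (use product_integrable_prod[OF finite_Basis f] in \<open>simp add: e\<close>)
  show "(LINT x|lborel. (\<Prod>b\<in>Basis. f b (x \<bullet> (b::'a)))) = (\<Prod>b\<in>(Basis::'a set). (LINT t|lborel. f b t))"
    by (subst lborel_eq[where 'a='a], subst integral_distr[OF T m]) (use product_integral_prod[OF finite_Basis f] in \<open>simp add: e\<close>)
qed

text \<open>Rescaling of the characteristic function of the standard normal law, taken at u / sqrt
  \<eta>.\<close>

lemma gauss_real:
  assumes e: "0 < (\<eta>::real)"
  shows "integrable lborel (\<lambda>t. cis (u * t) * of_real (exp (- \<eta> * t\<^sup>2 / 2)))"
    and "(LINT t|lborel. cis (u * t) * of_real (exp (- \<eta> * t\<^sup>2 / 2))) = of_real (sqrt (2 * pi / \<eta>) * exp (- u\<^sup>2 / (2 * \<eta>)))"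
proof -
  let ?g = "\<lambda>t. std_normal_density t *\<^sub>R cis ((u / sqrt \<eta>) * t)"
  have g: "integrable lborel ?g"
    by (rule integrable_cis_mult) (auto intro: integrable_normal_density)
  have "(LINT t|lborel. ?g t) = char std_normal_distribution (u / sqrt \<eta>)"
    unfolding char_def by (subst integral_density) (auto simp: cis_conv_exp)
  then have i: "(LINT t|lborel. ?g t) = of_real (exp (- u\<^sup>2 / (2 * \<eta>)))"
    using e by (simp add: char_std_normal_distribution power_divide)
  have sq: "sqrt \<eta> \<noteq> 0" using e by simp
  have eq: "?g (0 + sqrt \<eta> * t) = of_real (1 / sqrt (2 * pi)) * (cis (u * t) * of_real (exp (- \<eta> * t\<^sup>2 / 2)))" for t
    using e by (simp add: std_normal_density_def power_mult_distrib scaleR_conv_of_real)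
  have "integrable lborel (\<lambda>t. complex_of_real (sqrt (2 * pi)) * ?g (0 + sqrt \<eta> * t))"
    using lborel_integrable_real_affine[OF g sq, of 0] by (rule integrable_mult_right)
  then show "integrable lborel (\<lambda>t. cis (u * t) * of_real (exp (- \<eta> * t\<^sup>2 / 2)))"
    unfolding eq by simp
  have "of_real (exp (- u\<^sup>2 / (2 * \<eta>))) = sqrt \<eta> *\<^sub>R (LINT t|lborel. ?g (0 + sqrt \<eta> * t))"
    using lborel_integral_real_affine[OF sq, of ?g 0] i e by simp
  also have "\<dots> = of_real (sqrt \<eta> / sqrt (2 * pi)) * (LINT t|lborel. cis (u * t) * of_real (exp (- \<eta> * t\<^sup>2 / 2)))"
    unfolding eq by (simp add: scaleR_conv_of_real)
  finally show "(LINT t|lborel. cis (u * t) * of_real (exp (- \<eta> * t\<^sup>2 / 2))) = of_real (sqrt (2 * pi / \<eta>) * exp (- u\<^sup>2 / (2 * \<eta>)))"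
    using e by (simp add: field_simps real_sqrt_divide)
qed

definition gk :: "real \<Rightarrow> 'a::euclidean_space \<Rightarrow> real" where
  "gk \<eta> x = exp (- \<eta> * (norm x)\<^sup>2 / 2)"

lemma gk_pos: "0 < gk \<eta> x" and gk_nonneg: "0 \<le> gk \<eta> x" and gk_le_1: "0 \<le> \<eta> \<Longrightarrow> gk \<eta> x \<le> 1"
  by (auto simp: gk_def)

lemma gk_measurable[measurable]: "gk \<eta> \<in> borel_measurable borel"
  unfolding gk_def[abs_def] by measurable

lemma gk_scaleR: "gk \<eta> (a *\<^sub>R x) = gk (a\<^sup>2 * \<eta>) x"
  by (simp add: gk_def power_mult_distrib mult_ac)

lemma cis_sum: "finite A \<Longrightarrow> cis (\<Sum>x\<in>A. f x) = (\<Prod>x\<in>A. cis (f x))"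
  by (induction rule: finite_induct) (auto simp: cis_mult[symmetric])

lemma norm_power2_sum: "(norm x)\<^sup>2 = (\<Sum>b\<in>Basis. (x \<bullet> b)\<^sup>2)" for x :: "'a::euclidean_space"
  unfolding power2_norm_eq_inner euclidean_inner[of x x] by (simp add: power2_eq_square)

lemma gk_prod:
  "cis (x \<bullet> \<xi>) * of_real (gk \<eta> \<xi>) = (\<Prod>b\<in>Basis. cis ((x \<bullet> b) * (\<xi> \<bullet> b)) * of_real (exp (- \<eta> * (\<xi> \<bullet> b)\<^sup>2 / 2)))"
proof -
  have "- \<eta> * (norm \<xi>)\<^sup>2 / 2 = (\<Sum>b\<in>Basis. - \<eta> * (\<xi> \<bullet> b)\<^sup>2 / 2)"
    using sum_distrib_left[of "- \<eta> / 2" "\<lambda>b. (\<xi> \<bullet> b)\<^sup>2" Basis] by (simp add: norm_power2_sum)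
  then show ?thesis
    unfolding gk_def by (simp add: euclidean_inner[of x \<xi>] cis_sum exp_sum prod.distrib)
qed

text \<open>Total mass of \<open>gk \<eta>\<close>; the type argument carries the dimension.\<close>

definition gnorm :: "'a::euclidean_space itself \<Rightarrow> real \<Rightarrow> real" where
  "gnorm _ \<eta> = sqrt (2 * pi / \<eta>) ^ DIM('a)"

lemma gnorm_pos: "0 < \<eta> \<Longrightarrow> 0 < gnorm TYPE('a::euclidean_space) \<eta>"
  by (simp add: gnorm_def)

lemma gauss_fourier:
  fixes x :: "'a::euclidean_space"
  assumes e: "0 < \<eta>"
  shows "integrable lborel (\<lambda>\<xi>. cis (x \<bullet> \<xi>) * of_real (gk \<eta> \<xi>))"
    and "(LINT \<xi>|lborel. cis (x \<bullet> \<xi>) * of_real (gk \<eta> \<xi>)) = of_real (gnorm TYPE('a) \<eta> * gk (1 / \<eta>) x)"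
proof -
  show "integrable lborel (\<lambda>\<xi>. cis (x \<bullet> \<xi>) * of_real (gk \<eta> \<xi>))"
    unfolding gk_prod by (intro integrable_lborel_prod gauss_real e)
  have "- (1/\<eta>) * (norm x)\<^sup>2 / 2 = (\<Sum>b\<in>Basis. - (x \<bullet> b)\<^sup>2 / (2 * \<eta>))"
    using sum_distrib_left[of "- (1 / (2 * \<eta>))" "\<lambda>b. (x \<bullet> b)\<^sup>2" Basis] by (simp add: norm_power2_sum)
  then have "gk (1 / \<eta>) x = (\<Prod>b\<in>Basis. exp (- (x \<bullet> b)\<^sup>2 / (2 * \<eta>)))"
    by (simp add: gk_def exp_sum)
  then show "(LINT \<xi>|lborel. cis (x \<bullet> \<xi>) * of_real (gk \<eta> \<xi>)) = of_real (gnorm TYPE('a) \<eta> * gk (1 / \<eta>) x)"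
    unfolding gk_prod integral_lborel_prod[OF gauss_real(1)[OF e]] gauss_real(2)[OF e]
    by (simp add: prod.distrib gnorm_def)
qed

lemma gk_integrable: "0 < \<eta> \<Longrightarrow> integrable lborel (gk \<eta> :: 'a::euclidean_space \<Rightarrow> real)"
  using integrable_Re[OF gauss_fourier(1)[of \<eta> "0::'a"]] by simp

definition nd :: "'a::euclidean_space \<Rightarrow> real" where
  "nd x = gk 1 x / gnorm TYPE('a) 1"

lemma nd_nonneg: "0 \<le> nd x"
  by (auto simp: nd_def gk_pos gnorm_pos less_imp_le gk_nonneg)

lemma nd_integrable: "integrable lborel nd"
  unfolding nd_def[abs_def] by (simp add: gk_integrable)

lemma fourier_nd: "fourier nd \<xi> = of_real (gk 1 \<xi>)"
proof -
  have "fourier nd \<xi> = (LINT x|lborel. (cis ((- \<xi>) \<bullet> x) * of_real (gk 1 x)) / of_real (gnorm TYPE('a) 1))"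
    unfolding fourier_cis nd_def by (simp add: scaleR_conv_of_real inner_commute mult.commute)
  then show ?thesis
    using gnorm_pos[of 1, where 'a='a] by (simp add: gauss_fourier(2) gk_def[of _ "-\<xi>"] gk_def[of _ \<xi>] del: inner_minus_left)
qed

lemma nd_integral: "(LINT x|lborel. nd x) = 1"
  using fourier_nd[of 0] by (simp add: gk_def)

text \<open>Bounding |x|^2 / 4 by its exponential leaves a Gaussian of twice the variance. This
  moment is what makes the subordinated stable measure a Levy measure.\<close>

lemma nd_second_moment: "integrable lborel (\<lambda>x::'a::euclidean_space. (norm x)\<^sup>2 * nd x)"
proof (rule Bochner_Integration.integrable_bound)
  show "integrable lborel (\<lambda>x::'a. 4 / gnorm TYPE('a) 1 * gk (1/2) x)" by (simp add: gk_integrable)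
  show "AE x::'a in lborel. norm ((norm x)\<^sup>2 * nd x) \<le> norm (4 / gnorm TYPE('a) 1 * gk (1/2) x)"
  proof (rule AE_I2)
    fix x :: 'a
    have "(norm x)\<^sup>2 / 4 \<le> exp ((norm x)\<^sup>2 / 4)" using exp_ge_add_one_self[of "(norm x)\<^sup>2 / 4"] by linarith
    then have "(norm x)\<^sup>2 * exp (- (norm x)\<^sup>2 / 2) \<le> (4 * exp ((norm x)\<^sup>2 / 4)) * exp (- (norm x)\<^sup>2 / 2)"
      by (intro mult_right_mono) auto
    also have "\<dots> = 4 * exp (- (norm x)\<^sup>2 / 4)" by (simp add: exp_add[symmetric])
    finally show "norm ((norm x)\<^sup>2 * nd x) \<le> norm (4 / gnorm TYPE('a) 1 * gk (1/2) x)"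
      using gnorm_pos[of 1, where 'a='a] by (simp add: nd_def gk_def divide_right_mono)
  qed
qed (auto simp: nd_def)

section \<open>Gauss-positive functions\<close>

text \<open>Replaces positive definiteness: by Bochner's theorem these are the characteristic functions of
  finite measures. Regularising by a Gaussian avoids measures and keeps everything inside \<open>L\<^sup>1\<close>.\<close>

definition gp :: "('a::euclidean_space \<Rightarrow> complex) \<Rightarrow> bool" where
  "gp \<rho> \<longleftrightarrow> \<rho> \<in> borel_measurable borel \<and> (\<exists>M. \<forall>\<xi>. cmod (\<rho> \<xi>) \<le> M) \<and>
     (\<forall>\<eta>>0. \<forall>x. (LINT \<xi>|lborel. cis (x \<bullet> \<xi>) * (of_real (gk \<eta> \<xi>) * \<rho> \<xi>)) \<in> nonneg_Reals)"

lemma gpI: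
  assumes "\<rho> \<in> borel_measurable borel" "\<And>\<xi>. cmod (\<rho> \<xi>) \<le> M"
    "\<And>\<eta> x. 0 < \<eta> \<Longrightarrow> (LINT \<xi>|lborel. cis (x \<bullet> \<xi>) * (of_real (gk \<eta> \<xi>) * \<rho> \<xi>)) \<in> nonneg_Reals"
  shows "gp \<rho>"
  using assms unfolding gp_def by blast

lemma gpD: "gp \<rho> \<Longrightarrow> 0 < \<eta> \<Longrightarrow> (LINT \<xi>|lborel. cis (x \<bullet> \<xi>) * (of_real (gk \<eta> \<xi>) * \<rho> \<xi>)) \<in> nonneg_Reals"
  by (simp add: gp_def)

lemma gp_measurable: "gp \<rho> \<Longrightarrow> \<rho> \<in> borel_measurable borel" by (simp add: gp_def)

lemma gk_mult_integrable:
  fixes \<rho> :: "'a::euclidean_space \<Rightarrow> complex"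
  assumes [measurable]: "\<rho> \<in> borel_measurable borel" and b: "\<And>\<xi>. cmod (\<rho> \<xi>) \<le> M" and e: "0 < \<eta>"
  shows "integrable lborel (\<lambda>\<xi>. of_real (gk \<eta> \<xi>) * \<rho> \<xi>)"
proof (rule Bochner_Integration.integrable_bound)
  show "integrable lborel (\<lambda>\<xi>::'a. M * gk \<eta> \<xi>)" by (intro integrable_mult_right gk_integrable e)
  show "AE \<xi> in lborel. norm (of_real (gk \<eta> \<xi>) * \<rho> \<xi>) \<le> norm (M * gk \<eta> \<xi>)"
  proof (rule AE_I2)
    fix \<xi>
    have "0 \<le> M" using b[of \<xi>] norm_ge_zero order_trans by blast
    then show "norm (of_real (gk \<eta> \<xi>) * \<rho> \<xi>) \<le> norm (M * gk \<eta> \<xi>)"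
      using b[of \<xi>] by (simp add: norm_mult gk_nonneg mult.commute[of M] mult_left_mono)
  qed
qed simp

lemma gp_integrable:
  assumes "gp \<rho>" "0 < \<eta>"
  shows "integrable lborel (\<lambda>\<xi>. of_real (gk \<eta> \<xi>) * \<rho> \<xi>)"
  using assms gk_mult_integrable unfolding gp_def by blast

lemma gp_const: "gp (\<lambda>_::'a::euclidean_space. 1)"
proof (rule gpI[where M=1])
  show "(LINT \<xi>::'a|lborel. cis (x \<bullet> \<xi>) * (of_real (gk \<eta> \<xi>) * 1)) \<in> nonneg_Reals" if "0 < \<eta>" for \<eta> x
    using gnorm_pos[OF that, where 'a='a] gk_nonneg[of "1/\<eta>" x]
    by (simp only: mult_1_right gauss_fourier(2)[OF that] nonneg_Reals_of_real_iff) simp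
qed auto

text \<open>Counterpart of the continuity theorem for characteristic functions. The Gaussian factor
  in the definition supplies the dominating function, so pointwise convergence under a common bound
  is enough.\<close>

lemma gp_limit:
  fixes \<rho> :: "'a::euclidean_space \<Rightarrow> complex"
  assumes g: "\<And>n. gp (X n)" and b: "\<And>n \<xi>. cmod (X n \<xi>) \<le> M" and l: "\<And>\<xi>. (\<lambda>n. X n \<xi>) \<longlonglongrightarrow> \<rho> \<xi>"
  shows "gp \<rho>"
proof -
  have m[measurable]: "X n \<in> borel_measurable borel" for n using g by (simp add: gp_def)
  have mc[measurable]: "\<rho> \<in> borel_measurable borel"
    by (rule borel_measurable_LIMSEQ_metric[OF m l])
  have bc: "cmod (\<rho> \<xi>) \<le> M" for \<xi>
    by (rule Lim_bounded[OF tendsto_norm[OF l]]) (use b in auto)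
  have "(LINT \<xi>|lborel. cis (x \<bullet> \<xi>) * (of_real (gk \<eta> \<xi>) * \<rho> \<xi>)) \<in> nonneg_Reals" if e: "\<eta> > 0" for \<eta> x
  proof -
    have "(\<lambda>n. LINT \<xi>|lborel. cis (x \<bullet> \<xi>) * (of_real (gk \<eta> \<xi>) * X n \<xi>)) \<longlonglongrightarrow> (LINT \<xi>|lborel. cis (x \<bullet> \<xi>) * (of_real (gk \<eta> \<xi>) * \<rho> \<xi>))"
    proof (rule integral_dominated_convergence[where w="\<lambda>\<xi>. M * gk \<eta> \<xi>"])
      show "AE \<xi> in lborel. (\<lambda>n. cis (x \<bullet> \<xi>) * (of_real (gk \<eta> \<xi>) * X n \<xi>)) \<longlonglongrightarrow> cis (x \<bullet> \<xi>) * (of_real (gk \<eta> \<xi>) * \<rho> \<xi>)"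
        by (intro AE_I2 tendsto_intros l)
      show "AE \<xi> in lborel. norm (cis (x \<bullet> \<xi>) * (of_real (gk \<eta> \<xi>) * X n \<xi>)) \<le> M * gk \<eta> \<xi>" for n
        using b[of n] by (intro AE_I2) (simp add: norm_mult gk_nonneg mult.commute[of _ "gk _ _"] mult_left_mono)
    qed (intro integrable_mult_right gk_integrable e | simp)+
    then show ?thesis
      by (rule Lim_in_closed_set[rotated 3]) (use gpD[OF g e] in auto)
  qed
  with mc bc show ?thesis by (rule gpI)
qed

lemma gp_add:
  assumes "gp \<rho>" "gp \<psi>" shows "gp (\<lambda>\<xi>. \<rho> \<xi> + \<psi> \<xi>)"
proof -
  obtain M N where b: "\<And>\<xi>. cmod (\<rho> \<xi>) \<le> M" "\<And>\<xi>. cmod (\<psi> \<xi>) \<le> N" using assms unfolding gp_def by blast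
  have "cmod (\<rho> \<xi> + \<psi> \<xi>) \<le> M + N" for \<xi> using norm_triangle_mono[OF b] .
  moreover have "(LINT \<xi>|lborel. cis (x \<bullet> \<xi>) * (of_real (gk \<eta> \<xi>) * (\<rho> \<xi> + \<psi> \<xi>))) \<in> nonneg_Reals" if e: "\<eta> > 0" for \<eta> x
  proof -
    have "(LINT \<xi>|lborel. cis (x \<bullet> \<xi>) * (of_real (gk \<eta> \<xi>) * (\<rho> \<xi> + \<psi> \<xi>))) =
      (LINT \<xi>|lborel. cis (x \<bullet> \<xi>) * (of_real (gk \<eta> \<xi>) * \<rho> \<xi>)) + (LINT \<xi>|lborel. cis (x \<bullet> \<xi>) * (of_real (gk \<eta> \<xi>) * \<psi> \<xi>))"
      unfolding distrib_left
      by (intro Bochner_Integration.integral_add integrable_cis_mult_complex gp_integrable assms e) auto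
    then show ?thesis using gpD[OF assms(1) e] gpD[OF assms(2) e] by simp
  qed
  moreover have "(\<lambda>\<xi>. \<rho> \<xi> + \<psi> \<xi>) \<in> borel_measurable borel"
    using assms[THEN gp_measurable] by measurable
  ultimately show ?thesis by (intro gpI)
qed

lemma gp_scale:
  assumes "gp \<rho>" "0 \<le> (c::real)" shows "gp (\<lambda>\<xi>. of_real c * \<rho> \<xi>)"
proof -
  obtain M where b: "\<And>\<xi>. cmod (\<rho> \<xi>) \<le> M" using assms unfolding gp_def by blast
  have "cmod (of_real c * \<rho> \<xi>) \<le> c * M" for \<xi> using b[of \<xi>] assms by (simp add: norm_mult mult_left_mono)
  moreover have "(LINT \<xi>|lborel. cis (x \<bullet> \<xi>) * (of_real (gk \<eta> \<xi>) * (of_real c * \<rho> \<xi>))) \<in> nonneg_Reals" if e: "\<eta> > 0" for \<eta> x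
  proof -
    have "(LINT \<xi>|lborel. cis (x \<bullet> \<xi>) * (of_real (gk \<eta> \<xi>) * (of_real c * \<rho> \<xi>))) =
      of_real c * (LINT \<xi>|lborel. cis (x \<bullet> \<xi>) * (of_real (gk \<eta> \<xi>) * \<rho> \<xi>))"
      by (subst integral_mult_right_zero[symmetric]) (simp add: mult.left_commute)
    then show ?thesis using gpD[OF assms(1) e] assms(2) by simp
  qed
  moreover have "(\<lambda>\<xi>. of_real c * \<rho> \<xi>) \<in> borel_measurable borel"
    using assms(1)[THEN gp_measurable] by measurable
  ultimately show ?thesis by (intro gpI)
qed

lemma nonneg_Reals_integral:
  assumes "\<And>x. f x \<in> nonneg_Reals"
  shows "(LINT x|M. f x) \<in> (nonneg_Reals :: complex set)"
proof -
  have r: "0 \<le> Re (f x)" "of_real (Re (f x)) = f x" for x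
    using assms[of x] by (auto elim!: nonneg_Reals_cases)
  have "(LINT x|M. f x) = of_real (LINT x|M. Re (f x))"
    by (simp only: r(2) flip: integral_complex_of_real)
  moreover have "0 \<le> (LINT x|M. Re (f x))" by (rule integral_nonneg_AE) (simp add: r)
  ultimately show ?thesis by simp
qed

text \<open>Multiplying by the transform of a nonnegative \<open>g\<close> replaces the nonnegative
  inversion integrals by their averages against \<open>g\<close>.\<close>

lemma gp_mult_fourier:
  assumes c: "gp \<rho>" and g: "integrable lborel g" "\<And>x. 0 \<le> g x"
  shows "gp (\<lambda>\<xi>. \<rho> \<xi> * fourier g \<xi>)"
proof -
  obtain M where b: "\<And>\<xi>. cmod (\<rho> \<xi>) \<le> M" using c unfolding gp_def by blast
  have "cmod (\<rho> \<xi> * fourier g \<xi>) \<le> M * (LINT x|lborel. \<bar>g x\<bar>)" for \<xi>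
    unfolding norm_mult
    by (intro mult_mono b fourier_norm_le) (use b[of \<xi>] norm_ge_zero order_trans in \<open>blast, auto\<close>)
  moreover have "(LINT \<xi>|lborel. cis (x \<bullet> \<xi>) * (of_real (gk \<eta> \<xi>) * (\<rho> \<xi> * fourier g \<xi>))) \<in> nonneg_Reals" if e: "\<eta> > 0" for \<eta> x
  proof -
    have "(LINT \<xi>|lborel. cis (x \<bullet> \<xi>) * (of_real (gk \<eta> \<xi>) * (\<rho> \<xi> * fourier g \<xi>))) =
      (LINT y|lborel. g y *\<^sub>R (LINT \<xi>|lborel. cis ((x - y) \<bullet> \<xi>) * (of_real (gk \<eta> \<xi>) * \<rho> \<xi>)))"
      by (subst fubini_cis(1)[OF g(1) gp_integrable[OF c e]]) (simp add: mult_ac)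
    also have "\<dots> \<in> nonneg_Reals"
      using gpD[OF c e] g(2) by (intro nonneg_Reals_integral) (simp add: scaleR_conv_of_real)
    finally show ?thesis .
  qed
  moreover have "(\<lambda>\<xi>. \<rho> \<xi> * fourier g \<xi>) \<in> borel_measurable borel"
    using gp_measurable[OF c] fourier_measurable[OF g(1)] by measurable
  ultimately show ?thesis by (intro gpI)
qed

text \<open>With nonnegative coefficients each partial sum is a nonnegative combination of products,
  and |\<open>fourier g\<close>| is at most the norm of \<open>g\<close>, so the partial sums have a
  common bound and \<open>gp_limit\<close> applies. The intended \<open>H\<close> are
  \<open>exp\<close> and \<open>EE\<close>, that is, compound Poisson laws.\<close>

lemma gp_power_series:
  fixes g :: "'a::euclidean_space \<Rightarrow> real" and H :: "complex \<Rightarrow> complex"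
  assumes c: "gp \<rho>" and g: "integrable lborel g" "\<And>x. 0 \<le> g x"
    and a: "\<And>n. 0 \<le> (a n :: real)" and s: "\<And>r. summable (\<lambda>n. a n * r ^ n)"
    and H: "\<And>z. (\<lambda>n. of_real (a n) * z ^ n) sums H z"
  shows "gp (\<lambda>\<xi>. \<rho> \<xi> * H (fourier g \<xi>))"
proof -
  let ?G = "LINT x|lborel. \<bar>g x\<bar>"
  obtain M where b: "\<And>\<xi>. cmod (\<rho> \<xi>) \<le> M" using c unfolding gp_def by blast
  have M: "0 \<le> M" using b[of 0] norm_ge_zero order_trans by blast
  have pw: "gp (\<lambda>\<xi>. \<rho> \<xi> * fourier g \<xi> ^ n)" for n
  proof (induction n)
    case (Suc n) show ?case using gp_mult_fourier[OF Suc g] by (simp add: mult_ac)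
  qed (use c in simp)
  have "gp (\<lambda>\<xi>. \<Sum>n<N. of_real (a n) * (\<rho> \<xi> * fourier g \<xi> ^ n))" for N
  proof (induction N)
    case 0 show ?case using gp_scale[OF gp_const, of 0] by simp
  next
    case (Suc N) show ?case using gp_add[OF Suc gp_scale[OF pw a[of N], of N]] by simp
  qed
  then show ?thesis
  proof (rule gp_limit[where M="M * (\<Sum>n. a n * ?G ^ n)"])
    fix N \<xi>
    have "cmod (\<Sum>n<N. of_real (a n) * (\<rho> \<xi> * fourier g \<xi> ^ n)) \<le> (\<Sum>n<N. M * (a n * ?G ^ n))"
    proof (rule sum_norm_le)
      fix n
      have "cmod (of_real (a n) * (\<rho> \<xi> * fourier g \<xi> ^ n)) = a n * (cmod (\<rho> \<xi>) * cmod (fourier g \<xi>) ^ n)"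
        using a[of n] by (simp add: norm_mult norm_power)
      also have "\<dots> \<le> a n * (M * ?G ^ n)"
        by (intro mult_left_mono mult_mono b power_mono fourier_norm_le a M) auto
      finally show "cmod (of_real (a n) * (\<rho> \<xi> * fourier g \<xi> ^ n)) \<le> M * (a n * ?G ^ n)" by (simp add: mult_ac)
    qed
    also have "\<dots> = M * (\<Sum>n<N. a n * ?G ^ n)" by (simp add: sum_distrib_left)
    also have "\<dots> \<le> M * (\<Sum>n. a n * ?G ^ n)"
      by (intro mult_left_mono sum_le_suminf s M) (auto intro!: mult_nonneg_nonneg a)
    finally show "cmod (\<Sum>n<N. of_real (a n) * (\<rho> \<xi> * fourier g \<xi> ^ n)) \<le> M * (\<Sum>n. a n * ?G ^ n)" .
  next
    fix \<xi>
    have "(\<lambda>N. \<rho> \<xi> * (\<Sum>n<N. of_real (a n) * fourier g \<xi> ^ n)) \<longlonglongrightarrow> \<rho> \<xi> * H (fourier g \<xi>)"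
      using H unfolding sums_def by (intro tendsto_intros)
    then show "(\<lambda>N. \<Sum>n<N. of_real (a n) * (\<rho> \<xi> * fourier g \<xi> ^ n)) \<longlonglongrightarrow> \<rho> \<xi> * H (fourier g \<xi>)"
      by (simp add: sum_distrib_left mult_ac)
  qed
qed

lemma abs_gk [simp]: "\<bar>gk \<eta> x\<bar> = gk \<eta> x"
  by (rule abs_of_nonneg[OF gk_nonneg])

lemma gp_mult_gk:
  assumes g: "gp \<rho>" and e: "0 \<le> \<eta>"
  shows "gp (\<lambda>\<xi>. of_real (gk \<eta> \<xi>) * \<rho> \<xi>)"
proof -
  obtain M where b: "\<And>\<xi>. cmod (\<rho> \<xi>) \<le> M" using g unfolding gp_def by blast
  show ?thesis
  proof (rule gpI)
    show "cmod (of_real (gk \<eta> \<xi>) * \<rho> \<xi>) \<le> M" for \<xi>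
      using b[of \<xi>] gk_le_1[OF e, of \<xi>] gk_nonneg[of \<eta> \<xi>] mult_left_le_one_le[of "cmod (\<rho> \<xi>)" "gk \<eta> \<xi>"]
      by (simp add: norm_mult)
    have eq: "of_real (gk \<eta>' \<xi>) * (of_real (gk \<eta> \<xi>) * \<rho> \<xi>) = of_real (gk (\<eta> + \<eta>') \<xi>) * \<rho> \<xi>" for \<eta>' \<xi>
      by (simp add: gk_def exp_add[symmetric] algebra_simps add_divide_distrib flip: of_real_mult)
    show "(LINT \<xi>|lborel. cis (x \<bullet> \<xi>) * (of_real (gk \<eta>' \<xi>) * (of_real (gk \<eta> \<xi>) * \<rho> \<xi>))) \<in> nonneg_Reals" if "0 < \<eta>'" for \<eta>' x
      unfolding eq using gpD[OF g, of "\<eta> + \<eta>'" x] that e by simp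
  qed (use gp_measurable[OF g] in measurable)
qed

lemma fourier_gk:
  assumes "0 < \<eta>"
  shows "fourier (gk \<eta>) \<xi> = of_real (gnorm TYPE('a) \<eta> * gk (1 / \<eta>) (\<xi>::'a::euclidean_space))"
proof -
  have "fourier (gk \<eta>) \<xi> = (LINT x|lborel. cis ((- \<xi>) \<bullet> x) * of_real (gk \<eta> x))"
    unfolding fourier_cis by (simp add: scaleR_conv_of_real inner_commute mult.commute)
  also have "\<dots> = of_real (gnorm TYPE('a) \<eta> * gk (1 / \<eta>) (-\<xi>))" by (rule gauss_fourier(2)[OF assms])
  finally show ?thesis by (simp add: gk_def)
qed

text \<open>Cutting the inverse transform off by a Gaussian and transforming back yields the average
  of \<open>\<rho>\<close> around \<open>\<zeta>\<close> at scale \<open>a\<close>. This is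
  available before anything is known about the integrability of the inverse transform.\<close>

lemma gauss_regularized_inversion:
  fixes \<rho> :: "'a::euclidean_space \<Rightarrow> complex"
  assumes r: "integrable lborel \<rho>" and e: "0 < (a::real)"
  shows "(LINT y|lborel. gk (a\<^sup>2) y *\<^sub>R (cis (- (y \<bullet> \<zeta>)) * (LINT \<xi>|lborel. cis (y \<bullet> \<xi>) * \<rho> \<xi>))) =
    of_real ((2 * pi) ^ DIM('a)) * (LINT z|lborel. nd z *\<^sub>R \<rho> (\<zeta> + a *\<^sub>R z))"
    "integrable lborel (\<lambda>y. gk (a\<^sup>2) y *\<^sub>R (cis (- (y \<bullet> \<zeta>)) * (LINT \<xi>|lborel. cis (y \<bullet> \<xi>) * \<rho> \<xi>)))"
proof -
  have a2: "0 < a\<^sup>2" using e by simp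
  \<comment> \<open>The shift by \<open>\<zeta>\<close> moves the evaluation point to the origin.
    Then \<open>fubini_cis\<close> is used at x = 0, which reverses the sign of y and explains the
    reflections below.\<close>
  define \<kappa> where "\<kappa> = (\<lambda>\<xi>. \<rho> (\<xi> + \<zeta>))"
  have k: "integrable lborel \<kappa>" unfolding \<kappa>_def by (rule integrable_translate(1)[OF r])
  have I: "(LINT \<xi>|lborel. cis ((0 - y) \<bullet> \<xi>) * \<kappa> \<xi>) = cis (y \<bullet> \<zeta>) * (LINT \<xi>|lborel. cis ((-y) \<bullet> \<xi>) * \<rho> \<xi>)" for y
  proof -
    have "(LINT \<xi>|lborel. cis ((-y) \<bullet> \<xi>) * \<rho> \<xi>) = (LINT \<xi>|lborel. cis ((-y) \<bullet> (\<xi> + \<zeta>)) * \<rho> (\<xi> + \<zeta>))"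
      by (rule integral_translate(1)[OF integrable_cis_mult_complex[OF r], symmetric]) simp
    also have "\<dots> = (LINT \<xi>|lborel. cis (- (y \<bullet> \<zeta>)) * (cis ((0 - y) \<bullet> \<xi>) * \<kappa> \<xi>))"
      by (simp add: \<kappa>_def inner_add_right cis_mult add.commute flip: mult.assoc)
    also have "\<dots> = cis (- (y \<bullet> \<zeta>)) * (LINT \<xi>|lborel. cis ((0 - y) \<bullet> \<xi>) * \<kappa> \<xi>)"
      by (rule integral_mult_right_zero)
    finally show ?thesis by (simp add: cis_mult flip: mult.assoc)
  qed
  let ?F = "\<lambda>y. gk (a\<^sup>2) y *\<^sub>R (cis (- (y \<bullet> \<zeta>)) * (LINT \<xi>|lborel. cis (y \<bullet> \<xi>) * \<rho> \<xi>))"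
  have F: "gk (a\<^sup>2) y *\<^sub>R (LINT \<xi>|lborel. cis ((0 - y) \<bullet> \<xi>) * \<kappa> \<xi>) = ?F (0 - y)" for y
    unfolding I by (simp add: gk_def)
  have Fi: "integrable lborel (\<lambda>y. ?F (0 - y))"
    using fubini_cis(2)[OF gk_integrable[OF a2] k, of 0] unfolding F .
  from integrable_translate(3)[OF Fi, of 0] show Fint: "integrable lborel ?F" by simp
  have "(LINT y|lborel. ?F y) = (LINT y|lborel. ?F (0 - y))"
    by (rule integral_translate(3)[OF Fint, symmetric])
  also have "\<dots> = (LINT \<xi>|lborel. cis (0 \<bullet> \<xi>) * (\<kappa> \<xi> * fourier (gk (a\<^sup>2)) \<xi>))"
    using fubini_cis(1)[OF gk_integrable[OF a2] k, of 0] unfolding F .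
  also have "\<dots> = (LINT \<xi>|lborel. of_real (gnorm TYPE('a) (a\<^sup>2)) * (of_real (gk (1 / a\<^sup>2) \<xi>) * \<kappa> \<xi>))"
    by (simp add: fourier_gk[OF a2] mult_ac)
  also have "\<dots> = of_real (gnorm TYPE('a) (a\<^sup>2)) * (LINT \<xi>|lborel. of_real (gk (1 / a\<^sup>2) \<xi>) * \<kappa> \<xi>)"
    by (rule integral_mult_right_zero)
  also have "(LINT \<xi>|lborel. of_real (gk (1 / a\<^sup>2) \<xi>) * \<kappa> \<xi>) = \<bar>a\<bar>^DIM('a) *\<^sub>R (LINT z|lborel. of_real (gk (1 / a\<^sup>2) (0 + a *\<^sub>R z)) * \<kappa> (0 + a *\<^sub>R z))"
  proof (rule integral_lborel_affine)
    show "integrable lborel (\<lambda>\<xi>. of_real (gk (1 / a\<^sup>2) \<xi>) * \<kappa> \<xi>)"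
      by (rule Bochner_Integration.integrable_bound[OF k])
        (use gk_le_1[of "1/a\<^sup>2"] gk_nonneg k in \<open>auto simp: norm_mult intro!: AE_I2 mult_left_le_one_le\<close>)
  qed (use e in auto)
  also have "(LINT z|lborel. of_real (gk (1 / a\<^sup>2) (0 + a *\<^sub>R z)) * \<kappa> (0 + a *\<^sub>R z)) = (LINT z|lborel. of_real (gnorm TYPE('a) 1) * (nd z *\<^sub>R \<rho> (\<zeta> + a *\<^sub>R z)))"
    using e gnorm_pos[of 1, where 'a='a]
    by (simp add: gk_scaleR nd_def \<kappa>_def scaleR_conv_of_real add.commute)
  also have "\<dots> = of_real (gnorm TYPE('a) 1) * (LINT z|lborel. nd z *\<^sub>R \<rho> (\<zeta> + a *\<^sub>R z))"
    by (rule integral_mult_right_zero)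
  also have "of_real (gnorm TYPE('a) (a\<^sup>2)) * (\<bar>a\<bar>^DIM('a) *\<^sub>R (of_real (gnorm TYPE('a) 1) * X)) = of_real ((2 * pi) ^ DIM('a)) * X" for X :: complex
  proof -
    have "gnorm TYPE('a) (a\<^sup>2) * (\<bar>a\<bar>^DIM('a) * gnorm TYPE('a) 1) = (sqrt (2 * pi / a\<^sup>2) * (a * sqrt (2 * pi))) ^ DIM('a)"
      using e by (simp add: gnorm_def power_mult_distrib)
    also have "sqrt (2 * pi / a\<^sup>2) * (a * sqrt (2 * pi)) = 2 * pi"
      using e by (simp add: real_sqrt_divide)
    finally show ?thesis by (simp add: scaleR_conv_of_real mult.assoc[symmetric] flip: of_real_mult of_real_power)
  qed
  finally show "(LINT y|lborel. ?F y) = of_real ((2 * pi) ^ DIM('a)) * (LINT z|lborel. nd z *\<^sub>R \<rho> (\<zeta> + a *\<^sub>R z))" .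
qed

lemma nd_average_tendsto:
  fixes \<rho> :: "'a::euclidean_space \<Rightarrow> complex"
  assumes c: "continuous_on UNIV \<rho>" and b: "\<And>\<xi>. cmod (\<rho> \<xi>) \<le> M" and a: "a \<longlonglongrightarrow> 0"
  shows "(\<lambda>n. LINT z|lborel. nd z *\<^sub>R \<rho> (\<zeta> + a n *\<^sub>R z)) \<longlonglongrightarrow> \<rho> \<zeta>"
proof -
  have [measurable]: "\<rho> \<in> borel_measurable borel" "nd \<in> borel_measurable (borel :: 'a measure)"
    using borel_measurable_continuous_onI[OF c] nd_integrable by auto
  have "(\<lambda>n. LINT z|lborel. nd z *\<^sub>R \<rho> (\<zeta> + a n *\<^sub>R z)) \<longlonglongrightarrow> (LINT z|lborel. nd (z::'a) *\<^sub>R \<rho> \<zeta>)"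
  proof (rule integral_dominated_convergence[where w="\<lambda>z::'a. M * nd z"])
    show "AE z in lborel. (\<lambda>n. nd z *\<^sub>R \<rho> (\<zeta> + a n *\<^sub>R z)) \<longlonglongrightarrow> nd z *\<^sub>R \<rho> \<zeta>"
    proof (intro AE_I2 tendsto_intros)
      fix z :: 'a
      have "(\<lambda>n. \<zeta> + a n *\<^sub>R z) \<longlonglongrightarrow> \<zeta> + 0 *\<^sub>R z" by (intro tendsto_intros a)
      then show "(\<lambda>n. \<rho> (\<zeta> + a n *\<^sub>R z)) \<longlonglongrightarrow> \<rho> \<zeta>"
        using c by (intro continuous_on_tendsto_compose[OF c]) auto
    qed
    show "AE z in lborel. norm (nd z *\<^sub>R \<rho> (\<zeta> + a n *\<^sub>R z)) \<le> M * nd z" for n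
      using b by (intro AE_I2) (simp add: nd_nonneg mult.commute[of M] mult_left_mono)
  qed (intro integrable_mult_right nd_integrable | simp)+
  then show ?thesis by (simp add: nd_integrable nd_integral)
qed

text \<open>The regularisation in \<open>gp\<close> is removed by letting its parameter tend to 0,
  with \<open>\<rho>\<close> itself as dominating function.\<close>

lemma gp_inverse_nonneg:
  fixes \<rho> :: "'a::euclidean_space \<Rightarrow> complex"
  assumes g: "gp \<rho>" and i: "integrable lborel \<rho>"
  shows "(LINT \<xi>|lborel. cis (x \<bullet> \<xi>) * \<rho> \<xi>) \<in> nonneg_Reals"
proof -
  have [measurable]: "\<rho> \<in> borel_measurable borel" using gp_measurable[OF g] .
  let ?e = "\<lambda>n. inverse (real (Suc n))"
  have e: "?e \<longlonglongrightarrow> 0" by (rule LIMSEQ_inverse_real_of_nat)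
  have "(\<lambda>n. LINT \<xi>|lborel. cis (x \<bullet> \<xi>) * (of_real (gk (?e n) \<xi>) * \<rho> \<xi>)) \<longlonglongrightarrow> (LINT \<xi>|lborel. cis (x \<bullet> \<xi>) * \<rho> \<xi>)"
  proof (rule integral_dominated_convergence[where w="\<lambda>\<xi>. norm (\<rho> \<xi>)"])
    show "AE \<xi> in lborel. (\<lambda>n. cis (x \<bullet> \<xi>) * (of_real (gk (?e n) \<xi>) * \<rho> \<xi>)) \<longlonglongrightarrow> cis (x \<bullet> \<xi>) * \<rho> \<xi>"
    proof (intro AE_I2)
      fix \<xi> :: 'a
      have "(\<lambda>n. cis (x \<bullet> \<xi>) * (of_real (exp (- ?e n * (norm \<xi>)\<^sup>2 / 2)) * \<rho> \<xi>)) \<longlonglongrightarrow> cis (x \<bullet> \<xi>) * (of_real (exp (- 0 * (norm \<xi>)\<^sup>2 / 2)) * \<rho> \<xi>)"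
        by (intro tendsto_intros e) simp
      then show "(\<lambda>n. cis (x \<bullet> \<xi>) * (of_real (gk (?e n) \<xi>) * \<rho> \<xi>)) \<longlonglongrightarrow> cis (x \<bullet> \<xi>) * \<rho> \<xi>"
        unfolding gk_def by simp
    qed
    show "AE \<xi> in lborel. norm (cis (x \<bullet> \<xi>) * (of_real (gk (?e n) \<xi>) * \<rho> \<xi>)) \<le> norm (\<rho> \<xi>)" for n
      using gk_le_1[of "?e n"] gk_nonneg by (intro AE_I2) (auto simp: norm_mult intro!: mult_left_le_one_le)
  qed (use i in auto)
  then show ?thesis
    by (rule Lim_in_closed_set[rotated 3]) (use gpD[OF g] in auto)
qed

text \<open>The inverse transform is a nonnegative function not known to be integrable. Its Gaussian
  cut-offs increase to it, and at frequency 0 their integrals converge to the finite value of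
  \<open>\<rho>\<close> there, so monotone convergence gives integrability; dominated convergence
  then identifies the transform at every frequency.\<close>

lemma gp_inversion:
  fixes \<rho> :: "'a::euclidean_space \<Rightarrow> complex"
  assumes g: "gp \<rho>" and i: "integrable lborel \<rho>" and c: "continuous_on UNIV \<rho>"
  obtains k where "integrable lborel k" "\<And>x. 0 \<le> k x" "\<And>\<xi>. fourier k \<xi> = \<rho> \<xi>"
    "\<And>x. of_real (k x) = (LINT \<xi>|lborel. cis (x \<bullet> \<xi>) * \<rho> \<xi>) / of_real ((2 * pi) ^ DIM('a))"
proof -
  obtain M where b: "\<And>\<xi>. cmod (\<rho> \<xi>) \<le> M" using g unfolding gp_def by blast
  have [measurable]: "\<rho> \<in> borel_measurable borel" using gp_measurable[OF g] .
  let ?I = "\<lambda>x. LINT \<xi>|lborel. cis (x \<bullet> \<xi>) * \<rho> \<xi>" and ?cc = "(2 * pi) ^ DIM('a)"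
  define k where "k = (\<lambda>x. Re (?I x) / ?cc)"
  have cc: "0 < ?cc" by simp
  have I: "?I x = of_real (?cc * k x)" for x
    using gp_inverse_nonneg[OF g i, of x] by (auto simp: k_def elim!: nonneg_Reals_cases)
  have k0: "0 \<le> k x" for x
    using gp_inverse_nonneg[OF g i, of x] by (auto simp: k_def elim!: nonneg_Reals_cases)
  have [measurable]: "k \<in> borel_measurable borel" unfolding k_def by measurable
  define a where "a = (\<lambda>n. inverse (real (Suc n)))"
  have a: "a \<longlonglongrightarrow> 0" "0 < a n" for n unfolding a_def by (rule LIMSEQ_inverse_real_of_nat) simp
  have ga: "(\<lambda>n. gk ((a n)\<^sup>2) x) \<longlonglongrightarrow> 1" for x :: 'a
  proof -
    have "(\<lambda>n. exp (- (a n)\<^sup>2 * (norm x)\<^sup>2 / 2)) \<longlonglongrightarrow> exp (- 0\<^sup>2 * (norm x)\<^sup>2 / 2)"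
      by (intro tendsto_intros a) simp
    then show ?thesis by (simp add: gk_def)
  qed
  have lim: "(\<lambda>n. LINT y|lborel. gk ((a n)\<^sup>2) y *\<^sub>R (cis (- (y \<bullet> \<zeta>)) * of_real (k y))) \<longlonglongrightarrow> \<rho> \<zeta>" for \<zeta>
  proof -
    have "(LINT y|lborel. gk ((a n)\<^sup>2) y *\<^sub>R (cis (- (y \<bullet> \<zeta>)) * of_real (k y))) = (LINT z|lborel. nd z *\<^sub>R \<rho> (\<zeta> + a n *\<^sub>R z))" for n
    proof -
      have "of_real ?cc * (LINT y|lborel. gk ((a n)\<^sup>2) y *\<^sub>R (cis (- (y \<bullet> \<zeta>)) * of_real (k y))) =
        (LINT y|lborel. gk ((a n)\<^sup>2) y *\<^sub>R (cis (- (y \<bullet> \<zeta>)) * ?I y))"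
        unfolding I by (subst integral_mult_right_zero[symmetric]) (simp add: scaleR_conv_of_real mult_ac)
      also have "\<dots> = of_real ?cc * (LINT z|lborel. nd z *\<^sub>R \<rho> (\<zeta> + a n *\<^sub>R z))"
        by (rule gauss_regularized_inversion(1)[OF i a(2)])
      finally show ?thesis using cc by simp
    qed
    then show ?thesis using nd_average_tendsto[OF c b a(1), of \<zeta>] by simp
  qed
  have gki: "integrable lborel (\<lambda>y. gk ((a n)\<^sup>2) y * k y)" for n
  proof -
    have "integrable lborel (\<lambda>y. Re (gk ((a n)\<^sup>2) y *\<^sub>R (cis (- (y \<bullet> 0)) * ?I y)) / ?cc)"
      by (intro integrable_divide integrable_Re gauss_regularized_inversion(2)[OF i a(2)])
    then show ?thesis unfolding I by simp
  qed
  have "(\<lambda>n. Re (LINT y|lborel. gk ((a n)\<^sup>2) y *\<^sub>R (cis (- (y \<bullet> 0)) * of_real (k y)))) \<longlonglongrightarrow> Re (\<rho> 0)"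
    by (intro tendsto_Re lim)
  also have "(\<lambda>n. Re (LINT y|lborel. gk ((a n)\<^sup>2) y *\<^sub>R (cis (- (y \<bullet> 0)) * of_real (k y)))) = (\<lambda>n. LINT y|lborel. gk ((a n)\<^sup>2) y * k y)"
    by (simp add: scaleR_conv_of_real flip: of_real_mult)
  finally have l0: "(\<lambda>n. LINT y|lborel. gk ((a n)\<^sup>2) y * k y) \<longlonglongrightarrow> Re (\<rho> 0)" .
  have ki: "integrable lborel k"
  proof (rule integrable_monotone_convergence[OF gki _ _ l0])
    show "AE y in lborel. mono (\<lambda>n. gk ((a n)\<^sup>2) y * k y)"
    proof (intro AE_I2 monoI mult_right_mono k0)
      fix y :: 'a and n m :: nat assume "n \<le> m"
      then have "(a m)\<^sup>2 \<le> (a n)\<^sup>2" unfolding a_def by (intro power_mono) (auto simp: field_simps)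
      then show "gk ((a n)\<^sup>2) y \<le> gk ((a m)\<^sup>2) y" unfolding gk_def by (simp add: mult_right_mono)
    qed
    show "AE y in lborel. (\<lambda>n. gk ((a n)\<^sup>2) y * k y) \<longlonglongrightarrow> k y"
      using tendsto_mult[OF ga tendsto_const] by (intro AE_I2) simp
  qed simp
  have fk: "fourier k \<zeta> = \<rho> \<zeta>" for \<zeta>
  proof (rule LIMSEQ_unique[OF _ lim])
    show "(\<lambda>n. LINT y|lborel. gk ((a n)\<^sup>2) y *\<^sub>R (cis (- (y \<bullet> \<zeta>)) * of_real (k y))) \<longlonglongrightarrow> fourier k \<zeta>"
      unfolding fourier_cis
    proof (rule integral_dominated_convergence[where w=k])
      show "AE y in lborel. (\<lambda>n. gk ((a n)\<^sup>2) y *\<^sub>R (cis (- (y \<bullet> \<zeta>)) * of_real (k y))) \<longlonglongrightarrow> k y *\<^sub>R cis (- (y \<bullet> \<zeta>))"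
        using tendsto_scaleR[OF ga tendsto_const, of _ "cis (- (_ \<bullet> \<zeta>)) * of_real (k _)"]
        by (intro AE_I2) (simp add: scaleR_conv_of_real mult.commute)
      show "AE y in lborel. norm (gk ((a n)\<^sup>2) y *\<^sub>R (cis (- (y \<bullet> \<zeta>)) * of_real (k y))) \<le> k y" for n
        using gk_le_1[of "(a n)\<^sup>2"] gk_nonneg k0 by (intro AE_I2) (auto simp: norm_mult intro!: mult_left_le_one_le)
    qed (use ki in auto)
  qed
  show ?thesis
    by (rule that[OF ki k0 fk]) (use I cc in \<open>simp add: field_simps\<close>)
qed

text \<open>Both sides are compared after convolution with a narrow Gaussian, where the inversion formula
  applies pointwise.\<close>

lemma gp_multiplier_bound:
  fixes g f1 f2 :: "'a::euclidean_space \<Rightarrow> real"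
  assumes g: "integrable lborel g" and f1: "integrable lborel f1" and f2: "integrable lborel f2"
    and r1: "gp \<rho>1" "continuous_on UNIV \<rho>1" and r2: "gp \<rho>2" "continuous_on UNIV \<rho>2"
    and eq: "\<And>\<xi>. fourier g \<xi> = fourier f1 \<xi> * \<rho>1 \<xi> + fourier f2 \<xi> * \<rho>2 \<xi>"
  shows "(LINT x|lborel. \<bar>g x\<bar>) \<le> Re (\<rho>1 0) * (LINT x|lborel. \<bar>f1 x\<bar>) + Re (\<rho>2 0) * (LINT x|lborel. \<bar>f2 x\<bar>)"
    (is "_ \<le> ?B")
proof -
  have [measurable]: "g \<in> borel_measurable borel" using g by auto
  let ?cc = "(2 * pi) ^ DIM('a)"
  have cc: "0 < ?cc" by simp
  have main: "(LINT x|lborel. \<bar>cs a nd g x\<bar>) \<le> ?B" if a: "0 < a" for a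
  proof -
    have a2: "0 < a\<^sup>2" using a by simp
    have rk: "gp (\<lambda>\<xi>. of_real (gk (a\<^sup>2) \<xi>) * \<rho> \<xi>)" "integrable lborel (\<lambda>\<xi>. of_real (gk (a\<^sup>2) \<xi>) * \<rho> \<xi>)"
      "continuous_on UNIV (\<lambda>\<xi>. of_real (gk (a\<^sup>2) \<xi>) * \<rho> \<xi>)"
      if "gp \<rho>" "continuous_on UNIV \<rho>" for \<rho> :: "'a \<Rightarrow> complex"
      using gp_mult_gk[OF that(1), of "a\<^sup>2"] gp_integrable[OF that(1) a2] that(2)
      by (auto simp: gk_def intro!: continuous_intros)
    \<comment> \<open>The Gaussian factor makes the multipliers integrable; inversion turns them
      into nonnegative kernels whose masses are the values of \<open>\<rho>1\<close> and
      \<open>\<rho>2\<close> at 0.\<close>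
    obtain k1 where k1: "integrable lborel k1" "\<And>x. 0 \<le> k1 x" "\<And>\<xi>. fourier k1 \<xi> = of_real (gk (a\<^sup>2) \<xi>) * \<rho>1 \<xi>"
      "\<And>x. of_real (k1 x) = (LINT \<xi>|lborel. cis (x \<bullet> \<xi>) * (of_real (gk (a\<^sup>2) \<xi>) * \<rho>1 \<xi>)) / of_real ?cc"
      by (rule gp_inversion[OF rk[OF r1]]) blast
    obtain k2 where k2: "integrable lborel k2" "\<And>x. 0 \<le> k2 x" "\<And>\<xi>. fourier k2 \<xi> = of_real (gk (a\<^sup>2) \<xi>) * \<rho>2 \<xi>"
      "\<And>x. of_real (k2 x) = (LINT \<xi>|lborel. cis (x \<bullet> \<xi>) * (of_real (gk (a\<^sup>2) \<xi>) * \<rho>2 \<xi>)) / of_real ?cc"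
      by (rule gp_inversion[OF rk[OF r2]]) blast
    have conv: "of_real (cs 1 f k x) = (LINT \<xi>|lborel. cis (x \<bullet> \<xi>) * (of_real (gk (a\<^sup>2) \<xi>) * (fourier f \<xi> * \<rho> \<xi>))) / of_real ?cc"
      if f: "integrable lborel f" and r: "gp \<rho>"
        and k: "\<And>x. of_real (k x) = (LINT \<xi>|lborel. cis (x \<bullet> \<xi>) * (of_real (gk (a\<^sup>2) \<xi>) * \<rho> \<xi>)) / of_real ?cc"
      for f k \<rho> and x :: 'a
    proof -
      have "of_real (cs 1 f k x) = (LINT y|lborel. f y *\<^sub>R (LINT \<xi>|lborel. cis ((x - y) \<bullet> \<xi>) * (of_real (gk (a\<^sup>2) \<xi>) * \<rho> \<xi>)) / of_real ?cc)"
        unfolding cs_def integral_complex_of_real[symmetric] of_real_mult k by (simp add: scaleR_conv_of_real)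
      also have "\<dots> = (LINT \<xi>|lborel. cis (x \<bullet> \<xi>) * (of_real (gk (a\<^sup>2) \<xi>) * \<rho> \<xi> * fourier f \<xi>)) / of_real ?cc"
        by (subst integral_divide_zero, subst fubini_cis(1)[OF f gp_integrable[OF r a2]]) rule
      finally show ?thesis by (simp add: mult_ac)
    qed
    \<comment> \<open>The kernel belonging to the multiplier 1, i.e. the centred Gaussian density of
      variance \<open>a\<^sup>2\<close>. Convolving \<open>g\<close> with it is
      \<open>cs a nd g\<close> after the substitution y = x - a z.\<close>
    define kg where "kg = (\<lambda>x::'a. gnorm TYPE('a) (a\<^sup>2) * gk (1 / a\<^sup>2) x / ?cc)"
    have kg: "of_real (kg x) = (LINT \<xi>|lborel. cis (x \<bullet> \<xi>) * (of_real (gk (a\<^sup>2) \<xi>) * 1)) / of_real ?cc" for x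
      using gauss_fourier(2)[OF a2, of x] by (simp add: kg_def)
    have ndkg: "a ^ DIM('a) * kg (a *\<^sub>R z) = nd z" for z
    proof -
      have "a ^ DIM('a) * gnorm TYPE('a) (a\<^sup>2) * gnorm TYPE('a) 1 = (a * sqrt (2 * pi / a\<^sup>2) * sqrt (2 * pi)) ^ DIM('a)"
        by (simp add: gnorm_def power_mult_distrib)
      also have "a * sqrt (2 * pi / a\<^sup>2) * sqrt (2 * pi) = 2 * pi" using a by (simp add: real_sqrt_divide)
      finally show ?thesis using a cc gnorm_pos[of 1, where 'a='a]
        by (simp add: kg_def nd_def gk_scaleR field_simps)
    qed
    have csg: "cs a nd g x = cs 1 g kg x" for x
    proof -
      have i: "integrable lborel (\<lambda>y. g y * kg (x - y))"
      proof (rule Bochner_Integration.integrable_bound[of _ "\<lambda>y. (gnorm TYPE('a) (a\<^sup>2) / ?cc) * g y"])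
        show "AE y in lborel. norm (g y * kg (x - y)) \<le> norm ((gnorm TYPE('a) (a\<^sup>2) / ?cc) * g y)"
        proof (rule AE_I2)
          fix y
          have "\<bar>kg (x - y)\<bar> \<le> gnorm TYPE('a) (a\<^sup>2) / ?cc"
            using gk_le_1[of "1/a\<^sup>2" "x - y"] gk_nonneg[of "1/a\<^sup>2" "x - y"] gnorm_pos[OF a2, where 'a='a] cc
            by (simp add: kg_def divide_right_mono)
          then show "norm (g y * kg (x - y)) \<le> norm ((gnorm TYPE('a) (a\<^sup>2) / ?cc) * g y)"
            using mult_left_mono[of "\<bar>kg (x - y)\<bar>" "gnorm TYPE('a) (a\<^sup>2) / ?cc" "\<bar>g y\<bar>"] gnorm_pos[OF a2, where 'a='a] cc
            by (simp add: abs_mult mult.commute)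
        qed
      qed (use g in \<open>auto simp: kg_def\<close>)
      have "cs 1 g kg x = (LINT y|lborel. g y * kg (x - y))" by (simp add: cs_def)
      also have "\<dots> = \<bar>- a\<bar>^DIM('a) *\<^sub>R (LINT z|lborel. g (x + (- a) *\<^sub>R z) * kg (x - (x + (- a) *\<^sub>R z)))"
        by (rule integral_lborel_affine[OF i]) (use a in simp)
      also have "\<dots> = (LINT z|lborel. (a ^ DIM('a) * kg (a *\<^sub>R z)) * g (x - a *\<^sub>R z))"
        using a by (subst integral_scaleR_right[symmetric]) (simp_all add: mult_ac)
      finally show ?thesis unfolding ndkg by (simp add: cs_def)
    qed
    have ig: "integrable lborel (\<lambda>\<xi>. cis (x \<bullet> \<xi>) * (of_real (gk (a\<^sup>2) \<xi>) * (fourier f \<xi> * \<rho> \<xi>)))"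
      if f: "integrable lborel f" and r: "gp \<rho>" for f \<rho> and x :: 'a
    proof (rule integrable_cis_mult_complex)
      obtain M where b: "\<And>\<xi>. cmod (\<rho> \<xi>) \<le> M" using r unfolding gp_def by blast
      have "cmod (fourier f \<xi> * \<rho> \<xi>) \<le> (LINT x|lborel. \<bar>f x\<bar>) * M" for \<xi>
        unfolding norm_mult by (intro mult_mono b fourier_norm_le) auto
      then show "integrable lborel (\<lambda>\<xi>. of_real (gk (a\<^sup>2) \<xi>) * (fourier f \<xi> * \<rho> \<xi>))"
        using fourier_measurable[OF f] gp_measurable[OF r] by (intro gk_mult_integrable[OF _ _ a2]) auto
    qed simp
    have split: "cs a nd g x = cs 1 f1 k1 x + cs 1 f2 k2 x" for x
    proof -
      have "of_real (cs a nd g x) = (LINT \<xi>|lborel. cis (x \<bullet> \<xi>) * (of_real (gk (a\<^sup>2) \<xi>) * (fourier g \<xi> * 1))) / complex_of_real ?cc"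
        unfolding csg by (rule conv[OF g gp_const kg])
      also have "\<dots> = (LINT \<xi>|lborel. cis (x \<bullet> \<xi>) * (of_real (gk (a\<^sup>2) \<xi>) * (fourier f1 \<xi> * \<rho>1 \<xi>))
         + cis (x \<bullet> \<xi>) * (of_real (gk (a\<^sup>2) \<xi>) * (fourier f2 \<xi> * \<rho>2 \<xi>))) / complex_of_real ?cc"
        unfolding eq by (simp add: distrib_left)
      also have "\<dots> = complex_of_real (cs 1 f1 k1 x + cs 1 f2 k2 x)"
        unfolding of_real_add conv[OF f1 r1(1) k1(4)] conv[OF f2 r2(1) k2(4)]
        by (simp add: Bochner_Integration.integral_add[OF ig[OF f1 r1(1)] ig[OF f2 r2(1)]] add_divide_distrib)
      finally show ?thesis by (simp only: of_real_eq_iff)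
    qed
    have kint: "(LINT x|lborel. \<bar>k x\<bar>) = Re (\<rho> 0)"
      if "integrable lborel k" "\<And>x. 0 \<le> k x" "\<And>\<xi>. fourier k \<xi> = of_real (gk (a\<^sup>2) \<xi>) * \<rho> \<xi>" for k and \<rho> :: "'a \<Rightarrow> complex"
    proof -
      have "complex_of_real (LINT x|lborel. k x) = \<rho> 0" using that(3)[of 0] by (simp add: gk_def)
      then have "(LINT x|lborel. k x) = Re (\<rho> 0)" by (metis Re_complex_of_real)
      then show ?thesis using that(2) by simp
    qed
    note ci = cs_integrable[OF f1 k1(1), of 1] cs_integrable[OF f2 k2(1), of 1]
    have "(LINT x|lborel. \<bar>cs a nd g x\<bar>) \<le> (LINT x|lborel. \<bar>cs 1 f1 k1 x\<bar> + \<bar>cs 1 f2 k2 x\<bar>)"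
      unfolding split using ci by (intro integral_mono) auto
    also have "\<dots> = (LINT x|lborel. \<bar>cs 1 f1 k1 x\<bar>) + (LINT x|lborel. \<bar>cs 1 f2 k2 x\<bar>)"
      using ci by (intro Bochner_Integration.integral_add) auto
    also have "\<dots> \<le> (LINT x|lborel. \<bar>f1 x\<bar>) * (LINT x|lborel. \<bar>k1 x\<bar>) + (LINT x|lborel. \<bar>f2 x\<bar>) * (LINT x|lborel. \<bar>k2 x\<bar>)"
      by (intro add_mono cs_norm_le f1 f2 k1 k2)
    also have "\<dots> = ?B"
      unfolding kint[OF k1(1-3)] kint[OF k2(1-3)] by (simp add: mult.commute)
    finally show ?thesis .
  qed
  let ?a = "\<lambda>n. inverse (real (Suc n))"
  have l: "(\<lambda>n. LINT x|lborel. \<bar>cs (?a n) nd g x - (LINT y|lborel. nd (y::'a)) * g x\<bar>) \<longlonglongrightarrow> 0"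
    by (rule cs_approx_identity[OF nd_integrable g LIMSEQ_inverse_real_of_nat])
  have "(LINT x|lborel. \<bar>g x\<bar>) \<le> (LINT x|lborel. \<bar>cs (?a n) nd g x - (LINT y|lborel. nd (y::'a)) * g x\<bar>) + ?B" for n
  proof -
    note ci = cs_integrable[OF nd_integrable g, of "?a n"]
    have "(LINT x|lborel. \<bar>g x\<bar>) \<le> (LINT x|lborel. \<bar>cs (?a n) nd g x - 1 * g x\<bar> + \<bar>cs (?a n) nd g x\<bar>)"
      using ci g by (intro integral_mono) auto
    also have "\<dots> = (LINT x|lborel. \<bar>cs (?a n) nd g x - 1 * g x\<bar>) + (LINT x|lborel. \<bar>cs (?a n) nd g x\<bar>)"
      using ci g by (intro Bochner_Integration.integral_add) auto
    finally show ?thesis unfolding nd_integral using main[of "?a n"] by simp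
  qed
  then have "(LINT x|lborel. \<bar>g x\<bar>) \<le> 0 + ?B"
    by (intro LIMSEQ_le_const[OF tendsto_add[OF l tendsto_const]]) blast
  then show ?thesis by simp
qed

corollary gp_multiplier_bound1:
  fixes g f :: "'a::euclidean_space \<Rightarrow> real"
  assumes "integrable lborel g" "integrable lborel f" "gp \<rho>" "continuous_on UNIV \<rho>"
    and "\<And>\<xi>. fourier g \<xi> = fourier f \<xi> * \<rho> \<xi>"
  shows "(LINT x|lborel. \<bar>g x\<bar>) \<le> Re (\<rho> 0) * (LINT x|lborel. \<bar>f x\<bar>)"
  using gp_multiplier_bound[OF assms(1,2) integrable_zero assms(3,4) gp_const continuous_on_const] assms(5)
  by (simp add: fourier_cis)

text \<open>Equality case of the multiplier bound: the L1 norm of \<open>g\<close> is at most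
  \<open>Re (\<rho> 0)\<close> times the mass of \<open>f\<close>, and this product is the integral
  of \<open>g\<close>. Hence |g| = g almost everywhere. This is the source of positivity for weak
  solutions.\<close>

lemma gp_multiplier_nonneg:
  fixes g f :: "'a::euclidean_space \<Rightarrow> real"
  assumes g: "integrable lborel g" and f: "integrable lborel f" "\<And>x. 0 \<le> f x"
    and r: "gp \<rho>" "continuous_on UNIV \<rho>" and eq: "\<And>\<xi>. fourier g \<xi> = fourier f \<xi> * \<rho> \<xi>"
  shows "AE x in lborel. 0 \<le> g x"
proof -
  have "(LINT x|lborel. g x) = Re (fourier g 0)" by simp
  also have "\<dots> = Re (\<rho> 0) * (LINT x|lborel. \<bar>f x\<bar>)" unfolding eq using f(2) by simp
  finally have "(LINT x|lborel. \<bar>g x\<bar> - g x) \<le> 0"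
    using gp_multiplier_bound1[OF g f(1) r eq] g by (simp add: Bochner_Integration.integral_diff)
  moreover have "0 \<le> (LINT x|lborel. \<bar>g x\<bar> - g x)" by (rule integral_nonneg_AE) simp
  ultimately have "(LINT x|lborel. \<bar>g x\<bar> - g x) = 0" by simp
  then have "AE x in lborel. \<bar>g x\<bar> - g x = 0"
    using g by (subst (asm) integral_nonneg_eq_0_iff_AE) auto
  then show ?thesis by eventually_elim simp
qed

section \<open>Fractional moments through the characteristic function\<close>

text \<open>The density on the half-line against which 1 - cos (r z) integrates to a multiple of
  |z|^m; it converts a fractional moment into an integral of the characteristic function.\<close>

definition qq :: "real \<Rightarrow> real \<Rightarrow> real" where
  "qq m r = indicator {0<..} r * r powr (- 1 - m)"

lemma qq_nonneg [simp]: "0 \<le> qq m r" by (simp add: qq_def)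

lemma qq_measurable [measurable]: "qq m \<in> borel_measurable borel"
  unfolding qq_def[abs_def] by measurable

lemma integrable_lborel_of_has_integral:
  fixes f :: "real \<Rightarrow> real"
  assumes [measurable]: "f \<in> borel_measurable borel" "S \<in> sets borel" and nn: "\<And>x. x \<in> S \<Longrightarrow> 0 \<le> f x"
    and h: "(f has_integral I) S"
  shows "integrable lborel (\<lambda>x. indicator S x * f x)"
proof -
  have "((\<lambda>x. if x \<in> S then f x else 0) has_integral I) UNIV"
    using h by (simp add: has_integral_restrict_UNIV)
  moreover have "(\<lambda>x. if x \<in> S then f x else 0) = (\<lambda>x. indicator S x * f x)" by (auto simp: indicator_def)
  ultimately have h': "((\<lambda>x. indicator S x * f x) has_integral I) UNIV" by simp
  have "(\<integral>\<^sup>+x. indicator S x * f x \<partial>lborel) = I"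
    by (rule nn_integral_has_integral_lborel[OF _ _ h']) (use nn in \<open>auto simp: indicator_def\<close>)
  then show ?thesis
    using nn by (intro integrableI_nonneg) (auto simp: indicator_def)
qed

text \<open>The condition m < 1 gives convergence at the origin, 0 < m convergence at
  infinity.\<close>

lemma integrable_min_qq:
  assumes m: "0 < m" "m < 1"
  shows "integrable lborel (\<lambda>r. min 1 r * qq m r)"
proof (rule Bochner_Integration.integrable_bound)
  have "integrable lborel (\<lambda>r. indicator {0..1} r * r powr (- m))"
    by (rule integrable_lborel_of_has_integral[OF _ _ _ has_integral_powr_from_0]) (use m in auto)
  moreover have "integrable lborel (\<lambda>r. indicator {1..} r * r powr (- 1 - m))"
    by (rule integrable_lborel_of_has_integral[OF _ _ _ has_integral_powr_to_inf]) (use m in auto)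
  ultimately show "integrable lborel (\<lambda>r. indicator {0..1} r * r powr (- m) + indicator {1..} r * r powr (- 1 - m))"
    by (rule Bochner_Integration.integrable_add)
  have "r * r powr (- 1 - m) = r powr (- m)" if "0 < r" for r
    using that powr_mult_base[of r "- 1 - m"] by simp
  then show "AE r in lborel. norm (min 1 r * qq m r) \<le> norm (indicator {0..1} r * r powr (- m) + indicator {1..} r * r powr (- 1 - m))"
    by (intro AE_I2) (auto simp: qq_def indicator_def min_def)
qed simp

lemma one_minus_cos_le: "1 - cos t \<le> 2 * min 1 \<bar>t\<bar>" for t :: real
proof -
  have "1 - cos t = 2 * (sin (t/2))\<^sup>2" using cos_double_sin[of "t/2"] by simp
  also have "\<dots> = 2 * (\<bar>sin (t/2)\<bar> * \<bar>sin (t/2)\<bar>)" by (simp add: power2_eq_square)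
  also have "\<dots> \<le> 2 * (1 * min 1 \<bar>t\<bar>)"
    using abs_sin_le_one[of "t/2"] abs_sin_x_le_abs_x[of "t/2"] by (intro mult_left_mono mult_mono) auto
  finally show ?thesis by simp
qed

lemma integrable_cos_qq:
  assumes m: "0 < m" "m < 1"
  shows "integrable lborel (\<lambda>r. (1 - cos r) * qq m r)"
proof (rule Bochner_Integration.integrable_bound[of _ "\<lambda>r. 2 * (min 1 r * qq m r)"])
  show "AE r in lborel. norm ((1 - cos r) * qq m r) \<le> norm (2 * (min 1 r * qq m r))"
  proof (rule AE_I2)
    fix r :: real
    show "norm ((1 - cos r) * qq m r) \<le> norm (2 * (min 1 r * qq m r))"
      using one_minus_cos_le[of r] mult_right_mono[OF one_minus_cos_le[of r] qq_nonneg[of m r]]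
      by (cases "0 < r") (auto simp: abs_mult qq_def)
  qed
qed (use integrable_min_qq[OF m] in auto)

definition cm :: "real \<Rightarrow> real" where "cm m = (LINT r|lborel. (1 - cos r) * qq m r)"

lemma cm_pos:
  assumes m: "0 < m" "m < 1" shows "0 < cm m"
proof -
  have "0 \<le> cm m" unfolding cm_def by (intro integral_nonneg_AE AE_I2) simp
  moreover have "cm m \<noteq> 0"
  proof
    assume "cm m = 0"
    then have "AE r in lborel. (1 - cos r) * qq m r = 0"
      unfolding cm_def using integrable_cos_qq[OF m] by (subst (asm) integral_nonneg_eq_0_iff_AE) auto
    \<comment> \<open>On [1, 2] the integrand is strictly positive, because 2 < pi.\<close>
    then have "AE r in lborel. r \<notin> {1..2::real}"
    proof eventually_elim
      fix r :: real assume r: "(1 - cos r) * qq m r = 0"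
      show "r \<notin> {1..2}"
      proof
        assume "r \<in> {1..2}"
        then have "cos r < cos 0" by (intro cos_monotone_0_pi) (use pi_gt3 in auto)
        then show False using r \<open>r \<in> {1..2}\<close> by (simp add: qq_def)
      qed
    qed
    then have "emeasure lborel {1..2::real} = 0"
      by (subst (asm) AE_iff_measurable[of "{1..2}"]) auto
    then show False by simp
  qed
  ultimately show ?thesis by simp
qed

lemma cm_scale:
  assumes m: "0 < m" "m < 1"
  shows "integrable lborel (\<lambda>r. (1 - cos (r * z)) * qq m r)"
    and "(LINT r|lborel. (1 - cos (r * z)) * qq m r) = \<bar>z\<bar> powr m * cm m"
proof -
  have "integrable lborel (\<lambda>r. (1 - cos (r * z)) * qq m r) \<and> (LINT r|lborel. (1 - cos (r * z)) * qq m r) = \<bar>z\<bar> powr m * cm m"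
  proof (cases "z = 0")
    case False
    then have z: "0 < \<bar>z\<bar>" by simp
    have eq: "(1 - cos (0 + \<bar>z\<bar> * r)) * qq m (0 + \<bar>z\<bar> * r) = \<bar>z\<bar> powr (- 1 - m) * ((1 - cos (r * z)) * qq m r)" for r
      using z cos_abs_real[of "r * z"] by (auto simp: qq_def powr_mult indicator_def zero_less_mult_iff mult_ac cos_minus abs_if)
    have i: "integrable lborel (\<lambda>r. \<bar>z\<bar> powr (- 1 - m) * ((1 - cos (r * z)) * qq m r))"
      using lborel_integrable_real_affine[OF integrable_cos_qq[OF m], of "\<bar>z\<bar>" 0] z unfolding eq by simp
    have "cm m = \<bar>z\<bar> * (LINT r|lborel. \<bar>z\<bar> powr (- 1 - m) * ((1 - cos (r * z)) * qq m r))"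
      unfolding cm_def using lborel_integral_real_affine[of "\<bar>z\<bar>" "\<lambda>r. (1 - cos r) * qq m r" 0] z unfolding eq by simp
    also have "\<dots> = (\<bar>z\<bar> * \<bar>z\<bar> powr (- 1 - m)) * (LINT r|lborel. (1 - cos (r * z)) * qq m r)"
      by (subst integral_mult_right_zero) (rule mult.assoc[symmetric])
    also have "\<bar>z\<bar> * \<bar>z\<bar> powr (- 1 - m) = \<bar>z\<bar> powr (- m)"
      using z powr_mult_base[of "\<bar>z\<bar>" "- 1 - m"] by simp
    finally have "\<bar>z\<bar> powr m * cm m = (\<bar>z\<bar> powr m * \<bar>z\<bar> powr (- m)) * (LINT r|lborel. (1 - cos (r * z)) * qq m r)" by simp
    then show ?thesis using i z by (simp flip: powr_add)
  qed simp
  then show "integrable lborel (\<lambda>r. (1 - cos (r * z)) * qq m r)"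
    "(LINT r|lborel. (1 - cos (r * z)) * qq m r) = \<bar>z\<bar> powr m * cm m" by auto
qed

lemma Re_fourier_diff:
  fixes f :: "'a::euclidean_space \<Rightarrow> real"
  assumes f: "integrable lborel f"
  shows "Re (fourier f 0 - fourier f \<xi>) = (LINT x|lborel. f x * (1 - cos (x \<bullet> \<xi>)))"
    "integrable lborel (\<lambda>x. f x * (1 - cos (x \<bullet> \<xi>)))"
proof -
  have e: "f x * (1 - cos (x \<bullet> \<xi>)) = Re (f x *\<^sub>R cis (- (x \<bullet> 0)) - f x *\<^sub>R cis (- (x \<bullet> \<xi>)))" for x
    by (simp add: algebra_simps)
  have i: "integrable lborel (\<lambda>x. f x *\<^sub>R cis (- (x \<bullet> \<zeta>)))" for \<zeta> by (rule integrable_cis_mult[OF f]) simp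
  have "fourier f 0 - fourier f \<xi> = (LINT x|lborel. f x *\<^sub>R cis (- (x \<bullet> 0)) - f x *\<^sub>R cis (- (x \<bullet> \<xi>)))"
    unfolding fourier_cis by (rule Bochner_Integration.integral_diff[OF i i, symmetric])
  moreover have i2: "integrable lborel (\<lambda>x. f x *\<^sub>R cis (- (x \<bullet> 0)) - f x *\<^sub>R cis (- (x \<bullet> \<xi>)))"
    using i by (intro Bochner_Integration.integrable_diff)
  ultimately show "Re (fourier f 0 - fourier f \<xi>) = (LINT x|lborel. f x * (1 - cos (x \<bullet> \<xi>)))"
    unfolding e by (simp only: integral_Re)
  show "integrable lborel (\<lambda>x. f x * (1 - cos (x \<bullet> \<xi>)))"
    unfolding e by (rule integrable_Re[OF i2])
qed

text \<open>The identity of \<open>cm_scale\<close> for |z|^m is inserted under the integral and the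
  order is exchanged by Tonelli. Stated in extended reals, so that finiteness of either side carries
  over to the other.\<close>

lemma moment_nn_integral:
  fixes f :: "'a::euclidean_space \<Rightarrow> real"
  assumes m: "0 < m" "m < 1" and f: "integrable lborel f" "AE x in lborel. 0 \<le> f x"
  shows "(\<integral>\<^sup>+x. ennreal (cm m * (\<bar>x \<bullet> i\<bar> powr m * f x)) \<partial>lborel) =
    (\<integral>\<^sup>+r. ennreal (qq m r * Re (fourier f 0 - fourier f (r *\<^sub>R i))) \<partial>lborel)"
proof -
  have [measurable]: "f \<in> borel_measurable borel" using f by auto
  have "(\<integral>\<^sup>+x. ennreal (cm m * (\<bar>x \<bullet> i\<bar> powr m * f x)) \<partial>lborel) = (\<integral>\<^sup>+x. (\<integral>\<^sup>+r. ennreal (f x * ((1 - cos (r * (x \<bullet> i))) * qq m r)) \<partial>lborel) \<partial>lborel)"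
  proof (rule nn_integral_cong_AE, use f(2) in eventually_elim)
    fix x assume x: "0 \<le> f x"
    have "(\<integral>\<^sup>+r. ennreal (f x * ((1 - cos (r * (x \<bullet> i))) * qq m r)) \<partial>lborel) = ennreal (f x) * (\<integral>\<^sup>+r. ennreal ((1 - cos (r * (x \<bullet> i))) * qq m r) \<partial>lborel)"
      using x by (subst nn_integral_cmult[symmetric]) (auto simp: ennreal_mult')
    also have "\<dots> = ennreal (f x) * ennreal (\<bar>x \<bullet> i\<bar> powr m * cm m)"
      by (subst nn_integral_eq_integral[OF cm_scale(1)[OF m]]) (auto simp: cm_scale(2)[OF m])
    also have "\<dots> = ennreal (cm m * (\<bar>x \<bullet> i\<bar> powr m * f x))"
      using x by (simp add: mult_ac flip: ennreal_mult')
    finally show "ennreal (cm m * (\<bar>x \<bullet> i\<bar> powr m * f x)) = (\<integral>\<^sup>+r. ennreal (f x * ((1 - cos (r * (x \<bullet> i))) * qq m r)) \<partial>lborel)" ..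
  qed
  also have "\<dots> = (\<integral>\<^sup>+r. (\<integral>\<^sup>+x. ennreal (f x * ((1 - cos (r * (x \<bullet> i))) * qq m r)) \<partial>lborel) \<partial>lborel)"
    by (rule lborel_pair.Fubini'[symmetric]) measurable
  also have "\<dots> = (\<integral>\<^sup>+r. ennreal (qq m r * Re (fourier f 0 - fourier f (r *\<^sub>R i))) \<partial>lborel)"
  proof (rule nn_integral_cong)
    fix r :: real
    have "(\<integral>\<^sup>+x. ennreal (f x * ((1 - cos (r * (x \<bullet> i))) * qq m r)) \<partial>lborel) = (\<integral>\<^sup>+x. ennreal (qq m r) * ennreal (f x * (1 - cos (x \<bullet> (r *\<^sub>R i)))) \<partial>lborel)"
      by (intro nn_integral_cong) (simp add: mult_ac flip: ennreal_mult')
    also have "\<dots> = ennreal (qq m r) * (\<integral>\<^sup>+x. ennreal (f x * (1 - cos (x \<bullet> (r *\<^sub>R i)))) \<partial>lborel)"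
      by (rule nn_integral_cmult) measurable
    also have "(\<integral>\<^sup>+x. ennreal (f x * (1 - cos (x \<bullet> (r *\<^sub>R i)))) \<partial>lborel) = ennreal (Re (fourier f 0 - fourier f (r *\<^sub>R i)))"
      unfolding Re_fourier_diff(1)[OF f(1)]
    proof (rule nn_integral_eq_integral[OF Re_fourier_diff(2)[OF f(1)]])
      show "AE x in lborel. 0 \<le> f x * (1 - cos (x \<bullet> r *\<^sub>R i))" using f(2) by eventually_elim simp
    qed
    finally show "(\<integral>\<^sup>+x. ennreal (f x * ((1 - cos (r * (x \<bullet> i))) * qq m r)) \<partial>lborel) = ennreal (qq m r * Re (fourier f 0 - fourier f (r *\<^sub>R i)))"
      by (simp add: ennreal_mult')
  qed
  finally show ?thesis .
qed

lemma Re_fourier_diff_nonneg: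
  fixes f :: "'a::euclidean_space \<Rightarrow> real"
  assumes f: "integrable lborel f" "AE x in lborel. 0 \<le> f x"
  shows "0 \<le> Re (fourier f 0 - fourier f \<xi>)"
  unfolding Re_fourier_diff(1)[OF f(1)]
proof (rule integral_nonneg_AE)
  show "AE x in lborel. 0 \<le> f x * (1 - cos (x \<bullet> \<xi>))" using f(2) by eventually_elim simp
qed

lemma moment_fourier:
  fixes f :: "'a::euclidean_space \<Rightarrow> real"
  assumes m: "0 < m" "m < 1" and f: "integrable lborel f" "AE x in lborel. 0 \<le> f x"
  shows "integrable lborel (\<lambda>x. \<bar>x \<bullet> i\<bar> powr m * f x) \<longleftrightarrow> integrable lborel (\<lambda>r. qq m r * Re (fourier f 0 - fourier f (r *\<^sub>R i)))"
      (is "?P \<longleftrightarrow> ?Q")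
    and "integrable lborel (\<lambda>r. qq m r * Re (fourier f 0 - fourier f (r *\<^sub>R i))) \<Longrightarrow>
      cm m * (LINT x|lborel. \<bar>x \<bullet> i\<bar> powr m * f x) = (LINT r|lborel. qq m r * Re (fourier f 0 - fourier f (r *\<^sub>R i)))"
proof -
  have [measurable]: "f \<in> borel_measurable borel" "fourier f \<in> borel_measurable borel" using f by auto
  note cmp = cm_pos[OF m]
  have nn1: "AE x in lborel. 0 \<le> cm m * (\<bar>x \<bullet> i\<bar> powr m * f x)" using f(2) by eventually_elim (use cmp in simp)
  have nn2: "0 \<le> qq m r * Re (fourier f 0 - fourier f (r *\<^sub>R i))" for r
    by (intro mult_nonneg_nonneg qq_nonneg Re_fourier_diff_nonneg f)
  note eq = moment_nn_integral[OF m f, of i]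
  have "integrable lborel (\<lambda>x. cm m * (\<bar>x \<bullet> i\<bar> powr m * f x)) \<longleftrightarrow> (\<integral>\<^sup>+x. ennreal (cm m * (\<bar>x \<bullet> i\<bar> powr m * f x)) \<partial>lborel) < \<infinity>"
  proof -
    have "(\<integral>\<^sup>+x. ennreal (norm (cm m * (\<bar>x \<bullet> i\<bar> powr m * f x))) \<partial>lborel) = (\<integral>\<^sup>+x. ennreal (cm m * (\<bar>x \<bullet> i\<bar> powr m * f x)) \<partial>lborel)"
      by (rule nn_integral_cong_AE, use nn1 in eventually_elim) simp
    then show ?thesis by (subst integrable_iff_bounded) simp
  qed
  moreover have "?Q \<longleftrightarrow> (\<integral>\<^sup>+r. ennreal (qq m r * Re (fourier f 0 - fourier f (r *\<^sub>R i))) \<partial>lborel) < \<infinity>"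
    using nn2 by (subst integrable_iff_bounded) simp
  ultimately show PQ: "?P \<longleftrightarrow> ?Q" using cmp unfolding eq by simp
  assume Q: ?Q
  then have P: "integrable lborel (\<lambda>x. cm m * (\<bar>x \<bullet> i\<bar> powr m * f x))" using PQ by simp
  have "ennreal (LINT x|lborel. cm m * (\<bar>x \<bullet> i\<bar> powr m * f x)) = ennreal (LINT r|lborel. qq m r * Re (fourier f 0 - fourier f (r *\<^sub>R i)))"
    using eq nn_integral_eq_integral[OF P nn1] nn_integral_eq_integral[OF Q] nn2 by auto
  moreover have "0 \<le> (LINT x|lborel. cm m * (\<bar>x \<bullet> i\<bar> powr m * f x))" by (rule integral_nonneg_AE[OF nn1])
  moreover have "0 \<le> (LINT r|lborel. qq m r * Re (fourier f 0 - fourier f (r *\<^sub>R i)))"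
    by (rule integral_nonneg_AE[OF AE_I2[OF nn2]])
  ultimately have "(LINT x|lborel. cm m * (\<bar>x \<bullet> i\<bar> powr m * f x)) = (LINT r|lborel. qq m r * Re (fourier f 0 - fourier f (r *\<^sub>R i)))"
    by (simp only: ennreal_inj)
  then show "cm m * (LINT x|lborel. \<bar>x \<bullet> i\<bar> powr m * f x) = (LINT r|lborel. qq m r * Re (fourier f 0 - fourier f (r *\<^sub>R i)))"
    by simp
qed

text \<open>A linear bound at the origin, cut off at 1, controls the moments of every order below 1
  with a constant depending on m and K only; this is how uniformity in s and \<epsilon> reaches the
  moments.\<close>

lemma moment_bound:
  fixes f :: "'a::euclidean_space \<Rightarrow> real"
  assumes m: "0 < m" "m < 1" and f: "integrable lborel f" "AE x in lborel. 0 \<le> f x"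
    and b: "\<And>r. 0 < r \<Longrightarrow> Re (fourier f 0 - fourier f (r *\<^sub>R i)) \<le> K * min 1 r"
  shows "integrable lborel (\<lambda>x. \<bar>x \<bullet> i\<bar> powr m * f x)"
    and "(LINT x|lborel. \<bar>x \<bullet> i\<bar> powr m * f x) \<le> K * (LINT r|lborel. min 1 r * qq m r) / cm m"
proof -
  have [measurable]: "fourier f \<in> borel_measurable borel" using f by auto
  have le: "qq m r * Re (fourier f 0 - fourier f (r *\<^sub>R i)) \<le> K * (min 1 r * qq m r)" for r
  proof (cases "0 < r")
    case True
    then show ?thesis using mult_left_mono[OF b[OF True] qq_nonneg[of m r]] by (simp add: mult_ac)
  qed (simp add: qq_def)
  have nn: "0 \<le> qq m r * Re (fourier f 0 - fourier f (r *\<^sub>R i))" for r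
    by (intro mult_nonneg_nonneg qq_nonneg Re_fourier_diff_nonneg f)
  have i: "integrable lborel (\<lambda>r. K * (min 1 r * qq m r))" using integrable_min_qq[OF m] by (intro integrable_mult_right)
  have Q: "integrable lborel (\<lambda>r. qq m r * Re (fourier f 0 - fourier f (r *\<^sub>R i)))"
    by (rule Bochner_Integration.integrable_bound[OF i])
       (use nn le in \<open>auto intro!: AE_I2 order_trans[OF _ abs_ge_self] simp del: minus_complex.sel\<close>)
  then show "integrable lborel (\<lambda>x. \<bar>x \<bullet> i\<bar> powr m * f x)" using moment_fourier(1)[OF m f] by simp
  have "cm m * (LINT x|lborel. \<bar>x \<bullet> i\<bar> powr m * f x) \<le> (LINT r|lborel. K * (min 1 r * qq m r))"
    unfolding moment_fourier(2)[OF m f Q] by (rule integral_mono[OF Q i le])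
  then show "(LINT x|lborel. \<bar>x \<bullet> i\<bar> powr m * f x) \<le> K * (LINT r|lborel. min 1 r * qq m r) / cm m"
    using cm_pos[OF m] by (simp add: field_simps)
qed

section \<open>Subadditivity of powers and bounds for the weight\<close>

lemma powr_add_le:
  fixes a b k :: real
  assumes "0 \<le> a" "0 \<le> b" "0 \<le> k" "k \<le> 1"
  shows "(a + b) powr k \<le> a powr k + b powr k"
proof (cases "a + b = 0")
  case False
  then have s: "0 < a + b" using assms by simp
  \<comment> \<open>After division by a + b both quotients lie in [0, 1], where a power of exponent
    at most 1 does not decrease a number.\<close>
  have le: "t \<le> t powr k" if "0 \<le> t" "t \<le> 1" for t
    using that assms powr_mono'[of k 1 t] by (cases "t = 0") auto
  have "a / (a + b) \<le> (a / (a + b)) powr k" "b / (a + b) \<le> (b / (a + b)) powr k"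
    using s assms by (auto intro!: le)
  moreover have "a / (a + b) + b / (a + b) = 1" using s by (simp flip: add_divide_distrib)
  ultimately have "1 \<le> (a / (a + b)) powr k + (b / (a + b)) powr k" by linarith
  then have "(a + b) powr k * 1 \<le> (a + b) powr k * ((a / (a + b)) powr k + (b / (a + b)) powr k)"
    by (intro mult_left_mono) auto
  then show ?thesis using s assms by (simp add: powr_divide distrib_left)
qed (use assms in auto)

lemma powr_sum_le:
  fixes k :: real
  assumes "finite A" "\<And>i. i \<in> A \<Longrightarrow> 0 \<le> a i" "0 \<le> k" "k \<le> 1"
  shows "(\<Sum>i\<in>A. a i) powr k \<le> (\<Sum>i\<in>A. a i powr k)"
  using assms
proof (induction rule: finite_induct)
  case (insert x F)
  have "(\<Sum>i\<in>insert x F. a i) powr k \<le> a x powr k + (\<Sum>i\<in>F. a i) powr k"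
    using insert by (simp add: powr_add_le sum_nonneg)
  with insert show ?case by fastforce
qed simp

lemma jbr_ge_1: "1 \<le> jbr x" and jbr_ge_norm: "norm x \<le> jbr x"
  by (auto simp: jbr_def intro: real_le_rsqrt)

lemma jbr_pos: "0 < jbr x" using jbr_ge_1[of x] by simp

lemma jbr_measurable[measurable]: "jbr \<in> borel_measurable borel"
  unfolding jbr_def[abs_def] by measurable

lemma jbr_powr_ge_1: "0 \<le> k \<Longrightarrow> 1 \<le> jbr x powr k"
  using jbr_ge_1[of x] by (rule ge_one_powr_ge_zero)

lemma jbr_powr_ge_coord:
  fixes x :: "'a::euclidean_space"
  assumes "0 \<le> k" "i \<in> Basis" shows "\<bar>x \<bullet> i\<bar> powr k \<le> jbr x powr k"
  using Basis_le_norm[OF assms(2), of x] jbr_ge_norm[of x] assms(1) by (intro powr_mono2) auto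

text \<open>The cosine formula sees a law only along one direction, so the weight is reduced to
  powers of single coordinates; \<open>k \<le> 1\<close> makes the power subadditive.\<close>

lemma jbr_powr_le:
  fixes x :: "'a::euclidean_space"
  assumes k: "0 \<le> k" "k \<le> 1"
  shows "jbr x powr k \<le> 1 + (\<Sum>i\<in>Basis. \<bar>x \<bullet> i\<bar> powr k)"
proof -
  have "jbr x \<le> 1 + norm x" unfolding jbr_def by (rule real_le_lsqrt) (auto simp: power2_eq_square algebra_simps)
  also have "\<dots> \<le> 1 + (\<Sum>i\<in>Basis. \<bar>x \<bullet> i\<bar>)" using norm_le_l1[of x] by simp
  finally have "jbr x powr k \<le> (1 + (\<Sum>i\<in>Basis. \<bar>x \<bullet> i\<bar>)) powr k"
    using jbr_pos[of x] k by (intro powr_mono2) auto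
  also have "\<dots> \<le> 1 powr k + (\<Sum>i\<in>Basis. \<bar>x \<bullet> i\<bar>) powr k"
    by (intro powr_add_le k) (auto intro: sum_nonneg)
  also have "(\<Sum>i\<in>Basis. \<bar>x \<bullet> i\<bar>) powr k \<le> (\<Sum>i\<in>Basis. \<bar>x \<bullet> i\<bar> powr k)"
    by (intro powr_sum_le k) auto
  finally show ?thesis by simp
qed

lemma in_L1k_integrable:
  fixes f :: "'a::euclidean_space \<Rightarrow> real"
  assumes f: "in_L1k k f" and k: "0 \<le> k"
  shows "integrable lborel f" "integrable lborel (\<lambda>x. jbr x powr k * f x)"
    "i \<in> Basis \<Longrightarrow> integrable lborel (\<lambda>x. \<bar>x \<bullet> i\<bar> powr k * f x)"
proof -
  have [measurable]: "f \<in> borel_measurable borel" using f by (simp add: in_L1k_def)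
  show j: "integrable lborel (\<lambda>x. jbr x powr k * f x)" using f by (simp add: in_L1k_def)
  show "integrable lborel f"
    by (rule Bochner_Integration.integrable_bound[OF j])
      (use mult_right_mono[OF jbr_powr_ge_1[OF k] abs_ge_zero] in \<open>auto simp: abs_mult intro!: AE_I2\<close>)
  show "integrable lborel (\<lambda>x. \<bar>x \<bullet> i\<bar> powr k * f x)" if "i \<in> Basis"
    by (rule Bochner_Integration.integrable_bound[OF j])
      (use mult_right_mono[OF jbr_powr_ge_coord[OF k that] abs_ge_zero] in \<open>auto simp: abs_mult intro!: AE_I2\<close>)
qed

lemma L1k_norm_moments:
  fixes f :: "'a::euclidean_space \<Rightarrow> real"
  assumes k: "0 \<le> k" "k \<le> 1" and f: "integrable lborel f"
    and fi: "\<And>i. i \<in> Basis \<Longrightarrow> integrable lborel (\<lambda>x. \<bar>x \<bullet> i\<bar> powr k * f x)"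
  shows "integrable lborel (\<lambda>x. jbr x powr k * f x)"
    and "L1k_norm k f \<le> (LINT x|lborel. \<bar>f x\<bar>) + (\<Sum>i\<in>Basis. LINT x|lborel. \<bar>x \<bullet> i\<bar> powr k * \<bar>f x\<bar>)"
proof -
  have [measurable]: "f \<in> borel_measurable borel" using f by auto
  have fi': "integrable lborel (\<lambda>x. \<bar>x \<bullet> i\<bar> powr k * \<bar>f x\<bar>)" if "i \<in> Basis" for i
    using integrable_abs[OF fi[OF that]] by (simp add: abs_mult)
  have i: "integrable lborel (\<lambda>x. \<bar>f x\<bar> + (\<Sum>i\<in>Basis. \<bar>x \<bullet> i\<bar> powr k * \<bar>f x\<bar>))"
    using f fi' by (intro Bochner_Integration.integrable_add Bochner_Integration.integrable_sum) auto
  have le: "jbr x powr k * \<bar>f x\<bar> \<le> \<bar>f x\<bar> + (\<Sum>i\<in>Basis. \<bar>x \<bullet> i\<bar> powr k * \<bar>f x\<bar>)" for x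
    using mult_right_mono[OF jbr_powr_le[OF k, of x], of "\<bar>f x\<bar>"] by (simp add: distrib_right sum_distrib_right)
  show j: "integrable lborel (\<lambda>x. jbr x powr k * f x)"
    by (rule Bochner_Integration.integrable_bound[OF i]) (use le in \<open>auto simp: abs_mult intro!: AE_I2 order_trans[OF _ abs_ge_self]\<close>)
  have "integrable lborel (\<lambda>x. jbr x powr k * \<bar>f x\<bar>)" using integrable_abs[OF j] by (simp add: abs_mult)
  then have "L1k_norm k f \<le> (LINT x|lborel. \<bar>f x\<bar> + (\<Sum>i\<in>Basis. \<bar>x \<bullet> i\<bar> powr k * \<bar>f x\<bar>))"
    unfolding L1k_norm_def by (rule integral_mono[OF _ i le])
  also have "\<dots> = (LINT x|lborel. \<bar>f x\<bar>) + (\<Sum>i\<in>Basis. LINT x|lborel. \<bar>x \<bullet> i\<bar> powr k * \<bar>f x\<bar>)"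
    using f fi' by (subst Bochner_Integration.integral_add) (auto simp: Bochner_Integration.integral_sum)
  finally show "L1k_norm k f \<le> (LINT x|lborel. \<bar>f x\<bar>) + (\<Sum>i\<in>Basis. LINT x|lborel. \<bar>x \<bullet> i\<bar> powr k * \<bar>f x\<bar>)" .
qed

section \<open>Convergence to equilibrium\<close>

text \<open>Density of a Y when Y has density \<open>w\<close>; its transform is that of
  \<open>w\<close> at \<open>a *\<^sub>R \<xi>\<close>.\<close>

definition dil :: "real \<Rightarrow> ('a::euclidean_space \<Rightarrow> real) \<Rightarrow> 'a \<Rightarrow> real" where
  "dil a w x = (1 / a) ^ DIM('a) * w ((1 / a) *\<^sub>R x)"

lemma dil_props:
  fixes w :: "'a::euclidean_space \<Rightarrow> real"
  assumes w: "integrable lborel w" and a: "0 < a"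
  shows "integrable lborel (dil a w)" "fourier (dil a w) \<xi> = fourier w (a *\<^sub>R \<xi>)"
    "(LINT x|lborel. \<bar>dil a w x\<bar>) = (LINT x|lborel. \<bar>w x\<bar>)"
proof -
  have i: "integrable lborel (\<lambda>x. w ((1 / a) *\<^sub>R x))"
    using integrable_lborel_affine[OF w, of "1/a" 0] a by simp
  then show "integrable lborel (dil a w)" unfolding dil_def[abs_def] by simp
  have "fourier (dil a w) \<xi> = of_real ((1 / a) ^ DIM('a)) * fourier (\<lambda>x. w ((1 / a) *\<^sub>R x)) \<xi>"
    unfolding fourier_cis dil_def by (simp add: scaleR_conv_of_real mult.assoc)
  also have "\<dots> = fourier w (a *\<^sub>R \<xi>)"
    using a by (subst fourier_scale[OF w]) simp_all
  finally show "fourier (dil a w) \<xi> = fourier w (a *\<^sub>R \<xi>)" .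
  show "(LINT x|lborel. \<bar>dil a w x\<bar>) = (LINT x|lborel. \<bar>w x\<bar>)"
    using integral_lborel_affine[OF integrable_abs[OF w], of "1/a" 0] a
    by (simp add: dil_def abs_mult)
qed

text \<open>The distance to equilibrium starts from w0 = u0 - F, of integral zero, and its transform
  is that of w0 at exp (-t) \<xi> times \<open>E t \<xi>\<close>. In the decomposition of
  \<open>E t\<close> the part \<open>\<rho>1\<close> costs at most \<kappa> times the norm of w0;
  the other part contains the convolution of \<open>h\<close> with the contracted w0, which tends to
  0 because w0 has no mass. Only integrability of the data enters, so no rate results.\<close>

lemma L1_convergence:
  fixes u :: "real \<Rightarrow> 'a::euclidean_space \<Rightarrow> real" and F u0 :: "'a \<Rightarrow> real"
  assumes u: "\<And>t. 0 \<le> t \<Longrightarrow> integrable lborel (u t)" and F: "integrable lborel F" and u0: "integrable lborel u0"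
    and mass: "(LINT x|lborel. u0 x) = (LINT x|lborel. F x)"
    and fu: "\<And>t \<xi>. 0 \<le> t \<Longrightarrow> fourier (u t) \<xi> = fourier u0 (exp (-t) *\<^sub>R \<xi>) * E t \<xi>"
    and fF: "\<And>t \<xi>. 0 \<le> t \<Longrightarrow> fourier F \<xi> = fourier F (exp (-t) *\<^sub>R \<xi>) * E t \<xi>"
    and dec: "\<And>\<kappa>. 0 < \<kappa> \<Longrightarrow> \<exists>h b T. integrable lborel h \<and> 0 \<le> b \<and> (\<forall>t\<ge>T. \<exists>\<rho>1 \<rho>2. gp \<rho>1 \<and> continuous_on UNIV \<rho>1 \<and>
       gp \<rho>2 \<and> continuous_on UNIV \<rho>2 \<and> Re (\<rho>1 0) \<le> \<kappa> \<and> Re (\<rho>2 0) \<le> b \<and> (\<forall>\<xi>. E t \<xi> = \<rho>1 \<xi> + fourier h \<xi> * \<rho>2 \<xi>))"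
  shows "((\<lambda>t. LINT x|lborel. \<bar>u t x - F x\<bar>) \<longlongrightarrow> 0) at_top"
proof (rule tendsto_at_topI_sequentially)
  fix X :: "nat \<Rightarrow> real" assume X: "filterlim X at_top sequentially"
  define w0 where "w0 = (\<lambda>x. u0 x - F x)"
  have w0: "integrable lborel w0" unfolding w0_def using u0 F by simp
  have m0: "(LINT x|lborel. w0 x) = 0" unfolding w0_def using u0 F mass by (simp add: Bochner_Integration.integral_diff)
  let ?W = "LINT x|lborel. \<bar>w0 x\<bar>"
  have W: "0 \<le> ?W" by simp
  have aX: "(\<lambda>n. exp (- X n)) \<longlonglongrightarrow> 0"
    using X by (intro filterlim_compose[OF exp_at_bot] filterlim_compose[OF filterlim_uminus_at_bot_at_top])
  show "(\<lambda>n. LINT x|lborel. \<bar>u (X n) x - F x\<bar>) \<longlonglongrightarrow> 0"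
  proof (rule LIMSEQ_I)
    fix \<epsilon> :: real assume \<epsilon>: "0 < \<epsilon>"
    define \<kappa> where "\<kappa> = \<epsilon> / (2 * (?W + 1))"
    have \<kappa>: "0 < \<kappa>" "\<kappa> * ?W < \<epsilon> / 2"
    proof -
      have *: "0 < \<epsilon> / (2 * (w + 1)) \<and> \<epsilon> / (2 * (w + 1)) * w < \<epsilon> / 2" if "0 \<le> w" for w
        using \<epsilon> that by (simp add: field_simps add_nonneg_pos)
      show "0 < \<kappa>" "\<kappa> * ?W < \<epsilon> / 2" using *[OF W] unfolding \<kappa>_def by auto
    qed
    obtain h b T where h: "integrable lborel h" "0 \<le> b" and d: "\<And>t. t \<ge> T \<Longrightarrow> \<exists>\<rho>1 \<rho>2. gp \<rho>1 \<and> continuous_on UNIV \<rho>1 \<and>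
       gp \<rho>2 \<and> continuous_on UNIV \<rho>2 \<and> Re (\<rho>1 0) \<le> \<kappa> \<and> Re (\<rho>2 0) \<le> b \<and> (\<forall>\<xi>. E t \<xi> = \<rho>1 \<xi> + fourier h \<xi> * \<rho>2 \<xi>)"
      using dec[OF \<kappa>(1)] by blast
    have "(\<lambda>n. b * (LINT x|lborel. \<bar>cs (exp (- X n)) w0 h x - (LINT y|lborel. w0 y) * h x\<bar>)) \<longlonglongrightarrow> 0"
      by (intro tendsto_mult_right_zero cs_approx_identity w0 h aX)
    then have "(\<lambda>n. b * (LINT x|lborel. \<bar>cs (exp (- X n)) w0 h x\<bar>)) \<longlonglongrightarrow> 0" unfolding m0 by simp
    then have "eventually (\<lambda>n. b * (LINT x|lborel. \<bar>cs (exp (- X n)) w0 h x\<bar>) < \<epsilon> / 2) sequentially"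
      using \<epsilon> by (intro order_tendstoD) auto
    moreover have "eventually (\<lambda>n. X n \<ge> max 0 T) sequentially"
      using X unfolding filterlim_at_top by blast
    ultimately have "eventually (\<lambda>n. (LINT x|lborel. \<bar>u (X n) x - F x\<bar>) < \<epsilon>) sequentially"
    proof eventually_elim
      fix n assume n: "b * (LINT x|lborel. \<bar>cs (exp (- X n)) w0 h x\<bar>) < \<epsilon> / 2" "X n \<ge> max 0 T"
      define t a where "t = X n" and "a = exp (- t)"
      have t: "0 \<le> t" "T \<le> t" and a: "0 < a" using n by (auto simp: t_def a_def)
      obtain \<rho>1 \<rho>2 where r: "gp \<rho>1" "continuous_on UNIV \<rho>1" "gp \<rho>2" "continuous_on UNIV \<rho>2" "Re (\<rho>1 0) \<le> \<kappa>" "Re (\<rho>2 0) \<le> b"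
        "\<And>\<xi>. E t \<xi> = \<rho>1 \<xi> + fourier h \<xi> * \<rho>2 \<xi>" using d[OF t(2)] by blast
      have "(LINT x|lborel. \<bar>u t x - F x\<bar>) \<le> Re (\<rho>1 0) * (LINT x|lborel. \<bar>dil a w0 x\<bar>) + Re (\<rho>2 0) * (LINT x|lborel. \<bar>cs a w0 h x\<bar>)"
      proof (rule gp_multiplier_bound[OF _ _ _ r(1-4)])
        fix \<xi>
        have "fourier (\<lambda>x. u t x - F x) \<xi> = (fourier u0 (a *\<^sub>R \<xi>) - fourier F (a *\<^sub>R \<xi>)) * E t \<xi>"
          unfolding fourier_diff[OF u[OF t(1)] F] fu[OF t(1)] by (subst fF[OF t(1)]) (simp add: a_def algebra_simps)
        also have "\<dots> = fourier w0 (a *\<^sub>R \<xi>) * E t \<xi>"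
          unfolding w0_def fourier_diff[OF u0 F] ..
        finally show "fourier (\<lambda>x. u t x - F x) \<xi> = fourier (dil a w0) \<xi> * \<rho>1 \<xi> + fourier (cs a w0 h) \<xi> * \<rho>2 \<xi>"
          unfolding dil_props(2)[OF w0 a] fourier_cs[OF w0 h(1)] r(7) by (simp add: algebra_simps)
      qed (use u[OF t(1)] F dil_props[OF w0 a] cs_integrable[OF w0 h(1)] in auto)
      also have "\<dots> \<le> \<kappa> * ?W + b * (LINT x|lborel. \<bar>cs a w0 h x\<bar>)"
        unfolding dil_props(3)[OF w0 a] by (intro add_mono mult_right_mono r) auto
      also have "\<dots> < \<epsilon>" using \<kappa>(2) n(1) by (simp add: a_def t_def)
      finally show "(LINT x|lborel. \<bar>u (X n) x - F x\<bar>) < \<epsilon>" by (simp add: t_def)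
    qed
    then obtain n0 where "\<And>n. n \<ge> n0 \<Longrightarrow> (LINT x|lborel. \<bar>u (X n) x - F x\<bar>) < \<epsilon>"
      unfolding eventually_sequentially by blast
    moreover have "norm ((LINT x|lborel. \<bar>u (X n) x - F x\<bar>) - 0) = (LINT x|lborel. \<bar>u (X n) x - F x\<bar>)" for n
      by simp
    ultimately show "\<exists>no. \<forall>n\<ge>no. norm ((LINT x|lborel. \<bar>u (X n) x - F x\<bar>) - 0) < \<epsilon>"
      by metis
  qed
qed

text \<open>A weighted form of Scheffe's lemma:
  \<open>\<integral>\<phi>|u - F| = \<integral>\<phi>(u - F) + 2 \<integral>\<phi>(F - u)\<^sup>+\<close> and \<open>(F - u)\<^sup>+ \<le> F\<close>.\<close>

lemma weighted_Scheffe: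
  fixes u :: "real \<Rightarrow> 'a::euclidean_space \<Rightarrow> real" and F \<phi> :: "'a \<Rightarrow> real"
  assumes [measurable]: "\<phi> \<in> borel_measurable borel" and p: "\<And>x. 0 \<le> \<phi> x"
    and u: "\<And>t. 0 \<le> t \<Longrightarrow> integrable lborel (u t)" "\<And>t. 0 \<le> t \<Longrightarrow> AE x in lborel. 0 \<le> u t x"
    "\<And>t. 0 \<le> t \<Longrightarrow> integrable lborel (\<lambda>x. \<phi> x * u t x)"
    and F: "integrable lborel F" "\<And>x. 0 \<le> F x" "integrable lborel (\<lambda>x. \<phi> x * F x)"
    and conv: "((\<lambda>t. LINT x|lborel. \<bar>u t x - F x\<bar>) \<longlongrightarrow> 0) at_top"
    and sup: "\<And>\<kappa>. 0 < \<kappa> \<Longrightarrow> eventually (\<lambda>t. (LINT x|lborel. \<phi> x * u t x) \<le> (LINT x|lborel. \<phi> x * F x) + \<kappa>) at_top"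
  shows "((\<lambda>t. LINT x|lborel. \<phi> x * \<bar>u t x - F x\<bar>) \<longlongrightarrow> 0) at_top"
proof (rule order_tendstoI)
  fix c :: real assume c: "c < 0"
  have "0 \<le> (LINT x|lborel. \<phi> x * \<bar>u t x - F x\<bar>)" for t
    by (intro integral_nonneg_AE AE_I2 mult_nonneg_nonneg abs_ge_zero p)
  then show "eventually (\<lambda>t. c < (LINT x|lborel. \<phi> x * \<bar>u t x - F x\<bar>)) at_top"
    using c by (intro always_eventually allI) (meson less_le_trans)
next
  fix \<epsilon> :: real assume \<epsilon>: "0 < \<epsilon>"
  have [measurable]: "F \<in> borel_measurable borel" using F by auto
  \<comment> \<open>Where \<open>\<phi>\<close> is at most N the positive part costs at most N times
    the L1 distance; beyond N it is at most \<open>\<phi>\<close> times \<open>F\<close>, a tail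
    that does not depend on time.\<close>
  have "(\<lambda>n. LINT x|lborel. (if \<phi> x \<le> real n then 0 else \<phi> x * F x)) \<longlonglongrightarrow> (LINT x|(lborel :: 'a measure). 0)"
  proof (rule integral_dominated_convergence[where w="\<lambda>x. \<phi> x * F x"])
    show "AE x in lborel. (\<lambda>n. if \<phi> x \<le> real n then 0 else \<phi> x * F x) \<longlonglongrightarrow> 0"
    proof (intro AE_I2 tendsto_eventually)
      fix x
      show "eventually (\<lambda>n. (if \<phi> x \<le> real n then 0 else \<phi> x * F x) = 0) sequentially"
        using eventually_ge_at_top[of "nat \<lceil>\<phi> x\<rceil>"] by eventually_elim (auto simp: nat_ceiling_le_eq)
    qed
  qed (use F p in auto)
  then have "eventually (\<lambda>n. (LINT x|lborel. (if \<phi> x \<le> real n then 0 else \<phi> x * F x)) < \<epsilon> / 8) sequentially"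
    using \<epsilon> by (intro order_tendstoD(2)[where y=0]) auto
  then obtain N where N: "(LINT x|lborel. (if \<phi> x \<le> real N then 0 else \<phi> x * F x)) < \<epsilon> / 8"
    by (auto simp: eventually_sequentially)
  have tailint: "integrable lborel (\<lambda>x. if \<phi> x \<le> real N then 0 else \<phi> x * F x)"
    by (rule Bochner_Integration.integrable_bound[OF F(3)]) auto
  have "eventually (\<lambda>t. (LINT x|lborel. \<bar>u t x - F x\<bar>) < \<epsilon> / (8 * (real N + 1))) at_top"
    using conv \<epsilon> by (intro order_tendstoD) auto
  moreover have "eventually (\<lambda>t. (LINT x|lborel. \<phi> x * u t x) \<le> (LINT x|lborel. \<phi> x * F x) + \<epsilon> / 4) at_top"
    using \<epsilon> by (intro sup) auto
  moreover have "eventually (\<lambda>t. 0 \<le> (t::real)) at_top" by (rule eventually_ge_at_top)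
  ultimately show "eventually (\<lambda>t. (LINT x|lborel. \<phi> x * \<bar>u t x - F x\<bar>) < \<epsilon>) at_top"
  proof eventually_elim
    fix t :: real assume l1: "(LINT x|lborel. \<bar>u t x - F x\<bar>) < \<epsilon> / (8 * (real N + 1))"
      and mo: "(LINT x|lborel. \<phi> x * u t x) \<le> (LINT x|lborel. \<phi> x * F x) + \<epsilon> / 4" and t: "0 \<le> t"
    note ut = u[OF t]
    have [measurable]: "u t \<in> borel_measurable borel" using ut by auto
    have iN: "integrable lborel (\<lambda>x. real N * \<bar>u t x - F x\<bar>)" using ut F by auto
    have "(LINT x|lborel. \<phi> x * \<bar>u t x - F x\<bar>) \<le>
      (LINT x|lborel. (\<phi> x * u t x - \<phi> x * F x) + 2 * (real N * \<bar>u t x - F x\<bar> + (if \<phi> x \<le> real N then 0 else \<phi> x * F x)))"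
    proof (rule integral_mono_AE)
      have "integrable lborel (\<lambda>x. \<phi> x * u t x - \<phi> x * F x)" using ut F by auto
      from integrable_abs[OF this] show "integrable lborel (\<lambda>x. \<phi> x * \<bar>u t x - F x\<bar>)"
        unfolding right_diff_distrib[symmetric] abs_mult abs_of_nonneg[OF p] .
      show "AE x in lborel. \<phi> x * \<bar>u t x - F x\<bar> \<le> (\<phi> x * u t x - \<phi> x * F x) + 2 * (real N * \<bar>u t x - F x\<bar> + (if \<phi> x \<le> real N then 0 else \<phi> x * F x))"
        using ut(2)
      proof eventually_elim
        fix x assume ux: "0 \<le> u t x"
        have "\<phi> x * \<bar>u t x - F x\<bar> = (\<phi> x * u t x - \<phi> x * F x) + 2 * (\<phi> x * max 0 (F x - u t x))"
        proof (cases "u t x \<le> F x")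
          case True
          then show ?thesis by (simp add: max_def algebra_simps)
        next
          case False
          then show ?thesis by (simp add: max_def algebra_simps)
        qed
        also have "\<phi> x * max 0 (F x - u t x) \<le> real N * \<bar>u t x - F x\<bar> + (if \<phi> x \<le> real N then 0 else \<phi> x * F x)"
        proof (cases "\<phi> x \<le> real N")
          case True
          then show ?thesis using p[of x] by (simp add: mult_mono)
        next
          case False
          have "\<phi> x * max 0 (F x - u t x) \<le> \<phi> x * F x" using ux F(2)[of x] by (intro mult_left_mono p) auto
          moreover have "0 \<le> real N * \<bar>u t x - F x\<bar>" by simp
          ultimately have "\<phi> x * max 0 (F x - u t x) \<le> real N * \<bar>u t x - F x\<bar> + \<phi> x * F x" by linarith
          then show ?thesis using False by simp
        qed
        finally show "\<phi> x * \<bar>u t x - F x\<bar> \<le> (\<phi> x * u t x - \<phi> x * F x) + 2 * (real N * \<bar>u t x - F x\<bar> + (if \<phi> x \<le> real N then 0 else \<phi> x * F x))"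
          by simp
      qed
    qed (use ut F tailint iN in auto)
    also have "\<dots> = ((LINT x|lborel. \<phi> x * u t x) - (LINT x|lborel. \<phi> x * F x)) + 2 * (real N * (LINT x|lborel. \<bar>u t x - F x\<bar>) + (LINT x|lborel. (if \<phi> x \<le> real N then 0 else \<phi> x * F x)))"
      using ut F tailint iN by (simp add: Bochner_Integration.integral_add Bochner_Integration.integral_diff)
    also have "\<dots> < \<epsilon>"
    proof -
      have "real N * (LINT x|lborel. \<bar>u t x - F x\<bar>) \<le> real N * (\<epsilon> / (8 * (real N + 1)))"
        using l1 by (intro mult_left_mono) auto
      also have "\<dots> \<le> \<epsilon> / 8" using \<epsilon> by (simp add: field_simps)
      finally have P: "real N * (LINT x|lborel. \<bar>u t x - F x\<bar>) \<le> \<epsilon> / 8" .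
      have "a - b + 2 * (p + q) < \<epsilon>" if "p \<le> \<epsilon> / 8" "a \<le> b + \<epsilon> / 4" "q < \<epsilon> / 8" for a b p q
        using that \<epsilon> by argo
      from this[OF P mo N] show ?thesis .
    qed
    finally show "(LINT x|lborel. \<phi> x * \<bar>u t x - F x\<bar>) < \<epsilon>" .
  qed
qed

text \<open>For characteristic functions of independent X and Y this bounds moments of X + Y, with a
  constant arbitrarily close to 1 on the noise \<open>w\<close> and a large one on the vanishing
  contribution \<open>z\<close> of the initial datum. It follows from 1 - z w = (1 - z) + (1 - w) -
  (1 - z)(1 - w), Young's inequality, and |1 - y|^2 <= 2 (1 - Re y) in the unit disc.\<close>

lemma Re_one_minus_mult_le:
  fixes z w :: complex
  assumes z: "cmod z \<le> 1" and w: "cmod w \<le> 1" and k: "0 < \<kappa>"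
  shows "1 - Re (z * w) \<le> (1 + \<kappa>) * (1 - Re w) + (1 + 1 / \<kappa>) * (1 - Re z)"
proof -
  have sq: "(cmod (1 - y))\<^sup>2 \<le> 2 * (1 - Re y)" if "cmod y \<le> 1" for y :: complex
  proof -
    have "(cmod (1 - y))\<^sup>2 = 1 - 2 * Re y + (cmod y)\<^sup>2"
      unfolding cmod_power2 by (simp add: power2_eq_square algebra_simps)
    moreover have "(cmod y)\<^sup>2 \<le> 1" using that by (simp add: power_le_one)
    ultimately show ?thesis by simp
  qed
  let ?p = "cmod (1 - z)" and ?q = "cmod (1 - w)"
  have "1 - z * w = (1 - z) + (1 - w) - (1 - z) * (1 - w)" by (simp add: algebra_simps)
  then have "1 - Re (z * w) = (1 - Re z) + (1 - Re w) - Re ((1 - z) * (1 - w))"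
    by (metis minus_complex.sel(1) one_complex.sel(1) plus_complex.sel(1))
  moreover have "- Re ((1 - z) * (1 - w)) \<le> ?p * ?q"
    using complex_Re_le_cmod[of "- ((1 - z) * (1 - w))"] by (simp add: norm_mult del: mult_minus_left mult_minus_right times_complex.sel)
  moreover have "?p * ?q \<le> (c * ?p\<^sup>2 + \<kappa> * ?q\<^sup>2) / 2" if c: "c = 1 / \<kappa>" for c
  proof -
    have "0 \<le> (?p - \<kappa> * ?q)\<^sup>2 / (2 * \<kappa>)" using k by simp
    also have "\<dots> = (c * ?p\<^sup>2 + \<kappa> * ?q\<^sup>2) / 2 - ?p * ?q"
      using k by (simp add: c power2_eq_square field_simps)
    finally show ?thesis by simp
  qed
  moreover have "(1 / \<kappa>) * ?p\<^sup>2 \<le> (1 / \<kappa>) * (2 * (1 - Re z))" using sq[OF z] k by (intro mult_left_mono) auto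
  moreover have "\<kappa> * ?q\<^sup>2 \<le> \<kappa> * (2 * (1 - Re w))" using sq[OF w] k by (intro mult_left_mono) auto
  ultimately have "1 - Re (z * w) \<le> (1 - Re z) + (1 - Re w) + ((1 / \<kappa>) * (2 * (1 - Re z)) + \<kappa> * (2 * (1 - Re w))) / 2"
    by (smt (verit) divide_right_mono)
  also have "\<dots> = (1 + \<kappa>) * (1 - Re w) + (1 + 1 / \<kappa>) * (1 - Re z)"
    by (simp add: algebra_simps add_divide_distrib diff_divide_distrib)
  finally show ?thesis .
qed

lemma moment_dil:
  fixes w :: "'a::euclidean_space \<Rightarrow> real"
  assumes w: "integrable lborel (\<lambda>x. \<bar>x \<bullet> i\<bar> powr k * w x)" and a: "0 < a"
  shows "integrable lborel (\<lambda>x. \<bar>x \<bullet> i\<bar> powr k * dil a w x)"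
    and "(LINT x|lborel. \<bar>x \<bullet> i\<bar> powr k * dil a w x) = a powr k * (LINT x|lborel. \<bar>x \<bullet> i\<bar> powr k * w x)"
proof -
  have e: "\<bar>x \<bullet> i\<bar> powr k * dil a w x = (a powr k * (1 / a) ^ DIM('a)) * (\<bar>(0 + (1 / a) *\<^sub>R x) \<bullet> i\<bar> powr k * w (0 + (1 / a) *\<^sub>R x))" for x
    using a by (simp add: dil_def abs_mult powr_divide)
  show "integrable lborel (\<lambda>x. \<bar>x \<bullet> i\<bar> powr k * dil a w x)"
    unfolding e using a by (intro integrable_mult_right integrable_lborel_affine[OF w]) simp
  show "(LINT x|lborel. \<bar>x \<bullet> i\<bar> powr k * dil a w x) = a powr k * (LINT x|lborel. \<bar>x \<bullet> i\<bar> powr k * w x)"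
    unfolding e using a integral_lborel_affine[OF w, of "1/a" 0] by simp
qed

lemma dil_nonneg: "0 < a \<Longrightarrow> (\<And>x. 0 \<le> w x) \<Longrightarrow> 0 \<le> dil a w x"
  by (simp add: dil_def)

text \<open>The setting shared by the two equations: \<open>E t\<close> is the characteristic function of the noise
  accumulated up to time \<open>t\<close> and \<open>F\<close> is a stationary density.\<close>

locale ou_curve =
  fixes k K :: real and u0 :: "'a::euclidean_space \<Rightarrow> real" and u :: "real \<Rightarrow> 'a \<Rightarrow> real"
    and E :: "real \<Rightarrow> 'a \<Rightarrow> complex"
  assumes k: "0 \<le> k" "k < 1"
    and u0: "prob_density u0" "in_L1k k u0"
    and u: "\<And>t. 0 \<le> t \<Longrightarrow> in_L1k k (u t)"
    and fu: "\<And>t \<xi>. 0 \<le> t \<Longrightarrow> fourier (u t) \<xi> = fourier u0 (exp (-t) *\<^sub>R \<xi>) * E t \<xi>"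
    and E_gp: "\<And>t. 0 \<le> t \<Longrightarrow> gp (E t)" "\<And>t. 0 \<le> t \<Longrightarrow> continuous_on UNIV (E t)"
    and E_0: "\<And>t. 0 \<le> t \<Longrightarrow> E t 0 = 1"
    and E_le: "\<And>t \<xi>. 0 \<le> t \<Longrightarrow> cmod (E t \<xi>) \<le> 1"
    and E_mom: "\<And>t i r. 0 \<le> t \<Longrightarrow> i \<in> Basis \<Longrightarrow> 0 < r \<Longrightarrow> 1 - Re (E t (r *\<^sub>R i)) \<le> K * min 1 r"
begin

lemma u0_int: "integrable lborel u0" "(LINT x|lborel. u0 x) = 1" "\<And>x. 0 \<le> u0 x"
  using u0 by (auto simp: prob_density_def)

lemma u0_le: "cmod (fourier u0 \<xi>) \<le> 1"
  using fourier_norm_le[of u0 \<xi>] u0_int by simp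

lemma u_int: "0 \<le> t \<Longrightarrow> integrable lborel (u t)"
  using in_L1k_integrable(1)[OF u k(1)] .

lemma u_moment_int: "0 \<le> t \<Longrightarrow> i \<in> Basis \<Longrightarrow> integrable lborel (\<lambda>x. \<bar>x \<bullet> i\<bar> powr k * u t x)"
  using in_L1k_integrable(3)[OF u k(1)] .

lemma fu_0: "0 \<le> t \<Longrightarrow> fourier (u t) 0 = 1"
  using fu[of t 0] E_0[of t] u0_int by simp

lemma u_mass: "0 \<le> t \<Longrightarrow> (LINT x|lborel. u t x) = 1"
  using fu_0[of t] by (simp add: of_real_eq_1_iff del: of_real_1)

lemma u_nonneg:
  assumes t: "0 \<le> t" shows "AE x in lborel. 0 \<le> u t x"
proof (rule gp_multiplier_nonneg[OF u_int[OF t] _ _ E_gp(1)[OF t] E_gp(2)[OF t]])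
  show "integrable lborel (dil (exp (-t)) u0)" by (rule dil_props(1)[OF u0_int(1)]) simp
  show "0 \<le> dil (exp (-t)) u0 x" for x by (rule dil_nonneg) (auto simp: u0_int)
  show "fourier (u t) \<xi> = fourier (dil (exp (-t)) u0) \<xi> * E t \<xi>" for \<xi>
    unfolding fu[OF t] by (subst dil_props(2)[OF u0_int(1)]) auto
qed

lemma u_abs_mass: "0 \<le> t \<Longrightarrow> (LINT x|lborel. \<bar>u t x\<bar>) = 1"
proof -
  assume t: "0 \<le> t"
  have "(LINT x|lborel. \<bar>u t x\<bar>) = (LINT x|lborel. u t x)"
    by (rule integral_cong_AE) (use u_int[OF t] u_nonneg[OF t] in auto)
  then show ?thesis using u_mass[OF t] by simp
qed

text \<open>The cosine formula for the contracted initial density: contraction by exp (-t)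
  multiplies the moment of order k by \<open>exp (-t) powr k\<close>, the only decay in time that
  the datum contributes.\<close>

lemma int_u0_part:
  assumes k0: "0 < k" and i: "i \<in> Basis" and t: "0 \<le> t"
  shows "integrable lborel (\<lambda>r. qq k r * (1 - Re (fourier u0 (exp (-t) *\<^sub>R (r *\<^sub>R i)))))"
    "(LINT r|lborel. qq k r * (1 - Re (fourier u0 (exp (-t) *\<^sub>R (r *\<^sub>R i))))) = cm k * (exp (-t) powr k * (LINT x|lborel. \<bar>x \<bullet> i\<bar> powr k * u0 x))"
proof -
  let ?d = "dil (exp (-t)) u0"
  have d: "integrable lborel ?d" "AE x in lborel. 0 \<le> ?d x"
    using dil_props(1)[OF u0_int(1), of "exp (-t)"] dil_nonneg[of "exp (-t)" u0] u0_int(3) by auto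
  have f: "fourier ?d \<xi> = fourier u0 (exp (-t) *\<^sub>R \<xi>)" for \<xi>
    by (rule dil_props(2)[OF u0_int(1)]) simp
  have m: "integrable lborel (\<lambda>x. \<bar>x \<bullet> i\<bar> powr k * u0 x)" by (rule in_L1k_integrable(3)[OF u0(2) k(1) i])
  have Q: "integrable lborel (\<lambda>r. qq k r * Re (fourier ?d 0 - fourier ?d (r *\<^sub>R i)))"
    using moment_fourier(1)[OF k0 k(2) d, of i] moment_dil(1)[OF m] by simp
  have e: "Re (fourier ?d 0 - fourier ?d (r *\<^sub>R i)) = 1 - Re (fourier u0 (exp (-t) *\<^sub>R (r *\<^sub>R i)))" for r
    unfolding f using u0_int(2) by simp
  show "integrable lborel (\<lambda>r. qq k r * (1 - Re (fourier u0 (exp (-t) *\<^sub>R (r *\<^sub>R i)))))"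
    using Q unfolding e .
  show "(LINT r|lborel. qq k r * (1 - Re (fourier u0 (exp (-t) *\<^sub>R (r *\<^sub>R i))))) = cm k * (exp (-t) powr k * (LINT x|lborel. \<bar>x \<bullet> i\<bar> powr k * u0 x))"
    using moment_fourier(2)[OF k0 k(2) d Q] moment_dil(2)[OF m, of "exp (-t)"] unfolding e by simp
qed

lemma int_E_part:
  assumes k0: "0 < k" and i: "i \<in> Basis" and t: "0 \<le> t"
  shows "integrable lborel (\<lambda>r. qq k r * (1 - Re (E t (r *\<^sub>R i))))"
proof (rule Bochner_Integration.integrable_bound)
  show "integrable lborel (\<lambda>r. K * (min 1 r * qq k r))"
    by (intro integrable_mult_right integrable_min_qq k0 k)
  have [measurable]: "E t \<in> borel_measurable borel" by (rule gp_measurable[OF E_gp(1)[OF t]])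
  show "(\<lambda>r. qq k r * (1 - Re (E t (r *\<^sub>R i)))) \<in> borel_measurable lborel" by measurable
  show "AE r in lborel. norm (qq k r * (1 - Re (E t (r *\<^sub>R i)))) \<le> norm (K * (min 1 r * qq k r))"
  proof (rule AE_I2)
    fix r :: real
    have "0 \<le> 1 - Re (E t (r *\<^sub>R i))" using E_le[OF t, of "r *\<^sub>R i"] complex_Re_le_cmod[of "E t (r *\<^sub>R i)"] by simp
    moreover have "qq k r * (1 - Re (E t (r *\<^sub>R i))) \<le> K * (min 1 r * qq k r)"
    proof (cases "0 < r")
      case True
      then show ?thesis using mult_left_mono[OF E_mom[OF t i True] qq_nonneg[of k r]] by (simp add: mult_ac)
    qed (simp add: qq_def)
    ultimately show "norm (qq k r * (1 - Re (E t (r *\<^sub>R i)))) \<le> norm (K * (min 1 r * qq k r))"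
      using abs_ge_self[of "K * (min 1 r * qq k r)"] by (simp only: real_norm_def abs_mult[of "qq k r"] abs_of_nonneg qq_nonneg)
  qed
qed

lemma u_moment_le:
  assumes k0: "0 < k" and i: "i \<in> Basis" and t: "0 \<le> t" and kp: "0 < \<kappa>"
  shows "(LINT x|lborel. \<bar>x \<bullet> i\<bar> powr k * u t x) \<le> (1 + \<kappa>) * ((LINT r|lborel. qq k r * (1 - Re (E t (r *\<^sub>R i)))) / cm k) +
     (1 + 1 / \<kappa>) * (exp (-t) powr k * (LINT x|lborel. \<bar>x \<bullet> i\<bar> powr k * u0 x))"
proof -
  have cmp: "0 < cm k" by (rule cm_pos[OF k0 k(2)])
  have Q: "integrable lborel (\<lambda>r. qq k r * Re (fourier (u t) 0 - fourier (u t) (r *\<^sub>R i)))"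
    using moment_fourier(1)[OF k0 k(2) u_int[OF t] u_nonneg[OF t]] u_moment_int[OF t i] by simp
  note i1 = int_E_part[OF k0 i t] and i2 = int_u0_part[OF k0 i t]
  have "cm k * (LINT x|lborel. \<bar>x \<bullet> i\<bar> powr k * u t x) = (LINT r|lborel. qq k r * Re (fourier (u t) 0 - fourier (u t) (r *\<^sub>R i)))"
    by (rule moment_fourier(2)[OF k0 k(2) u_int[OF t] u_nonneg[OF t] Q])
  also have "\<dots> \<le> (LINT r|lborel. (1 + \<kappa>) * (qq k r * (1 - Re (E t (r *\<^sub>R i)))) + (1 + 1 / \<kappa>) * (qq k r * (1 - Re (fourier u0 (exp (-t) *\<^sub>R (r *\<^sub>R i))))))"
  proof (rule integral_mono[OF Q])
    show "integrable lborel (\<lambda>r. (1 + \<kappa>) * (qq k r * (1 - Re (E t (r *\<^sub>R i)))) + (1 + 1 / \<kappa>) * (qq k r * (1 - Re (fourier u0 (exp (-t) *\<^sub>R (r *\<^sub>R i))))))"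
      by (intro Bochner_Integration.integrable_add integrable_mult_right i1 i2)
    fix r
    have "Re (fourier (u t) 0 - fourier (u t) (r *\<^sub>R i)) = 1 - Re (fourier u0 (exp (-t) *\<^sub>R (r *\<^sub>R i)) * E t (r *\<^sub>R i))"
      by (simp add: u_mass[OF t] fu[OF t, of "r *\<^sub>R i"])
    also have "\<dots> \<le> (1 + \<kappa>) * (1 - Re (E t (r *\<^sub>R i))) + (1 + 1 / \<kappa>) * (1 - Re (fourier u0 (exp (-t) *\<^sub>R (r *\<^sub>R i))))"
      by (rule Re_one_minus_mult_le[OF u0_le E_le[OF t] kp])
    finally show "qq k r * Re (fourier (u t) 0 - fourier (u t) (r *\<^sub>R i)) \<le> (1 + \<kappa>) * (qq k r * (1 - Re (E t (r *\<^sub>R i)))) + (1 + 1 / \<kappa>) * (qq k r * (1 - Re (fourier u0 (exp (-t) *\<^sub>R (r *\<^sub>R i)))))"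
      using mult_left_mono[OF _ qq_nonneg[of k r]] by (simp only: mult.left_commute[of _ "qq k r"] distrib_left[symmetric])
  qed
  also have "\<dots> = (1 + \<kappa>) * (LINT r|lborel. qq k r * (1 - Re (E t (r *\<^sub>R i)))) + (1 + 1 / \<kappa>) * (cm k * (exp (-t) powr k * (LINT x|lborel. \<bar>x \<bullet> i\<bar> powr k * u0 x)))"
    unfolding i2(2)[symmetric] using i1 i2(1)
    by (subst Bochner_Integration.integral_add) (simp_all only: integrable_mult_right integral_mult_right_zero)
  finally show ?thesis using cmp by (simp add: field_simps)
qed

lemma u_norm_bound:
  assumes t: "0 \<le> t"
  shows "L1k_norm k (u t) \<le> 1 + (\<Sum>i\<in>Basis. 1 + 2 * (K * (LINT r|lborel. min 1 r * qq k r) / cm k) + 2 * (LINT x|lborel. \<bar>x \<bullet> i\<bar> powr k * u0 x))"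
proof -
  have K: "0 \<le> K"
  proof -
    obtain i :: 'a where i: "i \<in> Basis" using nonempty_Basis by blast
    have "0 \<le> 1 - Re (E t (1 *\<^sub>R i))" using E_le[OF t, of "1 *\<^sub>R i"] complex_Re_le_cmod[of "E t (1 *\<^sub>R i)"] by simp
    also have "\<dots> \<le> K * min 1 1" by (rule E_mom[OF t i]) simp
    finally show ?thesis by simp
  qed
  have mom: "(LINT x|lborel. \<bar>x \<bullet> i\<bar> powr k * \<bar>u t x\<bar>) \<le> 1 + 2 * (K * (LINT r|lborel. min 1 r * qq k r) / cm k) + 2 * (LINT x|lborel. \<bar>x \<bullet> i\<bar> powr k * u0 x)"
    if i: "i \<in> Basis" for i
  proof -
    have "(LINT x|lborel. \<bar>x \<bullet> i\<bar> powr k * \<bar>u t x\<bar>) = (LINT x|lborel. \<bar>x \<bullet> i\<bar> powr k * u t x)"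
      by (rule integral_cong_AE) (use u_int[OF t] u_nonneg[OF t] in auto)
    also have "\<dots> \<le> 1 + 2 * (K * (LINT r|lborel. min 1 r * qq k r) / cm k) + 2 * (LINT x|lborel. \<bar>x \<bullet> i\<bar> powr k * u0 x)"
    proof (cases "k = 0")
      case True
      have "0 \<le> K * (LINT r|lborel. min 1 r * qq k r) / cm k"
      proof (intro divide_nonneg_nonneg mult_nonneg_nonneg K)
        have "0 \<le> min 1 r * qq k r" for r by (cases "0 < r") (auto simp: qq_def)
        then show "0 \<le> (LINT r|lborel. min 1 r * qq k r)" by (intro integral_nonneg_AE AE_I2)
        show "0 \<le> cm k" unfolding cm_def by (intro integral_nonneg_AE AE_I2 mult_nonneg_nonneg) auto
      qed
      moreover have "0 \<le> (LINT x|lborel. \<bar>x \<bullet> i\<bar> powr k * u0 x)" using u0_int(3) by (intro integral_nonneg_AE AE_I2) auto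
      \<comment> \<open>For k = 0 the weight is 1 off a hyperplane and, since
        \<open>0 powr 0 = 0\<close>, vanishes on it.\<close>
      moreover have "(LINT x|lborel. \<bar>x \<bullet> i\<bar> powr k * u t x) \<le> (LINT x|lborel. u t x)"
        by (rule integral_mono_AE[OF u_moment_int[OF t i] u_int[OF t]], use u_nonneg[OF t] in eventually_elim)
           (use True in auto)
      ultimately show ?thesis using u_mass[OF t] by linarith
    next
      case False
      then have k0: "0 < k" using k by simp
      have cmp: "0 < cm k" by (rule cm_pos[OF k0 k(2)])
      have "(LINT r|lborel. qq k r * (1 - Re (E t (r *\<^sub>R i)))) \<le> (LINT r|lborel. K * (min 1 r * qq k r))"
      proof (rule integral_mono[OF int_E_part[OF k0 i t] integrable_mult_right[OF integrable_min_qq[OF k0 k(2)]]])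
        show "qq k r * (1 - Re (E t (r *\<^sub>R i))) \<le> K * (min 1 r * qq k r)" for r
        proof (cases "0 < r")
          case True
          then show ?thesis using mult_left_mono[OF E_mom[OF t i True] qq_nonneg[of k r]] by (simp add: mult_ac)
        qed (simp add: qq_def)
      qed
      then have "(LINT r|lborel. qq k r * (1 - Re (E t (r *\<^sub>R i)))) / cm k \<le> K * (LINT r|lborel. min 1 r * qq k r) / cm k"
        using cmp by (simp add: divide_right_mono)
      moreover have "exp (-t) powr k * (LINT x|lborel. \<bar>x \<bullet> i\<bar> powr k * u0 x) \<le> 1 * (LINT x|lborel. \<bar>x \<bullet> i\<bar> powr k * u0 x)"
      proof (rule mult_right_mono)
        show "exp (-t) powr k \<le> 1" using t k by (simp add: exp_powr_real)
        show "0 \<le> (LINT x|lborel. \<bar>x \<bullet> i\<bar> powr k * u0 x)" using u0_int(3) by (intro integral_nonneg_AE AE_I2) auto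
      qed
      ultimately show ?thesis using u_moment_le[OF k0 i t, of 1] by simp
    qed
    finally show ?thesis .
  qed
  have "L1k_norm k (u t) \<le> (LINT x|lborel. \<bar>u t x\<bar>) + (\<Sum>i\<in>Basis. LINT x|lborel. \<bar>x \<bullet> i\<bar> powr k * \<bar>u t x\<bar>)"
    by (rule L1k_norm_moments(2)) (use k u_int[OF t] u_moment_int[OF t] in auto)
  also have "\<dots> \<le> 1 + (\<Sum>i\<in>Basis. 1 + 2 * (K * (LINT r|lborel. min 1 r * qq k r) / cm k) + 2 * (LINT x|lborel. \<bar>x \<bullet> i\<bar> powr k * u0 x))"
    unfolding u_abs_mass[OF t] by (intro add_mono order_refl sum_mono mom)
  finally show ?thesis .
qed

text \<open>Given L1 convergence, Scheffe's lemma asks for an asymptotic upper bound on the moments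
  only. It comes from \<open>u_moment_le\<close>: the noise part converges by domination to the
  moment of \<open>F\<close>, the datum contributes a multiple of \<open>exp (-t) powr k\<close>,
  and the prefactor can be taken as close to 1 as desired.\<close>

theorem L1k_convergence:
  assumes F: "prob_density F"
    and fF: "\<And>t \<xi>. 0 \<le> t \<Longrightarrow> fourier F \<xi> = fourier F (exp (-t) *\<^sub>R \<xi>) * E t \<xi>"
    and lim: "\<And>\<xi>. ((\<lambda>t. E t \<xi>) \<longlongrightarrow> fourier F \<xi>) at_top"
    and dec: "\<And>\<kappa>. 0 < \<kappa> \<Longrightarrow> \<exists>h b T. integrable lborel h \<and> 0 \<le> b \<and> (\<forall>t\<ge>T. \<exists>\<rho>1 \<rho>2. gp \<rho>1 \<and> continuous_on UNIV \<rho>1 \<and>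
       gp \<rho>2 \<and> continuous_on UNIV \<rho>2 \<and> Re (\<rho>1 0) \<le> \<kappa> \<and> Re (\<rho>2 0) \<le> b \<and> (\<forall>\<xi>. E t \<xi> = \<rho>1 \<xi> + fourier h \<xi> * \<rho>2 \<xi>))"
  shows "((\<lambda>t. L1k_norm k (\<lambda>x. u t x - F x)) \<longlongrightarrow> 0) at_top"
proof -
  have Fp: "integrable lborel F" "(LINT x|lborel. F x) = 1" "\<And>x. 0 \<le> F x"
    using F by (auto simp: prob_density_def)
  have F0: "fourier F 0 = 1" using Fp by simp
  have L1: "((\<lambda>t. LINT x|lborel. \<bar>u t x - F x\<bar>) \<longlongrightarrow> 0) at_top"
    by (rule L1_convergence[OF u_int Fp(1) u0_int(1) _ fu fF dec]) (use Fp u0_int in auto)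
  have mom_F: "1 - Re (fourier F (r *\<^sub>R i)) \<le> K * min 1 r" if "i \<in> Basis" "0 < r" for i r
  proof (rule tendsto_upperbound)
    show "((\<lambda>t. 1 - Re (E t (r *\<^sub>R i))) \<longlongrightarrow> 1 - Re (fourier F (r *\<^sub>R i))) at_top"
      by (intro tendsto_intros lim)
    show "eventually (\<lambda>t. 1 - Re (E t (r *\<^sub>R i)) \<le> K * min 1 r) at_top"
      using eventually_ge_at_top[of 0] by eventually_elim (rule E_mom[OF _ that])
  qed simp
  have Fmom: "integrable lborel (\<lambda>x. \<bar>x \<bullet> i\<bar> powr k * F x)" if i: "i \<in> Basis" for i
  proof (cases "k = 0")
    case True
    show ?thesis by (rule Bochner_Integration.integrable_bound[OF Fp(1)]) (use True Fp in auto)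
  next
    case False
    then have k0: "0 < k" using k by simp
    show ?thesis
      by (rule moment_bound(1)[OF k0 k(2) Fp(1), where K=K]) (use Fp mom_F[OF i] F0 in auto)
  qed
  have coord: "((\<lambda>t. LINT x|lborel. \<bar>x \<bullet> i\<bar> powr k * \<bar>u t x - F x\<bar>) \<longlongrightarrow> 0) at_top" if i: "i \<in> Basis" for i
  proof (rule weighted_Scheffe[OF _ _ u_int u_nonneg u_moment_int[OF _ i] Fp(1,3) Fmom[OF i] L1])
    fix \<kappa> :: real assume kp: "0 < \<kappa>"
    let ?M = "LINT x|lborel. \<bar>x \<bullet> i\<bar> powr k * F x" and ?Mu = "LINT x|lborel. \<bar>x \<bullet> i\<bar> powr k * u0 x"
    have M: "0 \<le> ?M" using Fp(3) by (intro integral_nonneg_AE AE_I2) auto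
    show "eventually (\<lambda>t. (LINT x|lborel. \<bar>x \<bullet> i\<bar> powr k * u t x) \<le> ?M + \<kappa>) at_top"
    proof (cases "k = 0")
      case True
      \<comment> \<open>By the convention \<open>0 powr 0 = 0\<close> the weight vanishes on this
        hyperplane, which is harmless as a null set.\<close>
      have null: "AE x::'a in lborel. x \<bullet> i \<noteq> 0"
      proof -
        have "{x. i \<bullet> x = 0} \<in> null_sets lebesgue" using negligible_hyperplane[of i 0] i nonzero_Basis by (auto simp: negligible_iff_null_sets)
        then have "AE x in lebesgue. i \<bullet> x \<noteq> 0" by (rule AE_I') auto
        then have "AE x in lborel. i \<bullet> x \<noteq> 0" by (simp add: AE_completion_iff)
        then show ?thesis by (simp add: inner_commute)
      qed
      have "(LINT x|lborel. \<bar>x \<bullet> i\<bar> powr k * f x) = (LINT x|lborel. f x)" if "integrable lborel f" for f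
        by (rule integral_cong_AE) (use that True null in auto)
      then show ?thesis
        using u_int Fp u_mass kp by (intro eventually_mono[OF eventually_ge_at_top[of 0]]) auto
    next
      case False
      then have k0: "0 < k" using k by simp
      have cmp: "0 < cm k" by (rule cm_pos[OF k0 k(2)])
      \<comment> \<open>Small enough for (1 + l) times the moment of \<open>F\<close> to stay below
        that moment plus \<open>\<kappa>\<close>; the added 1 avoids division by 0.\<close>
      define l where "l = \<kappa> / (2 * (?M + 1))"
      have l: "0 < l" "l * ?M < \<kappa>"
      proof -
        have *: "0 < \<kappa> / (2 * (w + 1)) \<and> \<kappa> / (2 * (w + 1)) * w < \<kappa>" if "0 \<le> w" for w
          using kp that by (simp add: field_simps add_nonneg_pos add_pos_nonneg)
        show "0 < l" "l * ?M < \<kappa>" using *[OF M] unfolding l_def by auto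
      qed
      have FQ: "integrable lborel (\<lambda>r. qq k r * Re (fourier F 0 - fourier F (r *\<^sub>R i)))"
        using moment_fourier(1)[OF k0 k(2) Fp(1), of i] Fp(3) Fmom[OF i] by simp
      have FM: "(LINT r|lborel. qq k r * (1 - Re (fourier F (r *\<^sub>R i)))) / cm k = ?M"
        using moment_fourier(2)[OF k0 k(2) Fp(1) _ FQ] Fp(3) cmp F0 by (simp add: field_simps)
      have Econv: "((\<lambda>t. LINT r|lborel. qq k r * (1 - Re (E t (r *\<^sub>R i)))) \<longlongrightarrow> (LINT r|lborel. qq k r * (1 - Re (fourier F (r *\<^sub>R i))))) at_top"
      proof (rule tendsto_at_topI_sequentially)
        fix X :: "nat \<Rightarrow> real" assume X: "filterlim X at_top sequentially"
        have "eventually (\<lambda>n. 0 \<le> X n) sequentially" using X unfolding filterlim_at_top by blast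
        then obtain N where N: "\<And>n. n \<ge> N \<Longrightarrow> 0 \<le> X n" by (auto simp: eventually_sequentially)
        have "(\<lambda>n. LINT r|lborel. qq k r * (1 - Re (E (X (n + N)) (r *\<^sub>R i)))) \<longlonglongrightarrow> (LINT r|lborel. qq k r * (1 - Re (fourier F (r *\<^sub>R i))))"
        proof (rule integral_dominated_convergence[where w="\<lambda>r. K * (min 1 r * qq k r)"])
          have "filterlim (\<lambda>n. X (n + N)) at_top sequentially"
            by (rule filterlim_compose[OF X filterlim_add_const_nat_at_top])
          note l = filterlim_compose[OF lim this]
          show "AE r in lborel. (\<lambda>n. qq k r * (1 - Re (E (X (n + N)) (r *\<^sub>R i)))) \<longlonglongrightarrow> qq k r * (1 - Re (fourier F (r *\<^sub>R i)))"
            by (intro AE_I2 tendsto_intros l)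
          show "integrable lborel (\<lambda>r. K * (min 1 r * qq k r))" by (intro integrable_mult_right integrable_min_qq k0 k)
          show "(\<lambda>r. qq k r * (1 - Re (fourier F (r *\<^sub>R i)))) \<in> borel_measurable lborel"
            using fourier_measurable[OF Fp(1)] by measurable
          show "(\<lambda>r. qq k r * (1 - Re (E (X (n + N)) (r *\<^sub>R i)))) \<in> borel_measurable lborel" for n
            using int_E_part[OF k0 i N[of "n + N"]] by simp
          show "AE r in lborel. norm (qq k r * (1 - Re (E (X (n + N)) (r *\<^sub>R i)))) \<le> K * (min 1 r * qq k r)" for n
          proof (rule AE_I2)
            fix r :: real
            have t: "0 \<le> X (n + N)" using N by simp
            have "0 \<le> 1 - Re (E (X (n + N)) (r *\<^sub>R i))" using E_le[OF t, of "r *\<^sub>R i"] complex_Re_le_cmod[of "E (X (n+N)) (r *\<^sub>R i)"] by simp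
            moreover have "qq k r * (1 - Re (E (X (n + N)) (r *\<^sub>R i))) \<le> K * (min 1 r * qq k r)"
            proof (cases "0 < r")
              case True
              then show ?thesis using mult_left_mono[OF E_mom[OF t i True] qq_nonneg[of k r]] by (simp add: mult_ac)
            qed (simp add: qq_def)
            ultimately show "norm (qq k r * (1 - Re (E (X (n + N)) (r *\<^sub>R i)))) \<le> K * (min 1 r * qq k r)" by (simp add: abs_mult)
          qed
        qed
        then show "(\<lambda>n. LINT r|lborel. qq k r * (1 - Re (E (X n) (r *\<^sub>R i)))) \<longlonglongrightarrow> (LINT r|lborel. qq k r * (1 - Re (fourier F (r *\<^sub>R i))))"
          by (rule LIMSEQ_offset)
      qed
      have e0: "((\<lambda>t. exp (-t) powr k) \<longlongrightarrow> 0) at_top" using k0 by real_asymp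
      have "((\<lambda>t. (1 + l) * ((LINT r|lborel. qq k r * (1 - Re (E t (r *\<^sub>R i)))) / cm k) + (1 + 1 / l) * (exp (-t) powr k * ?Mu)) \<longlongrightarrow>
         (1 + l) * ((LINT r|lborel. qq k r * (1 - Re (fourier F (r *\<^sub>R i)))) / cm k) + (1 + 1 / l) * (0 * ?Mu)) at_top"
        using cmp by (intro tendsto_intros Econv e0) auto
      then have "eventually (\<lambda>t. (1 + l) * ((LINT r|lborel. qq k r * (1 - Re (E t (r *\<^sub>R i)))) / cm k) + (1 + 1 / l) * (exp (-t) powr k * ?Mu) < ?M + \<kappa>) at_top"
      proof (rule order_tendstoD)
        show "(1 + l) * ((LINT r|lborel. qq k r * (1 - Re (fourier F (r *\<^sub>R i)))) / cm k) + (1 + 1 / l) * (0 * ?Mu) < ?M + \<kappa>"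
          unfolding FM using l by (simp add: distrib_right)
      qed
      then show ?thesis
        using eventually_ge_at_top[of 0]
        by eventually_elim (use u_moment_le[OF k0 i _ l(1)] in \<open>meson order.strict_trans1 less_imp_le\<close>)
    qed
  qed auto
  have "((\<lambda>t. (LINT x|lborel. \<bar>u t x - F x\<bar>) + (\<Sum>i\<in>Basis. LINT x|lborel. \<bar>x \<bullet> i\<bar> powr k * \<bar>u t x - F x\<bar>)) \<longlongrightarrow> 0 + (\<Sum>i\<in>(Basis::'a set). 0)) at_top"
    by (intro tendsto_add L1 tendsto_sum coord)
  then have "((\<lambda>t. (LINT x|lborel. \<bar>u t x - F x\<bar>) + (\<Sum>i\<in>Basis. LINT x|lborel. \<bar>x \<bullet> i\<bar> powr k * \<bar>u t x - F x\<bar>)) \<longlongrightarrow> 0) at_top" by simp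
  then show ?thesis
  proof (rule tendsto_sandwich[OF _ _ tendsto_const, rotated 2])
    show "eventually (\<lambda>t. 0 \<le> L1k_norm k (\<lambda>x. u t x - F x)) at_top"
      unfolding L1k_norm_def by (intro always_eventually allI integral_nonneg_AE AE_I2) simp
    show "eventually (\<lambda>t. L1k_norm k (\<lambda>x. u t x - F x) \<le> (LINT x|lborel. \<bar>u t x - F x\<bar>) + (\<Sum>i\<in>Basis. LINT x|lborel. \<bar>x \<bullet> i\<bar> powr k * \<bar>u t x - F x\<bar>)) at_top"
      using eventually_ge_at_top[of 0]
    proof eventually_elim
      fix t :: real assume t: "0 \<le> t"
      show "L1k_norm k (\<lambda>x. u t x - F x) \<le> (LINT x|lborel. \<bar>u t x - F x\<bar>) + (\<Sum>i\<in>Basis. LINT x|lborel. \<bar>x \<bullet> i\<bar> powr k * \<bar>u t x - F x\<bar>)"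
        by (rule L1k_norm_moments(2)) (use k u_int[OF t] Fp(1) u_moment_int[OF t] Fmom in \<open>auto simp: right_diff_distrib\<close>)
    qed
  qed
qed

end

section \<open>The Levy exponent of the rescaled kernel\<close>

text \<open>Mean value inequality: the half-plane is convex and the derivative of \<open>exp\<close>
  is bounded by exp c on it.\<close>

lemma exp_diff_le:
  fixes x y :: complex
  assumes "Re x \<le> c" "Re y \<le> c"
  shows "cmod (exp x - exp y) \<le> exp c * cmod (x - y)"
proof (rule field_differentiable_bound[of "{z. Re z \<le> c}" exp exp])
  show "convex {z. Re z \<le> c}" by (rule convex_halfspace_Re_le)
  show "(exp has_field_derivative exp z) (at z within {z. Re z \<le> c})" for z
    by (rule DERIV_subset[OF DERIV_exp]) simp
  show "cmod (exp z) \<le> exp c" if "z \<in> {z. Re z \<le> c}" for z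
    using that by simp
qed (use assms in auto)

lemma integral_exp_Ici:
  assumes p: "0 < (p::real)"
  shows "integrable lborel (\<lambda>\<tau>. indicator {0..} \<tau> * exp (- p * \<tau>))"
    and "(LINT \<tau>|lborel. indicator {0..} \<tau> * exp (- p * \<tau>)) = 1 / p"
proof -
  have h: "((\<lambda>\<tau>. exp (- p * \<tau>)) has_integral (exp (- p * 0) / p)) {0..}"
    by (rule has_integral_exp_minus_to_infinity[OF p])
  show i: "integrable lborel (\<lambda>\<tau>. indicator {0..} \<tau> * exp (- p * \<tau>))"
    by (rule integrable_lborel_of_has_integral[OF _ _ _ h]) auto
  have "((\<lambda>\<tau>. if \<tau> \<in> {0..} then exp (- p * \<tau>) else 0) has_integral (exp (- p * 0) / p)) UNIV"
    using h by (simp only: has_integral_restrict_UNIV)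
  moreover have "(\<lambda>\<tau>. if \<tau> \<in> {0..} then exp (- p * \<tau>) else 0) = (\<lambda>\<tau>. indicator {0..} \<tau> * exp (- p * \<tau>))"
    by (auto simp: indicator_def)
  ultimately have "((\<lambda>\<tau>. indicator {0..} \<tau> * exp (- p * \<tau>)) has_integral (1 / p)) UNIV" by simp
  then show "(LINT \<tau>|lborel. indicator {0..} \<tau> * exp (- p * \<tau>)) = 1 / p"
    using has_integral_integral_lborel[OF i] has_integral_unique by blast
qed

lemma rescale_eq_dil: "0 < \<epsilon> \<Longrightarrow> rescale j \<epsilon> = dil \<epsilon> (j :: 'a::euclidean_space \<Rightarrow> real)"
  by (rule ext) (simp add: rescale_def dil_def powr_minus powr_realpow power_divide inverse_eq_divide)

text \<open>The density of jumps accumulated over the time window \<open>[r, t]\<close>; its mass is \<open>t - r\<close>.\<close>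

definition hk :: "('a::euclidean_space \<Rightarrow> real) \<Rightarrow> real \<Rightarrow> real \<Rightarrow> real \<Rightarrow> 'a \<Rightarrow> real" where
  "hk j \<epsilon> r t x = (LINT \<tau>|lborel. indicator {r..t} \<tau> * dil (\<epsilon> * exp (-\<tau>)) j x)"

lemma hk_props:
  fixes j :: "'a::euclidean_space \<Rightarrow> real"
  assumes j: "prob_density j" and e: "0 < \<epsilon>"
  shows "integrable lborel (hk j \<epsilon> r t)" "0 \<le> hk j \<epsilon> r t x"
    "fourier (hk j \<epsilon> r t) \<xi> = (LINT \<tau>|lborel. indicator {r..t} \<tau> *\<^sub>R fourier j ((\<epsilon> * exp (-\<tau>)) *\<^sub>R \<xi>))"
proof -
  have ji: "integrable lborel j" "\<And>x. 0 \<le> j x" "(LINT x|lborel. j x) = 1" using j by (auto simp: prob_density_def)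
  have [measurable]: "j \<in> borel_measurable borel" using ji by auto
  have ep: "0 < \<epsilon> * exp (-\<tau>)" for \<tau> using e by simp
  have ind: "integrable lborel (indicator {r..t} :: real \<Rightarrow> real)"
    by (intro integrable_real_indicator) (auto simp: emeasure_lborel_Icc_eq)
  have dm: "(LINT x|lborel. \<bar>dil (\<epsilon> * exp (-\<tau>)) j x\<bar>) = 1" for \<tau>
    unfolding dil_props(3)[OF ji(1) ep] using ji by simp
  have int: "integrable (lborel \<Otimes>\<^sub>M lborel) (\<lambda>(\<tau>, x). indicator {r..t} \<tau> * dil (\<epsilon> * exp (-\<tau>)) j x)"
  proof (rule lborel_pair.Fubini_integrable)
    show "(\<lambda>(\<tau>, x). indicator {r..t} \<tau> * dil (\<epsilon> * exp (-\<tau>)) j x) \<in> borel_measurable (lborel \<Otimes>\<^sub>M lborel)"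
      unfolding dil_def by measurable
    show "integrable lborel (\<lambda>\<tau>. LINT x|lborel. norm (case (\<tau>, x) of (\<tau>, x) \<Rightarrow> indicator {r..t} \<tau> * dil (\<epsilon> * exp (-\<tau>)) j x))"
      using ind by (simp add: abs_mult dm)
    show "AE \<tau> in lborel. integrable lborel (\<lambda>x. case (\<tau>, x) of (\<tau>, x) \<Rightarrow> indicator {r..t} \<tau> * dil (\<epsilon> * exp (-\<tau>)) j x)"
      by (intro AE_I2) (use dil_props(1)[OF ji(1) ep] in auto)
  qed
  show "integrable lborel (hk j \<epsilon> r t)"
    using lborel_pair.integrable_snd[OF int] by (simp add: hk_def[abs_def])
  show "0 \<le> hk j \<epsilon> r t x"
    unfolding hk_def by (intro integral_nonneg_AE AE_I2 mult_nonneg_nonneg dil_nonneg ep ji) simp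
  let ?h = "\<lambda>\<tau> x. (indicator {r..t} \<tau> * dil (\<epsilon> * exp (-\<tau>)) j x) *\<^sub>R cis (- (x \<bullet> \<xi>))"
  have int2: "integrable (lborel \<Otimes>\<^sub>M lborel) (\<lambda>(\<tau>, x). ?h \<tau> x)"
    by (rule Bochner_Integration.integrable_bound[OF int]) (use int[THEN borel_measurable_integrable] in \<open>measurable, auto\<close>)
  have [measurable]: "(\<lambda>(\<tau>, x). indicator {r..t} \<tau> * dil (\<epsilon> * exp (-\<tau>)) j x) \<in> borel_measurable (borel \<Otimes>\<^sub>M borel)"
    unfolding dil_def by measurable
  have "fourier (hk j \<epsilon> r t) \<xi> = (LINT x|lborel. LINT \<tau>|lborel. ?h \<tau> x)"
    unfolding fourier_cis hk_def
  proof (rule integral_cong_AE)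
    have "AE x in lborel. integrable lborel (\<lambda>\<tau>. indicator {r..t} \<tau> * dil (\<epsilon> * exp (-\<tau>)) j x)"
      using lborel_pair.AE_integrable_snd[OF int] by simp
    then show "AE x in lborel. (LINT \<tau>|lborel. indicator {r..t} \<tau> * dil (\<epsilon> * exp (-\<tau>)) j x) *\<^sub>R cis (- (x \<bullet> \<xi>)) = (LINT \<tau>|lborel. ?h \<tau> x)"
      by eventually_elim simp
    show "(\<lambda>x. (LINT \<tau>|lborel. indicator {r..t} \<tau> * dil (\<epsilon> * exp (-\<tau>)) j x) *\<^sub>R cis (- (x \<bullet> \<xi>))) \<in> borel_measurable lborel"
      using lborel_pair.integrable_snd[OF int] by (intro borel_measurable_scaleR) auto
    show "(\<lambda>x. LINT \<tau>|lborel. ?h \<tau> x) \<in> borel_measurable lborel"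
      using lborel_pair.integrable_snd[OF int2] by auto
  qed
  also have "\<dots> = (LINT \<tau>|lborel. LINT x|lborel. ?h \<tau> x)"
    by (rule lborel_pair.Fubini_integral[OF int2])
  also have "\<dots> = (LINT \<tau>|lborel. indicator {r..t} \<tau> *\<^sub>R fourier (dil (\<epsilon> * exp (-\<tau>)) j) \<xi>)"
    unfolding fourier_cis by (intro Bochner_Integration.integral_cong refl, subst integral_scaleR_right[symmetric]) simp
  finally show "fourier (hk j \<epsilon> r t) \<xi> = (LINT \<tau>|lborel. indicator {r..t} \<tau> *\<^sub>R fourier j ((\<epsilon> * exp (-\<tau>)) *\<^sub>R \<xi>))"
    unfolding dil_props(2)[OF ji(1) ep] .
qed

text \<open>Radius within which the remainder of the expansion is at most half of the leading term;
  it depends on \<delta> and C0 only, not on s.\<close>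

definition r0 :: "real \<Rightarrow> real \<Rightarrow> real" where
  "r0 \<delta> C0 = min 1 ((1 / (2 * C0)) powr (1 / \<delta>))"

lemma r0_props:
  assumes "0 < \<delta>" "0 < C0"
  shows "0 < r0 \<delta> C0" "r0 \<delta> C0 \<le> 1" "0 \<le> r \<Longrightarrow> r \<le> r0 \<delta> C0 \<Longrightarrow> C0 * r powr \<delta> \<le> 1 / 2"
proof -
  show "0 < r0 \<delta> C0" "r0 \<delta> C0 \<le> 1" using assms by (auto simp: r0_def)
  assume r: "0 \<le> r" "r \<le> r0 \<delta> C0"
  have "r powr \<delta> \<le> ((1 / (2 * C0)) powr (1 / \<delta>)) powr \<delta>"
    using r assms by (intro powr_mono2) (auto simp: r0_def)
  also have "\<dots> = 1 / (2 * C0)" using assms by (simp add: powr_powr)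
  finally show "C0 * r powr \<delta> \<le> 1 / 2" using assms by (simp add: field_simps)
qed

text \<open>One member of the family. The constants in the estimates below are expressed by
  \<delta>, C0 and the dimension, which is how the final constant becomes independent of s.\<close>

locale kern =
  fixes s \<delta> C0 :: real and j :: "'a::euclidean_space \<Rightarrow> real"
  assumes s: "1 / 2 < s" "s < 1" and \<delta>: "0 < \<delta>" and C0: "0 < C0" and j: "prob_density j"
    and expansion: "\<And>\<xi>. norm \<xi> \<le> 1 \<Longrightarrow>
      cmod (fourier j \<xi> - complex_of_real (1 - norm \<xi> powr (2 * s))) \<le> C0 * norm \<xi> powr (2 * s + \<delta>)"
begin

definition a :: "'a \<Rightarrow> complex" where "a \<xi> = 1 - fourier j \<xi>"

lemma j_int: "integrable lborel j" "\<And>x. 0 \<le> j x" "(LINT x|lborel. j x) = 1"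
  using j by (auto simp: prob_density_def)

lemma fj_le: "cmod (fourier j \<xi>) \<le> 1"
  using fourier_norm_le[of j \<xi>] j_int by simp

lemma a_le2: "cmod (a \<xi>) \<le> 2"
  using norm_triangle_ineq4[of 1 "fourier j \<xi>"] fj_le[of \<xi>] by (simp add: a_def)

lemma a_Re: "0 \<le> Re (a \<xi>)"
  using complex_Re_le_cmod[of "fourier j \<xi>"] fj_le[of \<xi>] by (simp add: a_def)

lemma a_cont: "continuous_on UNIV a"
  unfolding a_def[abs_def] by (intro continuous_intros continuous_fourier j_int)

lemma a_meas[measurable]: "a \<in> borel_measurable borel"
  by (rule borel_measurable_continuous_onI[OF a_cont])

lemma a_near: "norm \<xi> \<le> 1 \<Longrightarrow> cmod (a \<xi> - of_real (norm \<xi> powr (2 * s))) \<le> C0 * norm \<xi> powr (2 * s + \<delta>)"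
proof -
  assume "norm \<xi> \<le> 1"
  moreover have "a \<xi> - of_real (norm \<xi> powr (2 * s)) = - (fourier j \<xi> - complex_of_real (1 - norm \<xi> powr (2 * s)))"
    by (simp add: a_def)
  ultimately show ?thesis using expansion by (simp only: norm_minus_cancel)
qed

lemma a_le: "cmod (a \<xi>) \<le> (2 + C0) * norm \<xi> powr (2 * s)"
proof (cases "norm \<xi> \<le> 1")
  case True
  have "cmod (a \<xi>) \<le> cmod (a \<xi> - of_real (norm \<xi> powr (2 * s))) + norm \<xi> powr (2 * s)"
    using norm_triangle_ineq[of "a \<xi> - of_real (norm \<xi> powr (2 * s))" "of_real (norm \<xi> powr (2 * s))"] by simp
  also have "\<dots> \<le> C0 * norm \<xi> powr (2 * s) + norm \<xi> powr (2 * s)"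
  proof -
    have "norm \<xi> powr (2 * s + \<delta>) \<le> norm \<xi> powr (2 * s)"
      using True \<delta> by (cases "\<xi> = 0") (auto intro!: powr_mono')
    then have "C0 * norm \<xi> powr (2 * s + \<delta>) \<le> C0 * norm \<xi> powr (2 * s)" using C0 by simp
    then show ?thesis using a_near[OF True] by linarith
  qed
  also have "\<dots> \<le> (2 + C0) * norm \<xi> powr (2 * s)" by (simp add: distrib_right)
  finally show ?thesis .
next
  case False
  have "cmod (a \<xi>) \<le> 2 * 1" using a_le2 by simp
  also have "\<dots> \<le> (2 + C0) * norm \<xi> powr (2 * s)"
    using False C0 s by (intro mult_mono ge_one_powr_ge_zero) auto
  finally show ?thesis .
qed

lemma a_lower: "norm \<xi> \<le> r0 \<delta> C0 \<Longrightarrow> norm \<xi> powr (2 * s) / 2 \<le> Re (a \<xi>)"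
proof -
  assume r: "norm \<xi> \<le> r0 \<delta> C0"
  then have "norm \<xi> \<le> 1" using r0_props(2)[OF \<delta> C0] by simp
  have "C0 * norm \<xi> powr (2 * s + \<delta>) = norm \<xi> powr (2 * s) * (C0 * norm \<xi> powr \<delta>)" by (simp add: powr_add)
  also have "\<dots> \<le> norm \<xi> powr (2 * s) * (1 / 2)" by (intro mult_left_mono r0_props(3)[OF \<delta> C0] r) auto
  finally have "cmod (a \<xi> - of_real (norm \<xi> powr (2 * s))) \<le> norm \<xi> powr (2 * s) / 2" using a_near[OF \<open>norm \<xi> \<le> 1\<close>] by simp
  then have "\<bar>Re (a \<xi> - of_real (norm \<xi> powr (2 * s)))\<bar> \<le> norm \<xi> powr (2 * s) / 2" using abs_Re_le_cmod order_trans by blast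
  then show ?thesis unfolding abs_le_iff by simp
qed

lemma a_exp_le: "cmod (a (exp (-\<tau>) *\<^sub>R \<eta>)) \<le> (2 + C0) * norm \<eta> powr (2 * s) * exp (- (2 * s) * \<tau>)"
proof -
  have "norm (exp (-\<tau>) *\<^sub>R \<eta>) powr (2 * s) = norm \<eta> powr (2 * s) * exp (- (2 * s) * \<tau>)"
    by (simp add: powr_mult exp_powr_real mult.commute)
  then show ?thesis using a_le[of "exp (-\<tau>) *\<^sub>R \<eta>"] by (simp add: mult.assoc)
qed

lemma a_integrable:
  assumes "S \<in> sets borel" "S \<subseteq> {0..}"
  shows "integrable lborel (\<lambda>\<tau>. indicator S \<tau> *\<^sub>R a (exp (-\<tau>) *\<^sub>R \<eta>))"
proof (rule Bochner_Integration.integrable_bound)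
  show "integrable lborel (\<lambda>\<tau>. (2 + C0) * norm \<eta> powr (2 * s) * (indicator {0..} \<tau> * exp (- (2 * s) * \<tau>)))"
    using s by (intro integrable_mult_right integral_exp_Ici(1)) simp
  show "AE \<tau> in lborel. norm (indicator S \<tau> *\<^sub>R a (exp (-\<tau>) *\<^sub>R \<eta>)) \<le> norm ((2 + C0) * norm \<eta> powr (2 * s) * (indicator {0..} \<tau> * exp (- (2 * s) * \<tau>)))"
    using a_exp_le C0 assms(2) by (intro AE_I2) (auto simp: indicator_def abs_mult)
  show "(\<lambda>\<tau>. indicator S \<tau> *\<^sub>R a (exp (-\<tau>) *\<^sub>R \<eta>)) \<in> borel_measurable lborel" using assms(1) by measurable
qed

text \<open>Exponent of the jumps accumulated and contracted over infinite time; the integral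
  converges since \<open>a\<close> is of order 2 s at the origin.\<close>

definition AA :: "'a \<Rightarrow> complex" where
  "AA \<eta> = (LINT \<tau>|lborel. indicator {0..} \<tau> *\<^sub>R a (exp (-\<tau>) *\<^sub>R \<eta>))"

definition At :: "real \<Rightarrow> 'a \<Rightarrow> complex" where
  "At t \<eta> = (LINT \<tau>|lborel. indicator {0..t} \<tau> *\<^sub>R a (exp (-\<tau>) *\<^sub>R \<eta>))"

lemma AA_le: "cmod (AA \<eta>) \<le> (2 + C0) * norm \<eta> powr (2 * s)"
  and At_le: "cmod (At t \<eta>) \<le> (2 + C0) * norm \<eta> powr (2 * s)"
proof -
  have *: "cmod (LINT \<tau>|lborel. indicator S \<tau> *\<^sub>R a (exp (-\<tau>) *\<^sub>R \<eta>)) \<le> (2 + C0) * norm \<eta> powr (2 * s)"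
    if S: "S \<in> sets borel" "S \<subseteq> {0..}" for S
  proof -
    have "cmod (LINT \<tau>|lborel. indicator S \<tau> *\<^sub>R a (exp (-\<tau>) *\<^sub>R \<eta>)) \<le> (LINT \<tau>|lborel. (2 + C0) * norm \<eta> powr (2 * s) * (indicator {0..} \<tau> * exp (- (2 * s) * \<tau>)))"
    proof (rule order_trans[OF integral_norm_bound], rule integral_mono)
      show "integrable lborel (\<lambda>\<tau>. norm (indicator S \<tau> *\<^sub>R a (exp (-\<tau>) *\<^sub>R \<eta>)))"
        by (rule integrable_norm[OF a_integrable[OF S]])
      show "integrable lborel (\<lambda>\<tau>. (2 + C0) * norm \<eta> powr (2 * s) * (indicator {0..} \<tau> * exp (- (2 * s) * \<tau>)))"
        using s by (intro integrable_mult_right integral_exp_Ici(1)) simp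
      show "norm (indicator S \<tau> *\<^sub>R a (exp (-\<tau>) *\<^sub>R \<eta>)) \<le> (2 + C0) * norm \<eta> powr (2 * s) * (indicator {0..} \<tau> * exp (- (2 * s) * \<tau>))" for \<tau>
        using a_exp_le[of \<tau> \<eta>] C0 S(2) by (auto simp: indicator_def)
    qed
    also have "\<dots> = (2 + C0) * norm \<eta> powr (2 * s) * (1 / (2 * s))"
      using s by (subst integral_mult_right_zero, subst integral_exp_Ici(2)) auto
    also have "\<dots> \<le> (2 + C0) * norm \<eta> powr (2 * s) * 1"
      using s C0 by (intro mult_left_mono) auto
    finally show ?thesis by simp
  qed
  show "cmod (AA \<eta>) \<le> (2 + C0) * norm \<eta> powr (2 * s)" unfolding AA_def by (rule *) auto
  show "cmod (At t \<eta>) \<le> (2 + C0) * norm \<eta> powr (2 * s)" unfolding At_def by (rule *) auto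
qed

lemma AA_Re: "0 \<le> Re (AA \<eta>)" and At_Re: "0 \<le> Re (At t \<eta>)"
proof -
  have *: "0 \<le> Re (LINT \<tau>|lborel. indicator S \<tau> *\<^sub>R a (exp (-\<tau>) *\<^sub>R \<eta>))"
    if S: "S \<in> sets borel" "S \<subseteq> {0..}" for S
    unfolding integral_Re[OF a_integrable[OF S], symmetric]
    by (intro integral_nonneg_AE AE_I2) (simp add: a_Re)
  show "0 \<le> Re (AA \<eta>)" unfolding AA_def by (rule *) auto
  show "0 \<le> Re (At t \<eta>)" unfolding At_def by (rule *) auto
qed

text \<open>Shifting time by t contracts the frequency. After exponentiation this is stationarity of
  F; for real parts it makes \<open>AA\<close> nondecreasing along rays.\<close>

lemma AA_split:
  assumes t: "0 \<le> t" shows "AA \<eta> = At t \<eta> + AA (exp (-t) *\<^sub>R \<eta>)"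
proof -
  have "AA \<eta> = (LINT \<tau>|lborel. indicator {0..t} \<tau> *\<^sub>R a (exp (-\<tau>) *\<^sub>R \<eta>) + indicator {t<..} \<tau> *\<^sub>R a (exp (-\<tau>) *\<^sub>R \<eta>))"
    unfolding AA_def by (rule Bochner_Integration.integral_cong) (use t in \<open>auto simp: indicator_def\<close>)
  also have "\<dots> = At t \<eta> + (LINT \<tau>|lborel. indicator {t<..} \<tau> *\<^sub>R a (exp (-\<tau>) *\<^sub>R \<eta>))"
    unfolding At_def by (rule Bochner_Integration.integral_add; rule a_integrable) (use t in auto)
  also have "(LINT \<tau>|lborel. indicator {t<..} \<tau> *\<^sub>R a (exp (-\<tau>) *\<^sub>R \<eta>)) = (LINT \<tau>|lborel. indicator {t<..} (t + 1 * \<tau>) *\<^sub>R a (exp (-(t + 1 * \<tau>)) *\<^sub>R \<eta>))"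
    by (subst lborel_integral_real_affine[where c=1 and t=t]) auto
  also have "\<dots> = AA (exp (-t) *\<^sub>R \<eta>)"
    unfolding AA_def
  proof (rule integral_cong_AE)
    have "AE \<tau> in lborel. \<tau> \<noteq> (0::real)" by (rule AE_lborel_singleton)
    then show "AE \<tau> in lborel. indicator {t<..} (t + 1 * \<tau>) *\<^sub>R a (exp (-(t + 1 * \<tau>)) *\<^sub>R \<eta>) = indicator {0..} \<tau> *\<^sub>R a (exp (-\<tau>) *\<^sub>R (exp (-t) *\<^sub>R \<eta>))"
      by eventually_elim (auto simp: indicator_def exp_add[symmetric] algebra_simps)
  qed measurable
  finally show ?thesis .
qed

text \<open>Writes the exponent as a mass minus the transform of a nonnegative density, the form
  from which positivity of the exponential follows.\<close>

lemma At_eq_hk: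
  assumes e: "0 < \<epsilon>" and t: "0 \<le> r" "r \<le> t"
  shows "of_real (t - r) - fourier (hk j \<epsilon> r t) \<xi> = (LINT \<tau>|lborel. indicator {r..t} \<tau> *\<^sub>R a (exp (-\<tau>) *\<^sub>R (\<epsilon> *\<^sub>R \<xi>)))"
proof -
  have i1: "integrable lborel (\<lambda>\<tau>. indicator {r..t} \<tau> *\<^sub>R (1::complex))"
    by (intro integrable_scaleR_left integrable_real_indicator) (auto simp: emeasure_lborel_Icc_eq)
  have i: "integrable lborel (\<lambda>\<tau>. indicator {r..t} \<tau> *\<^sub>R a (exp (-\<tau>) *\<^sub>R (\<epsilon> *\<^sub>R \<xi>)))"
    by (rule a_integrable) (use t in auto)
  have "fourier (hk j \<epsilon> r t) \<xi> = (LINT \<tau>|lborel. indicator {r..t} \<tau> *\<^sub>R 1 - indicator {r..t} \<tau> *\<^sub>R a (exp (-\<tau>) *\<^sub>R (\<epsilon> *\<^sub>R \<xi>)))"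
    unfolding hk_props(3)[OF j e] by (intro Bochner_Integration.integral_cong refl) (simp add: a_def mult.commute scaleR_diff_right)
  also have "\<dots> = (LINT \<tau>|lborel. indicator {r..t} \<tau> *\<^sub>R (1::complex)) - (LINT \<tau>|lborel. indicator {r..t} \<tau> *\<^sub>R a (exp (-\<tau>) *\<^sub>R (\<epsilon> *\<^sub>R \<xi>)))"
    by (rule Bochner_Integration.integral_diff[OF i1 i])
  also have "(LINT \<tau>|lborel. indicator {r..t} \<tau> *\<^sub>R (1::complex)) = of_real (t - r)"
    using t by (simp add: scaleR_conv_of_real)
  finally show ?thesis by simp
qed

lemma AA_cont: "continuous_on UNIV AA"
proof -
  have "(\<lambda>n. AA (Y n)) \<longlonglongrightarrow> AA y" if Y: "Y \<longlonglongrightarrow> y" for Y y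
  proof -
    obtain B where B: "\<And>n. norm (Y n) \<le> B"
      using convergent_imp_Bseq[of Y] Y unfolding Bseq_def convergent_def by auto
    show ?thesis
      unfolding AA_def
    proof (rule integral_dominated_convergence[where w="\<lambda>\<tau>. (2 + C0) * B powr (2 * s) * (indicator {0..} \<tau> * exp (- (2 * s) * \<tau>))"])
      show "AE \<tau> in lborel. (\<lambda>n. indicator {0..} \<tau> *\<^sub>R a (exp (-\<tau>) *\<^sub>R Y n)) \<longlonglongrightarrow> indicator {0..} \<tau> *\<^sub>R a (exp (-\<tau>) *\<^sub>R y)"
        by (intro AE_I2 tendsto_intros continuous_on_tendsto_compose[OF a_cont] Y) auto
      show "AE \<tau> in lborel. norm (indicator {0..} \<tau> *\<^sub>R a (exp (-\<tau>) *\<^sub>R Y n)) \<le> (2 + C0) * B powr (2 * s) * (indicator {0..} \<tau> * exp (- (2 * s) * \<tau>))" for n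
      proof (rule AE_I2)
        fix \<tau> :: real
        have "cmod (a (exp (-\<tau>) *\<^sub>R Y n)) \<le> (2 + C0) * norm (Y n) powr (2 * s) * exp (- (2 * s) * \<tau>)" by (rule a_exp_le)
        also have "\<dots> \<le> (2 + C0) * B powr (2 * s) * exp (- (2 * s) * \<tau>)"
          using B[of n] C0 s by (intro mult_right_mono mult_left_mono powr_mono2) auto
        finally show "norm (indicator {0..} \<tau> *\<^sub>R a (exp (-\<tau>) *\<^sub>R Y n)) \<le> (2 + C0) * B powr (2 * s) * (indicator {0..} \<tau> * exp (- (2 * s) * \<tau>))"
          by (auto simp: indicator_def)
      qed
      show "integrable lborel (\<lambda>\<tau>. (2 + C0) * B powr (2 * s) * (indicator {0..} \<tau> * exp (- (2 * s) * \<tau>)))"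
        using s by (intro integrable_mult_right integral_exp_Ici(1)) simp
    qed measurable
  qed
  then show ?thesis by (auto simp: continuous_on_sequentially comp_def)
qed

end

section \<open>Exponentials of transforms of nonnegative functions\<close>

lemma gp_exp:
  fixes g :: "'a::euclidean_space \<Rightarrow> real"
  assumes r: "gp \<rho>" and g: "integrable lborel g" "\<And>x. 0 \<le> g x" and c: "0 \<le> (c::real)"
  shows "gp (\<lambda>\<xi>. \<rho> \<xi> * exp (of_real c * fourier g \<xi>))"
proof (rule gp_power_series[OF r g, of "\<lambda>n. c ^ n / fact n"])
  show "0 \<le> c ^ n / fact n" for n using c by simp
  show "summable (\<lambda>n. c ^ n / fact n * r ^ n)" for r
    using summable_exp[of "c * r"] by (simp add: power_mult_distrib field_simps)
  show "(\<lambda>n. of_real (c ^ n / fact n) * z ^ n) sums exp (of_real c * z)" for z :: complex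
    using exp_converges[of "of_real c * z"] by (simp add: power_mult_distrib scaleR_conv_of_real field_simps)
qed

text \<open>The entire function (exp z - 1) / z. Splitting one factor z off exp z - 1 isolates one
  jump, and the Taylor coefficients stay nonnegative, so positivity is kept.\<close>

definition EE :: "complex \<Rightarrow> complex" where "EE z = (\<Sum>n. (1 / fact (Suc n)) * z ^ n)"

lemma summable_EE: "summable (\<lambda>n. (1 / fact (Suc n)) * (z::'b::{real_normed_field,banach}) ^ n)"
proof (rule summable_comparison_test')
  show "summable (\<lambda>n. inverse (fact n) * norm z ^ n)" by (rule summable_exp)
  show "norm ((1 / fact (Suc n)) * z ^ n) \<le> inverse (fact n) * norm z ^ n" if "n \<ge> 0" for n
  proof -
    have "(1::real) / fact (Suc n) \<le> inverse (fact n)"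
      by (simp add: inverse_eq_divide divide_simps)
    from mult_right_mono[OF this, of "norm z ^ n"] show ?thesis
      by (simp add: norm_mult norm_power norm_divide del: fact_Suc)
  qed
qed

lemma EE_sums: "(\<lambda>n. (1 / fact (Suc n)) * z ^ n) sums EE z"
  unfolding EE_def by (rule summable_sums[OF summable_EE])

lemma exp_EE: "exp z = 1 + z * EE z"
proof -
  have "(\<lambda>n. z ^ Suc n /\<^sub>R fact (Suc n)) sums (exp z - 1)"
    using exp_converges[of z] by (subst sums_Suc_iff) simp
  moreover have "(\<lambda>n. z ^ Suc n /\<^sub>R fact (Suc n)) sums (z * EE z)"
    using sums_mult[OF EE_sums, of z z] by (simp add: scaleR_conv_of_real field_simps del: fact_Suc)
  ultimately show ?thesis using sums_unique2 by (metis diff_add_cancel add.commute)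
qed

lemma EE_cont: "isCont EE z"
  unfolding EE_def[abs_def] by (rule isCont_powser_converges_everywhere[OF summable_EE])

lemma gp_EE:
  fixes g :: "'a::euclidean_space \<Rightarrow> real"
  assumes r: "gp \<rho>" and g: "integrable lborel g" "\<And>x. 0 \<le> g x" and c: "0 \<le> (c::real)"
  shows "gp (\<lambda>\<xi>. \<rho> \<xi> * EE (of_real c * fourier g \<xi>))"
proof (rule gp_power_series[OF r g, of "\<lambda>n. c ^ n / fact (Suc n)"])
  show "0 \<le> c ^ n / fact (Suc n)" for n using c by simp
  show "summable (\<lambda>n. c ^ n / fact (Suc n) * r ^ n)" for r
    using summable_EE[of "c * r"] by (simp add: power_mult_distrib field_simps del: fact_Suc)
  show "(\<lambda>n. of_real (c ^ n / fact (Suc n)) * z ^ n) sums EE (of_real c * z)" for z :: complex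
    using EE_sums[of "of_real c * z"] by (simp add: power_mult_distrib field_simps del: fact_Suc)
qed

lemma one_minus_exp_le: "0 \<le> Re z \<Longrightarrow> cmod (1 - exp (- z)) \<le> cmod z"
  using exp_diff_le[of 0 0 "-z"] by simp

context kern
begin

abbreviation lam :: "real \<Rightarrow> real" where "lam \<epsilon> \<equiv> \<epsilon> powr (- 2 * s)"

definition Eps :: "real \<Rightarrow> real \<Rightarrow> 'a \<Rightarrow> complex" where
  "Eps \<epsilon> t \<xi> = exp (- (of_real (lam \<epsilon>) * At t (\<epsilon> *\<^sub>R \<xi>)))"

definition Feps :: "real \<Rightarrow> 'a \<Rightarrow> complex" where
  "Feps \<epsilon> \<xi> = exp (- (of_real (lam \<epsilon>) * AA (\<epsilon> *\<^sub>R \<xi>)))"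

lemma Eps_0: "Eps \<epsilon> t 0 = 1" and Feps_0: "Feps \<epsilon> 0 = 1"
  using At_le[of t 0] AA_le[of 0] by (simp_all add: Eps_def Feps_def)

lemma Eps_le: "cmod (Eps \<epsilon> t \<xi>) \<le> 1" and Feps_le: "cmod (Feps \<epsilon> \<xi>) \<le> 1"
  using At_Re[of t "\<epsilon> *\<^sub>R \<xi>"] AA_Re[of "\<epsilon> *\<^sub>R \<xi>"] by (simp_all add: Eps_def Feps_def)

text \<open>Transform of the noise produced in the time window [r, t], a compound Poisson law with
  jump rate \<open>lam \<epsilon>\<close>.\<close>

definition Ew :: "real \<Rightarrow> real \<Rightarrow> real \<Rightarrow> 'a \<Rightarrow> complex" where
  "Ew \<epsilon> r t \<xi> = exp (of_real (lam \<epsilon>) * (fourier (hk j \<epsilon> r t) \<xi> - of_real (t - r)))"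

lemma Ew_gp:
  assumes "0 < \<epsilon>" shows "gp (Ew \<epsilon> r t)" "continuous_on UNIV (Ew \<epsilon> r t)"
proof -
  have "gp (\<lambda>\<xi>. of_real (exp (- lam \<epsilon> * (t - r))) * (1 * exp (of_real (lam \<epsilon>) * fourier (hk j \<epsilon> r t) \<xi>)))"
    by (intro gp_scale gp_exp gp_const hk_props(1,2)[OF j assms]) auto
  moreover have "of_real (exp (- lam \<epsilon> * (t - r))) * (1 * exp (of_real (lam \<epsilon>) * fourier (hk j \<epsilon> r t) \<xi>)) = Ew \<epsilon> r t \<xi>" for \<xi>
    unfolding Ew_def by (simp add: exp_add[symmetric] exp_of_real[symmetric] algebra_simps)
  ultimately show "gp (Ew \<epsilon> r t)" by simp
  show "continuous_on UNIV (Ew \<epsilon> r t)"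
    unfolding Ew_def[abs_def] by (intro continuous_intros continuous_fourier hk_props(1)[OF j assms])
qed

lemma Ew_0: "0 < \<epsilon> \<Longrightarrow> 0 \<le> r \<Longrightarrow> r \<le> t \<Longrightarrow> Ew \<epsilon> r t 0 = 1"
proof -
  assume e: "0 < \<epsilon>" and r: "0 \<le> r" "r \<le> t"
  have "a 0 = 0" using a_le[of 0] by simp
  then show ?thesis using At_eq_hk[OF e r, of 0] by (simp add: Ew_def)
qed

lemma Eps_eq_Ew: "0 < \<epsilon> \<Longrightarrow> 0 \<le> t \<Longrightarrow> Eps \<epsilon> t = Ew \<epsilon> 0 t"
proof
  fix \<xi> assume "0 < \<epsilon>" "0 \<le> t"
  then have At: "At t (\<epsilon> *\<^sub>R \<xi>) = of_real (t - 0) - fourier (hk j \<epsilon> 0 t) \<xi>"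
    using At_eq_hk[of \<epsilon> 0 t \<xi>] by (simp add: At_def)
  show "Eps \<epsilon> t \<xi> = Ew \<epsilon> 0 t \<xi>"
    unfolding Eps_def Ew_def At by (simp add: algebra_simps)
qed

lemma Eps_gp:
  assumes "0 < \<epsilon>" "0 \<le> t" shows "gp (Eps \<epsilon> t)" "continuous_on UNIV (Eps \<epsilon> t)"
  unfolding Eps_eq_Ew[OF assms] by (rule Ew_gp[OF assms(1)])+

lemma lam_scale: "0 < \<epsilon> \<Longrightarrow> lam \<epsilon> * norm (\<epsilon> *\<^sub>R \<xi>) powr (2 * s) = norm \<xi> powr (2 * s)"
  by (simp add: powr_mult mult.assoc[symmetric] powr_add[symmetric])

text \<open>The rate cancels the scaling: \<epsilon>^(-2 s) |\<epsilon> \<xi>|^(2 s) = |\<xi>|^(2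
  s), which is at most |\<xi>| in the unit ball because 2 s > 1. The bound is therefore independent
  of \<epsilon>, s and t.\<close>

lemma Eps_mom:
  assumes e: "0 < \<epsilon>" and r: "0 < r" and i: "i \<in> Basis"
  shows "1 - Re (Eps \<epsilon> t (r *\<^sub>R i)) \<le> (2 + C0) * min 1 r"
proof (cases "r \<le> 1")
  case True
  have "1 - Re (Eps \<epsilon> t (r *\<^sub>R i)) \<le> cmod (1 - Eps \<epsilon> t (r *\<^sub>R i))"
    using complex_Re_le_cmod[of "1 - Eps \<epsilon> t (r *\<^sub>R i)"] by simp
  also have "\<dots> \<le> cmod (of_real (lam \<epsilon>) * At t (\<epsilon> *\<^sub>R r *\<^sub>R i))"
    unfolding Eps_def by (rule one_minus_exp_le) (simp add: At_Re)
  also have "\<dots> \<le> lam \<epsilon> * ((2 + C0) * norm (\<epsilon> *\<^sub>R r *\<^sub>R i) powr (2 * s))"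
    unfolding norm_mult by (intro mult_mono At_le) auto
  also have "\<dots> = (2 + C0) * (lam \<epsilon> * norm (\<epsilon> *\<^sub>R r *\<^sub>R i) powr (2 * s))"
    by (rule mult.left_commute)
  also have "\<dots> = (2 + C0) * r powr (2 * s)"
    unfolding lam_scale[OF e] using r i by simp
  also have "\<dots> \<le> (2 + C0) * r powr 1"
    using True r s C0 by (intro mult_left_mono powr_mono') auto
  finally show ?thesis using True r by simp
next
  case False
  have "1 - Re (Eps \<epsilon> t (r *\<^sub>R i)) \<le> 2"
    using abs_Re_le_cmod[of "Eps \<epsilon> t (r *\<^sub>R i)"] Eps_le[of \<epsilon> t "r *\<^sub>R i"] by linarith
  then show ?thesis using False C0 by simp
qed

lemma Eps_lim: "((\<lambda>t. Eps \<epsilon> t \<xi>) \<longlongrightarrow> Feps \<epsilon> \<xi>) at_top"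
proof -
  let ?\<eta> = "\<epsilon> *\<^sub>R \<xi>"
  have "((\<lambda>t. exp (-t) *\<^sub>R ?\<eta>) \<longlongrightarrow> 0 *\<^sub>R ?\<eta>) at_top"
    by (intro tendsto_intros filterlim_compose[OF exp_at_bot] filterlim_uminus_at_bot_at_top)
  then have "((\<lambda>t. AA (exp (-t) *\<^sub>R ?\<eta>)) \<longlongrightarrow> AA (0 *\<^sub>R ?\<eta>)) at_top"
    by (intro continuous_on_tendsto_compose[OF AA_cont]) auto
  moreover have "AA 0 = 0" using AA_le[of 0] by simp
  ultimately have "((\<lambda>t. AA ?\<eta> - AA (exp (-t) *\<^sub>R ?\<eta>)) \<longlongrightarrow> AA ?\<eta> - 0) at_top"
    by (intro tendsto_intros) simp
  moreover have "eventually (\<lambda>t. AA ?\<eta> - AA (exp (-t) *\<^sub>R ?\<eta>) = At t ?\<eta>) at_top"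
    using eventually_ge_at_top[of 0] by eventually_elim (simp add: AA_split[of _ ?\<eta>])
  ultimately have "((\<lambda>t. At t ?\<eta>) \<longlongrightarrow> AA ?\<eta>) at_top"
    by (simp add: tendsto_cong)
  then show ?thesis unfolding Eps_def Feps_def by (intro tendsto_intros)
qed

lemma Feps_gp:
  assumes "0 < \<epsilon>" shows "gp (Feps \<epsilon>)" "continuous_on UNIV (Feps \<epsilon>)"
proof -
  show "gp (Feps \<epsilon>)"
  proof (rule gp_limit)
    show "gp (Eps \<epsilon> (real n))" for n using Eps_gp assms by simp
    show "(\<lambda>n. Eps \<epsilon> (real n) \<xi>) \<longlonglongrightarrow> Feps \<epsilon> \<xi>" for \<xi>
      by (rule filterlim_compose[OF Eps_lim filterlim_real_sequentially])
  qed (rule Eps_le)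
  show "continuous_on UNIV (Feps \<epsilon>)"
    unfolding Feps_def[abs_def]
    by (intro continuous_intros continuous_on_compose2[OF AA_cont]) auto
qed

lemma Feps_stationary: "0 \<le> t \<Longrightarrow> Feps \<epsilon> \<xi> = Feps \<epsilon> (exp (-t) *\<^sub>R \<xi>) * Eps \<epsilon> t \<xi>"
  unfolding Feps_def Eps_def
  by (subst AA_split[of t "\<epsilon> *\<^sub>R \<xi>"]) (simp_all add: exp_add[symmetric] algebra_simps)

text \<open>With probability \<open>1 - exp (- \<lambda> r)\<close> there is a jump before time \<open>r\<close>, and a jump has a density.\<close>

lemma Eps_dec:
  assumes e: "0 < \<epsilon>" and kp: "0 < \<kappa>"
  shows "\<exists>h b T. integrable lborel h \<and> 0 \<le> b \<and> (\<forall>t\<ge>T. \<exists>\<rho>1 \<rho>2. gp \<rho>1 \<and> continuous_on UNIV \<rho>1 \<and>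
       gp \<rho>2 \<and> continuous_on UNIV \<rho>2 \<and> Re (\<rho>1 0) \<le> \<kappa> \<and> Re (\<rho>2 0) \<le> b \<and> (\<forall>\<xi>. Eps \<epsilon> t \<xi> = \<rho>1 \<xi> + fourier h \<xi> * \<rho>2 \<xi>))"
proof -
  have l: "0 < lam \<epsilon>" using e by simp
  \<comment> \<open>Waiting time after which the atom exp (- lam r) is at most \<kappa>; the maximum
    with 0 covers \<kappa> > 1.\<close>
  define r where "r = max 0 (ln (1 / \<kappa>) / lam \<epsilon>)"
  have r: "0 \<le> r" "exp (- lam \<epsilon> * r) \<le> \<kappa>"
  proof -
    show "0 \<le> r" by (simp add: r_def)
    have "ln (1 / \<kappa>) \<le> lam \<epsilon> * r" using l by (simp add: r_def max_def field_simps)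
    then have "exp (- lam \<epsilon> * r) \<le> exp (- ln (1 / \<kappa>))" by simp
    also have "\<dots> = \<kappa>" using kp by (simp add: ln_div)
    finally show "exp (- lam \<epsilon> * r) \<le> \<kappa>" .
  qed
  let ?h = "hk j \<epsilon> 0 r"
  note h = hk_props(1,2)[OF j e, of 0 r]
  define c where "c = exp (- lam \<epsilon> * r)"
  \<comment> \<open>For t >= r the value of the second multiplier at 0 does not depend on t, since
    \<open>Ew\<close> equals 1 there; the absolute value only secures
    \<open>0 \<le> b\<close>.\<close>
  define b where "b = \<bar>Re (of_real (c * lam \<epsilon>) * EE (of_real (lam \<epsilon>) * fourier ?h 0))\<bar>"
  have "\<exists>\<rho>1 \<rho>2. gp \<rho>1 \<and> continuous_on UNIV \<rho>1 \<and> gp \<rho>2 \<and> continuous_on UNIV \<rho>2 \<and> Re (\<rho>1 0) \<le> \<kappa> \<and> Re (\<rho>2 0) \<le> b \<and>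
     (\<forall>\<xi>. Eps \<epsilon> t \<xi> = \<rho>1 \<xi> + fourier ?h \<xi> * \<rho>2 \<xi>)" if t: "t \<ge> r" for t
  proof (intro exI conjI allI)
    let ?\<rho>1 = "\<lambda>\<xi>. of_real c * Ew \<epsilon> r t \<xi>"
    let ?\<rho>2 = "\<lambda>\<xi>. of_real (c * lam \<epsilon>) * (Ew \<epsilon> r t \<xi> * EE (of_real (lam \<epsilon>) * fourier ?h \<xi>))"
    have c: "0 \<le> c" "0 \<le> c * lam \<epsilon>" using l by (auto simp: c_def)
    show "gp ?\<rho>1" by (intro gp_scale Ew_gp e c)
    show "continuous_on UNIV ?\<rho>1" by (intro continuous_intros Ew_gp e)
    show "gp ?\<rho>2" by (intro gp_scale gp_EE Ew_gp e c h) simp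
    show "continuous_on UNIV ?\<rho>2"
    proof -
      have "continuous_on UNIV EE" by (simp add: continuous_at_imp_continuous_on EE_cont)
      moreover have "continuous_on UNIV (\<lambda>\<xi>. of_real (lam \<epsilon>) * fourier ?h \<xi>)"
        by (intro continuous_on_mult continuous_on_const continuous_fourier h(1))
      ultimately have "continuous_on UNIV (\<lambda>\<xi>. EE (of_real (lam \<epsilon>) * fourier ?h \<xi>))"
        by (rule continuous_on_compose2) simp
      then show ?thesis by (intro continuous_on_mult continuous_on_const Ew_gp(2)[OF e])
    qed
    show "Re (?\<rho>1 0) \<le> \<kappa>" using r t e by (simp add: Ew_0 c_def)
    show "Re (?\<rho>2 0) \<le> b" unfolding b_def using r t e by (simp add: Ew_0 del: fourier_0)
    fix \<xi>
    have "Eps \<epsilon> t \<xi> = exp (of_real (- lam \<epsilon> * r)) * (Ew \<epsilon> r t \<xi> * exp (of_real (lam \<epsilon>) * fourier ?h \<xi>))"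
    proof -
      have i: "integrable lborel (\<lambda>\<tau>. indicator S \<tau> *\<^sub>R a (exp (-\<tau>) *\<^sub>R (\<epsilon> *\<^sub>R \<xi>)))" if "S \<in> sets borel" "S \<subseteq> {0..}" for S
        by (rule a_integrable[OF that])
      have "At t (\<epsilon> *\<^sub>R \<xi>) = (LINT \<tau>|lborel. indicator {0..r} \<tau> *\<^sub>R a (exp (-\<tau>) *\<^sub>R (\<epsilon> *\<^sub>R \<xi>)) + indicator {r..t} \<tau> *\<^sub>R a (exp (-\<tau>) *\<^sub>R (\<epsilon> *\<^sub>R \<xi>)))"
        unfolding At_def
      proof (rule integral_cong_AE)
        have "AE \<tau> in lborel. \<tau> \<noteq> r" by (rule AE_lborel_singleton)
        then show "AE \<tau> in lborel. indicator {0..t} \<tau> *\<^sub>R a (exp (-\<tau>) *\<^sub>R (\<epsilon> *\<^sub>R \<xi>)) =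
          indicator {0..r} \<tau> *\<^sub>R a (exp (-\<tau>) *\<^sub>R (\<epsilon> *\<^sub>R \<xi>)) + indicator {r..t} \<tau> *\<^sub>R a (exp (-\<tau>) *\<^sub>R (\<epsilon> *\<^sub>R \<xi>))"
          by eventually_elim (use r t in \<open>auto simp: indicator_def\<close>)
      qed measurable
      also have "\<dots> = (LINT \<tau>|lborel. indicator {0..r} \<tau> *\<^sub>R a (exp (-\<tau>) *\<^sub>R (\<epsilon> *\<^sub>R \<xi>))) + (LINT \<tau>|lborel. indicator {r..t} \<tau> *\<^sub>R a (exp (-\<tau>) *\<^sub>R (\<epsilon> *\<^sub>R \<xi>)))"
        by (intro Bochner_Integration.integral_add i) (use r in auto)
      also have "\<dots> = (of_real (r - 0) - fourier ?h \<xi>) + (of_real (t - r) - fourier (hk j \<epsilon> r t) \<xi>)"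
        using At_eq_hk[OF e order_refl r(1), of \<xi>] At_eq_hk[OF e r(1) t, of \<xi>] by simp
      finally have At: "At t (\<epsilon> *\<^sub>R \<xi>) = (of_real (r - 0) - fourier ?h \<xi>) + (of_real (t - r) - fourier (hk j \<epsilon> r t) \<xi>)" .
      show ?thesis unfolding Eps_def At Ew_def exp_add[symmetric] by (simp add: algebra_simps)
    qed
    also have "exp (of_real (lam \<epsilon>) * fourier ?h \<xi>) = 1 + of_real (lam \<epsilon>) * fourier ?h \<xi> * EE (of_real (lam \<epsilon>) * fourier ?h \<xi>)"
      by (rule exp_EE)
    finally show "Eps \<epsilon> t \<xi> = ?\<rho>1 \<xi> + fourier ?h \<xi> * ?\<rho>2 \<xi>"
      unfolding exp_of_real c_def[symmetric] by (simp add: algebra_simps)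
  qed
  moreover have "0 \<le> b" by (simp add: b_def)
  ultimately show ?thesis using h(1) by blast
qed

section \<open>The stable semigroup\<close>

definition St :: "real \<Rightarrow> 'a \<Rightarrow> complex" where
  "St c \<xi> = of_real (exp (- (c * norm \<xi> powr (2 * s))))"

lemma St_cont: "continuous_on UNIV (St c)"
  unfolding St_def[abs_def] using s by (intro continuous_intros continuous_on_powr') auto

text \<open>Positivity of the stable density comes from approximation by the rescaled kernels themselves.\<close>

lemma St_gp:
  assumes c: "0 \<le> c" shows "gp (St c)"
proof (rule gp_limit)
  let ?e = "\<lambda>n. inverse (real (Suc n))"
  let ?X = "\<lambda>n \<xi>. of_real (exp (- (c * lam (?e n)))) * (1 * exp (of_real (c * lam (?e n)) * fourier (dil (?e n) j) \<xi>))"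
  have e: "0 < ?e n" for n by simp
  have X: "?X n \<xi> = exp (- (of_real (c * lam (?e n)) * a (?e n *\<^sub>R \<xi>)))" for n \<xi>
    unfolding dil_props(2)[OF j_int(1) e] a_def by (simp add: exp_add[symmetric] exp_of_real[symmetric] algebra_simps)
  show "gp (?X n)" for n
    using c by (intro gp_scale gp_exp gp_const dil_props(1)[OF j_int(1) e] dil_nonneg e j_int) auto
  show "cmod (?X n \<xi>) \<le> 1" for n \<xi>
    unfolding X using a_Re[of "?e n *\<^sub>R \<xi>"] c by simp
  show "(\<lambda>n. ?X n \<xi>) \<longlonglongrightarrow> St c \<xi>" for \<xi>
  proof -
    \<comment> \<open>The expansion at the origin, rescaled: its remainder carries the factor
      \<open>?e n powr \<delta>\<close>, which tends to 0.\<close>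
    have "(\<lambda>n. of_real (lam (?e n)) * a (?e n *\<^sub>R \<xi>) - of_real (norm \<xi> powr (2 * s))) \<longlonglongrightarrow> 0"
    proof (rule Lim_null_comparison)
      have "(\<lambda>n. ?e n * norm \<xi>) \<longlonglongrightarrow> 0" using tendsto_mult_left_zero[OF LIMSEQ_inverse_real_of_nat] .
      then have "eventually (\<lambda>n. ?e n * norm \<xi> < 1) sequentially" by (rule order_tendstoD) simp
      then show "eventually (\<lambda>n. norm (of_real (lam (?e n)) * a (?e n *\<^sub>R \<xi>) - of_real (norm \<xi> powr (2 * s))) \<le> C0 * norm \<xi> powr (2 * s + \<delta>) * ?e n powr \<delta>) sequentially"
      proof eventually_elim
        fix n assume n: "?e n * norm \<xi> < 1"
        have "norm (of_real (lam (?e n)) * a (?e n *\<^sub>R \<xi>) - of_real (norm \<xi> powr (2 * s)))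
          = norm (of_real (lam (?e n)) * (a (?e n *\<^sub>R \<xi>) - of_real (norm (?e n *\<^sub>R \<xi>) powr (2 * s))))"
          unfolding right_diff_distrib of_real_mult[symmetric] lam_scale[OF e] ..
        also have "\<dots> \<le> lam (?e n) * (C0 * norm (?e n *\<^sub>R \<xi>) powr (2 * s + \<delta>))"
          unfolding norm_mult using a_near[of "?e n *\<^sub>R \<xi>"] n by (simp add: mult_left_mono)
        also have "\<dots> = C0 * norm \<xi> powr (2 * s + \<delta>) * ?e n powr \<delta>"
        proof -
          have "lam (?e n) * ?e n powr (2 * s + \<delta>) = ?e n powr \<delta>" unfolding powr_add[symmetric] by simp
          then have "lam (?e n) * (?e n * norm \<xi>) powr (2 * s + \<delta>) = norm \<xi> powr (2 * s + \<delta>) * ?e n powr \<delta>"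
            unfolding powr_mult by (metis mult.assoc mult.commute)
          then show ?thesis by (simp add: mult.left_commute)
        qed
        finally show "norm (of_real (lam (?e n)) * a (?e n *\<^sub>R \<xi>) - of_real (norm \<xi> powr (2 * s))) \<le> C0 * norm \<xi> powr (2 * s + \<delta>) * ?e n powr \<delta>" .
      qed
      have "(\<lambda>n. ?e n powr \<delta>) \<longlonglongrightarrow> 0 powr \<delta>"
        using \<delta> by (intro tendsto_powr' LIMSEQ_inverse_real_of_nat tendsto_const) auto
      then show "(\<lambda>n. C0 * norm \<xi> powr (2 * s + \<delta>) * ?e n powr \<delta>) \<longlonglongrightarrow> 0"
        using \<delta> by (intro tendsto_mult_right_zero) simp
    qed
    then have "(\<lambda>n. of_real (lam (?e n)) * a (?e n *\<^sub>R \<xi>)) \<longlonglongrightarrow> of_real (norm \<xi> powr (2 * s))" by (rule LIM_zero_cancel)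
    then have "(\<lambda>n. exp (- (of_real c * (of_real (lam (?e n)) * a (?e n *\<^sub>R \<xi>))))) \<longlonglongrightarrow> exp (- (of_real c * of_real (norm \<xi> powr (2 * s))))"
      by (intro tendsto_intros)
    then show ?thesis unfolding X St_def by (simp add: mult.assoc exp_of_real[symmetric])
  qed
qed

end

section \<open>Comparison of the stationary characteristic functions\<close>

lemma integral_lborel_of_has_integral:
  fixes f :: "real \<Rightarrow> real"
  assumes [measurable]: "f \<in> borel_measurable borel" "S \<in> sets borel" and nn: "\<And>x. x \<in> S \<Longrightarrow> 0 \<le> f x"
    and h: "(f has_integral I) S"
  shows "(LINT x|lborel. indicator S x * f x) = I"
proof -
  have i: "integrable lborel (\<lambda>x. indicator S x * f x)"
    by (rule integrable_lborel_of_has_integral[OF assms])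
  have "((\<lambda>x. if x \<in> S then f x else 0) has_integral I) UNIV"
    using h by (simp add: has_integral_restrict_UNIV)
  moreover have "(\<lambda>x. if x \<in> S then f x else 0) = (\<lambda>x. indicator S x * f x)" by (auto simp: indicator_def)
  ultimately have "((\<lambda>x. indicator S x * f x) has_integral I) UNIV" by simp
  then show ?thesis using has_integral_integral_lborel[OF i] has_integral_unique by blast
qed

text \<open>A pointwise bound by a multiple of \<open>wt\<close> yields integrability and square
  integrability at once; decay of order 2 d is enough in every dimension d.\<close>

definition wt :: "'a::euclidean_space \<Rightarrow> real" where
  "wt \<xi> = 1 / (1 + (norm \<xi>)\<^sup>2) ^ DIM('a)"

lemma wt_pos: "0 < wt \<xi>" and wt_nonneg: "0 \<le> wt \<xi>" and wt_le_1: "wt \<xi> \<le> 1"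
proof -
  have "1 \<le> (1 + (norm \<xi>)\<^sup>2) ^ DIM('a)" by (intro one_le_power) simp
  moreover from this have "0 < (1 + (norm \<xi>)\<^sup>2) ^ DIM('a)" by linarith
  ultimately show "0 < wt \<xi>" "0 \<le> wt \<xi>" "wt \<xi> \<le> 1"
    unfolding wt_def by (simp_all only: zero_less_divide_1_iff less_imp_le divide_le_eq_1_pos)
qed

lemma integrable_inverse_quad: "integrable lborel (\<lambda>t::real. 1 / (1 + t\<^sup>2))"
proof (rule Bochner_Integration.integrable_bound)
  have i: "integrable lborel (\<lambda>t::real. indicator {1..} t * t powr (-2))"
    by (rule integrable_lborel_of_has_integral[OF _ _ _ has_integral_powr_to_inf]) auto
  show "integrable lborel (\<lambda>t::real. indicator {-1..1} t + (indicator {1..} t * t powr (-2) + indicator {1..} (0 + (-1) * t) * (0 + (-1) * t) powr (-2)))"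
    by (intro Bochner_Integration.integrable_add i lborel_integrable_real_affine integrable_real_indicator) auto
  show "AE t::real in lborel. norm (1 / (1 + t\<^sup>2)) \<le> norm (indicator {-1..1} t + (indicator {1..} t * t powr (-2) + indicator {1..} (0 + (-1) * t) * (0 + (-1) * t) powr (-2)))"
  proof (rule AE_I2)
    fix t :: real
    have p: "u powr (-2) = 1 / u\<^sup>2" if "1 \<le> u" for u :: real
      using that powr_realpow[of u 2] by (simp add: powr_minus inverse_eq_divide)
    consider "\<bar>t\<bar> \<le> 1" | "1 < t" | "t < -1" by linarith
    then show "norm (1 / (1 + t\<^sup>2)) \<le> norm (indicator {-1..1} t + (indicator {1..} t * t powr (-2) + indicator {1..} (0 + (-1) * t) * (0 + (-1) * t) powr (-2)))"
    proof cases
      case 1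
      have "0 < 1 + t\<^sup>2" by (rule add_pos_nonneg) auto
      then have "1 / (1 + t\<^sup>2) \<le> 1" by (simp only: divide_le_eq_1_pos) simp
      moreover have "1 \<le> indicator {-1..1} t + (indicator {1..} t * t powr (-2) + indicator {1..} (0 + (-1) * t) * (0 + (-1) * t) powr (-2))"
        using 1 by (auto simp: indicator_def)
      ultimately show ?thesis by simp
    next
      case 2
      then have "1 / (1 + t\<^sup>2) \<le> 1 / t\<^sup>2" by (intro divide_left_mono) (auto intro!: mult_pos_pos add_pos_nonneg)
      then show ?thesis using 2 p[of t] by (simp add: indicator_def)
    next
      case 3
      then have "1 / (1 + t\<^sup>2) \<le> 1 / t\<^sup>2" by (intro divide_left_mono) (auto intro!: mult_pos_pos add_pos_nonneg zero_less_power2[THEN iffD2])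
      then show ?thesis using 3 p[of "-t"] by (simp add: indicator_def)
    qed
  qed
qed simp

text \<open>(1 + |\<xi>|^2)^d dominates the product over the coordinates of 1 plus the squared
  coordinate, so \<open>wt\<close> is bounded by a product of integrable functions of one
  variable.\<close>

lemma wt_integrable: "integrable lborel (wt :: 'a::euclidean_space \<Rightarrow> real)"
proof (rule Bochner_Integration.integrable_bound)
  show "integrable lborel (\<lambda>\<xi>::'a. \<Prod>b\<in>Basis. 1 / (1 + (\<xi> \<bullet> b)\<^sup>2))"
    by (rule integrable_lborel_prod[OF integrable_inverse_quad])
  show "AE \<xi>::'a in lborel. norm (wt \<xi>) \<le> norm (\<Prod>b\<in>Basis. 1 / (1 + (\<xi> \<bullet> b)\<^sup>2))"
  proof (rule AE_I2)
    fix \<xi> :: 'a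
    have "(\<Prod>b\<in>Basis. 1 + (\<xi> \<bullet> b)\<^sup>2) \<le> (\<Prod>b\<in>(Basis::'a set). 1 + (norm \<xi>)\<^sup>2)"
    proof (rule prod_mono)
      fix b :: 'a assume "b \<in> Basis"
      then have "(\<xi> \<bullet> b)\<^sup>2 \<le> (norm \<xi>)\<^sup>2" using Basis_le_norm[of b \<xi>] by (simp add: abs_le_square_iff[symmetric])
      then show "0 \<le> 1 + (\<xi> \<bullet> b)\<^sup>2 \<and> 1 + (\<xi> \<bullet> b)\<^sup>2 \<le> 1 + (norm \<xi>)\<^sup>2" by simp
    qed
    moreover have "0 < (\<Prod>b\<in>Basis. 1 + (\<xi> \<bullet> b)\<^sup>2)" by (intro prod_pos) (auto intro: add_pos_nonneg)
    ultimately have "wt \<xi> \<le> 1 / (\<Prod>b\<in>Basis. 1 + (\<xi> \<bullet> b)\<^sup>2)"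
      unfolding wt_def by (intro divide_left_mono) (auto intro!: mult_pos_pos zero_less_power add_pos_nonneg)
    also have "\<dots> = (\<Prod>b\<in>Basis. 1 / (1 + (\<xi> \<bullet> b)\<^sup>2))" by (simp add: prod_dividef)
    finally show "norm (wt \<xi>) \<le> norm (\<Prod>b\<in>Basis. 1 / (1 + (\<xi> \<bullet> b)\<^sup>2))"
      using wt_nonneg[of \<xi>] by simp
  qed
qed (simp add: wt_def[abs_def])

text \<open>Follows from (1 + y / M)^M <= exp y, where M exceeds the total degree n + 2 d of a
  polynomial in 1 + x that bounds the two growing factors.\<close>

lemma powr_exp_bound:
  fixes N :: real
  assumes N: "0 \<le> N"
  shows "\<exists>C>0. \<forall>x\<ge>0. x powr N * exp (- x / 4) * (1 + x\<^sup>2) ^ d \<le> C"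
proof -
  define n where "n = nat \<lceil>N\<rceil>"
  define M where "M = n + 2 * d + 1"
  have M: "0 < M" by (simp add: M_def)
  have "x powr N * exp (- x / 4) * (1 + x\<^sup>2) ^ d \<le> (4 * real M) ^ M" if x: "0 \<le> x" for x
  proof -
    have "x powr N \<le> (1 + x) powr N" using x N by (intro powr_mono2) auto
    also have "\<dots> \<le> (1 + x) powr real n" using x by (intro powr_mono) (auto simp: n_def real_nat_ceiling_ge)
    also have "\<dots> = (1 + x) ^ n" using x by (simp add: powr_realpow)
    finally have 1: "x powr N \<le> (1 + x) ^ n" .
    have "(1 + x\<^sup>2) ^ d \<le> ((1 + x)\<^sup>2) ^ d" using x by (intro power_mono) (auto simp: power2_eq_square algebra_simps)
    then have 2: "(1 + x\<^sup>2) ^ d \<le> (1 + x) ^ (2 * d)" by (simp add: power_mult)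
    have "1 + x \<le> 4 * real M * (1 + (x / 4) / real M)" using M x by (simp add: field_simps)
    then have "(1 + x) ^ M \<le> (4 * real M * (1 + (x / 4) / real M)) ^ M" using x by (intro power_mono) auto
    also have "\<dots> = (4 * real M) ^ M * (1 + (x / 4) / real M) ^ M" by (rule power_mult_distrib)
    also have "\<dots> \<le> (4 * real M) ^ M * exp (x / 4)"
      using exp_ge_one_plus_x_over_n_power_n[of M "x / 4"] M x by (intro mult_left_mono) auto
    finally have 3: "(1 + x) ^ M \<le> (4 * real M) ^ M * exp (x / 4)" .
    have "x powr N * exp (- x / 4) * (1 + x\<^sup>2) ^ d = exp (- x / 4) * (x powr N * (1 + x\<^sup>2) ^ d)" by (simp add: mult_ac)
    also have "\<dots> \<le> exp (- x / 4) * ((1 + x) ^ n * (1 + x) ^ (2 * d))"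
      using x by (intro mult_left_mono mult_mono 1 2) auto
    also have "(1 + x) ^ n * (1 + x) ^ (2 * d) \<le> (1 + x) ^ M"
      using x unfolding power_add[symmetric] M_def by (intro power_increasing) auto
    also note 3
    finally show ?thesis using x by (simp add: mult_left_mono exp_minus field_simps)
  qed
  then show ?thesis using M by (intro exI[of _ "(4 * real M) ^ M"]) auto
qed

text \<open>Replaces the exponent 2 s by 1, uniformly in s; the factor 2 covers y < 1, where exp (-
  y / 4) exceeds 1 / 2.\<close>

lemma exp_powr_le:
  fixes y p :: real
  assumes "0 \<le> y" "1 \<le> p" shows "exp (- (y powr p / 4)) \<le> 2 * exp (- y / 4)"
proof (cases "1 \<le> y")
  case True
  have "y powr 1 \<le> y powr p" by (rule powr_mono[OF assms(2) True])
  then have "exp (- (y powr p / 4)) \<le> exp (- y / 4)" using assms by simp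
  then show ?thesis by (smt (verit) exp_gt_zero)
next
  case False
  have "1 + (- y / 4) \<le> exp (- y / 4)" by (rule exp_ge_add_one_self)
  moreover have "exp (- (y powr p / 4)) \<le> 1" by simp
  ultimately show ?thesis using False by linarith
qed

section \<open>Lower bounds for the accumulated exponent, uniform in s\<close>

context kern
begin

lemma Re_AA: "Re (AA \<eta>) = (LINT \<tau>|lborel. indicator {0..} \<tau> * Re (a (exp (-\<tau>) *\<^sub>R \<eta>)))"
  unfolding AA_def by (subst integral_Re[symmetric]) (auto intro!: a_integrable)

lemma Re_a_integrable:
  assumes "S \<in> sets borel" "S \<subseteq> {0..}"
  shows "integrable lborel (\<lambda>\<tau>. indicator S \<tau> * Re (a (exp (-\<tau>) *\<^sub>R \<eta>)))"
  using integrable_Re[OF a_integrable[OF assms, of \<eta>]] by simp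

lemma norm_exp_powr: "norm (exp (-\<tau>) *\<^sub>R \<eta>) powr p = norm \<eta> powr p * exp (- p * \<tau>)"
  by (simp add: powr_mult exp_powr_real mult.commute)

lemma AA_lower_near:
  assumes "norm \<eta> \<le> r0 \<delta> C0"
  shows "norm \<eta> powr (2 * s) / 4 \<le> Re (AA \<eta>)"
proof -
  have "norm \<eta> powr (2 * s) / 4 \<le> (norm \<eta> powr (2 * s) / 2) * (1 / (2 * s))"
  proof -
    have "1 / 2 \<le> 1 / (2 * s)" using s by (simp add: field_simps)
    from mult_left_mono[OF this, of "norm \<eta> powr (2 * s) / 2"] show ?thesis by simp
  qed
  also have "\<dots> = (LINT \<tau>|lborel. (norm \<eta> powr (2 * s) / 2) * (indicator {0..} \<tau> * exp (- (2 * s) * \<tau>)))"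
    using s by (subst integral_mult_right_zero, subst integral_exp_Ici(2)) auto
  also have "\<dots> \<le> Re (AA \<eta>)"
    unfolding Re_AA
  proof (rule integral_mono)
    show "integrable lborel (\<lambda>\<tau>. (norm \<eta> powr (2 * s) / 2) * (indicator {0..} \<tau> * exp (- (2 * s) * \<tau>)))"
      using s by (intro integrable_mult_right integral_exp_Ici(1)) simp
    show "integrable lborel (\<lambda>\<tau>. indicator {0..} \<tau> * Re (a (exp (-\<tau>) *\<^sub>R \<eta>)))"
      by (rule Re_a_integrable) auto
    fix \<tau> :: real
    show "(norm \<eta> powr (2 * s) / 2) * (indicator {0..} \<tau> * exp (- (2 * s) * \<tau>)) \<le> indicator {0..} \<tau> * Re (a (exp (-\<tau>) *\<^sub>R \<eta>))"
    proof (cases "0 \<le> \<tau>")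
      case True
      have "norm (exp (-\<tau>) *\<^sub>R \<eta>) \<le> 1 * norm \<eta>" using True by (simp add: mult_left_le_one_le)
      then have "norm (exp (-\<tau>) *\<^sub>R \<eta>) \<le> r0 \<delta> C0" using assms by linarith
      from a_lower[OF this] show ?thesis unfolding norm_exp_powr using True by simp
    qed simp
  qed
  finally show ?thesis .
qed

lemma AA_mono: "0 \<le> t \<Longrightarrow> Re (AA (exp (-t) *\<^sub>R \<eta>)) \<le> Re (AA \<eta>)"
  using AA_split[of t \<eta>] At_Re[of t \<eta>] by simp

text \<open>Since \<open>AA\<close> is nondecreasing along rays, the bound on the sphere of radius
  \<open>r0 \<delta> C0\<close> propagates outwards; r^(2 s) >= r^2 for r <= 1 removes s.\<close>

lemma AA_lower_const:
  assumes "r0 \<delta> C0 \<le> norm \<eta>"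
  shows "(r0 \<delta> C0)\<^sup>2 / 4 \<le> Re (AA \<eta>)"
proof -
  let ?r = "r0 \<delta> C0"
  have r: "0 < ?r" "?r \<le> 1" using r0_props[OF \<delta> C0] by auto
  define t where "t = ln (norm \<eta> / ?r)"
  have t: "0 \<le> t" using assms r by (simp add: t_def)
  have "0 < norm \<eta> / ?r" using assms r by (intro divide_pos_pos) auto
  moreover have "\<eta> \<noteq> 0" using assms r by auto
  ultimately have n: "norm (exp (-t) *\<^sub>R \<eta>) = ?r" using r by (simp add: t_def exp_minus)
  have "?r\<^sup>2 = ?r powr 2" using r by simp
  also have "\<dots> \<le> ?r powr (2 * s)" using r s by (intro powr_mono') auto
  finally have "?r\<^sup>2 / 4 \<le> norm (exp (-t) *\<^sub>R \<eta>) powr (2 * s) / 4" unfolding n by simp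
  also have "\<dots> \<le> Re (AA (exp (-t) *\<^sub>R \<eta>))" by (rule AA_lower_near) (simp only: n order_refl)
  also have "\<dots> \<le> Re (AA \<eta>)" by (rule AA_mono[OF t])
  finally show ?thesis .
qed

text \<open>If |z| >= l / 2 >= 6, the integral of 1 - cos over the dyadic range of exp (-\<tau>) z
  is at least 1 / 6, while the left side is at most 2 / 12. If |z| < l / 2, then 1 - cos (r z / l)
  <= r^2 / 8 and the left side is negative. The subtracted r^2 / 4 thus pays for the jumps too small
  to be seen at this frequency.\<close>

lemma cos_average_lower:
  fixes z r l :: real
  assumes l: "12 \<le> l" and r: "0 < r" "r \<le> 1"
  shows "(1 - cos (r * (z / l)) - r\<^sup>2 / 4) / 12 \<le> (LINT \<tau>|lborel. indicator {0..ln 2} \<tau> * (1 - cos (exp (-\<tau>) * z)))"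
    (is "_ \<le> ?D")
proof -
  have D0: "0 \<le> ?D" by (intro integral_nonneg_AE AE_I2) simp
  show ?thesis
  proof (cases "l \<le> 2 * \<bar>z\<bar>")
    case False
    have "\<bar>r * (z / l)\<bar> \<le> r * (1 / 2)" using False l r by (simp add: abs_mult mult_left_mono field_simps)
    then have "(r * (z / l))\<^sup>2 \<le> (r * (1 / 2))\<^sup>2" using r by (simp add: abs_le_square_iff[symmetric])
    moreover have cosq: "1 - cos t \<le> t\<^sup>2 / 2" for t :: real
    proof -
      have "1 - cos t = 2 * (sin (t/2))\<^sup>2" using cos_double_sin[of "t/2"] by simp
      also have "\<dots> \<le> 2 * (t/2)\<^sup>2" using abs_sin_x_le_abs_x[of "t/2"] by (simp only: abs_le_square_iff[symmetric] mult_left_mono)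
      finally show ?thesis by (simp add: power_divide)
    qed
    moreover from cosq[of "r * (z / l)"] have "1 - cos (r * (z / l)) \<le> (r * (z / l))\<^sup>2 / 2" .
    moreover have "(r * (1 / 2))\<^sup>2 = r\<^sup>2 / 4" by (simp add: power_divide)
    ultimately have "1 - cos (r * (z / l)) \<le> r\<^sup>2 / 8" by argo
    moreover have "0 \<le> r\<^sup>2" by simp
    ultimately show ?thesis using D0 by argo
  next
    case True
    then have z: "6 \<le> \<bar>z\<bar>" using l by linarith
    then have z0: "z \<noteq> 0" by auto
    \<comment> \<open>The extra factor exp (-\<tau>) <= 1 makes the integrand an exact
      derivative.\<close>
    let ?f = "\<lambda>\<tau>. (1 - cos (exp (-\<tau>) * z)) * exp (-\<tau>)"
    let ?P = "\<lambda>\<tau>. - exp (-\<tau>) + sin (exp (-\<tau>) * z) / z"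
    have "(?f has_integral (?P (ln 2) - ?P 0)) {0..ln 2}"
    proof (rule fundamental_theorem_of_calculus)
      show "(?P has_vector_derivative ?f \<tau>) (at \<tau> within {0..ln 2})" for \<tau>
        unfolding has_real_derivative_iff_has_vector_derivative[symmetric]
        using z0 by (auto intro!: derivative_eq_intros simp: field_simps)
    qed simp
    then have v: "(LINT \<tau>|lborel. indicator {0..ln 2} \<tau> * ?f \<tau>) = ?P (ln 2) - ?P 0" and vi: "integrable lborel (\<lambda>\<tau>. indicator {0..ln 2} \<tau> * ?f \<tau>)"
      using integral_lborel_of_has_integral[of ?f "{0..ln 2}"] integrable_lborel_of_has_integral[of ?f "{0..ln 2}"] by auto
    have "(sin z - sin (z / 2)) / z \<le> 2 / \<bar>z\<bar>"
    proof -
      have "\<bar>(sin z - sin (z / 2)) / z\<bar> \<le> 2 / \<bar>z\<bar>"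
        unfolding abs_divide using abs_sin_le_one[of z] abs_sin_le_one[of "z / 2"] by (intro divide_right_mono) linarith+
      then show ?thesis by linarith
    qed
    also have "\<dots> \<le> 1 / 3" using z by (simp add: field_simps)
    finally have s3: "(sin z - sin (z / 2)) / z \<le> 1 / 3" .
    have "?P (ln 2) - ?P 0 = 1 / 2 - (sin z - sin (z / 2)) / z" by (simp add: exp_minus diff_divide_distrib)
    then have "1 / 6 \<le> ?P (ln 2) - ?P 0" using s3 by linarith
    also have "\<dots> = (LINT \<tau>|lborel. indicator {0..ln 2} \<tau> * ?f \<tau>)" by (rule v[symmetric])
    also have "\<dots> \<le> ?D"
    proof (rule integral_mono[OF vi])
      show "integrable lborel (\<lambda>\<tau>. indicator {0..ln 2} \<tau> * (1 - cos (exp (-\<tau>) * z)))"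
      proof (rule Bochner_Integration.integrable_bound[of _ "\<lambda>\<tau>. indicator {0..ln 2} \<tau> * (2::real)"])
        show "integrable lborel (\<lambda>\<tau>::real. indicator {0..ln 2} \<tau> * (2::real))"
          by (intro integrable_mult_left integrable_real_indicator) (auto simp: emeasure_lborel_Icc_eq)
        show "AE \<tau> in lborel. norm (indicator {0..ln 2} \<tau> * (1 - cos (exp (-\<tau>) * z))) \<le> norm (indicator {0..ln 2} \<tau> * (2::real))"
          using cos_ge_minus_one by (intro AE_I2) (auto simp: indicator_def)
      qed simp
      show "indicator {0..ln 2} \<tau> * ?f \<tau> \<le> indicator {0..ln 2} \<tau> * (1 - cos (exp (-\<tau>) * z))" for \<tau> :: real
        by (auto simp: indicator_def intro!: mult_left_le)
    qed
    finally have "1 / 6 \<le> ?D" .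
    moreover have "1 - cos (r * (z / l)) \<le> 2" using cos_ge_minus_one[of "r * (z / l)"] by linarith
    moreover have "0 < r\<^sup>2" "r\<^sup>2 \<le> 1" using r by (auto simp: power_le_one)
    ultimately show ?thesis by argo
  qed
qed

end

context kern
begin

abbreviation "rr \<equiv> r0 \<delta> C0"
abbreviation "c4 \<equiv> (r0 \<delta> C0)\<^sup>2 / 48"

lemma rr: "0 < rr" "rr \<le> 1" "0 < c4"
  using r0_props[OF \<delta> C0] by auto

text \<open>The kernel may be nearly concentrated on a lattice, so that \<open>1 - Re (fourier j)\<close> need not be bounded
  below away from the origin; only its logarithmic averages along rays are, uniformly in \<open>s\<close>.\<close>

lemma At_ln2_lower:
  assumes e: "12 \<le> norm \<eta>"
  shows "c4 \<le> Re (At (ln 2) \<eta>)"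
proof -
  let ?l = "norm \<eta>"
  have [measurable]: "j \<in> borel_measurable borel" using j_int by auto
  let ?h = "\<lambda>\<tau> y. indicator {0..ln 2} \<tau> * (j y * (1 - cos (y \<bullet> (exp (-\<tau>) *\<^sub>R \<eta>))))"
  have Rea: "Re (a \<zeta>) = (LINT y|lborel. j y * (1 - cos (y \<bullet> \<zeta>)))" for \<zeta>
    using Re_fourier_diff(1)[OF j_int(1), of \<zeta>] j_int(3) by (simp add: a_def)
  have i1: "integrable lborel (\<lambda>\<tau>::real. indicator {0..ln 2} \<tau> * (2::real))"
    by (intro integrable_mult_left integrable_real_indicator) (auto simp: emeasure_lborel_Icc_eq)
  have int: "integrable (lborel \<Otimes>\<^sub>M lborel) (\<lambda>(\<tau>, y). ?h \<tau> y)"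
  proof (rule Bochner_Integration.integrable_bound)
    show "integrable (lborel \<Otimes>\<^sub>M lborel) (\<lambda>(\<tau>::real, y). indicator {0..ln 2} \<tau> * 2 * j y)"
    proof (rule lborel_pair.Fubini_integrable)
      show "integrable lborel (\<lambda>\<tau>::real. LINT y|lborel. norm (case (\<tau>, y) of (\<tau>, y) \<Rightarrow> indicator {0..ln 2} \<tau> * 2 * j y))"
        using i1 j_int by (simp add: abs_mult)
      show "AE \<tau>::real in lborel. integrable lborel (\<lambda>y. case (\<tau>, y) of (\<tau>, y) \<Rightarrow> indicator {0..ln 2} \<tau> * 2 * j y)"
        using j_int by (intro AE_I2) simp
    qed measurable
    show "AE p in lborel \<Otimes>\<^sub>M lborel. norm (case p of (\<tau>, y) \<Rightarrow> ?h \<tau> y) \<le> norm (case p of (\<tau>, y) \<Rightarrow> indicator {0..ln 2} \<tau> * 2 * j y)"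
    proof (intro AE_I2, clarsimp simp: abs_mult)
      fix \<tau> :: real and y :: 'a
      have "1 - cos (exp (-\<tau>) * (y \<bullet> \<eta>)) \<le> 2" using cos_ge_minus_one[of "exp (-\<tau>) * (y \<bullet> \<eta>)"] by linarith
      then show "indicator {0..ln 2} \<tau> * (\<bar>j y\<bar> * (1 - cos (exp (-\<tau>) * (y \<bullet> \<eta>)))) \<le> indicator {0..ln 2} \<tau> * 2 * \<bar>j y\<bar>"
        by (auto simp: indicator_def mult.commute intro!: mult_left_mono)
    qed
  qed measurable
  have "Re (At (ln 2) \<eta>) = (LINT \<tau>|lborel. indicator {0..ln 2} \<tau> * Re (a (exp (-\<tau>) *\<^sub>R \<eta>)))"
    unfolding At_def by (subst integral_Re[symmetric]) (auto intro!: a_integrable)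
  also have "\<dots> = (LINT \<tau>|lborel. LINT y|lborel. ?h \<tau> y)"
    unfolding Rea by (intro Bochner_Integration.integral_cong refl) (rule integral_mult_right_zero[symmetric])
  also have "\<dots> = (LINT y|lborel. LINT \<tau>|lborel. ?h \<tau> y)"
    by (rule lborel_pair.Fubini_integral[OF int, symmetric])
  also have "\<dots> = (LINT y|lborel. j y * (LINT \<tau>|lborel. indicator {0..ln 2} \<tau> * (1 - cos (exp (-\<tau>) * (y \<bullet> \<eta>)))))"
    by (intro Bochner_Integration.integral_cong refl, subst integral_mult_right_zero[symmetric]) (simp add: mult.left_commute)
  finally have At: "Re (At (ln 2) \<eta>) = (LINT y|lborel. j y * (LINT \<tau>|lborel. indicator {0..ln 2} \<tau> * (1 - cos (exp (-\<tau>) * (y \<bullet> \<eta>)))))" .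
  have outer: "integrable lborel (\<lambda>y. j y * (LINT \<tau>|lborel. indicator {0..ln 2} \<tau> * (1 - cos (exp (-\<tau>) * (y \<bullet> \<eta>)))))"
  proof -
    have "integrable lborel (\<lambda>y. LINT \<tau>|lborel. ?h \<tau> y)" by (rule lborel_pair.integrable_snd[OF int])
    moreover have "(LINT \<tau>|lborel. ?h \<tau> y) = j y * (LINT \<tau>|lborel. indicator {0..ln 2} \<tau> * (1 - cos (exp (-\<tau>) * (y \<bullet> \<eta>))))" for y
      by (subst integral_mult_right_zero[symmetric]) (simp add: mult.left_commute)
    ultimately show ?thesis by simp
  qed
  \<comment> \<open>The point of the ray on the sphere of radius \<open>rr\<close>, where the
    expansion gives Re a >= rr^2 / 2. Integrating \<open>cos_average_lower\<close> against the jump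
    density leaves (rr^2 / 2 - rr^2 / 4) / 12 = \<open>c4\<close>.\<close>
  let ?\<omega> = "(rr / ?l) *\<^sub>R \<eta>"
  have "\<eta> \<noteq> 0" using e by auto
  then have n\<omega>: "norm ?\<omega> = rr" using rr by simp
  have inner: "y \<bullet> ?\<omega> = rr * ((y \<bullet> \<eta>) / ?l)" for y by simp
  note ic = Re_fourier_diff(2)[OF j_int(1), of ?\<omega>]
  have "rr\<^sup>2 / 2 \<le> Re (a ?\<omega>)"
  proof -
    have "rr\<^sup>2 = rr powr 2" using rr by simp
    also have "\<dots> \<le> rr powr (2 * s)" using rr s by (intro powr_mono') auto
    finally have "rr\<^sup>2 / 2 \<le> norm ?\<omega> powr (2 * s) / 2" unfolding n\<omega> by simp
    also have "\<dots> \<le> Re (a ?\<omega>)" by (rule a_lower) (simp only: n\<omega> order_refl)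
    finally show ?thesis .
  qed
  then have "c4 \<le> (Re (a ?\<omega>) - rr\<^sup>2 / 4) / 12" by simp
  also have "\<dots> = (LINT y|lborel. (1 / 12) * (j y * (1 - cos (y \<bullet> ?\<omega>)) - rr\<^sup>2 / 4 * j y))"
    unfolding Rea using ic j_int by (subst integral_mult_right_zero, subst Bochner_Integration.integral_diff) auto
  also have "\<dots> \<le> Re (At (ln 2) \<eta>)"
    unfolding At
  proof (rule integral_mono[OF _ outer])
    show "integrable lborel (\<lambda>y. (1 / 12) * (j y * (1 - cos (y \<bullet> ?\<omega>)) - rr\<^sup>2 / 4 * j y))"
      by (intro integrable_mult_right Bochner_Integration.integrable_diff ic j_int)
    fix y :: 'a
    have "(1 / 12) * (j y * (1 - cos (y \<bullet> ?\<omega>)) - rr\<^sup>2 / 4 * j y) = j y * ((1 - cos (rr * ((y \<bullet> \<eta>) / ?l)) - rr\<^sup>2 / 4) / 12)"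
      unfolding inner by (simp add: algebra_simps)
    also have "\<dots> \<le> j y * (LINT \<tau>|lborel. indicator {0..ln 2} \<tau> * (1 - cos (exp (-\<tau>) * (y \<bullet> \<eta>))))"
      by (intro mult_left_mono cos_average_lower e rr j_int)
    finally show "(1 / 12) * (j y * (1 - cos (y \<bullet> ?\<omega>)) - rr\<^sup>2 / 4 * j y) \<le> j y * (LINT \<tau>|lborel. indicator {0..ln 2} \<tau> * (1 - cos (exp (-\<tau>) * (y \<bullet> \<eta>))))" .
  qed
  finally show ?thesis .
qed

text \<open>Each halving of the frequency takes time ln 2 and contributes at least
  \<open>c4\<close>; the offset 12 is the constant bound rr^2 / 4 = 12 c4 for what remains at the
  end.\<close>

lemma AA_lower_dyadic: "12 * 2 ^ n \<le> norm \<eta> \<Longrightarrow> c4 * (real n + 12) \<le> Re (AA \<eta>)"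
proof (induction n arbitrary: \<eta>)
  case 0
  then have "rr \<le> norm \<eta>" using rr by simp
  from AA_lower_const[OF this] show ?case by simp
next
  case (Suc n)
  have h: "exp (- ln 2) *\<^sub>R \<eta> = (1 / 2) *\<^sub>R \<eta>" by (simp add: exp_minus)
  have "12 * 2 ^ n \<le> norm ((1 / 2) *\<^sub>R \<eta>)" using Suc.prems by simp
  from Suc.IH[OF this] have 1: "c4 * (real n + 12) \<le> Re (AA (exp (- ln 2) *\<^sub>R \<eta>))" unfolding h .
  have "(12::real) * 1 \<le> 12 * 2 ^ Suc n" by (intro mult_left_mono one_le_power) auto
  then have "12 \<le> norm \<eta>" using Suc.prems by linarith
  from At_ln2_lower[OF this] have 2: "c4 \<le> Re (At (ln 2) \<eta>)" .
  have "AA \<eta> = At (ln 2) \<eta> + AA (exp (- ln 2) *\<^sub>R \<eta>)" by (rule AA_split) simp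
  then have "Re (AA \<eta>) = Re (At (ln 2) \<eta>) + Re (AA (exp (- ln 2) *\<^sub>R \<eta>))" by simp
  moreover have "c4 * (real (Suc n) + 12) = c4 + c4 * (real n + 12)" by (simp add: algebra_simps)
  ultimately show ?case using 1 2 by linarith
qed

text \<open>The number of halvings is about the binary logarithm of |\<eta>| / 12. The crude bounds
  12 <= exp 4 and ln 2 <= 1 fit into the offset 12 of the dyadic estimate.\<close>

lemma AA_lower_log:
  assumes e: "rr \<le> norm \<eta>"
  shows "c4 * (1 + ln (max 1 (norm \<eta>))) \<le> Re (AA \<eta>)"
proof -
  have e4: "(16::real) \<le> exp 4"
  proof -
    have "2 \<le> exp (1::real)" using exp_ge_add_one_self[of 1] by simp
    then have "2 ^ 4 \<le> exp (1::real) ^ 4" by (intro power_mono) auto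
    also have "exp (1::real) ^ 4 = exp 4" by (simp add: exp_of_nat_mult[symmetric])
    finally show ?thesis by simp
  qed
  have ln2: "ln (2::real) \<le> 1" using ln_2_less_1 by simp
  show ?thesis
  proof (cases "norm \<eta> < 12")
    case True
    have "ln (max 1 (norm \<eta>)) \<le> ln (exp 4)" using True e4 by (subst ln_le_cancel_iff) auto
    then have "c4 * (1 + ln (max 1 (norm \<eta>))) \<le> c4 * 12" using rr by (intro mult_left_mono) auto
    also have "\<dots> = rr\<^sup>2 / 4" by simp
    also have "\<dots> \<le> Re (AA \<eta>)" by (rule AA_lower_const[OF e])
    finally show ?thesis .
  next
    case False
    define n where "n = nat \<lfloor>log 2 (norm \<eta> / 12)\<rfloor>"
    have "1 \<le> norm \<eta> / 12" using False by simp
    then have l0: "0 \<le> log 2 (norm \<eta> / 12)" by (intro zero_le_log_cancel_iff[THEN iffD2]) linarith+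
    have "real n \<le> log 2 (norm \<eta> / 12)" using l0 by (simp add: n_def)
    then have "2 powr real n \<le> norm \<eta> / 12" using False by (subst (asm) le_log_iff) auto
    then have n1: "12 * 2 ^ n \<le> norm \<eta>" by (simp add: powr_realpow)
    have "log 2 (norm \<eta> / 12) \<le> real n + 1" using l0 unfolding n_def by linarith
    then have "norm \<eta> / 12 \<le> 2 powr (real n + 1)" using False by (subst (asm) log_le_iff) auto
    also have "\<dots> = exp ((real n + 1) * ln 2)" by (simp add: powr_def)
    also have "\<dots> \<le> exp ((real n + 1) * 1)" using ln2 by (subst exp_le_cancel_iff, intro mult_left_mono) auto
    finally have "norm \<eta> \<le> 12 * exp (real n + 1)" by simp
    also have "\<dots> \<le> exp 4 * exp (real n + 1)" using e4 by (intro mult_right_mono) auto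
    also have "\<dots> = exp (real n + 5)" by (simp add: exp_add[symmetric])
    finally have "ln (norm \<eta>) \<le> ln (exp (real n + 5))" using False by (subst ln_le_cancel_iff) auto
    then have "1 + ln (max 1 (norm \<eta>)) \<le> real n + 12" using False by simp
    then have "c4 * (1 + ln (max 1 (norm \<eta>))) \<le> c4 * (real n + 12)" using rr by (intro mult_left_mono) auto
    also have "\<dots> \<le> Re (AA \<eta>)" by (rule AA_lower_dyadic[OF n1])
    finally show ?thesis .
  qed
qed

lemma lam_ge:
  assumes "0 < \<epsilon>" "\<epsilon> \<le> 1" shows "1 / \<epsilon> \<le> lam \<epsilon>"
proof -
  have "\<epsilon> powr (2 * s) \<le> \<epsilon> powr 1" using assms s by (intro powr_mono') auto
  then show ?thesis using assms by (simp add: powr_minus inverse_eq_divide divide_left_mono)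
qed

text \<open>As \<open>lam \<epsilon>\<close> >= 1 / \<epsilon>, the logarithmic bound gives exp (-
  c4 / \<epsilon>) X^(- c4 / \<epsilon>) with X = max 1 (\<epsilon> |\<xi>|). The first factor is
  O(\<epsilon>^N), the second is at most X^(-N) once \<epsilon> <= c4 / N, and \<epsilon> / X <= 1 /
  |\<xi>|.\<close>

lemma Feps_decay:
  assumes e: "0 < \<epsilon>" "\<epsilon> \<le> 1" and N: "0 < N" "\<epsilon> \<le> c4 / N" and far: "rr \<le> \<epsilon> * norm \<xi>"
  shows "cmod (Feps \<epsilon> \<xi>) \<le> (N / c4) powr N * norm \<xi> powr (- N)"
proof -
  define X where "X = max 1 (\<epsilon> * norm \<xi>)"
  have X: "1 \<le> X" "\<epsilon> * norm \<xi> \<le> X" by (auto simp: X_def)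
  have x: "0 < norm \<xi>" using far rr e by (metis less_le_trans mult_zero_right norm_ge_zero order_le_less)
  have le: "c4 * (1 + ln X) \<le> Re (AA (\<epsilon> *\<^sub>R \<xi>))"
    using AA_lower_log[of "\<epsilon> *\<^sub>R \<xi>"] far e by (simp add: X_def)
  have "cmod (Feps \<epsilon> \<xi>) = exp (- (lam \<epsilon> * Re (AA (\<epsilon> *\<^sub>R \<xi>))))" by (simp add: Feps_def)
  also have "\<dots> \<le> exp (- ((1 / \<epsilon>) * (c4 * (1 + ln X))))"
  proof -
    have "(1 / \<epsilon>) * (c4 * (1 + ln X)) \<le> lam \<epsilon> * Re (AA (\<epsilon> *\<^sub>R \<xi>))"
      using lam_ge[OF e] le rr X e by (intro mult_mono) auto
    then show ?thesis by simp
  qed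
  also have "\<dots> = exp (- (c4 / \<epsilon>)) * exp (- (c4 / \<epsilon> * ln X))" by (simp add: exp_add[symmetric] algebra_simps add_divide_distrib)
  also have "\<dots> \<le> (N / c4 * \<epsilon>) powr N * X powr (- N)"
  proof (rule mult_mono)
    define y where "y = c4 / (N * \<epsilon>)"
    have y: "0 < y" using rr N e by (simp add: y_def)
    have "y \<le> exp y" using exp_ge_add_one_self[of y] by linarith
    then have "y powr N \<le> exp y powr N" using y N by (intro powr_mono2) auto
    also have "\<dots> = exp (c4 / \<epsilon>)" using N e by (simp add: exp_powr_real y_def)
    finally have "exp (- (c4 / \<epsilon>)) \<le> 1 / y powr N" using y by (simp add: exp_minus field_simps)
    also have "1 / y powr N = (1 / y) powr N" using y by (simp add: powr_divide)
    also have "1 / y = N / c4 * \<epsilon>" by (simp add: y_def)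
    finally show "exp (- (c4 / \<epsilon>)) \<le> (N / c4 * \<epsilon>) powr N" .
    have "N \<le> c4 / \<epsilon>" using N e by (simp add: field_simps)
    then have "N * ln X \<le> c4 / \<epsilon> * ln X" using X by (intro mult_right_mono) auto
    then show "exp (- (c4 / \<epsilon> * ln X)) \<le> X powr (- N)" using X by (simp add: powr_def)
  qed auto
  also have "\<dots> = (N / c4) powr N * (\<epsilon> / X) powr N"
    using e N rr X by (simp add: powr_mult powr_divide powr_minus field_simps)
  also have "\<dots> \<le> (N / c4) powr N * (1 / norm \<xi>) powr N"
  proof (intro mult_left_mono powr_mono2)
    show "\<epsilon> / X \<le> 1 / norm \<xi>" using X x by (simp add: field_simps)
  qed (use e X N in auto)
  also have "(1 / norm \<xi>) powr N = norm \<xi> powr (- N)" using x by (simp add: powr_divide powr_minus inverse_eq_divide)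
  finally show ?thesis .
qed

text \<open>The expansion integrated along the ray: |\<eta>|^(2 s) acquires the factor 1 / (2 s),
  which is the parameter of the stable equilibrium.\<close>

lemma AA_near:
  assumes e: "norm \<eta> \<le> 1"
  shows "cmod (AA \<eta> - of_real (norm \<eta> powr (2 * s) / (2 * s))) \<le> C0 * norm \<eta> powr (2 * s + \<delta>)"
proof -
  let ?g = "\<lambda>p \<tau>. norm \<eta> powr p * (indicator {0..} \<tau> * exp (- p * \<tau>))"
  have gi: "integrable lborel (?g p)" "(LINT \<tau>|lborel. ?g p \<tau>) = norm \<eta> powr p / p" if "0 < p" for p
    using integral_exp_Ici[OF that] by (simp_all add: integrable_mult_right)
  have s2: "0 < 2 * s" "0 < 2 * s + \<delta>" using s \<delta> by auto
  have i: "integrable lborel (\<lambda>\<tau>. indicator {0..} \<tau> *\<^sub>R a (exp (-\<tau>) *\<^sub>R \<eta>))" by (rule a_integrable) auto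
  have eq: "AA \<eta> - of_real (norm \<eta> powr (2 * s) / (2 * s)) = (LINT \<tau>|lborel. indicator {0..} \<tau> *\<^sub>R a (exp (-\<tau>) *\<^sub>R \<eta>) - of_real (?g (2 * s) \<tau>))"
    unfolding AA_def gi(2)[OF s2(1), symmetric] integral_complex_of_real[symmetric]
    by (rule Bochner_Integration.integral_diff[symmetric, OF i]) (intro integrable_of_real gi s2)
  have "cmod (AA \<eta> - of_real (norm \<eta> powr (2 * s) / (2 * s))) \<le> (LINT \<tau>|lborel. C0 * ?g (2 * s + \<delta>) \<tau>)"
    unfolding eq
  proof (rule order_trans[OF integral_norm_bound], rule integral_mono)
    show "integrable lborel (\<lambda>\<tau>. norm (indicator {0..} \<tau> *\<^sub>R a (exp (-\<tau>) *\<^sub>R \<eta>) - of_real (?g (2 * s) \<tau>)))"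
      by (intro integrable_norm Bochner_Integration.integrable_diff i integrable_of_real gi s2)
    show "integrable lborel (\<lambda>\<tau>. C0 * ?g (2 * s + \<delta>) \<tau>)" by (intro integrable_mult_right gi s2)
    fix \<tau> :: real
    show "norm (indicator {0..} \<tau> *\<^sub>R a (exp (-\<tau>) *\<^sub>R \<eta>) - of_real (?g (2 * s) \<tau>)) \<le> C0 * ?g (2 * s + \<delta>) \<tau>"
    proof (cases "0 \<le> \<tau>")
      case True
      have "norm (exp (-\<tau>) *\<^sub>R \<eta>) \<le> 1" using True e by (simp add: mult_le_one)
      from a_near[OF this] show ?thesis unfolding norm_exp_powr using True by simp
    qed simp
  qed
  also have "\<dots> = C0 * (norm \<eta> powr (2 * s + \<delta>) / (2 * s + \<delta>))"
    by (subst integral_mult_right_zero, subst gi(2)[OF s2(2)]) (rule refl)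
  also have "\<dots> \<le> C0 * norm \<eta> powr (2 * s + \<delta>)"
  proof (rule mult_left_mono)
    have "norm \<eta> powr (2 * s + \<delta>) / (2 * s + \<delta>) \<le> norm \<eta> powr (2 * s + \<delta>) / 1"
      using s \<delta> by (intro divide_left_mono) auto
    then show "norm \<eta> powr (2 * s + \<delta>) / (2 * s + \<delta>) \<le> norm \<eta> powr (2 * s + \<delta>)" by simp
  qed (use C0 in simp)
  finally show ?thesis .
qed

lemma St_bound: "1 / 4 \<le> c \<Longrightarrow> cmod (St c \<xi>) \<le> 2 * exp (- norm \<xi> / 4)"
proof -
  assume "1 / 4 \<le> c"
  then have "norm \<xi> powr (2 * s) / 4 \<le> c * norm \<xi> powr (2 * s)" using mult_right_mono[of "1/4" c "norm \<xi> powr (2 * s)"] by simp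
  then have "cmod (St c \<xi>) \<le> exp (- (norm \<xi> powr (2 * s) / 4))" by (simp add: St_def)
  also have "\<dots> \<le> 2 * exp (- norm \<xi> / 4)" using s by (intro exp_powr_le) auto
  finally show ?thesis .
qed

text \<open>For \<epsilon> |\<xi>| <= \<open>rr\<close> the expansion applies and both exponents are
  at least |\<xi>|^(2 s) / 4, so their distance, of size \<epsilon>^\<delta> |\<xi>|^(2 s +
  \<delta>), is multiplied by an exponential. For larger \<epsilon> |\<xi>| the two transforms are
  small separately, and \<epsilon>^\<delta> is bought with (\<epsilon> |\<xi>| / rr)^\<delta> >= 1.
  The decay order 2 d + \<delta> leaves 2 d after this loss, the order of \<open>wt\<close>; this
  choice fixes the threshold on \<epsilon>.\<close>

lemma stationary_difference:
  assumes e: "0 < \<epsilon>" "\<epsilon> \<le> 1" "\<epsilon> \<le> c4 / (2 * DIM('a) + \<delta>)"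
    and P: "\<And>x. 0 \<le> x \<Longrightarrow> x powr 0 * exp (- x / 4) * (1 + x\<^sup>2) ^ DIM('a) \<le> P1"
      "\<And>x. 0 \<le> x \<Longrightarrow> x powr (2 + \<delta>) * exp (- x / 4) * (1 + x\<^sup>2) ^ DIM('a) \<le> P2"
      "\<And>x. 0 \<le> x \<Longrightarrow> x powr \<delta> * exp (- x / 4) * (1 + x\<^sup>2) ^ DIM('a) \<le> P3"
  shows "cmod (Feps \<epsilon> \<xi> - St (1 / (2 * s)) \<xi>) \<le>
    (2 * C0 * (P1 + P2) + rr powr (- \<delta>) * (((2 * DIM('a) + \<delta>) / c4) powr (2 * DIM('a) + \<delta>) * (1 + 1 / rr\<^sup>2) ^ DIM('a) + 2 * P3)) * \<epsilon> powr \<delta> * wt \<xi>"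
proof -
  let ?y = "norm \<xi>" and ?N = "2 * real DIM('a) + \<delta>"
  have N: "0 < ?N" using \<delta> by (simp add: add_nonneg_pos)
  have toP: "?y powr q * exp (- ?y / 4) \<le> Q * wt \<xi>" if "?y powr q * exp (- ?y / 4) * (1 + ?y\<^sup>2) ^ DIM('a) \<le> Q" for q Q
    using that by (simp add: wt_def pos_le_divide_eq add_pos_nonneg)
  have Pp: "0 \<le> P1" "0 \<le> P2" "0 \<le> P3" using P[of 0] P[of 1] by (auto intro: order_trans[rotated])
  have s2: "1 / 4 \<le> 1 / (2 * s)" using s by (simp add: field_simps)
  define K2 where "K2 = rr powr (- \<delta>) * ((?N / c4) powr ?N * (1 + 1 / rr\<^sup>2) ^ DIM('a) + 2 * P3)"
  have K2: "0 \<le> K2" using Pp by (simp add: K2_def)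
  have K1: "0 \<le> 2 * C0 * (P1 + P2)" using C0 Pp by simp
  have "cmod (Feps \<epsilon> \<xi> - St (1 / (2 * s)) \<xi>) \<le> (2 * C0 * (P1 + P2) + K2) * \<epsilon> powr \<delta> * wt \<xi>"
  proof (cases "\<epsilon> * ?y \<le> rr")
    case True
    let ?\<eta> = "\<epsilon> *\<^sub>R \<xi>"
    have n: "norm ?\<eta> \<le> rr" "norm ?\<eta> \<le> 1" using True e rr by auto
    let ?x = "- (of_real (lam \<epsilon>) * AA ?\<eta>)" and ?z = "- complex_of_real (1 / (2 * s) * ?y powr (2 * s))"
    have "cmod (?x - ?z) = cmod (of_real (lam \<epsilon>) * (AA ?\<eta> - of_real (norm ?\<eta> powr (2 * s) / (2 * s))))"
    proof -
      have "lam \<epsilon> * (norm ?\<eta> powr (2 * s) / (2 * s)) = 1 / (2 * s) * ?y powr (2 * s)"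
        using lam_scale[OF e(1), of \<xi>] by simp
      then have "complex_of_real (lam \<epsilon>) * of_real (norm ?\<eta> powr (2 * s) / (2 * s)) = of_real (1 / (2 * s) * ?y powr (2 * s))"
        unfolding of_real_mult[symmetric] by (rule arg_cong)
      then have "?x - ?z = - (of_real (lam \<epsilon>) * (AA ?\<eta> - of_real (norm ?\<eta> powr (2 * s) / (2 * s))))"
        unfolding right_diff_distrib by (simp only: minus_diff_eq) (simp only: diff_minus_eq_add minus_add_distrib uminus_add_conv_diff add.commute)
      then show ?thesis by (simp only: norm_minus_cancel)
    qed
    also have "\<dots> \<le> lam \<epsilon> * (C0 * norm ?\<eta> powr (2 * s + \<delta>))"
      unfolding norm_mult using AA_near[OF n(2)] by (intro mult_mono) auto
    also have "\<dots> = C0 * \<epsilon> powr \<delta> * ?y powr (2 * s + \<delta>)"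
    proof -
      have "lam \<epsilon> * \<epsilon> powr (2 * s + \<delta>) = \<epsilon> powr \<delta>" unfolding powr_add[symmetric] by simp
      then have "lam \<epsilon> * (\<epsilon> * ?y) powr (2 * s + \<delta>) = \<epsilon> powr \<delta> * ?y powr (2 * s + \<delta>)"
        unfolding powr_mult by (metis mult.assoc)
      then show ?thesis using e by (simp add: mult.left_commute)
    qed
    finally have xz: "cmod (?x - ?z) \<le> C0 * \<epsilon> powr \<delta> * ?y powr (2 * s + \<delta>)" .
    have "cmod (exp ?x - exp ?z) \<le> exp (- (?y powr (2 * s) / 4)) * cmod (?x - ?z)"
    proof (rule exp_diff_le)
      have "lam \<epsilon> * (norm ?\<eta> powr (2 * s) / 4) \<le> lam \<epsilon> * Re (AA ?\<eta>)"
        by (intro mult_left_mono AA_lower_near n) auto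
      then have "?y powr (2 * s) / 4 \<le> lam \<epsilon> * Re (AA ?\<eta>)" using lam_scale[OF e(1), of \<xi>] by simp
      then show "Re ?x \<le> - (?y powr (2 * s) / 4)" by simp
      show "Re ?z \<le> - (?y powr (2 * s) / 4)" using mult_right_mono[OF s2, of "?y powr (2 * s)"] by simp
    qed
    also have "\<dots> \<le> exp (- (?y powr (2 * s) / 4)) * (C0 * \<epsilon> powr \<delta> * ?y powr (2 * s + \<delta>))"
      by (intro mult_left_mono xz) simp
    also have "exp (- (?y powr (2 * s) / 4)) * (C0 * \<epsilon> powr \<delta> * ?y powr (2 * s + \<delta>)) \<le> (2 * exp (- ?y / 4)) * (C0 * \<epsilon> powr \<delta> * (?y powr 0 + ?y powr (2 + \<delta>)))"
    proof (intro mult_mono mult_left_mono exp_powr_le)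
      \<comment> \<open>Replaces the exponent by two that do not depend on s; at
        \<open>\<xi> = 0\<close> all three powers vanish, \<open>0 powr 0\<close> included.\<close>
      show "?y powr (2 * s + \<delta>) \<le> ?y powr 0 + ?y powr (2 + \<delta>)"
      proof (cases "?y \<le> 1")
        case True
        then show ?thesis using s \<delta> by (cases "\<xi> = 0") (auto intro!: add_increasing2 powr_le1)
      next
        case False
        then have "?y powr (2 * s + \<delta>) \<le> ?y powr (2 + \<delta>)" using s by (intro powr_mono) auto
        then show ?thesis by (simp add: add_increasing)
      qed
    qed (use s C0 in auto)
    also have "\<dots> = 2 * C0 * \<epsilon> powr \<delta> * (?y powr 0 * exp (- ?y / 4) + ?y powr (2 + \<delta>) * exp (- ?y / 4))"
      by (simp add: algebra_simps)
    also have "\<dots> \<le> 2 * C0 * \<epsilon> powr \<delta> * (P1 * wt \<xi> + P2 * wt \<xi>)"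
      by (intro mult_left_mono add_mono toP P) (use C0 in auto)
    also have "\<dots> = (2 * C0 * (P1 + P2)) * \<epsilon> powr \<delta> * wt \<xi>" by (simp add: algebra_simps)
    also have "\<dots> \<le> (2 * C0 * (P1 + P2) + K2) * \<epsilon> powr \<delta> * wt \<xi>"
      by (intro mult_right_mono) (use K2 wt_nonneg in auto)
    finally show ?thesis unfolding Feps_def St_def exp_of_real[symmetric] of_real_minus .
  next
    case False
    then have far: "rr \<le> \<epsilon> * ?y" by simp
    have y: "rr \<le> ?y" using far e mult_left_le_one_le[of ?y \<epsilon>] by simp
    have y0: "0 < ?y" using y rr by linarith
    have one: "1 \<le> \<epsilon> powr \<delta> * (rr powr (- \<delta>) * ?y powr \<delta>)"
    proof -
      have "1 \<le> (\<epsilon> * ?y / rr) powr \<delta>" using far rr \<delta> by (intro ge_one_powr_ge_zero) auto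
      also have "\<dots> = \<epsilon> powr \<delta> * (rr powr (- \<delta>) * ?y powr \<delta>)"
        using e rr y0 by (simp add: powr_divide powr_mult powr_minus field_simps)
      finally show ?thesis .
    qed
    have b1: "cmod (Feps \<epsilon> \<xi>) \<le> (?N / c4) powr ?N * ?y powr (- ?N)"
      by (rule Feps_decay[OF e(1,2) N]) (use e far in auto)
    have b2: "cmod (St (1 / (2 * s)) \<xi>) \<le> 2 * exp (- ?y / 4)" by (rule St_bound[OF s2])
    have "cmod (Feps \<epsilon> \<xi> - St (1 / (2 * s)) \<xi>) \<le> ((?N / c4) powr ?N * ?y powr (- ?N) + 2 * exp (- ?y / 4)) * 1"
      using norm_triangle_ineq4[of "Feps \<epsilon> \<xi>" "St (1 / (2 * s)) \<xi>"] b1 b2 by simp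
    also have "\<dots> \<le> ((?N / c4) powr ?N * ?y powr (- ?N) + 2 * exp (- ?y / 4)) * (\<epsilon> powr \<delta> * (rr powr (- \<delta>) * ?y powr \<delta>))"
      by (intro mult_left_mono one) auto
    also have "\<dots> = rr powr (- \<delta>) * \<epsilon> powr \<delta> * ((?N / c4) powr ?N * (?y powr (- ?N) * ?y powr \<delta>) + 2 * (?y powr \<delta> * exp (- ?y / 4)))"
      by (simp add: algebra_simps)
    also have "\<dots> \<le> rr powr (- \<delta>) * \<epsilon> powr \<delta> * ((?N / c4) powr ?N * ((1 + 1 / rr\<^sup>2) ^ DIM('a) * wt \<xi>) + 2 * (P3 * wt \<xi>))"
    proof (intro mult_left_mono add_mono toP P)
      have "?y powr (- ?N) * ?y powr \<delta> = ?y powr (- real (2 * DIM('a)))" by (simp flip: powr_add)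
      also have "\<dots> = 1 / (?y\<^sup>2) ^ DIM('a)" using y0 by (subst powr_minus, subst powr_realpow) (auto simp: power_mult inverse_eq_divide)
      also have "\<dots> \<le> (1 + 1 / rr\<^sup>2) ^ DIM('a) * wt \<xi>"
      proof -
        have "rr\<^sup>2 \<le> ?y\<^sup>2" using y rr by (intro power_mono) auto
        then have "1 \<le> ?y\<^sup>2 / rr\<^sup>2" using rr by (simp add: le_divide_eq)
        then have "1 + ?y\<^sup>2 \<le> (1 + 1 / rr\<^sup>2) * ?y\<^sup>2" by (simp add: algebra_simps)
        then have "(1 + ?y\<^sup>2) ^ DIM('a) \<le> (1 + 1 / rr\<^sup>2) ^ DIM('a) * (?y\<^sup>2) ^ DIM('a)"
          unfolding power_mult_distrib[symmetric] by (intro power_mono) auto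
        moreover have "0 < (1 + ?y\<^sup>2) ^ DIM('a)" "0 < (?y\<^sup>2) ^ DIM('a)" using y0 by (auto intro!: zero_less_power add_pos_nonneg)
        ultimately show ?thesis unfolding wt_def by (simp add: divide_le_eq pos_divide_le_eq mult.commute)
      qed
      finally show "?y powr (- ?N) * ?y powr \<delta> \<le> (1 + 1 / rr\<^sup>2) ^ DIM('a) * wt \<xi>" .
    qed auto
    also have "\<dots> = K2 * \<epsilon> powr \<delta> * wt \<xi>" by (simp add: K2_def algebra_simps)
    also have "\<dots> \<le> (2 * C0 * (P1 + P2) + K2) * \<epsilon> powr \<delta> * wt \<xi>"
      by (intro mult_right_mono) (use K1 wt_nonneg in auto)
    finally show ?thesis .
  qed
  then show ?thesis by (simp add: K2_def)
qed

end

section \<open>Interpolation between \<open>L\<^sup>2\<close> and weighted \<open>L\<^sup>1\<close>\<close>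

text \<open>Split at radius R. Inside, 2 |f| <= c f^2 + 1 / c trades the L2 norm against the volume
  of the ball; outside, the weight of order k is at most R^(k - m) times the weight of order
  m.\<close>

lemma interpolation:
  fixes f :: "'a::euclidean_space \<Rightarrow> real"
  assumes k: "0 \<le> k" "k < m" "m < 1" and e: "0 < \<eta>" "\<eta> \<le> 1"
    and f: "f \<in> borel_measurable borel" "integrable lborel (\<lambda>x. (f x)\<^sup>2)" "(LINT x|lborel. (f x)\<^sup>2) \<le> D * \<eta>\<^sup>2"
    and fm: "integrable lborel (\<lambda>x. jbr x powr m * \<bar>f x\<bar>)" "(LINT x|lborel. jbr x powr m * \<bar>f x\<bar>) \<le> M"
  shows "L1k_norm k f \<le> (D + unit_ball_vol (real DIM('a)) + M) * \<eta> powr ((m - k) / (m + real DIM('a) / 2))"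
proof -
  have [measurable]: "f \<in> borel_measurable borel" by fact
  let ?d = "real DIM('a)" and ?V = "unit_ball_vol (real DIM('a))"
  let ?q = "m + ?d / 2"
  have q: "0 < ?q" using k by (simp add: add_pos_pos)
  \<comment> \<open>Solves R^(k + d/2) \<eta> = R^(k - m), the equality of the inner and the outer
    contribution.\<close>
  define R where "R = \<eta> powr (- 1 / ?q)"
  have R: "1 \<le> R"
    using powr_mono2'[of "1 / ?q" \<eta> 1] e q by (simp add: R_def powr_minus one_le_inverse_iff powr_le1)
  \<comment> \<open>Balances c \<eta>^2 against R^d / c: both become R^(d/2) \<eta>.\<close>
  define c where "c = R powr (?d / 2) / \<eta>"
  have c: "0 < c" using R e by (simp add: c_def)
  let ?B = "cball (0::'a) R"
  have vol: "measure lborel ?B = ?V * R ^ DIM('a)" using content_cball[of R "0::'a"] R by simp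
  have iB: "integrable lborel (indicator ?B :: 'a \<Rightarrow> real)"
    by (intro integrable_real_indicator) (use emeasure_bounded_finite[of ?B] in auto)
  have pw: "jbr x powr k * \<bar>f x\<bar> \<le> R powr k * (c * (f x)\<^sup>2 + 1 / c * indicator ?B x) + R powr (k - m) * (jbr x powr m * \<bar>f x\<bar>)" for x
  proof (cases "x \<in> ?B")
    case True
    then have n: "norm x \<le> R" by simp
    have "jbr x \<le> 1 + norm x" unfolding jbr_def by (rule real_le_lsqrt) (auto simp: power2_eq_square algebra_simps)
    then have "jbr x \<le> 2 * R" using n R by linarith
    then have "jbr x powr k \<le> (2 * R) powr k" using k jbr_pos[of x] by (intro powr_mono2) auto
    also have "\<dots> = 2 powr k * R powr k" using R by (simp add: powr_mult)
    also have "\<dots> \<le> 2 powr 1 * R powr k" using k by (intro mult_right_mono powr_mono) auto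
    finally have "jbr x powr k * \<bar>f x\<bar> \<le> 2 * R powr k * \<bar>f x\<bar>" by (intro mult_right_mono) auto
    also have "2 * \<bar>f x\<bar> \<le> c * (f x)\<^sup>2 + 1 / c"
    proof -
      have "0 \<le> (c * \<bar>f x\<bar> - 1)\<^sup>2 / c" using c by simp
      also have "\<dots> = c * (f x)\<^sup>2 + 1 / c - 2 * \<bar>f x\<bar>"
        using c by (simp add: power2_eq_square field_simps)
      finally show ?thesis by simp
    qed
    then have "2 * R powr k * \<bar>f x\<bar> \<le> R powr k * (c * (f x)\<^sup>2 + 1 / c)"
      using mult_left_mono[of "2 * \<bar>f x\<bar>" "c * (f x)\<^sup>2 + 1 / c" "R powr k"] by (simp add: mult_ac)
    moreover have "0 \<le> R powr (k - m) * (jbr x powr m * \<bar>f x\<bar>)" by simp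
    ultimately have "jbr x powr k * \<bar>f x\<bar> \<le> R powr k * (c * (f x)\<^sup>2 + 1 / c) + R powr (k - m) * (jbr x powr m * \<bar>f x\<bar>)"
      using \<open>jbr x powr k * \<bar>f x\<bar> \<le> 2 * R powr k * \<bar>f x\<bar>\<close> by linarith
    then show ?thesis using True by simp
  next
    case False
    then have "R \<le> jbr x" using jbr_ge_norm[of x] by simp
    then have "jbr x powr (k - m) \<le> R powr (k - m)" using k R by (intro powr_mono2') auto
    then have "jbr x powr (k - m) * (jbr x powr m * \<bar>f x\<bar>) \<le> R powr (k - m) * (jbr x powr m * \<bar>f x\<bar>)"
      by (intro mult_right_mono) auto
    moreover have "jbr x powr (k - m) * (jbr x powr m * \<bar>f x\<bar>) = jbr x powr k * \<bar>f x\<bar>"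
      using jbr_pos[of x] by (simp add: mult.assoc[symmetric] powr_add[symmetric])
    moreover have "0 \<le> R powr k * (c * (f x)\<^sup>2 + 1 / c * indicator ?B x)" using c by (intro mult_nonneg_nonneg add_nonneg_nonneg) auto
    ultimately show ?thesis by linarith
  qed
  have int: "integrable lborel (\<lambda>x. R powr k * (c * (f x)\<^sup>2 + 1 / c * indicator ?B x) + R powr (k - m) * (jbr x powr m * \<bar>f x\<bar>))"
    by (intro Bochner_Integration.integrable_add integrable_mult_right f fm iB)
  have "L1k_norm k f \<le> (LINT x|lborel. R powr k * (c * (f x)\<^sup>2 + 1 / c * indicator ?B x) + R powr (k - m) * (jbr x powr m * \<bar>f x\<bar>))"
    unfolding L1k_norm_def
  proof (rule integral_mono[OF _ int pw])
    show "integrable lborel (\<lambda>x. jbr x powr k * \<bar>f x\<bar>)"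
      by (rule Bochner_Integration.integrable_bound[OF int]) (use pw in \<open>auto intro!: AE_I2 order_trans[OF _ abs_ge_self]\<close>)
  qed
  also have "\<dots> = R powr k * (c * (LINT x|lborel. (f x)\<^sup>2) + 1 / c * measure lborel ?B) + R powr (k - m) * (LINT x|lborel. jbr x powr m * \<bar>f x\<bar>)"
    using f fm iB by (simp add: Bochner_Integration.integral_add)
  also have "\<dots> \<le> R powr k * (c * (D * \<eta>\<^sup>2) + 1 / c * (?V * R ^ DIM('a))) + R powr (k - m) * M"
    unfolding vol using c f fm by (intro add_mono mult_left_mono order_refl) auto
  also have "\<dots> = (D + ?V) * (R powr (k + ?d / 2) * \<eta>) + R powr (k - m) * M"
  proof -
    have Rd: "R ^ DIM('a) = R powr (?d / 2) * R powr (?d / 2)" using R by (simp add: powr_realpow flip: powr_add)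
    have A: "c * (D * \<eta>\<^sup>2) = D * (R powr (?d / 2) * \<eta>)" using e by (simp add: c_def power2_eq_square)
    have B: "1 / c * (?V * R ^ DIM('a)) = ?V * (R powr (?d / 2) * \<eta>)" unfolding Rd c_def using R by simp
    show ?thesis unfolding A B powr_add by (simp only: distrib_left distrib_right mult_ac)
  qed
  also have "R powr (k + ?d / 2) * \<eta> = \<eta> powr ((m - k) / ?q)"
  proof -
    have "R powr (k + ?d / 2) * \<eta> powr 1 = \<eta> powr (- 1 / ?q * (k + ?d / 2) + 1)"
      unfolding R_def powr_powr by (rule powr_add[symmetric])
    also have "- 1 / ?q * (k + ?d / 2) + 1 = (m - k) / ?q" using q by (simp add: field_simps)
    finally show ?thesis using e by simp
  qed
  also have "R powr (k - m) = \<eta> powr ((m - k) / ?q)"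
    unfolding R_def powr_powr by (simp add: diff_divide_distrib)
  finally show ?thesis by (simp add: algebra_simps)
qed

text \<open>By inversion the integrable \<open>f\<close> is also bounded, so its square is
  integrable. The identity behind the estimate is \<open>fubini_cis\<close> at x = 0 with the
  reflected transform as \<open>\<kappa>\<close>, whose inner integral is (2 pi)^d f; finally the
  square of \<open>wt\<close> is bounded by \<open>wt\<close>.\<close>

lemma Plancherel_le:
  fixes f :: "'a::euclidean_space \<Rightarrow> real"
  assumes f: "integrable lborel f" and b: "\<And>\<xi>. cmod (fourier f \<xi>) \<le> L * wt \<xi>"
    and inv: "\<And>x. of_real (f x) = (LINT \<xi>|lborel. cis (x \<bullet> \<xi>) * fourier f \<xi>) / of_real ((2 * pi) ^ DIM('a))"
  shows "integrable lborel (\<lambda>x. (f x)\<^sup>2)"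
    "(LINT x|lborel. (f x)\<^sup>2) \<le> (LINT \<xi>|lborel. wt (\<xi>::'a)) / (2 * pi) ^ DIM('a) * L\<^sup>2"
proof -
  let ?cc = "(2 * pi) ^ DIM('a)" and ?w = "LINT \<xi>|lborel. wt (\<xi>::'a)"
  have cc: "0 < ?cc" by simp
  have [measurable]: "f \<in> borel_measurable borel" using f by auto
  have "0 \<le> L * wt (0::'a)" by (rule order_trans[OF norm_ge_zero b])
  then have L: "0 \<le> L" by (simp add: wt_def)
  have ki: "integrable lborel (fourier f)"
    by (rule Bochner_Integration.integrable_bound[OF integrable_mult_right[OF wt_integrable, of L]])
      (use order_trans[OF b abs_ge_self] f in \<open>auto intro!: AE_I2\<close>)
  have bd: "\<bar>f x\<bar> \<le> L * ?w / ?cc" for x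
  proof -
    have "\<bar>f x\<bar> = cmod (of_real (f x))" by simp
    also have "\<dots> = cmod (LINT \<xi>|lborel. cis (x \<bullet> \<xi>) * fourier f \<xi>) / ?cc" unfolding inv by (simp add: norm_divide norm_power norm_mult)
    also have "\<dots> \<le> (LINT \<xi>|lborel. L * wt (\<xi>::'a)) / ?cc"
    proof (rule divide_right_mono, rule order_trans[OF integral_norm_bound], rule integral_mono)
      show "integrable lborel (\<lambda>\<xi>. norm (cis (x \<bullet> \<xi>) * fourier f \<xi>))"
        by (intro integrable_norm integrable_cis_mult_complex ki) simp
      show "integrable lborel (\<lambda>\<xi>::'a. L * wt \<xi>)" by (intro integrable_mult_right wt_integrable)
    qed (use b in \<open>auto simp: norm_mult\<close>)
    finally show ?thesis by simp
  qed
  show sq: "integrable lborel (\<lambda>x. (f x)\<^sup>2)"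
  proof (rule Bochner_Integration.integrable_bound[OF integrable_mult_right[OF f, of "L * ?w / ?cc"]])
    show "AE x in lborel. norm ((f x)\<^sup>2) \<le> norm (L * ?w / ?cc * f x)"
    proof (rule AE_I2)
      fix x
      have "\<bar>f x\<bar> * \<bar>f x\<bar> \<le> \<bar>L * ?w / ?cc\<bar> * \<bar>f x\<bar>" using bd[of x] by (intro mult_right_mono) linarith+
      then show "norm ((f x)\<^sup>2) \<le> norm (L * ?w / ?cc * f x)" by (simp only: real_norm_def abs_mult power2_eq_square)
    qed
  qed simp
  define \<kappa> where "\<kappa> = (\<lambda>\<xi>. fourier f (0 - \<xi>))"
  have k: "integrable lborel \<kappa>" unfolding \<kappa>_def by (rule integrable_translate(3)[OF ki])
  have I: "(LINT \<xi>|lborel. cis ((0 - y) \<bullet> \<xi>) * \<kappa> \<xi>) = of_real (?cc * f y)" for y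
  proof -
    have "(LINT \<xi>|lborel. cis ((0 - y) \<bullet> \<xi>) * \<kappa> \<xi>) = (LINT \<xi>|lborel. cis (y \<bullet> (0 - \<xi>)) * fourier f (0 - \<xi>))"
      by (simp add: \<kappa>_def)
    also have "\<dots> = (LINT \<xi>|lborel. cis (y \<bullet> \<xi>) * fourier f \<xi>)"
      by (rule integral_translate(3)[OF integrable_cis_mult_complex[OF ki]]) simp
    also have "\<dots> = of_real (?cc * f y)" unfolding of_real_mult inv by simp
    finally show ?thesis .
  qed
  have "of_real (?cc * (LINT x|lborel. (f x)\<^sup>2)) = (LINT y|lborel. f y *\<^sub>R complex_of_real (?cc * f y))"
    unfolding integral_mult_right_zero[symmetric] integral_complex_of_real[symmetric]
    by (simp add: scaleR_conv_of_real power2_eq_square mult_ac)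
  also have "\<dots> = (LINT \<xi>|lborel. cis (0 \<bullet> \<xi>) * (\<kappa> \<xi> * fourier f \<xi>))"
    unfolding I[symmetric] by (rule fubini_cis(1)[OF f k])
  finally have eq: "complex_of_real (?cc * (LINT x|lborel. (f x)\<^sup>2)) = (LINT \<xi>|lborel. \<kappa> \<xi> * fourier f \<xi>)" by simp
  have pw: "norm (\<kappa> \<xi> * fourier f \<xi>) \<le> L\<^sup>2 * wt \<xi>" for \<xi>
  proof -
    have "norm (\<kappa> \<xi> * fourier f \<xi>) \<le> (L * wt \<xi>) * (L * wt \<xi>)"
      unfolding norm_mult \<kappa>_def using b[of "0 - \<xi>"] b[of \<xi>] L wt_nonneg[of \<xi>] by (intro mult_mono) (auto simp: wt_def)
    also have "\<dots> = L\<^sup>2 * (wt \<xi> * wt \<xi>)" by (simp add: power2_eq_square mult_ac)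
    also have "\<dots> \<le> L\<^sup>2 * (wt \<xi> * 1)" using wt_le_1[of \<xi>] wt_nonneg[of \<xi>] by (intro mult_left_mono) auto
    finally show ?thesis by simp
  qed
  have i2: "integrable lborel (\<lambda>\<xi>. L\<^sup>2 * wt (\<xi>::'a))" by (intro integrable_mult_right wt_integrable)
  have "?cc * (LINT x|lborel. (f x)\<^sup>2) \<le> cmod (complex_of_real (?cc * (LINT x|lborel. (f x)\<^sup>2)))"
    by (simp only: norm_of_real abs_ge_self)
  also have "\<dots> \<le> (LINT \<xi>|lborel. L\<^sup>2 * wt (\<xi>::'a))"
    unfolding eq
  proof (rule order_trans[OF integral_norm_bound], rule integral_mono[OF _ i2 pw])
    show "integrable lborel (\<lambda>\<xi>. norm (\<kappa> \<xi> * fourier f \<xi>))"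
      using k ki by (intro Bochner_Integration.integrable_bound[OF i2]) (auto intro!: AE_I2 order_trans[OF pw] abs_ge_self)
  qed
  also have "\<dots> = L\<^sup>2 * ?w" by (rule integral_mult_right_zero)
  finally show "(LINT x|lborel. (f x)\<^sup>2) \<le> ?w / ?cc * L\<^sup>2" using cc by (simp add: field_simps)
qed

section \<open>Moments and distance of the stationary densities\<close>

context kern
begin

lemma St_le: "0 \<le> c \<Longrightarrow> cmod (St c \<xi>) \<le> 1" by (simp add: St_def)

lemma St_mom:
  assumes c: "0 \<le> c" "c \<le> 1" and r: "0 < r" and i: "i \<in> Basis"
  shows "1 - Re (St c (r *\<^sub>R i)) \<le> (2 + C0) * min 1 r"
proof (cases "r \<le> 1")
  case True
  have "1 - Re (St c (r *\<^sub>R i)) = 1 - exp (- (c * r powr (2 * s)))" using i r by (simp add: St_def)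
  also have "\<dots> \<le> c * r powr (2 * s)" using exp_ge_add_one_self[of "- (c * r powr (2 * s))"] by linarith
  also have "\<dots> \<le> 1 * r powr 1" using True r s c by (intro mult_mono powr_mono') auto
  also have "\<dots> \<le> (2 + C0) * r" using r C0 by (simp add: distrib_right)
  finally show ?thesis using True by simp
next
  case False
  have "1 - Re (St c (r *\<^sub>R i)) \<le> 1" by (simp add: St_def)
  then show ?thesis using False C0 by simp
qed

lemma St_integrable:
  assumes P: "\<And>x::real. 0 \<le> x \<Longrightarrow> x powr 0 * exp (- x / 4) * (1 + x\<^sup>2) ^ DIM('a) \<le> P1" and c: "1 / 4 \<le> c"
  shows "integrable lborel (St c)"
proof (rule Bochner_Integration.integrable_bound)
  show "integrable lborel (\<lambda>\<xi>::'a. 2 * (P1 * wt \<xi>))" by (intro integrable_mult_right wt_integrable)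
  show "AE \<xi> in lborel. norm (St c \<xi>) \<le> norm (2 * (P1 * wt \<xi>))"
  proof (rule AE_I2)
    fix \<xi> :: 'a
    \<comment> \<open>At \<open>\<xi> = 0\<close> the hypothesis on P1 yields no more than
      \<open>0 \<le> P1\<close>, because \<open>0 powr 0 = 0\<close>; it is therefore used at 1
      instead.\<close>
    have "exp (- norm \<xi> / 4) \<le> P1 * wt \<xi>"
    proof (cases "\<xi> = 0")
      case True
      have "exp (- 1 / 4 :: real) * (1 + 1) ^ DIM('a) \<le> P1" using P[of 1] by simp
      moreover have "1 \<le> exp (- 1 / 4 :: real) * (1 + 1) ^ DIM('a)"
      proof -
        have "(3::real) / 4 \<le> exp (- 1 / 4)" using exp_ge_add_one_self[of "- 1 / 4"] by simp
        moreover have "(2::real) ^ 1 \<le> 2 ^ DIM('a)" by (rule power_increasing) (auto simp: Suc_le_eq)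
        ultimately have "3 / 4 * 2 \<le> exp (- 1 / 4) * (2::real) ^ DIM('a)" by (intro mult_mono) auto
        then show ?thesis by simp
      qed
      ultimately show ?thesis using True by (simp add: wt_def)
    next
      case False
      then show ?thesis using P[of "norm \<xi>"] by (simp add: wt_def pos_le_divide_eq add_pos_nonneg)
    qed
    then show "norm (St c \<xi>) \<le> norm (2 * (P1 * wt \<xi>))" using St_bound[OF c, of \<xi>] by simp
  qed
  show "St c \<in> borel_measurable lborel" using borel_measurable_continuous_onI[OF St_cont] by simp
qed

definition MM :: "real \<Rightarrow> real" where
  "MM m = 1 + DIM('a) * ((2 + C0) * (LINT r|lborel. min 1 r * qq m r) / cm m)"

lemma density_moment:
  fixes F :: "'a \<Rightarrow> real"
  assumes m: "0 < m" "m < 1" and F: "prob_density F"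
    and b: "\<And>r i. 0 < r \<Longrightarrow> i \<in> Basis \<Longrightarrow> 1 - Re (fourier F (r *\<^sub>R i)) \<le> (2 + C0) * min 1 r"
  shows "integrable lborel (\<lambda>x. jbr x powr m * F x)" "L1k_norm m F \<le> MM m"
proof -
  have Fp: "integrable lborel F" "(LINT x|lborel. F x) = 1" "\<And>x. 0 \<le> F x"
    using F by (auto simp: prob_density_def)
  have mi: "integrable lborel (\<lambda>x. \<bar>x \<bullet> i\<bar> powr m * F x)"
    and mb: "(LINT x|lborel. \<bar>x \<bullet> i\<bar> powr m * F x) \<le> (2 + C0) * (LINT r|lborel. min 1 r * qq m r) / cm m"
    if i: "i \<in> Basis" for i
    using moment_bound[OF m Fp(1), of i "2 + C0"] Fp b[OF _ i] by auto
  show "integrable lborel (\<lambda>x. jbr x powr m * F x)"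
    by (rule L1k_norm_moments(1)) (use m Fp mi in auto)
  have "L1k_norm m F \<le> (LINT x|lborel. \<bar>F x\<bar>) + (\<Sum>i\<in>Basis. LINT x|lborel. \<bar>x \<bullet> i\<bar> powr m * \<bar>F x\<bar>)"
    by (rule L1k_norm_moments(2)) (use m Fp mi in auto)
  also have "\<dots> \<le> 1 + (\<Sum>i\<in>(Basis::'a set). (2 + C0) * (LINT r|lborel. min 1 r * qq m r) / cm m)"
  proof (rule add_mono)
    show "(\<Sum>i\<in>Basis. LINT x|lborel. \<bar>x \<bullet> i\<bar> powr m * \<bar>F x\<bar>) \<le> (\<Sum>i\<in>(Basis::'a set). (2 + C0) * (LINT r|lborel. min 1 r * qq m r) / cm m)"
    proof (rule sum_mono)
      fix i :: 'a assume "i \<in> Basis"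
      from mb[OF this] show "(LINT x|lborel. \<bar>x \<bullet> i\<bar> powr m * \<bar>F x\<bar>) \<le> (2 + C0) * (LINT r|lborel. min 1 r * qq m r) / cm m"
        using Fp(3) by simp
    qed
  qed (use Fp in simp)
  finally show "L1k_norm m F \<le> MM m" by (simp add: MM_def)
qed

text \<open>Integrability of \<open>Feps \<epsilon>\<close>, which produces the density F, is
  inherited from the stable transform through the bound on the difference. The moment bound for F is
  the limit of that for \<open>Eps\<close>, and the interpolation is applied with \<eta> =
  \<epsilon>^\<delta>.\<close>

lemma stationary_estimate:
  assumes e: "0 < \<epsilon>" "\<epsilon> \<le> 1" and k: "0 \<le> k" "k < m" "m < 1"
    and P: "\<And>x::real. 0 \<le> x \<Longrightarrow> x powr 0 * exp (- x / 4) * (1 + x\<^sup>2) ^ DIM('a) \<le> P1"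
    and diff: "\<And>\<xi>. cmod (Feps \<epsilon> \<xi> - St (1 / (2 * s)) \<xi>) \<le> L * \<epsilon> powr \<delta> * wt \<xi>"
  obtains F G where "prob_density F" "\<And>\<xi>. fourier F \<xi> = Feps \<epsilon> \<xi>" "in_L1k k F"
    "prob_density G" "\<And>\<xi>. fourier G \<xi> = St (1 / (2 * s)) \<xi>" "in_L1k k G"
    "L1k_norm k (\<lambda>x. F x - G x) \<le> ((LINT \<xi>|lborel. wt (\<xi>::'a)) / (2 * pi) ^ DIM('a) * L\<^sup>2 + unit_ball_vol (real DIM('a)) + 2 * MM m)
       * \<epsilon> powr ((m - k) / (m + real DIM('a) / 2) * \<delta>)"
proof -
  let ?c = "1 / (2 * s)" and ?cc = "complex_of_real ((2 * pi) ^ DIM('a))"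
  have m: "0 < m" "m < 1" using k by auto
  have c: "0 \<le> ?c" "1 / 4 \<le> ?c" "?c \<le> 1" using s by (auto simp: field_simps)
  have Si: "integrable lborel (St ?c)" by (rule St_integrable[OF P c(2)])
  have Fm: "Feps \<epsilon> \<in> borel_measurable borel" by (rule gp_measurable[OF Feps_gp(1)[OF e(1)]])
  have Di: "integrable lborel (\<lambda>\<xi>. Feps \<epsilon> \<xi> - St ?c \<xi>)"
  proof (rule Bochner_Integration.integrable_bound)
    show "integrable lborel (\<lambda>\<xi>::'a. L * \<epsilon> powr \<delta> * wt \<xi>)" by (intro integrable_mult_right wt_integrable)
    show "AE \<xi> in lborel. norm (Feps \<epsilon> \<xi> - St ?c \<xi>) \<le> norm (L * \<epsilon> powr \<delta> * wt \<xi>)"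
      using diff by (intro AE_I2) (auto intro: order_trans[OF _ abs_ge_self])
    show "(\<lambda>\<xi>. Feps \<epsilon> \<xi> - St ?c \<xi>) \<in> borel_measurable lborel" using Fm Si by auto
  qed
  have Fi: "integrable lborel (Feps \<epsilon>)" using Bochner_Integration.integrable_add[OF Di Si] by simp
  obtain F where F: "integrable lborel F" "\<And>x. 0 \<le> F x" "\<And>\<xi>. fourier F \<xi> = Feps \<epsilon> \<xi>"
    "\<And>x. of_real (F x) = (LINT \<xi>|lborel. cis (x \<bullet> \<xi>) * Feps \<epsilon> \<xi>) / ?cc"
    by (rule gp_inversion[OF Feps_gp(1)[OF e(1)] Fi Feps_gp(2)[OF e(1)]]) blast
  obtain G where G: "integrable lborel G" "\<And>x. 0 \<le> G x" "\<And>\<xi>. fourier G \<xi> = St ?c \<xi>"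
    "\<And>x. of_real (G x) = (LINT \<xi>|lborel. cis (x \<bullet> \<xi>) * St ?c \<xi>) / ?cc"
    by (rule gp_inversion[OF St_gp[OF c(1)] Si St_cont]) blast
  have one: "(LINT x|lborel. H x) = 1" if "fourier H 0 = 1" for H :: "'a \<Rightarrow> real"
    using that by (simp add: of_real_eq_1_iff del: of_real_1)
  have "fourier F 0 = 1" "fourier G 0 = 1" unfolding F(3) G(3) using Feps_0 s by (auto simp: St_def)
  then have pF: "prob_density F" and pG: "prob_density G"
    using F(1,2) G(1,2) one[of F] one[of G] by (auto simp: prob_density_def)
  have momF: "1 - Re (fourier F (r *\<^sub>R i)) \<le> (2 + C0) * min 1 r" if "0 < r" "i \<in> Basis" for r i
  proof (rule tendsto_upperbound)
    show "((\<lambda>t. 1 - Re (Eps \<epsilon> t (r *\<^sub>R i))) \<longlongrightarrow> 1 - Re (fourier F (r *\<^sub>R i))) at_top"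
      unfolding F(3) by (intro tendsto_intros Eps_lim)
    show "eventually (\<lambda>t. 1 - Re (Eps \<epsilon> t (r *\<^sub>R i)) \<le> (2 + C0) * min 1 r) at_top"
      using Eps_mom[OF e(1) that] by simp
  qed simp
  have momG: "1 - Re (fourier G (r *\<^sub>R i)) \<le> (2 + C0) * min 1 r" if "0 < r" "i \<in> Basis" for r i
    unfolding G(3) by (rule St_mom[OF c(1,3) that])
  note dF = density_moment[OF m pF momF] and dG = density_moment[OF m pG momG]
  let ?f = "\<lambda>x. F x - G x"
  have fi: "integrable lborel ?f" using F G by simp
  have ff: "fourier ?f \<xi> = Feps \<epsilon> \<xi> - St ?c \<xi>" for \<xi>
    unfolding fourier_diff[OF F(1) G(1)] F(3) G(3) ..
  have inv: "of_real (?f x) = (LINT \<xi>|lborel. cis (x \<bullet> \<xi>) * fourier ?f \<xi>) / ?cc" for x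
  proof -
    have "of_real (?f x) = ((LINT \<xi>|lborel. cis (x \<bullet> \<xi>) * Feps \<epsilon> \<xi>) - (LINT \<xi>|lborel. cis (x \<bullet> \<xi>) * St ?c \<xi>)) / ?cc"
      unfolding of_real_diff F(4) G(4) by (rule diff_divide_distrib[symmetric])
    also have "(LINT \<xi>|lborel. cis (x \<bullet> \<xi>) * Feps \<epsilon> \<xi>) - (LINT \<xi>|lborel. cis (x \<bullet> \<xi>) * St ?c \<xi>) = (LINT \<xi>|lborel. cis (x \<bullet> \<xi>) * Feps \<epsilon> \<xi> - cis (x \<bullet> \<xi>) * St ?c \<xi>)"
      by (rule Bochner_Integration.integral_diff[symmetric]) (intro integrable_cis_mult_complex Fi Si, simp)+
    finally show ?thesis unfolding ff by (simp add: right_diff_distrib)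
  qed
  note Pl = Plancherel_le[OF fi _ inv, of "L * \<epsilon> powr \<delta>", unfolded ff, OF diff]
  have jm: "integrable lborel (\<lambda>x. jbr x powr m * F x + jbr x powr m * G x)" using dF(1) dG(1) by simp
  have fm: "integrable lborel (\<lambda>x. jbr x powr m * \<bar>?f x\<bar>)"
  proof (rule Bochner_Integration.integrable_bound[OF jm])
    show "AE x in lborel. norm (jbr x powr m * \<bar>?f x\<bar>) \<le> norm (jbr x powr m * F x + jbr x powr m * G x)"
    proof (rule AE_I2)
      fix x
      have "jbr x powr m * \<bar>?f x\<bar> \<le> jbr x powr m * (F x + G x)" using F(2)[of x] G(2)[of x] by (intro mult_left_mono) auto
      then show "norm (jbr x powr m * \<bar>?f x\<bar>) \<le> norm (jbr x powr m * F x + jbr x powr m * G x)"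
        using F(2)[of x] G(2)[of x] by (simp add: abs_mult distrib_left)
    qed
  qed (use F(1) G(1) in auto)
  have "(LINT x|lborel. jbr x powr m * \<bar>?f x\<bar>) \<le> (LINT x|lborel. jbr x powr m * F x + jbr x powr m * G x)"
  proof (rule integral_mono[OF fm jm])
    show "jbr x powr m * \<bar>?f x\<bar> \<le> jbr x powr m * F x + jbr x powr m * G x" for x
      unfolding distrib_left[symmetric] using F(2)[of x] G(2)[of x] by (intro mult_left_mono) auto
  qed
  also have "\<dots> = L1k_norm m F + L1k_norm m G"
    using dF(1) dG(1) F(2) G(2) by (simp add: L1k_norm_def)
  also have "\<dots> \<le> 2 * MM m" using dF(2) dG(2) by simp
  finally have fM: "(LINT x|lborel. jbr x powr m * \<bar>?f x\<bar>) \<le> 2 * MM m" .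
  let ?D = "(LINT \<xi>|lborel. wt (\<xi>::'a)) / (2 * pi) ^ DIM('a) * L\<^sup>2"
  have e\<delta>: "0 < \<epsilon> powr \<delta>" "\<epsilon> powr \<delta> \<le> 1" using e \<delta> by (auto intro: powr_le1)
  have "L1k_norm k ?f \<le> (?D + unit_ball_vol (real DIM('a)) + 2 * MM m) * (\<epsilon> powr \<delta>) powr ((m - k) / (m + real DIM('a) / 2))"
    by (rule interpolation[OF k e\<delta> _ Pl(1) _ fm fM]) (use fi Pl(2) in \<open>auto simp: power_mult_distrib mult.assoc\<close>)
  then have est: "L1k_norm k ?f \<le> (?D + unit_ball_vol (real DIM('a)) + 2 * MM m) * \<epsilon> powr ((m - k) / (m + real DIM('a) / 2) * \<delta>)"
    by (simp add: powr_powr mult.commute)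
  have L1k: "in_L1k k H" if H: "integrable lborel H" "integrable lborel (\<lambda>x. jbr x powr m * H x)" for H :: "'a \<Rightarrow> real"
    unfolding in_L1k_def
  proof
    show "integrable lborel (\<lambda>x. jbr x powr k * H x)"
      by (rule Bochner_Integration.integrable_bound[OF H(2)])
        (use H(1) k jbr_ge_1 in \<open>auto simp: abs_mult intro!: AE_I2 mult_right_mono powr_mono\<close>)
  qed (use H in auto)
  show ?thesis
    by (rule that[OF pF F(3) L1k[OF F(1) dF(1)] pG G(3) L1k[OF G(1) dG(1)] est])
qed

end

section \<open>Test functions\<close>

lemma power_le_exp: "0 \<le> x \<Longrightarrow> x ^ k \<le> real k ^ k * exp x"
proof (cases "k = 0")
  case False
  assume x: "0 \<le> x"
  have "x ^ k = real k ^ k * (x / real k) ^ k" using False by (simp add: power_divide)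
  also have "\<dots> \<le> real k ^ k * (1 + x / real k) ^ k" using x by (intro mult_left_mono power_mono) auto
  also have "\<dots> \<le> real k ^ k * exp x"
    using exp_ge_one_plus_x_over_n_power_n[of k x] False x by (intro mult_left_mono) auto
  finally show ?thesis .
qed simp

lemma poly_exp_bound:
  fixes P :: "real poly"
  obtains B where "\<And>x. 0 \<le> x \<Longrightarrow> \<bar>poly P x * exp (- x)\<bar> \<le> B"
proof
  fix x :: real assume x: "0 \<le> x"
  have "\<bar>poly P x\<bar> \<le> (\<Sum>i\<le>degree P. \<bar>coeff P i * x ^ i\<bar>)" unfolding poly_altdef by (rule sum_abs)
  also have "\<dots> \<le> (\<Sum>i\<le>degree P. \<bar>coeff P i\<bar> * (real i ^ i * exp x))"
    using x power_le_exp[OF x] by (intro sum_mono) (simp add: abs_mult mult_left_mono)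
  also have "\<dots> = (\<Sum>i\<le>degree P. \<bar>coeff P i\<bar> * real i ^ i) * exp x" by (simp add: sum_distrib_right mult.assoc)
  finally have "\<bar>poly P x\<bar> * exp (- x) \<le> (\<Sum>i\<le>degree P. \<bar>coeff P i\<bar> * real i ^ i) * exp x * exp (- x)" by (rule mult_right_mono) simp
  then show "\<bar>poly P x * exp (- x)\<bar> \<le> (\<Sum>i\<le>degree P. \<bar>coeff P i\<bar> * real i ^ i)"
    by (simp add: abs_mult mult.assoc flip: exp_add)
qed

lemma poly_exp_tendsto: "((\<lambda>x. poly P x * exp (- x)) \<longlongrightarrow> (0::real)) at_top"
proof -
  have "((\<lambda>x. \<Sum>i\<le>degree P. coeff P i * (x ^ i / exp x)) \<longlongrightarrow> (\<Sum>i\<le>degree P. coeff P i * 0)) at_top"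
    by (intro tendsto_intros tendsto_power_div_exp_0)
  moreover have "poly P x * exp (- x) = (\<Sum>i\<le>degree P. coeff P i * (x ^ i / exp x))" for x
    by (simp add: poly_altdef sum_distrib_right exp_minus divide_inverse mult.assoc)
  ultimately show ?thesis by simp
qed

text \<open>The functions P (1 / t) exp (- 1 / t), flat at 0. The family is closed under
  differentiation, P becoming X^2 (P - P'), so a single derivative computation gives
  smoothness.\<close>

definition fl :: "real poly \<Rightarrow> real \<Rightarrow> real" where
  "fl P t = (if 0 < t then poly P (1 / t) * exp (- (1 / t)) else 0)"

lemma fl_deriv: "(fl P has_real_derivative fl ([:0, 0, 1:] * (P - pderiv P)) t) (at t)"
proof -
  consider "0 < t" | "t < 0" | "t = 0" by linarith
  then show ?thesis
  proof cases
    case 1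
    have "((\<lambda>t. poly P (1 / t) * exp (- (1 / t))) has_real_derivative fl ([:0, 0, 1:] * (P - pderiv P)) t) (at t)"
      using 1 by (auto intro!: derivative_eq_intros poly_DERIV simp: fl_def field_simps power2_eq_square)
    then show ?thesis
      by (rule has_field_derivative_transform_within_open[of _ _ _ "{0<..}"]) (use 1 in \<open>auto simp: fl_def\<close>)
  next
    case 2
    have "((\<lambda>t. 0) has_real_derivative fl ([:0, 0, 1:] * (P - pderiv P)) t) (at t)" using 2 by (simp add: fl_def)
    then show ?thesis
      by (rule has_field_derivative_transform_within_open[of _ _ _ "{..<0}"]) (use 2 in \<open>auto simp: fl_def\<close>)
  next
    case 3
    \<comment> \<open>From the right the quotient is a function of the same kind with X P in place
      of P, hence it tends to 0.\<close>
    have "((\<lambda>h. fl P h / h) \<longlongrightarrow> 0) (at 0)"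
    proof (rule filterlim_split_at)
      have "eventually (\<lambda>h. 0 = fl P h / h) (at_left (0::real))"
        by (auto simp: fl_def eventually_at_filter)
      then show "((\<lambda>h. fl P h / h) \<longlongrightarrow> 0) (at_left 0)" by (rule tendsto_cong[THEN iffD1]) simp
      have "filterlim (\<lambda>h::real. 1 / h) at_top (at_right 0)"
        using filterlim_inverse_at_top_right by (simp add: inverse_eq_divide)
      from filterlim_compose[OF poly_exp_tendsto[of "[:0, 1:] * P"] this]
      have l: "((\<lambda>h. poly ([:0, 1:] * P) (1 / h) * exp (- (1 / h))) \<longlongrightarrow> 0) (at_right 0)" .
      have "eventually (\<lambda>h. poly ([:0, 1:] * P) (1 / h) * exp (- (1 / h)) = fl P h / h) (at_right (0::real))"
        by (auto simp: fl_def eventually_at_filter)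
      then show "((\<lambda>h. fl P h / h) \<longlongrightarrow> 0) (at_right 0)" using l by (rule tendsto_cong[THEN iffD1])
    qed
    then show ?thesis using 3 by (simp add: has_field_derivative_iff fl_def)
  qed
qed

lemma fl_bound: obtains B where "\<And>t. \<bar>fl P t\<bar> \<le> B"
proof -
  obtain B where B: "\<And>x. 0 \<le> x \<Longrightarrow> \<bar>poly P x * exp (- x)\<bar> \<le> B" using poly_exp_bound[of P] by blast
  have "0 \<le> B" using B[of 0] by linarith
  then have "\<bar>fl P t\<bar> \<le> B" for t using B[of "1 / t"] by (simp add: fl_def)
  then show ?thesis by (rule that)
qed

text \<open>\<open>D n\<close> is the n-th derivative of \<open>D 0\<close>. Carrying the whole
  sequence avoids iterated derivative operators, and its bounds feed the estimates of
  differences.\<close>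

definition jets :: "(nat \<Rightarrow> real \<Rightarrow> real) \<Rightarrow> bool" where
  "jets D \<longleftrightarrow> (\<forall>n t. (D n has_real_derivative D (Suc n) t) (at t)) \<and> (\<forall>n. \<exists>B. \<forall>t. \<bar>D n t\<bar> \<le> B)"

definition flj :: "nat \<Rightarrow> real \<Rightarrow> real" where
  "flj n = fl (((\<lambda>P. [:0, 0, 1:] * (P - pderiv P)) ^^ n) 1)"

text \<open>A shift by a quarter period per order writes all derivatives of cos in one
  formula.\<close>

definition cosj :: "nat \<Rightarrow> real \<Rightarrow> real" where "cosj n t = cos (t + real n * pi / 2)"

lemma jets_flj: "jets flj"
  unfolding jets_def
proof (intro conjI allI)
  show "(flj n has_real_derivative flj (Suc n) t) (at t)" for n t unfolding flj_def using fl_deriv by simp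
  show "\<exists>B. \<forall>t. \<bar>flj n t\<bar> \<le> B" for n unfolding flj_def by (meson fl_bound)
qed

lemma jets_cosj: "jets cosj"
  unfolding jets_def
proof (intro conjI allI)
  fix n t
  have "cos (t + real (Suc n) * pi / 2) = - sin (t + real n * pi / 2)"
    using cos_add[of "t + real n * pi / 2" "pi / 2"] by (simp add: algebra_simps add_divide_distrib)
  then show "(cosj n has_real_derivative cosj (Suc n) t) (at t)"
    unfolding cosj_def by (auto intro!: derivative_eq_intros)
  show "\<exists>B. \<forall>t. \<bar>cosj n t\<bar> \<le> B" for n by (rule exI[of _ 1]) (simp add: cosj_def)
qed

lemma jets_cont: "jets D \<Longrightarrow> continuous_on UNIV (D n)"
  unfolding jets_def by (meson DERIV_isCont continuous_at_imp_continuous_on)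

section \<open>Calculus of \<open>Ck\<close> functions\<close>

lemma Ck_cont: "Ck n f \<Longrightarrow> continuous_on UNIV f"
  by (cases n) auto

lemma Ck_SucD: "Ck (Suc n) f \<Longrightarrow> Ck n f"
proof (induction n arbitrary: f)
  case (Suc n)
  have "\<exists>g. (\<forall>x. ((\<lambda>h. f (x + h *\<^sub>R i)) has_real_derivative g x) (at 0)) \<and> Ck n g" if "i \<in> Basis" for i
  proof -
    obtain g where "\<forall>x. ((\<lambda>h. f (x + h *\<^sub>R i)) has_real_derivative g x) (at 0)" "Ck (Suc n) g"
      using Suc.prems \<open>i \<in> Basis\<close> by (auto simp del: Ck.simps simp: Ck.simps(2)[of "Suc n"])
    then show ?thesis using Suc.IH by blast
  qed
  then show ?case using Suc.prems by (auto dest: Ck_cont)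
qed auto

lemma Ck_add: "Ck n f \<Longrightarrow> Ck n g \<Longrightarrow> Ck n (\<lambda>x. f x + g x)"
proof (induction n arbitrary: f g)
  case (Suc n)
  have "\<exists>k. (\<forall>x. ((\<lambda>h. f (x + h *\<^sub>R i) + g (x + h *\<^sub>R i)) has_real_derivative k x) (at 0)) \<and> Ck n k" if i: "i \<in> Basis" for i
  proof -
    obtain f' where f': "\<And>x. ((\<lambda>h. f (x + h *\<^sub>R i)) has_real_derivative f' x) (at 0)" "Ck n f'"
      using Suc.prems(1) i by auto
    obtain g' where g': "\<And>x. ((\<lambda>h. g (x + h *\<^sub>R i)) has_real_derivative g' x) (at 0)" "Ck n g'"
      using Suc.prems(2) i by auto
    have "Ck n (\<lambda>x. f' x + g' x)" by (rule Suc.IH[OF f'(2) g'(2)])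
    moreover have "((\<lambda>h. f (x + h *\<^sub>R i) + g (x + h *\<^sub>R i)) has_real_derivative f' x + g' x) (at 0)" for x
      by (rule DERIV_add[OF f'(1) g'(1)])
    ultimately show ?thesis by (intro exI[of _ "\<lambda>x. f' x + g' x"]) simp
  qed
  then show ?case using Suc.prems by (auto intro!: continuous_intros)
qed (auto intro!: continuous_intros)

lemma Ck_mult: "Ck n f \<Longrightarrow> Ck n g \<Longrightarrow> Ck n (\<lambda>x. f x * g x)"
proof (induction n arbitrary: f g)
  case (Suc n)
  have "\<exists>k. (\<forall>x. ((\<lambda>h. f (x + h *\<^sub>R i) * g (x + h *\<^sub>R i)) has_real_derivative k x) (at 0)) \<and> Ck n k" if i: "i \<in> Basis" for i
  proof -
    obtain f' where f': "\<And>x. ((\<lambda>h. f (x + h *\<^sub>R i)) has_real_derivative f' x) (at 0)" "Ck n f'"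
      using Suc.prems(1) i by auto
    obtain g' where g': "\<And>x. ((\<lambda>h. g (x + h *\<^sub>R i)) has_real_derivative g' x) (at 0)" "Ck n g'"
      using Suc.prems(2) i by auto
    have "Ck n (\<lambda>x. f' x * g x + g' x * f x)"
      using Suc.IH[OF f'(2) Ck_SucD[OF Suc.prems(2)]] Suc.IH[OF g'(2) Ck_SucD[OF Suc.prems(1)]] by (rule Ck_add)
    moreover have "((\<lambda>h. f (x + h *\<^sub>R i) * g (x + h *\<^sub>R i)) has_real_derivative f' x * g x + g' x * f x) (at 0)" for x
      using DERIV_mult[OF f'(1)[of x] g'(1)[of x]] by simp
    ultimately show ?thesis by (intro exI[of _ "\<lambda>x. f' x * g x + g' x * f x"]) simp
  qed
  then show ?case using Suc.prems by (auto intro!: continuous_intros)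
qed (auto intro!: continuous_intros)

text \<open>A derivative of a ridge function is a ridge function with the next member of the jet and
  another prefactor, so the induction has to leave \<open>m\<close> and \<open>K\<close>
  free.\<close>

lemma Ck_ridge:
  assumes D: "jets D" shows "Ck n (\<lambda>x. K * D m (c + x \<bullet> v))"
proof (induction n arbitrary: m K)
  case (Suc n)
  have "((\<lambda>h. K * D m (c + (x + h *\<^sub>R i) \<bullet> v)) has_real_derivative (K * (i \<bullet> v)) * D (Suc m) (c + x \<bullet> v)) (at 0)" for x i
  proof -
    have "(D m has_real_derivative D (Suc m) (c + (x + 0 *\<^sub>R i) \<bullet> v)) (at (c + (x + 0 *\<^sub>R i) \<bullet> v))"
      using D unfolding jets_def by blast
    moreover have "((\<lambda>h. c + (x + h *\<^sub>R i) \<bullet> v) has_real_derivative i \<bullet> v) (at 0)"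
      by (auto intro!: derivative_eq_intros simp: inner_add_left)
    ultimately have "((\<lambda>h. D m (c + (x + h *\<^sub>R i) \<bullet> v)) has_real_derivative D (Suc m) (c + x \<bullet> v) * (i \<bullet> v)) (at 0)"
      using DERIV_chain2 by fastforce
    from DERIV_cmult[OF this, of K] show ?thesis by (simp add: mult_ac)
  qed
  moreover have "continuous_on UNIV (\<lambda>x. K * D m (c + x \<bullet> v))"
    by (intro continuous_intros continuous_on_compose2[OF jets_cont[OF D]]) auto
  moreover have "Ck n (\<lambda>x. (K * (i \<bullet> v)) * D (Suc m) (c + x \<bullet> v))" for i by (rule Suc.IH)
  ultimately show ?case unfolding Ck.simps(2)
    by (intro conjI ballI exI[of _ "\<lambda>x. (K * (_ \<bullet> v)) * D (Suc m) (c + x \<bullet> v)"] allI)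
next
  case 0
  show ?case by (auto intro!: continuous_intros continuous_on_compose2[OF jets_cont[OF D]])
qed

text \<open>Bounds for a function and its first and second differences; unlike derivative bounds they
  multiply without reference to any derivative.\<close>

definition SD :: "real \<Rightarrow> ('a::euclidean_space \<Rightarrow> real) \<Rightarrow> bool" where
  "SD C f \<longleftrightarrow> (\<forall>x. \<bar>f x\<bar> \<le> C) \<and> (\<forall>x y. \<bar>f (x + y) - f x\<bar> \<le> C * norm y) \<and>
     (\<forall>x y. \<bar>f (x + y) + f (x - y) - 2 * f x\<bar> \<le> C * (norm y)\<^sup>2)"

lemma SD_nonneg: "SD C f \<Longrightarrow> 0 \<le> C"
  unfolding SD_def using abs_ge_zero order_trans by blast

lemma SD_mult:
  assumes f: "SD C f" and g: "SD D g" shows "SD (4 * C * D) (\<lambda>x. f x * g x)"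
proof -
  have C: "0 \<le> C" "0 \<le> D" using SD_nonneg f g by auto
  have fb: "\<bar>f x\<bar> \<le> C" "\<bar>f (x + y) - f x\<bar> \<le> C * norm y" "\<bar>f (x + y) + f (x - y) - 2 * f x\<bar> \<le> C * (norm y)\<^sup>2" for x y
    using f unfolding SD_def by auto
  have gb: "\<bar>g x\<bar> \<le> D" "\<bar>g (x + y) - g x\<bar> \<le> D * norm y" "\<bar>g (x + y) + g (x - y) - 2 * g x\<bar> \<le> D * (norm y)\<^sup>2" for x y
    using g unfolding SD_def by auto
  have CD: "0 \<le> C * D" using C by simp
  show ?thesis unfolding SD_def
  proof (intro conjI allI)
    fix x y
    have "\<bar>f x * g x\<bar> \<le> C * D" unfolding abs_mult by (intro mult_mono fb gb C) auto
    then show "\<bar>f x * g x\<bar> \<le> 4 * C * D" using CD by simp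
    have "f (x + y) * g (x + y) - f x * g x = f (x + y) * (g (x + y) - g x) + (f (x + y) - f x) * g x"
      by (simp add: algebra_simps)
    also have "\<bar>\<dots>\<bar> \<le> C * (D * norm y) + (C * norm y) * D"
      by (intro order_trans[OF abs_triangle_ineq] add_mono; unfold abs_mult; intro mult_mono fb gb) (use C in auto)
    also have "\<dots> \<le> 4 * C * D * norm y"
      using mult_nonneg_nonneg[OF CD norm_ge_zero[of y]] by (simp add: algebra_simps)
    finally show "\<bar>f (x + y) * g (x + y) - f x * g x\<bar> \<le> 4 * C * D * norm y" .
    have l: "\<bar>f (x - y) - f x\<bar> \<le> C * norm y" "\<bar>g (x - y) - g x\<bar> \<le> D * norm y"
      using fb(2)[of x "-y"] gb(2)[of x "-y"] by simp_all
    \<comment> \<open>Discrete Leibniz rule: two second differences and two products of first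
      differences, whence the constant 4.\<close>
    have "f (x + y) * g (x + y) + f (x - y) * g (x - y) - 2 * (f x * g x) =
      (f x * (g (x + y) + g (x - y) - 2 * g x) + g x * (f (x + y) + f (x - y) - 2 * f x)) +
      ((f (x + y) - f x) * (g (x + y) - g x) + (f (x - y) - f x) * (g (x - y) - g x))"
      by (simp add: algebra_simps)
    also have "\<bar>\<dots>\<bar> \<le> (C * (D * (norm y)\<^sup>2) + D * (C * (norm y)\<^sup>2)) + ((C * norm y) * (D * norm y) + (C * norm y) * (D * norm y))"
      by (intro order_trans[OF abs_triangle_ineq] add_mono; (intro order_trans[OF abs_triangle_ineq] add_mono)?; unfold abs_mult; intro mult_mono fb gb l) (use C in auto)
    also have "\<dots> = 4 * C * D * (norm y)\<^sup>2" by (simp add: power2_eq_square algebra_simps)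
    finally show "\<bar>f (x + y) * g (x + y) + f (x - y) * g (x - y) - 2 * (f x * g x)\<bar> \<le> 4 * C * D * (norm y)\<^sup>2" .
  qed
qed

lemma SD_prod:
  assumes "finite A" "\<And>i. i \<in> A \<Longrightarrow> SD C (f i)" "1 \<le> C"
  shows "SD ((4 * C) ^ card A) (\<lambda>x. \<Prod>i\<in>A. f i x)"
  using assms
proof (induction rule: finite_induct)
  case empty
  show ?case by (simp add: SD_def)
next
  case (insert a A)
  have "SD (4 * C * (4 * C) ^ card A) (\<lambda>x. f a x * (\<Prod>i\<in>A. f i x))"
    using insert by (intro SD_mult) auto
  then show ?case using insert by simp
qed

text \<open>The direction v enters the three bounds with the powers 0, 1 and 2 of its length; for H
  >= 1 the factor H^2 dominates all of them.\<close>

lemma SD_ridge: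
  assumes D: "jets D"
  obtains C where "1 \<le> C" "\<And>c v H. norm (v::'a::euclidean_space) \<le> H \<Longrightarrow> 1 \<le> H \<Longrightarrow> SD (C * H\<^sup>2) (\<lambda>x. D 0 (c + x \<bullet> v))"
proof -
  obtain B0 B1 B2 where B: "\<And>t. \<bar>D 0 t\<bar> \<le> B0" "\<And>t. \<bar>D 1 t\<bar> \<le> B1" "\<And>t. \<bar>D 2 t\<bar> \<le> B2"
    using D unfolding jets_def by metis
  have d: "(D n has_real_derivative D (Suc n) t) (at t)" for n t using D unfolding jets_def by blast
  have Bp: "0 \<le> B0" "0 \<le> B1" "0 \<le> B2" using B order_trans[OF abs_ge_zero] by blast+
  define C where "C = 1 + B0 + B1 + B2"
  have lip: "\<bar>D n (t + h) - D n t\<bar> \<le> M * \<bar>h\<bar>" if M: "\<And>t. \<bar>D (Suc n) t\<bar> \<le> M" for n t h M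
    using field_differentiable_bound[of UNIV "D n" "D (Suc n)" M "t + h" t] d M by (auto simp: abs_minus_commute)
  \<comment> \<open>The second difference is the increment over [0, 1] of r -> D 0 (t + r h) + D 0
    (t - r h), whose derivative is a first difference of D 1.\<close>
  have sec: "\<bar>D 0 (t + h) + D 0 (t - h) - 2 * D 0 t\<bar> \<le> B2 * h\<^sup>2 * 2" for t h
  proof -
    have "((\<lambda>r. D 0 (t + r * h) + D 0 (t - r * h)) has_real_derivative (D 1 (t + r * h) - D 1 (t - r * h)) * h) (at r within {0..1})" for r
      by (rule DERIV_subset[of _ _ _ UNIV])
        (auto intro!: derivative_eq_intros DERIV_chain2[OF d[of 0, simplified]] simp: algebra_simps)
    moreover have "norm ((D 1 (t + r * h) - D 1 (t - r * h)) * h) \<le> B2 * h\<^sup>2 * 2" if "r \<in> {0..1}" for r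
    proof -
      have "\<bar>D 1 (t + r * h) - D 1 (t - r * h)\<bar> \<le> B2 * \<bar>2 * r * h\<bar>"
      proof -
        have e: "t - r * h + 2 * r * h = t + r * h" by simp
        show ?thesis using lip[of 1 B2 "t - r * h" "2 * r * h"] B(3) unfolding e by (simp add: numeral_2_eq_2)
      qed
      also have "\<dots> \<le> B2 * (2 * \<bar>h\<bar>)" using that Bp by (intro mult_left_mono) (auto simp: abs_mult mult_left_le_one_le)
      finally have "\<bar>D 1 (t + r * h) - D 1 (t - r * h)\<bar> * \<bar>h\<bar> \<le> B2 * (2 * \<bar>h\<bar>) * \<bar>h\<bar>" by (rule mult_right_mono) simp
      then show ?thesis by (simp add: abs_mult power2_eq_square mult_ac)
    qed
    ultimately have "norm ((D 0 (t + 1 * h) + D 0 (t - 1 * h)) - (D 0 (t + 0 * h) + D 0 (t - 0 * h))) \<le> B2 * h\<^sup>2 * 2 * norm (1 - 0 :: real)"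
      by (intro field_differentiable_bound[of "{0..1::real}"]) auto
    then show ?thesis by simp
  qed
  show ?thesis
  proof (rule that)
    show "1 \<le> 2 * C" using Bp by (simp add: C_def)
    fix c H :: real and v :: 'a assume v: "norm v \<le> H" "1 \<le> H"
    have H2: "1 \<le> H\<^sup>2" "H \<le> H\<^sup>2" using v by (auto simp: power2_eq_square intro: mult_mono[of 1 H 1 H, simplified])
    have ip: "\<bar>y \<bullet> v\<bar> \<le> H * norm y" for y using Cauchy_Schwarz_ineq2[of y v] mult_left_mono[OF v(1), of "norm y"] by (simp add: mult.commute)
    show "SD (2 * C * H\<^sup>2) (\<lambda>x. D 0 (c + x \<bullet> v))" unfolding SD_def
    proof (intro conjI allI)
      fix x y
      have "B0 \<le> 2 * C * 1" using Bp by (simp add: C_def)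
      also have "\<dots> \<le> 2 * C * H\<^sup>2" using Bp H2 by (intro mult_left_mono) (auto simp: C_def)
      finally show "\<bar>D 0 (c + x \<bullet> v)\<bar> \<le> 2 * C * H\<^sup>2" using B(1) order_trans by blast
      have "\<bar>D 0 (c + (x + y) \<bullet> v) - D 0 (c + x \<bullet> v)\<bar> \<le> B1 * \<bar>y \<bullet> v\<bar>"
        using lip[of 0 B1 "c + x \<bullet> v" "y \<bullet> v"] B(2) by (simp add: inner_add_left add.assoc)
      also have "\<dots> \<le> (2 * C) * (H\<^sup>2 * norm y)"
        using Bp ip[of y] H2 by (intro mult_mono order_trans[OF ip] mult_right_mono) (auto simp: C_def)
      finally show "\<bar>D 0 (c + (x + y) \<bullet> v) - D 0 (c + x \<bullet> v)\<bar> \<le> 2 * C * H\<^sup>2 * norm y" by (simp add: mult.assoc)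
      have "\<bar>D 0 (c + (x + y) \<bullet> v) + D 0 (c + (x - y) \<bullet> v) - 2 * D 0 (c + x \<bullet> v)\<bar> \<le> B2 * (y \<bullet> v)\<^sup>2 * 2"
        using sec[of "c + x \<bullet> v" "y \<bullet> v"] by (simp add: inner_add_left inner_diff_left add.assoc add_diff_eq)
      also have "\<dots> \<le> B2 * (H * norm y)\<^sup>2 * 2"
        using Bp ip[of y] v by (intro mult_right_mono mult_left_mono) (auto simp: abs_le_square_iff[symmetric] abs_mult)
      also have "\<dots> = 2 * B2 * (H\<^sup>2 * (norm y)\<^sup>2)" by (simp add: power_mult_distrib)
      also have "\<dots> \<le> 2 * C * (H\<^sup>2 * (norm y)\<^sup>2)" using Bp by (intro mult_right_mono) (auto simp: C_def)
      finally show "\<bar>D 0 (c + (x + y) \<bullet> v) + D 0 (c + (x - y) \<bullet> v) - 2 * D 0 (c + x \<bullet> v)\<bar> \<le> 2 * C * H\<^sup>2 * (norm y)\<^sup>2" by (simp add: mult.assoc)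
    qed
  qed
qed

text \<open>Frechet differentiability is isolated because the drift term of the weak formulation is
  a \<open>frechet_derivative\<close>, whereas \<open>Ck\<close> speaks of derivatives along the
  axes; continuity is asked of the partial derivatives only.\<close>

definition C1f :: "('a::euclidean_space \<Rightarrow> real) \<Rightarrow> bool" where
  "C1f f \<longleftrightarrow> (\<exists>f'. (\<forall>x. (f has_derivative f' x) (at x)) \<and> (\<forall>i\<in>Basis. continuous_on UNIV (\<lambda>x. f' x i)))"

lemma C1f_const: "C1f (\<lambda>x. c)"
  unfolding C1f_def by (intro exI[of _ "\<lambda>x y. 0"]) auto

lemma C1f_cont: "C1f f \<Longrightarrow> continuous_on UNIV f"
  unfolding C1f_def by (meson continuous_at_imp_continuous_on has_derivative_continuous)

lemma C1f_mult:
  assumes f: "C1f f" and g: "C1f g" shows "C1f (\<lambda>x. f x * g x)"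
proof -
  obtain f' where f': "\<And>x. (f has_derivative f' x) (at x)" "\<And>i. i \<in> Basis \<Longrightarrow> continuous_on UNIV (\<lambda>x. f' x i)"
    using f unfolding C1f_def by blast
  obtain g' where g': "\<And>x. (g has_derivative g' x) (at x)" "\<And>i. i \<in> Basis \<Longrightarrow> continuous_on UNIV (\<lambda>x. g' x i)"
    using g unfolding C1f_def by blast
  show ?thesis unfolding C1f_def
  proof (intro exI[of _ "\<lambda>x h. f x * g' x h + f' x h * g x"] conjI allI ballI)
    show "((\<lambda>x. f x * g x) has_derivative (\<lambda>h. f x * g' x h + f' x h * g x)) (at x)" for x
      by (rule has_derivative_mult[OF f'(1) g'(1)])
    show "continuous_on UNIV (\<lambda>x. f x * g' x i + f' x i * g x)" if "i \<in> Basis" for i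
      by (intro continuous_intros C1f_cont f g f'(2) g'(2) that)
  qed
qed

lemma C1f_prod: "finite A \<Longrightarrow> (\<And>i. i \<in> A \<Longrightarrow> C1f (f i)) \<Longrightarrow> C1f (\<lambda>x. \<Prod>i\<in>A. f i x)"
  by (induction rule: finite_induct) (auto intro: C1f_const C1f_mult)

lemma C1f_ridge:
  fixes v :: "'a::euclidean_space"
  assumes D: "jets D" shows "C1f (\<lambda>x. K * D 0 (c + x \<bullet> v))"
  unfolding C1f_def
proof (intro exI[of _ "\<lambda>x h. K * (D 1 (c + x \<bullet> v) * (h \<bullet> v))"] conjI allI ballI)
  fix x :: 'a
  have "(D 0 has_derivative (\<lambda>h. D 1 (c + x \<bullet> v) * h)) (at (c + x \<bullet> v))"
    using D unfolding jets_def has_field_derivative_def by simp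
  moreover have "((\<lambda>x. c + x \<bullet> v) has_derivative (\<lambda>h. h \<bullet> v)) (at x)"
    by (auto intro!: derivative_eq_intros)
  ultimately have "((\<lambda>x. D 0 (c + x \<bullet> v)) has_derivative (\<lambda>h. D 1 (c + x \<bullet> v) * (h \<bullet> v))) (at x)"
    by (rule has_derivative_compose[rotated])
  then show "((\<lambda>x. K * D 0 (c + x \<bullet> v)) has_derivative (\<lambda>h. K * (D 1 (c + x \<bullet> v) * (h \<bullet> v)))) (at x)"
    by (rule has_derivative_mult_right)
  show "continuous_on UNIV (\<lambda>x. K * (D 1 (c + x \<bullet> v) * (i \<bullet> v)))" for i
    by (intro continuous_intros continuous_on_compose2[OF jets_cont[OF D]]) auto
qed

text \<open>The radial derivative, up to sign the adjoint of the drift div (x u).\<close>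

definition euler :: "('a::euclidean_space \<Rightarrow> real) \<Rightarrow> 'a \<Rightarrow> real" where
  "euler \<phi> y = frechet_derivative \<phi> (at y) y"

lemma C1f_derivative: "C1f \<phi> \<Longrightarrow> (\<phi> has_derivative frechet_derivative \<phi> (at x)) (at x)"
  unfolding C1f_def by (meson differentiableI frechet_derivative_works)

lemma euler_cont:
  fixes \<phi> :: "'a::euclidean_space \<Rightarrow> real"
  assumes p: "C1f \<phi>" shows "continuous_on UNIV (euler \<phi>)"
proof -
  obtain f' where f': "\<And>x. (\<phi> has_derivative f' x) (at x)" "\<And>i. i \<in> Basis \<Longrightarrow> continuous_on UNIV (\<lambda>x. f' x i)"
    using p unfolding C1f_def by blast
  have "euler \<phi> y = (\<Sum>i\<in>Basis. (y \<bullet> i) * f' y i)" for y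
  proof -
    have "euler \<phi> y = f' y y" unfolding euler_def by (simp add: frechet_derivative_at[OF f'(1), symmetric])
    also have "\<dots> = f' y (\<Sum>i\<in>Basis. (y \<bullet> i) *\<^sub>R i)" by (simp add: euclidean_representation)
    also have "\<dots> = (\<Sum>i\<in>Basis. (y \<bullet> i) * f' y i)"
      using has_derivative_linear[OF f'(1)[of y]] by (simp add: linear_sum linear_cmul)
    finally show ?thesis .
  qed
  then have "euler \<phi> = (\<lambda>y. \<Sum>i\<in>Basis. (y \<bullet> i) * f' y i)" by (rule ext)
  then show ?thesis by (auto intro!: continuous_intros f'(2))
qed

lemma euler_bounded:
  fixes \<phi> :: "'a::euclidean_space \<Rightarrow> real"
  assumes p: "C1f \<phi>" and b: "bounded {x. \<phi> x \<noteq> 0}"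
  obtains B where "\<And>y. \<bar>euler \<phi> y\<bar> \<le> B"
proof -
  obtain R where R: "\<And>x. \<phi> x \<noteq> 0 \<Longrightarrow> norm x \<le> R" using b by (auto simp: bounded_iff)
  have z: "euler \<phi> y = 0" if y: "y \<notin> cball 0 R" for y
  proof -
    have "(\<phi> has_derivative (\<lambda>h. 0)) (at y)"
    proof (rule has_derivative_transform_within_open[of "\<lambda>_. 0" _ _ UNIV "- cball 0 R"])
      show "0 = \<phi> x" if "x \<in> - cball 0 R" for x using R[of x] that by auto
    qed (use y in auto)
    then show ?thesis unfolding euler_def by (simp add: frechet_derivative_at[symmetric])
  qed
  have "bounded (euler \<phi> ` cball 0 R)"
    by (intro compact_imp_bounded compact_continuous_image continuous_on_subset[OF euler_cont[OF p]]) auto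
  then obtain B where "\<forall>x\<in>euler \<phi> ` cball 0 R. norm x \<le> B" unfolding bounded_iff by blast
  then have B: "y \<in> cball 0 R \<Longrightarrow> \<bar>euler \<phi> y\<bar> \<le> B" for y by auto
  have "\<bar>euler \<phi> y\<bar> \<le> max B 0" for y using B[of y] z[of y] by (cases "y \<in> cball 0 R") auto
  then show ?thesis by (rule that)
qed

lemma euler_dilate:
  assumes p: "C1f \<phi>" shows "frechet_derivative (\<lambda>x. \<phi> (c *\<^sub>R x)) (at y) y = euler \<phi> (c *\<^sub>R y)"
proof -
  have "((\<lambda>x. \<phi> (c *\<^sub>R x)) has_derivative (\<lambda>h. frechet_derivative \<phi> (at (c *\<^sub>R y)) (c *\<^sub>R h))) (at y)"
    by (rule has_derivative_compose[OF _ C1f_derivative[OF p]]) (auto intro!: derivative_eq_intros)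
  then show ?thesis by (simp add: frechet_derivative_at[symmetric] euler_def)
qed

lemma euler_time_deriv:
  assumes p: "C1f \<phi>"
  shows "((\<lambda>t. \<phi> (exp t *\<^sub>R y)) has_real_derivative euler \<phi> (exp t *\<^sub>R y)) (at t within S)"
proof -
  have "((\<lambda>t. exp t *\<^sub>R y) has_derivative (\<lambda>h. h *\<^sub>R (exp t *\<^sub>R y))) (at t within S)"
    by (auto intro!: derivative_eq_intros)
  from has_derivative_compose[OF this C1f_derivative[OF p]]
  have "((\<lambda>t. \<phi> (exp t *\<^sub>R y)) has_derivative (\<lambda>h. frechet_derivative \<phi> (at (exp t *\<^sub>R y)) (h *\<^sub>R (exp t *\<^sub>R y)))) (at t within S)" .
  then show ?thesis
    unfolding has_field_derivative_def euler_def
    by (rule has_derivative_eq_rhs)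
      (simp add: fun_eq_iff linear_cmul[OF has_derivative_linear[OF C1f_derivative[OF p]]])
qed

section \<open>From the weak formulation to the Fourier side\<close>

locale L1curve =
  fixes k :: real and u0 :: "'a::euclidean_space \<Rightarrow> real" and u :: "real \<Rightarrow> 'a \<Rightarrow> real"
  assumes k: "0 \<le> k" and curve: "L1k_curve k u0 u" and u0_L1k: "in_L1k k u0"
begin

lemma u0: "integrable lborel u0" using in_L1k_integrable(1)[OF u0_L1k k] .

lemma u_L1k: "0 \<le> t \<Longrightarrow> in_L1k k (u t)" using curve by (simp add: L1k_curve_def)

lemma u_int: "0 \<le> t \<Longrightarrow> integrable lborel (u t)"
  using in_L1k_integrable(1)[OF u_L1k k] .

lemma pair_int:
  fixes f L :: "'a \<Rightarrow> real"
  assumes "integrable lborel f" "L \<in> borel_measurable borel" "\<And>x. \<bar>L x\<bar> \<le> B"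
  shows "integrable lborel (\<lambda>x. f x * L x)"
proof (rule Bochner_Integration.integrable_bound[of _ "\<lambda>x. f x * B"])
  show "AE x in lborel. norm (f x * L x) \<le> norm (f x * B)"
    using order_trans[OF assms(3) abs_ge_self] by (intro AE_I2) (simp add: abs_mult mult_left_mono)
qed (use assms in auto)

lemma L1_le_L1k:
  fixes f :: "'a \<Rightarrow> real"
  assumes "integrable lborel f" "integrable lborel (\<lambda>x. jbr x powr k * f x)"
  shows "(LINT x|lborel. \<bar>f x\<bar>) \<le> L1k_norm k f"
  unfolding L1k_norm_def
proof (rule integral_mono)
  show "integrable lborel (\<lambda>x. jbr x powr k * \<bar>f x\<bar>)" using integrable_abs[OF assms(2)] by (simp add: abs_mult)
  show "\<bar>f x\<bar> \<le> jbr x powr k * \<bar>f x\<bar>" for x using mult_right_mono[OF jbr_powr_ge_1[OF k, of x] abs_ge_zero[of "f x"]] by simp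
qed (use assms in auto)

lemma u_cont:
  assumes t: "0 \<le> t" and X: "X \<longlonglongrightarrow> t" "\<And>n. 0 \<le> X n"
  shows "(\<lambda>n. LINT x|lborel. \<bar>u (X n) x - u t x\<bar>) \<longlonglongrightarrow> 0"
proof -
  have "((\<lambda>r. L1k_norm k (\<lambda>x. u r x - u t x)) \<longlongrightarrow> 0) (at t within {0..})"
    using curve t by (simp add: L1k_curve_def)
  \<comment> \<open>The limit in \<open>L1k_curve\<close> leaves out the point t itself. The value
    there is 0, so it is a statement of continuity and covers sequences that meet t.\<close>
  then have "((\<lambda>r. L1k_norm k (\<lambda>x. u r x - u t x)) \<longlongrightarrow> L1k_norm k (\<lambda>x. u t x - u t x)) (at t within {0..})"
    by (simp add: L1k_norm_def)
  then have "continuous (at t within {0..}) (\<lambda>r. L1k_norm k (\<lambda>x. u r x - u t x))"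
    by (simp add: continuous_within)
  then have "(\<lambda>n. L1k_norm k (\<lambda>x. u (X n) x - u t x)) \<longlonglongrightarrow> L1k_norm k (\<lambda>x. u t x - u t x)"
    using X by (auto simp: continuous_within_sequentially comp_def)
  then have "(\<lambda>n. L1k_norm k (\<lambda>x. u (X n) x - u t x)) \<longlonglongrightarrow> 0" by (simp add: L1k_norm_def)
  then show ?thesis
  proof (rule tendsto_sandwich[OF _ _ tendsto_const, rotated 2])
    show "eventually (\<lambda>n. (LINT x|lborel. \<bar>u (X n) x - u t x\<bar>) \<le> L1k_norm k (\<lambda>x. u (X n) x - u t x)) sequentially"
      using u_int[OF X(2)] u_int[OF t] in_L1k_integrable(2)[OF u_L1k[OF X(2)] k] in_L1k_integrable(2)[OF u_L1k[OF t] k]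
      by (intro always_eventually allI L1_le_L1k) (auto simp: right_diff_distrib)
  qed auto
qed

text \<open>Norm convergence of the curve against bounded pointwise convergence of the test
  functions: dominated convergence for the fixed function \<open>u t\<close>, the common bound for
  the difference. The limits of pairings below, in time and in the cut-off, are instances.\<close>

lemma pair_cont:
  assumes t: "0 \<le> t" and X: "X \<longlonglongrightarrow> t" "\<And>n. 0 \<le> X n"
    and L: "\<And>n. L n \<in> borel_measurable borel" "\<And>n x. \<bar>L n x\<bar> \<le> B" "\<And>x. (\<lambda>n. L n x) \<longlonglongrightarrow> L' x"
  shows "(\<lambda>n. LINT x|lborel. u (X n) x * L n x) \<longlonglongrightarrow> (LINT x|lborel. u t x * L' x)"
proof -
  have "(\<lambda>n. LINT x|lborel. u t x * L n x) \<longlonglongrightarrow> (LINT x|lborel. u t x * L' x)"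
  proof (rule integral_dominated_convergence[where w="\<lambda>x. \<bar>u t x\<bar> * B"])
    show "AE x in lborel. norm (u t x * L n x) \<le> \<bar>u t x\<bar> * B" for n
      using L(2)[of n] by (intro AE_I2) (simp add: abs_mult mult_left_mono)
    show "(\<lambda>x. u t x * L' x) \<in> borel_measurable lborel"
      using borel_measurable_LIMSEQ_metric[OF L(1,3)] u_int[OF t] by auto
  qed (use u_int[OF t] L in \<open>auto intro!: AE_I2 tendsto_intros\<close>)
  moreover have "(\<lambda>n. LINT x|lborel. (u (X n) x - u t x) * L n x) \<longlonglongrightarrow> 0"
  proof (rule Lim_null_comparison)
    have d: "integrable lborel (\<lambda>x. u (X n) x - u t x)" for n using u_int[OF X(2)] u_int[OF t] by auto
    show "eventually (\<lambda>n. norm (LINT x|lborel. (u (X n) x - u t x) * L n x) \<le> (LINT x|lborel. \<bar>u (X n) x - u t x\<bar>) * B) sequentially"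
    proof (intro always_eventually allI)
      fix n
      have "norm (LINT x|lborel. (u (X n) x - u t x) * L n x) \<le> (LINT x|lborel. \<bar>u (X n) x - u t x\<bar> * B)"
      proof (rule order_trans[OF integral_norm_bound], rule integral_mono)
        show "integrable lborel (\<lambda>x. norm ((u (X n) x - u t x) * L n x))"
          by (intro integrable_norm pair_int[OF d L(1) L(2)])
        show "norm ((u (X n) x - u t x) * L n x) \<le> \<bar>u (X n) x - u t x\<bar> * B" for x
          using L(2)[of n x] by (simp add: abs_mult mult_left_mono)
      qed (use d in auto)
      then show "norm (LINT x|lborel. (u (X n) x - u t x) * L n x) \<le> (LINT x|lborel. \<bar>u (X n) x - u t x\<bar>) * B" by simp
    qed
    show "(\<lambda>n. (LINT x|lborel. \<bar>u (X n) x - u t x\<bar>) * B) \<longlonglongrightarrow> 0"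
      by (intro tendsto_mult_left_zero u_cont t X)
  qed
  ultimately have "(\<lambda>n. (LINT x|lborel. u t x * L n x) + (LINT x|lborel. (u (X n) x - u t x) * L n x)) \<longlonglongrightarrow> (LINT x|lborel. u t x * L' x) + 0"
    by (rule tendsto_add)
  moreover have "(LINT x|lborel. u t x * L n x) + (LINT x|lborel. (u (X n) x - u t x) * L n x) = (LINT x|lborel. u (X n) x * L n x)" for n
    using pair_int[OF u_int[OF t] L(1) L(2), of n] pair_int[OF u_int[OF X(2)] L(1) L(2), of n n]
    by (simp add: left_diff_distrib Bochner_Integration.integral_diff)
  ultimately show ?thesis by simp
qed

lemma u_initial: "AE x in lborel. u 0 x = u0 x"
proof -
  have j: "integrable lborel (\<lambda>x. jbr x powr k * (u 0 x - u0 x))"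
    using in_L1k_integrable(2)[OF u_L1k k, of 0] in_L1k_integrable(2)[OF u0_L1k k] by (simp add: right_diff_distrib)
  then have "integrable lborel (\<lambda>x. jbr x powr k * \<bar>u 0 x - u0 x\<bar>)"
    using integrable_abs[OF j] by (simp add: abs_mult)
  moreover have "(LINT x|lborel. jbr x powr k * \<bar>u 0 x - u0 x\<bar>) = 0"
    using curve by (simp add: L1k_curve_def L1k_norm_def)
  ultimately have "AE x in lborel. jbr x powr k * \<bar>u 0 x - u0 x\<bar> = 0"
    by (subst (asm) integral_nonneg_eq_0_iff_AE) auto
  then show ?thesis
  proof eventually_elim
    fix x assume "jbr x powr k * \<bar>u 0 x - u0 x\<bar> = 0"
    then show "u 0 x = u0 x" using jbr_pos[of x] by simp
  qed
qed

end

context L1curve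
begin

text \<open>Testing with \<open>\<phi> (e\<^sup>t x)\<close> moves along the characteristics of the drift, so that its unbounded
  contribution disappears.\<close>

lemma transport:
  fixes \<phi> :: "'a \<Rightarrow> real" and G :: "real \<Rightarrow> 'a \<Rightarrow> real"
  assumes p: "C1f \<phi>" "bounded {x. \<phi> x \<noteq> 0}" "\<And>x. \<bar>\<phi> x\<bar> \<le> M"
    and G: "\<And>t. 0 \<le> t \<Longrightarrow> t \<le> T \<Longrightarrow> G t \<in> borel_measurable borel" "\<And>t. 0 \<le> t \<Longrightarrow> t \<le> T \<Longrightarrow> \<exists>B. \<forall>x. \<bar>G t x\<bar> \<le> B"
    and weak: "\<And>t r. 0 \<le> t \<Longrightarrow> t \<le> T \<Longrightarrow> 0 \<le> r \<Longrightarrow> (LINT x|lborel. u r x * \<phi> (exp t *\<^sub>R x)) = (LINT x|lborel. u0 x * \<phi> (exp t *\<^sub>R x)) +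
      (LBINT \<tau>=0..r. (LINT y|lborel. u \<tau> y * (G t y - frechet_derivative (\<lambda>x. \<phi> (exp t *\<^sub>R x)) (at y) y)))"
    and T: "0 \<le> T"
  shows "((\<lambda>t. LINT y|lborel. u t y * G t y) has_integral
    ((LINT x|lborel. u T x * \<phi> (exp T *\<^sub>R x)) - (LINT x|lborel. u0 x * \<phi> x))) {0..T}"
proof -
  define h where "h t = (LINT x|lborel. u t x * \<phi> (exp t *\<^sub>R x))" for t
  have pm[measurable]: "\<phi> \<in> borel_measurable borel" by (intro borel_measurable_continuous_onI C1f_cont p)
  have em[measurable]: "euler \<phi> \<in> borel_measurable borel" by (intro borel_measurable_continuous_onI euler_cont p)
  obtain Be where Be: "\<And>y. \<bar>euler \<phi> y\<bar> \<le> Be" using euler_bounded[OF p(1,2)] by blast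
  have deriv: "(h has_vector_derivative (LINT y|lborel. u t y * G t y)) (at t within {0..T})" if t: "t \<in> {0..T}" for t
  proof -
    have t0: "0 \<le> t" and tT: "t \<le> T" using t by auto
    obtain Bt where Bt: "\<And>x. \<bar>G t x\<bar> \<le> Bt" using G(2)[OF t0 tT] by blast
    have [measurable]: "G t \<in> borel_measurable borel" by (rule G(1)[OF t0 tT])
    let ?L = "\<lambda>y. G t y - euler \<phi> (exp t *\<^sub>R y)"
    have Lb: "\<bar>?L y\<bar> \<le> Bt + Be" for y using Bt[of y] Be[of "exp t *\<^sub>R y"] by linarith
    define f where "f = (\<lambda>\<tau>. LINT y|lborel. u \<tau> y * ?L y)"
    have fc: "continuous_on {0..T} f"
      unfolding continuous_on_sequentially f_def comp_def
      by (intro allI ballI impI pair_cont[where B="Bt + Be"]) (use Lb in auto)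
    \<comment> \<open>\<open>P\<close> freezes the test function at time t and is differentiated by
      the weak equation; \<open>Q\<close> below carries its motion. The radial derivatives in the
      two contributions cancel.\<close>
    define P where "P = (\<lambda>\<tau>. LINT x|lborel. u \<tau> x * \<phi> (exp t *\<^sub>R x))"
    have Peq: "P \<tau> = (LINT x|lborel. u0 x * \<phi> (exp t *\<^sub>R x)) + (LBINT r=ereal 0..ereal \<tau>. f r)" if "0 \<le> \<tau>" for \<tau>
      unfolding P_def f_def using weak[OF t0 tT that] by (simp add: euler_dilate[OF p(1)] zero_ereal_def)
    have "((\<lambda>\<tau>. (LINT x|lborel. u0 x * \<phi> (exp t *\<^sub>R x)) + (LBINT r=ereal 0..ereal \<tau>. f r)) has_vector_derivative 0 + f t) (at t within {0..T})"
      by (intro has_vector_derivative_add has_vector_derivative_const interval_integral_FTC2[OF _ _ fc]) (use t T in auto)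
    then have Pd: "(P has_vector_derivative f t) (at t within {0..T})"
      using has_vector_derivative_transform[OF t, of P "\<lambda>\<tau>. (LINT x|lborel. u0 x * \<phi> (exp t *\<^sub>R x)) + (LBINT r=ereal 0..ereal \<tau>. f r)" "f t"] Peq by simp
    \<comment> \<open>Since \<open>Q t\<close> vanishes, its difference quotient is a single pairing
      of the curve with difference quotients of the test function, and these are bounded by the
      bound for \<open>euler \<phi>\<close>.\<close>
    define Q where "Q = (\<lambda>\<tau>. LINT x|lborel. u \<tau> x * (\<phi> (exp \<tau> *\<^sub>R x) - \<phi> (exp t *\<^sub>R x)))"
    have Qd: "(Q has_real_derivative (LINT x|lborel. u t x * euler \<phi> (exp t *\<^sub>R x))) (at t within {0..T})"
      unfolding has_field_derivative_iff tendsto_at_iff_sequentially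
    proof (intro allI impI)
      fix X :: "nat \<Rightarrow> real" assume X: "\<forall>n. X n \<in> {0..T} - {t}" and Xl: "X \<longlonglongrightarrow> t"
      let ?q = "\<lambda>n x. (\<phi> (exp (X n) *\<^sub>R x) - \<phi> (exp t *\<^sub>R x)) / (X n - t)"
      have lim: "(\<lambda>n. LINT x|lborel. u (X n) x * ?q n x) \<longlonglongrightarrow> (LINT x|lborel. u t x * euler \<phi> (exp t *\<^sub>R x))"
      proof (rule pair_cont[OF t0 Xl, where B=Be])
        show "0 \<le> X n" for n using X by auto
        show "?q n \<in> borel_measurable borel" for n by measurable
        show "\<bar>?q n x\<bar> \<le> Be" for n x
        proof -
          have "norm (\<phi> (exp (X n) *\<^sub>R x) - \<phi> (exp t *\<^sub>R x)) \<le> Be * norm (X n - t)"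
            by (rule field_differentiable_bound[of UNIV "\<lambda>r. \<phi> (exp r *\<^sub>R x)" "\<lambda>r. euler \<phi> (exp r *\<^sub>R x)"])
              (use euler_time_deriv[OF p(1)] Be in auto)
          moreover have "0 < \<bar>X n - t\<bar>" using X by auto
          ultimately show ?thesis by (simp add: abs_divide pos_divide_le_eq)
        qed
        show "(\<lambda>n. ?q n x) \<longlonglongrightarrow> euler \<phi> (exp t *\<^sub>R x)" for x
          using euler_time_deriv[OF p(1), of x t "{0..T}"] X Xl
          unfolding has_field_derivative_iff tendsto_at_iff_sequentially by (auto simp: comp_def)
      qed
      have "(Q (X n) - Q t) / (X n - t) = (LINT x|lborel. u (X n) x * ?q n x)" for n
        unfolding Q_def by (simp flip: integral_divide_zero)
      then show "((\<lambda>\<tau>. (Q \<tau> - Q t) / (\<tau> - t)) \<circ> X) \<longlonglongrightarrow> (LINT x|lborel. u t x * euler \<phi> (exp t *\<^sub>R x))"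
        using lim unfolding comp_def by presburger
    qed
    have "((\<lambda>\<tau>. P \<tau> + Q \<tau>) has_vector_derivative f t + (LINT x|lborel. u t x * euler \<phi> (exp t *\<^sub>R x))) (at t within {0..T})"
      using Pd Qd[unfolded has_real_derivative_iff_has_vector_derivative] by (rule has_vector_derivative_add)
    moreover have "f t + (LINT x|lborel. u t x * euler \<phi> (exp t *\<^sub>R x)) = (LINT y|lborel. u t y * G t y)"
    proof -
      have "integrable lborel (\<lambda>y. u t y * G t y)" by (rule pair_int[OF u_int[OF t0] _ Bt]) simp
      moreover have "integrable lborel (\<lambda>y. u t y * euler \<phi> (exp t *\<^sub>R y))" by (rule pair_int[OF u_int[OF t0] _ Be]) simp
      ultimately show ?thesis unfolding f_def by (simp add: right_diff_distrib Bochner_Integration.integral_diff)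
    qed
    moreover have "P \<tau> + Q \<tau> = h \<tau>" if "\<tau> \<in> {0..T}" for \<tau>
    proof -
      have t0: "0 \<le> \<tau>" using that by simp
      have "integrable lborel (\<lambda>x. u \<tau> x * \<phi> (exp t *\<^sub>R x))" "integrable lborel (\<lambda>x. u \<tau> x * \<phi> (exp \<tau> *\<^sub>R x))"
        by (rule pair_int[OF u_int[OF t0] _ p(3)], measurable)+
      then show ?thesis unfolding P_def Q_def h_def by (simp add: right_diff_distrib Bochner_Integration.integral_diff)
    qed
    ultimately show ?thesis using has_vector_derivative_transform[OF t, of h "\<lambda>\<tau>. P \<tau> + Q \<tau>"] by simp
  qed
  have "((\<lambda>t. LINT y|lborel. u t y * G t y) has_integral (h T - h 0)) {0..T}"
    by (rule fundamental_theorem_of_calculus[OF T deriv])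
  moreover have "h 0 = (LINT x|lborel. u0 x * \<phi> x)"
    unfolding h_def by (rule integral_cong_AE) (use u_int[of 0] u0 u_initial in auto)
  ultimately show ?thesis by (simp add: h_def)
qed

end

text \<open>A smooth cut-off of size \<open>1 / \<rho>\<close> times a plane wave; the factor \<open>exp (2 * DIM('a))\<close> makes
  the cut-off tend to \<open>1\<close> as \<open>\<rho>\<close> tends to \<open>0\<close>.\<close>

definition tf :: "real \<Rightarrow> 'a::euclidean_space \<Rightarrow> real \<Rightarrow> 'a \<Rightarrow> real" where
  "tf \<rho> \<eta> \<alpha> x = (\<Prod>i\<in>Basis. flj 0 (1 + x \<bullet> (\<rho> *\<^sub>R i)) * flj 0 (1 + x \<bullet> ((-\<rho>) *\<^sub>R i))) * (exp (2 * real DIM('a)) * cosj 0 (\<alpha> + x \<bullet> \<eta>))"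

lemma tf_dilate: "tf \<rho> \<eta> \<alpha> (c *\<^sub>R x) = tf (c * \<rho>) (c *\<^sub>R \<eta>) \<alpha> x"
  unfolding tf_def by (simp add: mult_ac)

lemma Ck_const: "Ck n (\<lambda>x. c)"
  by (induction n arbitrary: c) (auto intro!: exI[of _ "\<lambda>x. 0"])

lemma Ck_prod: "finite A \<Longrightarrow> (\<And>i. i \<in> A \<Longrightarrow> Ck n (f i)) \<Longrightarrow> Ck n (\<lambda>x. \<Prod>i\<in>A. f i x)"
  by (induction rule: finite_induct) (auto intro: Ck_const Ck_mult)

lemma tf_C1f: "C1f (tf \<rho> (\<eta>::'a::euclidean_space) \<alpha>)"
proof -
  have f: "C1f (\<lambda>x. flj 0 (1 + x \<bullet> v))" "C1f (\<lambda>x. cosj 0 (\<alpha> + x \<bullet> v))" for v :: 'a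
    using C1f_ridge[OF jets_flj, of 1 1 v] C1f_ridge[OF jets_cosj, of 1 \<alpha> v] by simp_all
  show ?thesis unfolding tf_def[abs_def] by (intro C1f_mult C1f_prod f C1f_const finite_Basis)
qed

lemma tf_bounded_support:
  fixes \<eta> :: "'a::euclidean_space"
  assumes "0 < \<rho>" shows "bounded {x. tf \<rho> \<eta> \<alpha> x \<noteq> 0}"
proof -
  have "norm x \<le> real DIM('a) * (1 / \<rho>)" if "tf \<rho> \<eta> \<alpha> x \<noteq> 0" for x
  proof -
    have "\<bar>x \<bullet> i\<bar> \<le> 1 / \<rho>" if i: "i \<in> Basis" for i
    proof -
      have "flj 0 (1 + x \<bullet> (\<rho> *\<^sub>R i)) \<noteq> 0" "flj 0 (1 + x \<bullet> ((-\<rho>) *\<^sub>R i)) \<noteq> 0"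
        using \<open>tf \<rho> \<eta> \<alpha> x \<noteq> 0\<close> i unfolding tf_def by auto
      then have "0 < 1 + \<rho> * (x \<bullet> i)" "0 < 1 - \<rho> * (x \<bullet> i)" by (auto simp: flj_def fl_def split: if_splits)
      then have "\<rho> * \<bar>x \<bullet> i\<bar> \<le> 1" by (auto simp: abs_if)
      then show ?thesis using assms by (simp add: field_simps)
    qed
    then have "(\<Sum>i\<in>Basis. \<bar>x \<bullet> i\<bar>) \<le> (\<Sum>i\<in>(Basis::'a set). 1 / \<rho>)" by (intro sum_mono)
    then show ?thesis using norm_le_l1[of x] by simp
  qed
  then show ?thesis unfolding bounded_iff by blast
qed

lemma tf_test_fun: "0 < \<rho> \<Longrightarrow> test_fun (tf \<rho> (\<eta>::'a::euclidean_space) \<alpha>)"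
proof -
  assume r: "0 < \<rho>"
  have "Ck n (tf \<rho> \<eta> \<alpha>)" for n
  proof -
    have f: "Ck n (\<lambda>x. flj 0 (1 + x \<bullet> v))" "Ck n (\<lambda>x. cosj 0 (\<alpha> + x \<bullet> v))" for v :: 'a
      using Ck_ridge[OF jets_flj, of n 1 0 1 v] Ck_ridge[OF jets_cosj, of n 1 0 \<alpha> v] by simp_all
    show ?thesis unfolding tf_def[abs_def] by (intro Ck_mult Ck_prod f Ck_const finite_Basis)
  qed
  then show ?thesis unfolding test_fun_def using tf_bounded_support[OF r] by blast
qed

text \<open>One constant for all cut-off sizes and phases and all frequencies in a ball; it supplies
  the domination when \<rho> tends to 0.\<close>

lemma tf_SD: "\<exists>C\<ge>0. \<forall>\<rho> \<eta> \<alpha>. 0 \<le> \<rho> \<longrightarrow> \<rho> \<le> 1 \<longrightarrow> norm \<eta> \<le> H \<longrightarrow> SD C (tf \<rho> (\<eta>::'a::euclidean_space) \<alpha>)"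
proof -
  obtain C1 where C1: "1 \<le> C1" "\<And>c v H. norm (v::'a) \<le> H \<Longrightarrow> 1 \<le> H \<Longrightarrow> SD (C1 * H\<^sup>2) (\<lambda>x. flj 0 (c + x \<bullet> v))"
    using SD_ridge[OF jets_flj, where 'a='a] by blast
  obtain C2 where C2: "1 \<le> C2" "\<And>c v H. norm (v::'a) \<le> H \<Longrightarrow> 1 \<le> H \<Longrightarrow> SD (C2 * H\<^sup>2) (\<lambda>x. cosj 0 (c + x \<bullet> v))"
    using SD_ridge[OF jets_cosj, where 'a='a] by blast
  define Z where "Z = max 1 H"
  define K where "K = 4 * (4 * (4 * C1 * C1)) ^ DIM('a) * (4 * exp (2 * real DIM('a)) * (C2 * Z\<^sup>2))"
  have "SD K (tf \<rho> \<eta> \<alpha>)" if r: "0 \<le> \<rho>" "\<rho> \<le> 1" and e: "norm \<eta> \<le> H" for \<rho> \<alpha> and \<eta> :: 'a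
    unfolding tf_def[abs_def] K_def
  proof (intro SD_mult SD_prod finite_Basis)
    have "SD (C1 * 1\<^sup>2) (\<lambda>x. flj 0 (1 + x \<bullet> v))" if "norm v \<le> 1" for v :: 'a by (rule C1(2)[OF that]) simp
    then have f: "SD C1 (\<lambda>x. flj 0 (1 + x \<bullet> v))" if "norm v \<le> 1" for v :: 'a using that by simp
    show "SD C1 (\<lambda>x. flj 0 (1 + x \<bullet> \<rho> *\<^sub>R i))" if "i \<in> Basis" for i :: 'a
      by (rule f) (use that r in simp)
    show "SD C1 (\<lambda>x. flj 0 (1 + x \<bullet> (- \<rho>) *\<^sub>R i))" if "i \<in> Basis" for i :: 'a
      by (rule f) (use that r in simp)
    show "1 \<le> 4 * C1 * C1" using C1(1) mult_mono[OF C1(1) C1(1)] by simp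
    show "SD (exp (2 * real DIM('a))) (\<lambda>x. exp (2 * real DIM('a)))" by (simp add: SD_def)
    show "SD (C2 * Z\<^sup>2) (\<lambda>x. cosj 0 (\<alpha> + x \<bullet> \<eta>))" by (rule C2(2)) (use e in \<open>auto simp: Z_def\<close>)
  qed
  moreover have "0 \<le> K" using C1(1) C2(1) by (simp add: K_def)
  ultimately show ?thesis by blast
qed

lemma tf_lim:
  fixes \<eta> :: "'a::euclidean_space"
  assumes "\<rho> \<longlonglongrightarrow> 0"
  shows "(\<lambda>n. tf (\<rho> n) \<eta> \<alpha> x) \<longlonglongrightarrow> cos (\<alpha> + x \<bullet> \<eta>)"
proof -
  have f: "(\<lambda>n. flj 0 (1 + x \<bullet> (r n *\<^sub>R i))) \<longlonglongrightarrow> exp (-1)" if r: "r \<longlonglongrightarrow> 0" for r and i :: 'a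
  proof -
    have "(\<lambda>n. 1 + x \<bullet> (r n *\<^sub>R i)) \<longlonglongrightarrow> 1 + x \<bullet> (0 *\<^sub>R i)" by (intro tendsto_intros r)
    then have "(\<lambda>n. flj 0 (1 + x \<bullet> (r n *\<^sub>R i))) \<longlonglongrightarrow> flj 0 (1 + x \<bullet> (0 *\<^sub>R i))"
      by (intro continuous_on_tendsto_compose[OF jets_cont[OF jets_flj]]) auto
    then show ?thesis by (simp add: flj_def fl_def)
  qed
  have n: "(\<lambda>n. - \<rho> n) \<longlonglongrightarrow> 0" using tendsto_minus[OF assms] by simp
  have "(\<lambda>n. tf (\<rho> n) \<eta> \<alpha> x) \<longlonglongrightarrow> (\<Prod>i\<in>(Basis::'a set). exp (-1) * exp (-1)) * (exp (2 * real DIM('a)) * cosj 0 (\<alpha> + x \<bullet> \<eta>))"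
    unfolding tf_def by (intro tendsto_intros f assms n)
  also have "(\<Prod>i\<in>(Basis::'a set). exp (-1) * exp (-1 :: real)) = exp (- (2 * real DIM('a)))"
    by (simp flip: exp_add exp_of_nat_mult)
  finally show ?thesis by (simp add: cosj_def mult.assoc[symmetric] flip: exp_add)
qed

lemma Re_cis_fourier:
  fixes f :: "'a::euclidean_space \<Rightarrow> real"
  assumes f: "integrable lborel f"
  shows "(LINT y|lborel. f y * Re (c * cis (- (\<alpha> + y \<bullet> \<eta>)))) = Re (c * cis (- \<alpha>) * fourier f \<eta>)"
proof -
  have i: "integrable lborel (\<lambda>y. f y *\<^sub>R cis (- (y \<bullet> \<eta>)))" by (rule integrable_cis_mult[OF f]) simp
  have "Re (c * cis (- \<alpha>) * fourier f \<eta>) = Re (LINT y|lborel. c * cis (- \<alpha>) * (f y *\<^sub>R cis (- (y \<bullet> \<eta>))))"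
    unfolding fourier_cis by (simp only: integral_mult_right_zero)
  also have "\<dots> = (LINT y|lborel. Re (c * cis (- \<alpha>) * (f y *\<^sub>R cis (- (y \<bullet> \<eta>)))))"
    by (rule integral_Re[symmetric]) (intro integrable_mult_right i)
  also have "\<dots> = (LINT y|lborel. f y * Re (c * cis (- (\<alpha> + y \<bullet> \<eta>))))"
  proof (intro Bochner_Integration.integral_cong refl)
    fix y
    have "cis (- (\<alpha> + y \<bullet> \<eta>)) = cis (- \<alpha>) * cis (- (y \<bullet> \<eta>))" by (simp only: cis_mult minus_add_distrib)
    then show "Re (c * cis (- \<alpha>) * (f y *\<^sub>R cis (- (y \<bullet> \<eta>)))) = f y * Re (c * cis (- (\<alpha> + y \<bullet> \<eta>)))"
      by (simp only: mult_scaleR_right scaleR_complex.simps mult.assoc)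
  qed
  finally show ?thesis by simp
qed

context L1curve
begin

lemma norm_bounded: obtains B where "\<And>t. 0 \<le> t \<Longrightarrow> t \<le> T \<Longrightarrow> (LINT x|lborel. \<bar>u t x\<bar>) \<le> B"
proof -
  have "continuous_on {0..T} (\<lambda>t. LINT x|lborel. \<bar>u t x\<bar>)"
    unfolding continuous_on_sequentially comp_def
  proof (intro allI ballI impI)
    fix X t assume t: "t \<in> {0..T}" and X: "(\<forall>n. X n \<in> {0..T}) \<and> X \<longlonglongrightarrow> t"
    have t0: "0 \<le> t" "\<And>n. 0 \<le> X n" using t X by auto
    have "(\<lambda>n. (LINT x|lborel. \<bar>u (X n) x\<bar>) - (LINT x|lborel. \<bar>u t x\<bar>)) \<longlonglongrightarrow> 0"
    proof (rule Lim_null_comparison[OF always_eventually u_cont[OF t0(1) _ t0(2)]], rule allI)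
      fix n
      note [simp] = u_int[OF t0(1)] u_int[OF t0(2)]
      have "(LINT x|lborel. \<bar>u (X n) x\<bar>) - (LINT x|lborel. \<bar>u t x\<bar>) = (LINT x|lborel. \<bar>u (X n) x\<bar> - \<bar>u t x\<bar>)" by simp
      also have "norm \<dots> \<le> (LINT x|lborel. norm (\<bar>u (X n) x\<bar> - \<bar>u t x\<bar>))" by (rule integral_norm_bound)
      also have "\<dots> \<le> (LINT x|lborel. \<bar>u (X n) x - u t x\<bar>)" by (rule integral_mono) auto
      finally show "norm ((LINT x|lborel. \<bar>u (X n) x\<bar>) - (LINT x|lborel. \<bar>u t x\<bar>)) \<le> (LINT x|lborel. \<bar>u (X n) x - u t x\<bar>)" .
    qed (use X in simp)
    then show "(\<lambda>n. LINT x|lborel. \<bar>u (X n) x\<bar>) \<longlonglongrightarrow> (LINT x|lborel. \<bar>u t x\<bar>)" by (rule LIM_zero_cancel)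
  qed
  then have "bounded ((\<lambda>t. LINT x|lborel. \<bar>u t x\<bar>) ` {0..T})" by (intro compact_imp_bounded compact_continuous_image) auto
  then obtain B where "\<forall>y\<in>(\<lambda>t. LINT x|lborel. \<bar>u t x\<bar>) ` {0..T}. norm y \<le> B" unfolding bounded_iff by blast
  then have "(LINT x|lborel. \<bar>u t x\<bar>) \<le> B" if "0 \<le> t" "t \<le> T" for t using that by fastforce
  then show ?thesis by (rule that)
qed

end

text \<open>\<open>L\<close> is the adjoint operator applied to the test function \<open>tf\<close>,
  and \<open>mm\<close> is its symbol. A nonlocal operator does not act explicitly on a cut-off
  wave, so only a uniform bound and the limit \<rho> -> 0 are asked for; both equations then share
  the passage to the Fourier side.\<close>

locale weak_flow = L1curve k u0 u for k :: real and u0 :: "'a::euclidean_space \<Rightarrow> real" and u +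
  fixes L :: "real \<Rightarrow> 'a \<Rightarrow> real \<Rightarrow> 'a \<Rightarrow> real" and mm :: "'a \<Rightarrow> complex"
  assumes mm_cont: "continuous_on UNIV mm"
    and L_meas: "\<And>\<rho> \<eta> \<alpha>. 0 < \<rho> \<Longrightarrow> L \<rho> \<eta> \<alpha> \<in> borel_measurable borel"
    and L_bound: "\<And>H. \<exists>B. \<forall>\<rho> \<eta> \<alpha> x. 0 < \<rho> \<longrightarrow> \<rho> \<le> 1 \<longrightarrow> norm \<eta> \<le> H \<longrightarrow> \<bar>L \<rho> \<eta> \<alpha> x\<bar> \<le> B"
    and L_lim: "\<And>r \<eta> \<alpha> x. r \<longlonglongrightarrow> 0 \<Longrightarrow> (\<And>n. 0 < r n) \<Longrightarrow> (\<And>n. r n \<le> 1) \<Longrightarrow>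
       (\<lambda>n. L (r n) \<eta> \<alpha> x) \<longlonglongrightarrow> Re (mm \<eta> * cis (- (\<alpha> + x \<bullet> \<eta>)))"
    and weak: "\<And>\<rho> \<eta> \<alpha> T. 0 < \<rho> \<Longrightarrow> \<rho> \<le> 1 \<Longrightarrow> 0 \<le> T \<Longrightarrow> (LINT x|lborel. u T x * tf \<rho> \<eta> \<alpha> x) = (LINT x|lborel. u0 x * tf \<rho> \<eta> \<alpha> x) +
      (LBINT \<tau>=0..T. (LINT y|lborel. u \<tau> y * (L \<rho> \<eta> \<alpha> y - frechet_derivative (tf \<rho> \<eta> \<alpha>) (at y) y)))"
begin

text \<open>The test function moves with the flow as a wave of frequency exp t \<xi>. Removing the
  cut-off turns each pairing into the real part of a transform rotated by the phase \<alpha>; the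
  uniform bounds permit dominated convergence of the time integrals.\<close>

lemma flow_real:
  assumes T: "0 \<le> T"
  shows "((\<lambda>t. Re (cis (- \<alpha>) * (mm (exp t *\<^sub>R \<xi>) * fourier (u t) (exp t *\<^sub>R \<xi>)))) has_integral
    Re (cis (- \<alpha>) * (fourier (u T) (exp T *\<^sub>R \<xi>) - fourier u0 \<xi>))) {0..T}"
proof -
  define H where "H = exp T * norm \<xi>"
  \<comment> \<open>At time t the cut-off parameter is exp t times r n; the factor exp (- T) keeps
    it at most 1 on the whole interval, as the uniform bounds require.\<close>
  define r where "r n = exp (- T) / real (Suc n)" for n
  have r0: "0 < r n" for n by (simp add: r_def)
  have rt: "r n * exp t \<le> 1" if "t \<le> T" for n t
  proof -
    have "r n * exp t \<le> r n * exp T" using that r0[of n] by simp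
    also have "\<dots> = 1 / real (Suc n)" by (simp add: r_def exp_minus)
    finally show ?thesis by (simp add: divide_le_eq_1 order_trans)
  qed
  have rlim: "(\<lambda>n. exp t * r n) \<longlonglongrightarrow> 0" for t
    using tendsto_mult_right_zero[OF LIMSEQ_inverse_real_of_nat, of "exp t * exp (- T)"] by (simp add: r_def divide_inverse mult.assoc)
  have eH: "norm (exp t *\<^sub>R \<xi>) \<le> H" if "t \<le> T" for t using that by (simp add: H_def mult_right_mono)
  obtain BB where BB: "\<And>\<rho> \<eta> \<alpha> x. 0 < \<rho> \<Longrightarrow> \<rho> \<le> 1 \<Longrightarrow> norm \<eta> \<le> H \<Longrightarrow> \<bar>L \<rho> \<eta> \<alpha> x\<bar> \<le> BB" using L_bound[of H] by blast
  have "0 \<le> BB" using BB[of 1 0 0 0] order_trans[OF abs_ge_zero] by (simp add: H_def)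
  obtain C where C: "0 \<le> C" "\<And>\<rho> \<eta> \<alpha>. 0 \<le> \<rho> \<Longrightarrow> \<rho> \<le> 1 \<Longrightarrow> norm \<eta> \<le> H \<Longrightarrow> SD C (tf \<rho> (\<eta>::'a) \<alpha>)" using tf_SD[of H] by blast
  then have Cb: "\<bar>tf \<rho> \<eta> \<alpha> x\<bar> \<le> C" if "0 \<le> \<rho>" "\<rho> \<le> 1" "norm \<eta> \<le> H" for \<rho> \<alpha> x and \<eta> :: 'a
    using that unfolding SD_def by blast
  obtain U where U: "\<And>t. 0 \<le> t \<Longrightarrow> t \<le> T \<Longrightarrow> (LINT x|lborel. \<bar>u t x\<bar>) \<le> U" using norm_bounded by blast
  define G where "G n t = L (exp t * r n) (exp t *\<^sub>R \<xi>) \<alpha>" for n t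
  have Gm: "G n t \<in> borel_measurable borel" for n t unfolding G_def using r0 by (intro L_meas) simp
  have Gb: "\<bar>G n t x\<bar> \<le> BB" if "t \<le> T" for n t x unfolding G_def using r0 rt[OF that, of n] eH[OF that] by (intro BB) (auto simp: mult.commute)
  have Gi: "integrable lborel (\<lambda>y. u t y * G n t y)" if "0 \<le> t" "t \<le> T" for n t
    by (rule pair_int[OF u_int[OF that(1)] Gm Gb[OF that(2)]])
  define y where "y n = (LINT x|lborel. u T x * tf (exp T * r n) (exp T *\<^sub>R \<xi>) \<alpha> x) - (LINT x|lborel. u0 x * tf (r n) \<xi> \<alpha> x)" for n
  have step: "((\<lambda>t. LINT y|lborel. u t y * G n t y) has_integral y n) {0..T}" for n
  proof -
    have n: "r n \<le> 1" "norm \<xi> \<le> H" using rt[of 0 n] eH[of 0] T by auto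
    have "((\<lambda>t. LINT y|lborel. u t y * G n t y) has_integral
      ((LINT x|lborel. u T x * tf (r n) \<xi> \<alpha> (exp T *\<^sub>R x)) - (LINT x|lborel. u0 x * tf (r n) \<xi> \<alpha> x))) {0..T}"
    proof (rule transport[OF tf_C1f tf_bounded_support[OF r0] _ Gm _ _ T])
      show "\<bar>tf (r n) \<xi> \<alpha> x\<bar> \<le> C" for x using r0[of n] n by (intro Cb) auto
      show "\<exists>B. \<forall>x. \<bar>G n t x\<bar> \<le> B" if "t \<le> T" for t using Gb[OF that] by blast
    next
      fix t R :: real assume "0 \<le> t" "t \<le> T" "0 \<le> R"
      then show "(LINT x|lborel. u R x * tf (r n) \<xi> \<alpha> (exp t *\<^sub>R x)) = (LINT x|lborel. u0 x * tf (r n) \<xi> \<alpha> (exp t *\<^sub>R x)) +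
        (LBINT \<tau>=0..R. (LINT y|lborel. u \<tau> y * (G n t y - frechet_derivative (\<lambda>x. tf (r n) \<xi> \<alpha> (exp t *\<^sub>R x)) (at y) y)))"
        unfolding tf_dilate G_def using weak[of "exp t * r n" R "exp t *\<^sub>R \<xi>" \<alpha>] r0[of n] rt[of t n] by (simp add: mult.commute)
    qed
    then show ?thesis by (simp add: y_def tf_dilate)
  qed
  have tm: "tf \<rho> \<eta> \<alpha> \<in> borel_measurable borel" for \<rho> and \<eta> :: 'a by (intro borel_measurable_continuous_onI C1f_cont tf_C1f)
  have c1: "(\<lambda>n. LINT x|lborel. u T x * tf (exp T * r n) (exp T *\<^sub>R \<xi>) \<alpha> x) \<longlonglongrightarrow> (LINT x|lborel. u T x * cos (\<alpha> + x \<bullet> (exp T *\<^sub>R \<xi>)))"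
    by (rule pair_cont[OF T tendsto_const T, where B=C])
      (use tm rt[of T] r0 eH[of T] in \<open>auto intro!: Cb tf_lim rlim simp: mult.commute less_imp_le simp del: inner_scaleR_right\<close>)
  have c2: "(\<lambda>n. LINT x|lborel. u 0 x * tf (r n) \<xi> \<alpha> x) \<longlonglongrightarrow> (LINT x|lborel. u 0 x * cos (\<alpha> + x \<bullet> \<xi>))"
    by (rule pair_cont[OF _ tendsto_const, where B=C])
      (use tm rt[of 0] r0 eH[of 0] T rlim[of 0] in \<open>auto intro!: Cb tf_lim simp: less_imp_le simp del: inner_scaleR_right\<close>)
  have u00: "(LINT x|lborel. u0 x * f x) = (LINT x|lborel. u 0 x * f x)" if [measurable]: "f \<in> borel_measurable borel" for f :: "'a \<Rightarrow> real"
    by (rule integral_cong_AE) (use u_int[of 0] u0 u_initial in auto)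
  have co: "(LINT x|lborel. f x * cos (\<alpha> + x \<bullet> \<eta>)) = Re (cis (- \<alpha>) * fourier f \<eta>)" if "integrable lborel f" for f and \<eta> :: 'a
    using Re_cis_fourier[OF that, of 1 \<alpha> \<eta>] by (simp only: mult_1_left cis.simps cos_minus)
  have "y \<longlonglongrightarrow> (LINT x|lborel. u T x * cos (\<alpha> + x \<bullet> (exp T *\<^sub>R \<xi>))) - (LINT x|lborel. u0 x * cos (\<alpha> + x \<bullet> \<xi>))"
    unfolding y_def u00[OF tm] using tendsto_diff[OF c1 c2] by (simp add: u00)
  then have yl: "y \<longlonglongrightarrow> Re (cis (- \<alpha>) * (fourier (u T) (exp T *\<^sub>R \<xi>) - fourier u0 \<xi>))"
    by (simp only: co[OF u_int[OF T]] co[OF u0] right_diff_distrib minus_complex.simps)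
  show ?thesis
  proof (rule has_integral_dominated_convergence[OF step integrable_const_ivl[of "BB * U"] _ _ yl])
    show "\<forall>t\<in>{0..T}. norm (LINT y|lborel. u t y * G n t y) \<le> BB * U" for n
    proof
      fix t assume t: "t \<in> {0..T}"
      have "norm (LINT y|lborel. u t y * G n t y) \<le> (LINT y|lborel. norm (u t y * G n t y))" by (rule integral_norm_bound)
      also have "\<dots> \<le> (LINT y|lborel. BB * \<bar>u t y\<bar>)"
        using integrable_abs[OF Gi[of t n]] u_int[of t] Gb[of t n] t
        by (intro integral_mono) (auto simp: abs_mult mult.commute[of BB] intro!: mult_left_mono)
      also have "\<dots> \<le> BB * U" using U[of t] t \<open>0 \<le> BB\<close> by (simp add: mult_left_mono)
      finally show "norm (LINT y|lborel. u t y * G n t y) \<le> BB * U" .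
    qed
    show "\<forall>t\<in>{0..T}. (\<lambda>n. LINT y|lborel. u t y * G n t y) \<longlonglongrightarrow> Re (cis (- \<alpha>) * (mm (exp t *\<^sub>R \<xi>) * fourier (u t) (exp t *\<^sub>R \<xi>)))"
    proof
      fix t assume t: "t \<in> {0..T}"
      then have t0: "0 \<le> t" and tT: "t \<le> T" by auto
      have "(\<lambda>n. LINT y|lborel. u t y * G n t y) \<longlonglongrightarrow> (LINT y|lborel. u t y * Re (mm (exp t *\<^sub>R \<xi>) * cis (- (\<alpha> + y \<bullet> (exp t *\<^sub>R \<xi>)))))"
      proof (rule pair_cont[OF t0 tendsto_const t0 Gm Gb[OF tT]])
        show "(\<lambda>n. G n t x) \<longlonglongrightarrow> Re (mm (exp t *\<^sub>R \<xi>) * cis (- (\<alpha> + x \<bullet> exp t *\<^sub>R \<xi>)))" for x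
          unfolding G_def by (rule L_lim[OF rlim]) (use r0 rt[OF tT] in \<open>auto simp: mult.commute\<close>)
      qed
      then show "(\<lambda>n. LINT y|lborel. u t y * G n t y) \<longlonglongrightarrow> Re (cis (- \<alpha>) * (mm (exp t *\<^sub>R \<xi>) * fourier (u t) (exp t *\<^sub>R \<xi>)))"
        by (simp only: Re_cis_fourier[OF u_int[OF t0]] mult_ac)
    qed
  qed
qed

lemma flow:
  assumes T: "0 \<le> T"
  shows "((\<lambda>t. mm (exp t *\<^sub>R \<xi>) * fourier (u t) (exp t *\<^sub>R \<xi>)) has_integral
    fourier (u T) (exp T *\<^sub>R \<xi>) - fourier u0 \<xi>) {0..T}"
proof -
  \<comment> \<open>The phases 0 and pi / 2 recover the real and the imaginary part.\<close>
  have c: "cis (- (pi / 2)) = - \<i>" by (simp add: complex_eq_iff)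
  have "Re (cis (- (pi / 2)) * z) = Im z" for z unfolding c by simp
  then show ?thesis
    using flow_real[OF T, of 0 \<xi>] flow_real[OF T, of "pi / 2" \<xi>]
    unfolding has_integral_componentwise_iff[where 'b=complex]
    by (auto simp: Basis_complex_def inner_complex_def add.commute)
qed

text \<open>Along the ray the transform solves a scalar linear equation. At first only an integral
  identity is known: continuity comes from the indefinite integral, differentiability from
  continuity, and then the integrating factor exp (- M) concludes.\<close>

lemma fourier_flow:
  assumes T: "0 \<le> T"
  shows "fourier (u T) (exp T *\<^sub>R \<xi>) = fourier u0 \<xi> * exp (integral {0..T} (\<lambda>t. mm (exp t *\<^sub>R \<xi>)))"
proof -
  define D where "D t = fourier (u t) (exp t *\<^sub>R \<xi>)" for t
  define m where "m t = mm (exp t *\<^sub>R \<xi>)" for t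
  have mc: "continuous_on {0..T} m" unfolding m_def
    by (rule continuous_on_compose2[OF mm_cont]) (auto intro!: continuous_intros)
  have Di: "D t = fourier u0 \<xi> + integral {0..t} (\<lambda>t. m t * D t)" if "0 \<le> t" for t
    using integral_unique[OF flow[OF that, of \<xi>]] by (simp add: D_def m_def)
  have "(\<lambda>t. m t * D t) integrable_on {0..T}" using flow[OF T, of \<xi>] unfolding D_def m_def by blast
  then have "continuous_on {0..T} (\<lambda>t. fourier u0 \<xi> + integral {0..t} (\<lambda>t. m t * D t))"
    by (intro continuous_intros indefinite_integral_continuous_1)
  then have Dc: "continuous_on {0..T} D" by (rule continuous_on_eq) (simp add: Di)
  have Dd: "(D has_vector_derivative m t * D t) (at t within {0..T})" if t: "t \<in> {0..T}" for t
  proof -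
    have "((\<lambda>t. fourier u0 \<xi> + integral {0..t} (\<lambda>t. m t * D t)) has_vector_derivative 0 + m t * D t) (at t within {0..T})"
      by (intro has_vector_derivative_add has_vector_derivative_const integral_has_vector_derivative[OF _ t])
        (intro continuous_intros mc Dc)
    then show ?thesis
      using has_vector_derivative_transform[OF t, of D "\<lambda>t. fourier u0 \<xi> + integral {0..t} (\<lambda>t. m t * D t)"] Di by simp
  qed
  define M where "M t = integral {0..t} m" for t
  have Md: "(M has_vector_derivative m t) (at t within {0..T})" if "t \<in> {0..T}" for t
    unfolding M_def by (rule integral_has_vector_derivative[OF mc that])
  have "((\<lambda>t. D t * exp (- M t)) has_vector_derivative 0) (at t within {0..T})" if t: "t \<in> {0..T}" for t
  proof -
    have "((\<lambda>z. exp (- z)) has_field_derivative - exp (- M t)) (at (M t) within M ` {0..T})"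
      by (auto intro!: derivative_eq_intros)
    from field_vector_diff_chain_within[OF Md[OF t] this]
    have "((\<lambda>t. exp (- M t)) has_vector_derivative m t * - exp (- M t)) (at t within {0..T})" by (simp add: comp_def)
    from has_vector_derivative_mult[OF Dd[OF t] this] show ?thesis by (simp add: algebra_simps)
  qed
  then obtain c where c: "\<And>t. t \<in> {0..T} \<Longrightarrow> D t * exp (- M t) = c"
    using has_derivative_zero_constant[of "{0..T}" "\<lambda>t. D t * exp (- M t)"] unfolding has_vector_derivative_def by auto
  have "D T * exp (- M T) = D 0 * exp (- M 0)" using c[of T] c[of 0] T by simp
  moreover have "M 0 = 0" "D 0 = fourier u0 \<xi>" using Di[of 0] by (simp_all add: M_def)
  ultimately have "D T * exp (- M T) * exp (M T) = fourier u0 \<xi> * exp (M T)" by simp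
  then show ?thesis by (simp add: D_def M_def m_def[abs_def] mult.assoc flip: exp_add)
qed

text \<open>Reversing time places the given frequency at the end of the ray and makes the integral
  run along contractions, the form required by \<open>ou_curve\<close>. The right side depends on
  \<open>u0\<close> only, which amounts to uniqueness.\<close>

lemma fourier_solution:
  assumes t: "0 \<le> t"
  shows "fourier (u t) \<eta> = fourier u0 (exp (- t) *\<^sub>R \<eta>) * exp (LINT \<tau>|lborel. indicator {0..t} \<tau> *\<^sub>R mm (exp (- \<tau>) *\<^sub>R \<eta>))"
proof -
  have c: "continuous_on A (\<lambda>\<tau>. mm (exp (c * \<tau> + d) *\<^sub>R z))" for A :: "real set" and c d and z :: 'a
    by (rule continuous_on_compose2[OF mm_cont]) (auto intro!: continuous_intros)
  have "integral {0..t} (\<lambda>\<tau>. mm (exp (\<tau> - t) *\<^sub>R \<eta>)) = integral {- t..0} (\<lambda>\<tau>. mm (exp \<tau> *\<^sub>R \<eta>))"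
    using integral_shift_Icc_real[of 0 t "\<lambda>\<tau>. mm (exp \<tau> *\<^sub>R \<eta>)" "- t"] by (simp add: comp_def)
  also have "\<dots> = integral {0..t} (\<lambda>\<tau>. mm (exp (- \<tau>) *\<^sub>R \<eta>))"
    using Henstock_Kurzweil_Integration.integral_reflect_real[of t 0 "\<lambda>\<tau>. mm (exp (- \<tau>) *\<^sub>R \<eta>)"] by simp
  also have "\<dots> = (LINT \<tau>:{0..t}|lborel. mm (exp (- \<tau>) *\<^sub>R \<eta>))"
    by (rule set_borel_integral_eq_integral(2)[symmetric], rule borel_integrable_atLeastAtMost')
      (use c[of _ "-1" 0] in simp)
  finally have e: "integral {0..t} (\<lambda>\<tau>. mm (exp (\<tau> - t) *\<^sub>R \<eta>)) = (LINT \<tau>|lborel. indicator {0..t} \<tau> *\<^sub>R mm (exp (- \<tau>) *\<^sub>R \<eta>))"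
    unfolding set_lebesgue_integral_def .
  show ?thesis
    using fourier_flow[OF t, of "exp (- t) *\<^sub>R \<eta>"] by (simp add: e[symmetric] flip: exp_add)
qed

end

section \<open>Levy operators on test functions\<close>

text \<open>Signed so that nonnegative weights produce operators with nonnegative symbol, like the
  fractional Laplacian.\<close>

definition sd :: "('a::euclidean_space \<Rightarrow> real) \<Rightarrow> 'a \<Rightarrow> 'a \<Rightarrow> real" where
  "sd \<phi> x y = 2 * \<phi> x - \<phi> (x + y) - \<phi> (x - y)"

lemma sd_bound:
  assumes "SD C \<phi>" shows "\<bar>sd \<phi> x y\<bar> \<le> 4 * C * min 1 ((norm y)\<^sup>2)"
proof -
  have C: "0 \<le> C" using SD_nonneg[OF assms] .
  have b: "\<bar>\<phi> x\<bar> \<le> C" for x using assms unfolding SD_def by blast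
  have "\<bar>\<phi> (x + y) + \<phi> (x - y) - 2 * \<phi> x\<bar> \<le> C * (norm y)\<^sup>2" using assms unfolding SD_def by blast
  then have "\<bar>sd \<phi> x y\<bar> \<le> C * (norm y)\<^sup>2" unfolding sd_def by linarith
  moreover have "C * (norm y)\<^sup>2 \<le> 4 * C * (norm y)\<^sup>2" using C by (simp add: mult_right_mono)
  moreover have "\<bar>sd \<phi> x y\<bar> \<le> 4 * C" unfolding sd_def using b[of x] b[of "x + y"] b[of "x - y"] by linarith
  ultimately show ?thesis by (auto simp: min_def)
qed

text \<open>The Levy measure is the image of \<open>W\<close> under the jump map \<open>z\<close>.
  Parametrising it from another space allows a mixture of Gaussians to be used without computing its
  density on the target space.\<close>

locale levy =
  fixes W :: "'b::euclidean_space \<Rightarrow> real" and z :: "'b \<Rightarrow> 'a::euclidean_space"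
  assumes Wm[measurable]: "W \<in> borel_measurable borel" and zm[measurable]: "z \<in> borel_measurable borel"
    and Wnn: "\<And>p. 0 \<le> W p" and Wint: "integrable lborel (\<lambda>p. W p * min 1 ((norm (z p))\<^sup>2))"
begin

definition lg :: "('a \<Rightarrow> real) \<Rightarrow> 'a \<Rightarrow> real" where
  "lg \<phi> x = (LINT p|lborel. W p * sd \<phi> x (z p))"

definition mass :: real where "mass = (LINT p|lborel. W p * min 1 ((norm (z p))\<^sup>2))"

lemma W_sd_bound: "SD C \<phi> \<Longrightarrow> \<bar>W p * sd \<phi> x (z p)\<bar> \<le> 4 * C * (W p * min 1 ((norm (z p))\<^sup>2))"
  using mult_left_mono[OF sd_bound[of C \<phi> x "z p"] Wnn[of p]] Wnn[of p] by (simp add: abs_mult mult_ac)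

lemma W_sd_integrable:
  assumes "SD C \<phi>" and [measurable]: "\<phi> \<in> borel_measurable borel"
  shows "integrable lborel (\<lambda>p. W p * sd \<phi> x (z p))"
proof (rule Bochner_Integration.integrable_bound)
  show "integrable lborel (\<lambda>p. 4 * C * (W p * min 1 ((norm (z p))\<^sup>2)))" by (intro integrable_mult_right Wint)
  show "(\<lambda>p. W p * sd \<phi> x (z p)) \<in> borel_measurable lborel" unfolding sd_def by measurable
  show "AE p in lborel. norm (W p * sd \<phi> x (z p)) \<le> norm (4 * C * (W p * min 1 ((norm (z p))\<^sup>2)))"
    using W_sd_bound[OF assms(1)] by (intro AE_I2) (metis abs_ge_self order_trans real_norm_def)
qed

lemma lg_bound:
  assumes "SD C \<phi>" "\<phi> \<in> borel_measurable borel" shows "\<bar>lg \<phi> x\<bar> \<le> 4 * C * mass"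
proof -
  have "\<bar>lg \<phi> x\<bar> \<le> (LINT p|lborel. \<bar>W p * sd \<phi> x (z p)\<bar>)" unfolding lg_def by (rule integral_abs_bound)
  also have "\<dots> \<le> (LINT p|lborel. 4 * C * (W p * min 1 ((norm (z p))\<^sup>2)))"
    by (intro integral_mono integrable_abs W_sd_integrable[OF assms] integrable_mult_right Wint W_sd_bound assms(1))
  finally show ?thesis by (simp add: mass_def)
qed

lemma lg_lim:
  assumes "\<And>n. SD C (\<phi> n)" and [measurable]: "\<And>n. \<phi> n \<in> borel_measurable borel" and l: "\<And>x. (\<lambda>n. \<phi> n x) \<longlonglongrightarrow> \<psi> x"
  shows "(\<lambda>n. lg (\<phi> n) x) \<longlonglongrightarrow> lg \<psi> x"
  unfolding lg_def
proof (rule integral_dominated_convergence)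
  have [measurable]: "\<psi> \<in> borel_measurable borel" by (rule borel_measurable_LIMSEQ_metric[OF assms(2) l])
  show "(\<lambda>p. W p * sd \<psi> x (z p)) \<in> borel_measurable lborel" "(\<lambda>p. W p * sd (\<phi> n) x (z p)) \<in> borel_measurable lborel" for n
    unfolding sd_def by measurable
  show "integrable lborel (\<lambda>p. 4 * C * (W p * min 1 ((norm (z p))\<^sup>2)))" by (intro integrable_mult_right Wint)
  show "AE p in lborel. norm (W p * sd (\<phi> n) x (z p)) \<le> 4 * C * (W p * min 1 ((norm (z p))\<^sup>2))" for n
    using W_sd_bound[OF assms(1)] by (intro AE_I2) simp
  show "AE p in lborel. (\<lambda>n. W p * sd (\<phi> n) x (z p)) \<longlonglongrightarrow> W p * sd \<psi> x (z p)"
    unfolding sd_def by (intro AE_I2 tendsto_intros l)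
qed

lemma lg_cont:
  assumes "SD C \<phi>" and c: "continuous_on UNIV \<phi>" shows "continuous_on UNIV (lg \<phi>)"
  unfolding continuous_on_sequentially comp_def
proof (intro allI ballI impI)
  fix X :: "nat \<Rightarrow> 'a" and x :: 'a assume X: "(\<forall>n. X n \<in> UNIV) \<and> X \<longlonglongrightarrow> x"
  \<comment> \<open>The variation of the point is moved onto the function, so that
    \<open>lg_lim\<close> applies; the bounds in \<open>SD\<close> are invariant under
    translation.\<close>
  have e: "lg (\<lambda>y. \<phi> (y + (X n - x))) x = lg \<phi> (X n)" for n
    unfolding lg_def sd_def by (simp add: algebra_simps)
  have "(\<lambda>n. lg (\<lambda>y. \<phi> (y + (X n - x))) x) \<longlonglongrightarrow> lg \<phi> x"
  proof (rule lg_lim)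
    have "SD C (\<lambda>y. \<phi> (y + h))" for h
      unfolding SD_def
    proof (intro conjI allI)
      fix y w
      show "\<bar>\<phi> (y + h)\<bar> \<le> C" using assms(1) unfolding SD_def by blast
      have "\<bar>\<phi> ((y + h) + w) - \<phi> (y + h)\<bar> \<le> C * norm w" using assms(1) unfolding SD_def by blast
      then show "\<bar>\<phi> (y + w + h) - \<phi> (y + h)\<bar> \<le> C * norm w" by (simp add: add_ac)
      have "\<bar>\<phi> ((y + h) + w) + \<phi> ((y + h) - w) - 2 * \<phi> (y + h)\<bar> \<le> C * (norm w)\<^sup>2" using assms(1) unfolding SD_def by blast
      then show "\<bar>\<phi> (y + w + h) + \<phi> (y - w + h) - 2 * \<phi> (y + h)\<bar> \<le> C * (norm w)\<^sup>2" by (simp add: algebra_simps)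
    qed
    then show "SD C (\<lambda>y. \<phi> (y + (X n - x)))" for n .
    have [measurable]: "\<phi> \<in> borel_measurable borel" by (rule borel_measurable_continuous_onI[OF c])
    show "(\<lambda>y. \<phi> (y + (X n - x))) \<in> borel_measurable borel" for n by measurable
    show "(\<lambda>n. \<phi> (y + (X n - x))) \<longlonglongrightarrow> \<phi> y" for y
    proof -
      have "(\<lambda>n. y + (X n - x)) \<longlonglongrightarrow> y + (x - x)" using X by (intro tendsto_intros) auto
      then show ?thesis using continuous_on_tendsto_compose[OF c, of "\<lambda>n. y + (X n - x)" y] by simp
    qed
  qed
  then show "(\<lambda>n. lg \<phi> (X n)) \<longlonglongrightarrow> lg \<phi> x" by (simp add: e)
qed

lemma lg_cos: "lg (\<lambda>x. cos (\<alpha> + x \<bullet> \<eta>)) x = cos (\<alpha> + x \<bullet> \<eta>) * (LINT p|lborel. W p * (2 * (1 - cos (z p \<bullet> \<eta>))))"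
proof -
  have "sd (\<lambda>x. cos (\<alpha> + x \<bullet> \<eta>)) x y = cos (\<alpha> + x \<bullet> \<eta>) * (2 * (1 - cos (y \<bullet> \<eta>)))" for y
    using cos_add[of "\<alpha> + x \<bullet> \<eta>" "y \<bullet> \<eta>"] cos_diff[of "\<alpha> + x \<bullet> \<eta>" "y \<bullet> \<eta>"]
    unfolding sd_def inner_add_left inner_diff_left add.assoc[symmetric] add_diff_eq by (simp add: algebra_simps)
  then show ?thesis unfolding lg_def by (simp add: mult.left_commute[of "W _" "cos (\<alpha> + x \<bullet> \<eta>)"])
qed

section \<open>Symbol of a Levy operator on test functions\<close>

context
  fixes \<phi> :: "'a \<Rightarrow> real" and C
  assumes S: "SD C \<phi>" and c: "continuous_on UNIV \<phi>" and b: "bounded {x. \<phi> x \<noteq> 0}"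
begin

lemma phi_integrable: "integrable lborel \<phi>"
proof -
  obtain R where R: "\<And>x. \<phi> x \<noteq> 0 \<Longrightarrow> norm x \<le> R" using b by (auto simp: bounded_iff)
  have "integrable lborel (\<lambda>x. indicator (cball 0 R) x *\<^sub>R \<phi> x)"
    by (intro borel_integrable_compact continuous_on_subset[OF c]) auto
  moreover have "(\<lambda>x. indicator (cball 0 R) x *\<^sub>R \<phi> x) = \<phi>"
    using R by (auto simp: fun_eq_iff indicator_def)
  ultimately show ?thesis by simp
qed

lemma sd_integrable: "integrable lborel (\<lambda>x. sd \<phi> x y)"
  unfolding sd_def using integrable_translate(1,2)[OF phi_integrable, of y] phi_integrable by auto

text \<open>For |y| <= 1 the second-difference bound on a ball of radius R + 1 around the support,
  for larger y the triangle inequality. This is the integrability needed to exchange the Levy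
  integral with the Fourier integral.\<close>

lemma sd_L1: obtains D where "0 \<le> D" "\<And>y. (LINT x|lborel. \<bar>sd \<phi> x y\<bar>) \<le> D * min 1 ((norm y)\<^sup>2)"
proof -
  obtain R where R: "\<And>x. \<phi> x \<noteq> 0 \<Longrightarrow> norm x \<le> R" using b by (auto simp: bounded_iff)
  define V where "V = measure lborel (cball (0::'a) (R + 1))"
  define D where "D = 4 * (LINT x|lborel. \<bar>\<phi> x\<bar>) + 4 * C * V"
  have C: "0 \<le> C" using SD_nonneg[OF S] .
  have I: "0 \<le> (LINT x|lborel. \<bar>\<phi> x\<bar>)" by simp
  have V: "0 \<le> V" by (simp add: V_def)
  have "(LINT x|lborel. \<bar>sd \<phi> x y\<bar>) \<le> D * min 1 ((norm y)\<^sup>2)" for y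
  proof (cases "norm y \<le> 1")
    case True
    have le: "\<bar>sd \<phi> x y\<bar> \<le> indicator (cball 0 (R + 1)) x * (4 * C * min 1 ((norm y)\<^sup>2))" for x
    proof (cases "x \<in> cball 0 (R + 1)")
      case False
      then have x: "R + 1 < norm x" by simp
      have "norm x \<le> norm (x + y) + norm y" "norm x \<le> norm (x - y) + norm y"
        using norm_triangle_ineq4[of "x + y" y] norm_triangle_ineq[of "x - y" y] by simp_all
      then have "\<phi> x = 0" "\<phi> (x + y) = 0" "\<phi> (x - y) = 0"
        using R[of x] R[of "x + y"] R[of "x - y"] x True by linarith+
      then show ?thesis using C by (simp add: sd_def)
    qed (use sd_bound[OF S] in simp)
    have "integrable lborel (indicat_real (cball (0::'a) (R + 1)))"
      by (rule integrable_real_indicator[OF _ emeasure_lborel_cball_finite]) simp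
    then have "integrable lborel (\<lambda>x. indicat_real (cball (0::'a) (R + 1)) x * (4 * C * min 1 ((norm y)\<^sup>2)))"
      by (rule integrable_mult_left)
    then have "(LINT x|lborel. \<bar>sd \<phi> x y\<bar>) \<le> (LINT x|lborel. indicator (cball (0::'a) (R + 1)) x * (4 * C * min 1 ((norm y)\<^sup>2)))"
      using le by (intro integral_mono[OF integrable_abs[OF sd_integrable]])
    also have "\<dots> = V * (4 * C * min 1 ((norm y)\<^sup>2))" by (simp add: V_def)
    also have "\<dots> = 4 * C * V * min 1 ((norm y)\<^sup>2)" by simp
    also have "\<dots> \<le> D * min 1 ((norm y)\<^sup>2)" unfolding D_def using I by (intro mult_right_mono) auto
    finally show ?thesis .
  next
    case False
    then have m: "min 1 ((norm y)\<^sup>2) = 1" by (simp add: min_def)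
    note t = integrable_translate(1,2)[OF phi_integrable, of y] phi_integrable
    have "(LINT x|lborel. \<bar>sd \<phi> x y\<bar>) \<le> (LINT x|lborel. 2 * \<bar>\<phi> x\<bar> + \<bar>\<phi> (x + y)\<bar> + \<bar>\<phi> (x - y)\<bar>)"
      by (rule integral_mono) (use t sd_integrable in \<open>auto simp: sd_def\<close>)
    also have "\<dots> = 2 * (LINT x|lborel. \<bar>\<phi> x\<bar>) + (LINT x|lborel. \<bar>\<phi> (x + y)\<bar>) + (LINT x|lborel. \<bar>\<phi> (x - y)\<bar>)"
      using t by simp
    also have "\<dots> = 4 * (LINT x|lborel. \<bar>\<phi> x\<bar>)"
      using integral_translate(1,2)[OF integrable_abs[OF phi_integrable], of y] by simp
    also have "\<dots> \<le> D" unfolding D_def using C V by simp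
    finally show ?thesis by (simp add: m)
  qed
  moreover have "0 \<le> D" unfolding D_def using I C V by simp
  ultimately show ?thesis using that by blast
qed

lemma fourier_sd: "(LINT x|lborel. sd \<phi> x y *\<^sub>R cis (- (x \<bullet> \<xi>))) = fourier \<phi> \<xi> * of_real (2 * (1 - cos (y \<bullet> \<xi>)))"
proof -
  have i: "integrable lborel (\<lambda>x. \<phi> (x + h) *\<^sub>R cis (- (x \<bullet> \<xi>)))" for h
    by (rule integrable_cis_mult[OF integrable_translate(1)[OF phi_integrable]]) simp
  have s: "(LINT x|lborel. \<phi> (x + h) *\<^sub>R cis (- (x \<bullet> \<xi>))) = cis (h \<bullet> \<xi>) * fourier \<phi> \<xi>" for h
  proof -
    have "integrable lborel (\<lambda>x. \<phi> x *\<^sub>R cis (- ((x - h) \<bullet> \<xi>)))" by (rule integrable_cis_mult[OF phi_integrable]) simp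
    from integral_translate(1)[OF this, of h]
    have "(LINT x|lborel. \<phi> (x + h) *\<^sub>R cis (- (x \<bullet> \<xi>))) = (LINT x|lborel. \<phi> x *\<^sub>R cis (- ((x - h) \<bullet> \<xi>)))" by simp
    also have "\<dots> = (LINT x|lborel. cis (h \<bullet> \<xi>) * (\<phi> x *\<^sub>R cis (- (x \<bullet> \<xi>))))"
      by (intro Bochner_Integration.integral_cong refl) (simp add: inner_diff_left cis_mult mult_scaleR_right del: scaleR_conv_of_real)
    finally show ?thesis unfolding fourier_cis by (simp only: integral_mult_right_zero)
  qed
  have "(LINT x|lborel. sd \<phi> x y *\<^sub>R cis (- (x \<bullet> \<xi>))) = (LINT x|lborel. 2 * (\<phi> (x + 0) *\<^sub>R cis (- (x \<bullet> \<xi>))) - \<phi> (x + y) *\<^sub>R cis (- (x \<bullet> \<xi>)) - \<phi> (x + (- y)) *\<^sub>R cis (- (x \<bullet> \<xi>)))"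
    by (intro Bochner_Integration.integral_cong refl) (simp add: sd_def scaleR_conv_of_real algebra_simps)
  also have "\<dots> = 2 * (cis (0 \<bullet> \<xi>) * fourier \<phi> \<xi>) - cis (y \<bullet> \<xi>) * fourier \<phi> \<xi> - cis ((- y) \<bullet> \<xi>) * fourier \<phi> \<xi>"
    unfolding s[symmetric]
    by (subst Bochner_Integration.integral_diff, (intro Bochner_Integration.integrable_diff integrable_mult_right i)+,
        subst Bochner_Integration.integral_diff, (intro integrable_mult_right i)+, simp only: integral_mult_right_zero)
  also have "\<dots> = fourier \<phi> \<xi> * (2 - (cis (y \<bullet> \<xi>) + cis (- (y \<bullet> \<xi>))))" by (simp add: algebra_simps)
  also have "cis (y \<bullet> \<xi>) + cis (- (y \<bullet> \<xi>)) = of_real (2 * cos (y \<bullet> \<xi>))" by (simp add: complex_eq_iff)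
  finally show ?thesis by (simp add: algebra_simps)
qed

lemma lg_fourier:
  shows lg_integrable: "integrable lborel (lg \<phi>)"
    and fourier_lg: "fourier (lg \<phi>) \<xi> = of_real (LINT p|lborel. W p * (2 * (1 - cos (z p \<bullet> \<xi>)))) * fourier \<phi> \<xi>"
proof -
  have [measurable]: "\<phi> \<in> borel_measurable borel" by (rule borel_measurable_continuous_onI[OF c])
  obtain D where D: "0 \<le> D" "\<And>y. (LINT x|lborel. \<bar>sd \<phi> x y\<bar>) \<le> D * min 1 ((norm y)\<^sup>2)" using sd_L1 by blast
  have m: "integrable lborel (\<lambda>p. LINT x|lborel. \<bar>W p * sd \<phi> x (z p)\<bar>)"
  proof (rule Bochner_Integration.integrable_bound)
    show "integrable lborel (\<lambda>p. D * (W p * min 1 ((norm (z p))\<^sup>2)))" by (intro integrable_mult_right Wint)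
    show "(\<lambda>p. LINT x|lborel. \<bar>W p * sd \<phi> x (z p)\<bar>) \<in> borel_measurable lborel" unfolding sd_def by measurable
    show "AE p in lborel. norm (LINT x|lborel. \<bar>W p * sd \<phi> x (z p)\<bar>) \<le> norm (D * (W p * min 1 ((norm (z p))\<^sup>2)))"
    proof (rule AE_I2)
      fix p
      have "(LINT x|lborel. \<bar>W p * sd \<phi> x (z p)\<bar>) = W p * (LINT x|lborel. \<bar>sd \<phi> x (z p)\<bar>)" using Wnn[of p] by (simp add: abs_mult)
      also have "\<dots> \<le> W p * (D * min 1 ((norm (z p))\<^sup>2))" by (rule mult_left_mono[OF D(2) Wnn])
      also have "\<dots> \<le> norm (D * (W p * min 1 ((norm (z p))\<^sup>2)))" by (simp add: mult_ac)
      finally show "norm (LINT x|lborel. \<bar>W p * sd \<phi> x (z p)\<bar>) \<le> norm (D * (W p * min 1 ((norm (z p))\<^sup>2)))" by simp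
    qed
  qed
  have int1: "integrable (lborel \<Otimes>\<^sub>M lborel) (\<lambda>(p, x). W p * sd \<phi> x (z p))"
  proof (rule lborel_pair.Fubini_integrable)
    show "(\<lambda>(p, x). W p * sd \<phi> x (z p)) \<in> borel_measurable (lborel \<Otimes>\<^sub>M lborel)" unfolding sd_def by measurable
    show "AE p in lborel. integrable lborel (\<lambda>x. case (p, x) of (p, x) \<Rightarrow> W p * sd \<phi> x (z p))" by (simp add: sd_integrable)
  qed (use m in simp)
  show "integrable lborel (lg \<phi>)" unfolding lg_def[abs_def] using lborel_pair.integrable_snd[OF int1] by simp
  have int2: "integrable (lborel \<Otimes>\<^sub>M lborel) (\<lambda>(p, x). (W p * sd \<phi> x (z p)) *\<^sub>R cis (- (x \<bullet> \<xi>)))"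
  proof (rule Bochner_Integration.integrable_bound[OF int1])
    show "(\<lambda>(p, x). (W p * sd \<phi> x (z p)) *\<^sub>R cis (- (x \<bullet> \<xi>))) \<in> borel_measurable (lborel \<Otimes>\<^sub>M lborel)" unfolding sd_def by measurable
    show "AE q in lborel \<Otimes>\<^sub>M lborel. norm (case q of (p, x) \<Rightarrow> (W p * sd \<phi> x (z p)) *\<^sub>R cis (- (x \<bullet> \<xi>))) \<le> norm (case q of (p, x) \<Rightarrow> W p * sd \<phi> x (z p))"
      by (rule AE_I2) (auto split: prod.splits)
  qed
  have "fourier (lg \<phi>) \<xi> = (LINT x|lborel. LINT p|lborel. (W p * sd \<phi> x (z p)) *\<^sub>R cis (- (x \<bullet> \<xi>)))"
    unfolding fourier_cis lg_def
  proof (intro Bochner_Integration.integral_cong refl)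
    fix x
    show "(LINT p|lborel. W p * sd \<phi> x (z p)) *\<^sub>R cis (- (x \<bullet> \<xi>)) = (LINT p|lborel. (W p * sd \<phi> x (z p)) *\<^sub>R cis (- (x \<bullet> \<xi>)))"
      by (rule integral_scaleR_left[symmetric]) (intro W_sd_integrable[OF S], measurable)
  qed
  also have "\<dots> = (LINT p|lborel. LINT x|lborel. (W p * sd \<phi> x (z p)) *\<^sub>R cis (- (x \<bullet> \<xi>)))"
    by (rule lborel_pair.Fubini_integral[OF int2])
  also have "\<dots> = (LINT p|lborel. of_real (W p * (2 * (1 - cos (z p \<bullet> \<xi>)))) * fourier \<phi> \<xi>)"
  proof (intro Bochner_Integration.integral_cong refl)
    fix p
    have "(LINT x|lborel. (W p * sd \<phi> x (z p)) *\<^sub>R cis (- (x \<bullet> \<xi>))) = (LINT x|lborel. W p *\<^sub>R (sd \<phi> x (z p) *\<^sub>R cis (- (x \<bullet> \<xi>))))"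
      by (simp only: scaleR_scaleR)
    also have "\<dots> = W p *\<^sub>R (fourier \<phi> \<xi> * of_real (2 * (1 - cos (z p \<bullet> \<xi>))))" by (simp only: integral_scaleR_right fourier_sd)
    also have "\<dots> = of_real (W p * (2 * (1 - cos (z p \<bullet> \<xi>)))) * fourier \<phi> \<xi>" by (simp only: scaleR_conv_of_real of_real_mult mult_ac)
    finally show "(LINT x|lborel. (W p * sd \<phi> x (z p)) *\<^sub>R cis (- (x \<bullet> \<xi>))) = of_real (W p * (2 * (1 - cos (z p \<bullet> \<xi>)))) * fourier \<phi> \<xi>" .
  qed
  also have "\<dots> = (LINT p|lborel. of_real (W p * (2 * (1 - cos (z p \<bullet> \<xi>))))) * fourier \<phi> \<xi>" by (rule integral_mult_left_zero)
  also have "(LINT p|lborel. complex_of_real (W p * (2 * (1 - cos (z p \<bullet> \<xi>))))) = of_real (LINT p|lborel. W p * (2 * (1 - cos (z p \<bullet> \<xi>))))"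
    by (rule integral_complex_of_real)
  finally show "fourier (lg \<phi>) \<xi> = of_real (LINT p|lborel. W p * (2 * (1 - cos (z p \<bullet> \<xi>)))) * fourier \<phi> \<xi>" .
qed

text \<open>The weak formulation speaks only about pairs \<phi>, g related by
  \<open>is_frac_lap\<close>, so such a \<open>g\<close> has to be exhibited for every test function
  used. A Levy operator with the right symbol supplies it, together with integrability, continuity
  and boundedness.\<close>

lemma is_frac_lap_lg:
  assumes "\<And>\<xi>. (LINT p|lborel. W p * (2 * (1 - cos (z p \<bullet> \<xi>)))) = norm \<xi> powr (2 * s)"
  shows "is_frac_lap s \<phi> (lg \<phi>)"
  unfolding is_frac_lap_def
proof (intro conjI allI)
  have m: "\<phi> \<in> borel_measurable borel" by (rule borel_measurable_continuous_onI[OF c])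
  show "bounded (range (lg \<phi>))" unfolding bounded_iff using lg_bound[OF S m] by auto
  show "fourier (lg \<phi>) \<xi> = of_real (norm \<xi> powr (2 * s)) * fourier \<phi> \<xi>" for \<xi> using fourier_lg[of \<xi>] assms by simp
qed (use lg_integrable lg_cont[OF S c] in auto)

end

end

section \<open>The stable operator by subordination\<close>

lemma integrable_pair_prod:
  fixes f :: "'b::euclidean_space \<Rightarrow> real" and g :: "'c::euclidean_space \<Rightarrow> real"
  assumes f: "integrable lborel f" and g: "integrable lborel g"
  shows "integrable (lborel :: ('b \<times> 'c) measure) (\<lambda>p. f (fst p) * g (snd p))"
proof -
  have [measurable]: "f \<in> borel_measurable borel" "g \<in> borel_measurable borel" using f g by auto
  have "integrable (lborel \<Otimes>\<^sub>M lborel) (\<lambda>(x, y). f x * g y)"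
  proof (rule lborel_pair.Fubini_integrable)
    show "(\<lambda>(x, y). f x * g y) \<in> borel_measurable (lborel \<Otimes>\<^sub>M lborel)" by measurable
  qed (use f g in \<open>auto simp: abs_mult\<close>)
  then show ?thesis by (simp add: lborel_prod case_prod_unfold)
qed

lemma min_one_bound: "x \<le> v * u \<Longrightarrow> x \<le> 4 \<Longrightarrow> 0 \<le> u \<Longrightarrow> 0 \<le> v \<Longrightarrow> x \<le> (4 + v) * min 1 (u::real)"
  by (cases "u \<le> 1") (auto simp: min_def distrib_right)

context
  fixes s :: real assumes s: "0 < s" "s < 1"
begin

lemma integrable_exp_qq: "integrable lborel (\<lambda>r. qq s r * (1 - exp (- (r / 2))))"
proof (rule Bochner_Integration.integrable_bound[OF integrable_min_qq[OF s]])
  show "AE r in lborel. norm (qq s r * (1 - exp (- (r / 2)))) \<le> norm (min 1 r * qq s r)"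
  proof (rule AE_I2)
    fix r :: real
    show "norm (qq s r * (1 - exp (- (r / 2)))) \<le> norm (min 1 r * qq s r)"
    proof (cases "0 < r")
      case True
      have "1 - exp (- (r / 2)) \<le> min 1 r" "0 \<le> 1 - exp (- (r / 2))"
        using exp_ge_add_one_self[of "- (r / 2)"] True by auto
      then show ?thesis using True by (simp add: abs_mult mult.commute[of "min 1 r"] mult_left_mono)
    qed (simp add: qq_def)
  qed
qed (simp add: qq_def)

text \<open>Normalisation of the s-stable subordinator with Levy density r^(-1 - s), whose Laplace
  exponent at c / 2 is c^s times this constant.\<close>

definition Ks :: real where "Ks = (LINT r|lborel. qq s r * (1 - exp (- (r / 2))))"

lemma exp_qq_nonneg: "0 \<le> qq s r * (1 - exp (- (r / 2)))"
  by (cases "0 < r") (auto simp: qq_def)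

lemma Ks_pos: "0 < Ks"
proof -
  have "0 \<le> Ks" unfolding Ks_def by (intro integral_nonneg_AE AE_I2 exp_qq_nonneg)
  moreover have "Ks \<noteq> 0"
  proof
    assume "Ks = 0"
    then have "AE r in lborel. qq s r * (1 - exp (- (r / 2))) = 0"
      unfolding Ks_def using integrable_exp_qq by (subst (asm) integral_nonneg_eq_0_iff_AE) (auto simp: exp_qq_nonneg)
    then have "AE r in lborel. r \<notin> {1..2::real}"
      by eventually_elim (auto simp: qq_def)
    then have "emeasure lborel {1..2::real} = 0"
      by (subst (asm) AE_iff_measurable[of "{1..2}"]) auto
    then show False by simp
  qed
  ultimately show ?thesis by simp
qed

lemma Ks_scale:
  assumes c: "0 \<le> c" shows "(LINT r|lborel. qq s r * (1 - exp (- (r * c / 2)))) = c powr s * Ks"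
proof (cases "c = 0")
  case False
  then have c: "0 < c" using c by simp
  have q: "qq s (c * r) = c powr (- 1 - s) * qq s r" for r
    using c by (cases "0 < r") (auto simp: qq_def powr_mult zero_less_mult_iff)
  have "Ks = c * (LINT r|lborel. qq s (c * r) * (1 - exp (- (c * r / 2))))"
    using integral_lborel_affine[OF integrable_exp_qq, of c 0] c by (simp add: Ks_def)
  also have "\<dots> = c * (LINT r|lborel. c powr (- 1 - s) * (qq s r * (1 - exp (- (r * c / 2)))))"
    by (simp add: q[simplified mult.commute[of c]] mult.assoc mult.commute[of c])
  also have "\<dots> = c * c powr (- 1 - s) * (LINT r|lborel. qq s r * (1 - exp (- (r * c / 2))))"
    by (simp only: integral_mult_right_zero mult.assoc)
  also have "c * c powr (- 1 - s) = c powr (- s)" using c powr_add[of c 1 "- 1 - s"] by simp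
  finally show ?thesis using c by (simp add: powr_minus field_simps)
qed (use s in simp)

text \<open>Subordination: the stable Levy measure as a mixture of Gaussians of variance \<open>r\<close>.\<close>

definition sW :: "real \<times> 'a::euclidean_space \<Rightarrow> real" where "sW p = qq s (fst p) * nd (snd p) / (2 * Ks)"
definition sz :: "real \<times> 'a::euclidean_space \<Rightarrow> 'a" where "sz p = sqrt (fst p) *\<^sub>R snd p"

lemma nd_meas: "(nd :: 'a::euclidean_space \<Rightarrow> real) \<in> borel_measurable borel" using nd_integrable by auto

lemma sW_meas: "(sW :: real \<times> 'a::euclidean_space \<Rightarrow> real) \<in> borel_measurable borel"
proof -
  note nd_meas[measurable]
  have [measurable]: "qq s \<in> borel_measurable borel" by (simp add: qq_def)
  have "(sW :: real \<times> 'a \<Rightarrow> real) \<in> borel_measurable (borel \<Otimes>\<^sub>M borel)" unfolding sW_def[abs_def] by measurable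
  then show ?thesis by (simp add: borel_prod)
qed

lemma sz_meas: "(sz :: real \<times> 'a::euclidean_space \<Rightarrow> 'a) \<in> borel_measurable borel"
  unfolding sz_def[abs_def] by (intro borel_measurable_continuous_onI continuous_intros)

lemma stable_levy: "levy (sW :: real \<times> 'a::euclidean_space \<Rightarrow> real) sz"
proof
  note [measurable] = sW_meas sz_meas
  show "sW \<in> borel_measurable borel" "sz \<in> borel_measurable borel" by measurable
  show nn: "0 \<le> sW p" for p :: "real \<times> 'a" using Ks_pos by (simp add: sW_def nd_nonneg)
  have "integrable lborel (\<lambda>p::real \<times> 'a. (min 1 (fst p) * qq s (fst p)) * (nd (snd p) + (norm (snd p))\<^sup>2 * nd (snd p)))"
    by (intro integrable_pair_prod integrable_min_qq[OF s] Bochner_Integration.integrable_add nd_integrable nd_second_moment)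
  then have "integrable lborel (\<lambda>p::real \<times> 'a. (1 / (2 * Ks)) * ((min 1 (fst p) * qq s (fst p)) * (nd (snd p) + (norm (snd p))\<^sup>2 * nd (snd p))))"
    by (rule integrable_mult_right)
  then show "integrable lborel (\<lambda>p::real \<times> 'a. sW p * min 1 ((norm (sz p))\<^sup>2))"
  proof (rule Bochner_Integration.integrable_bound)
    show "AE p::real \<times> 'a in lborel. norm (sW p * min 1 ((norm (sz p))\<^sup>2)) \<le>
      norm (1 / (2 * Ks) * (min 1 (fst p) * qq s (fst p) * (nd (snd p) + (norm (snd p))\<^sup>2 * nd (snd p))))"
    proof (rule AE_I2)
      fix p :: "real \<times> 'a"
      obtain r y where p: "p = (r, y)" by fastforce
      show "norm (sW p * min 1 ((norm (sz p))\<^sup>2)) \<le>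
        norm (1 / (2 * Ks) * (min 1 (fst p) * qq s (fst p) * (nd (snd p) + (norm (snd p))\<^sup>2 * nd (snd p))))"
      proof (cases "0 < r")
        case True
        \<comment> \<open>Separates r from y, so that a product of a function of r and a function of
          y dominates.\<close>
        have "min 1 (r * (norm y)\<^sup>2) \<le> min 1 r * (1 + (norm y)\<^sup>2)"
        proof (cases "r \<le> 1")
          case False
          then have "min 1 r = 1" by simp
          then show ?thesis using min.cobounded1[of 1 "r * (norm y)\<^sup>2"] zero_le_power2[of "norm y"] by (simp only: mult_1_left)
        qed (use True in \<open>simp add: min_def algebra_simps\<close>)
        then have m: "min 1 ((norm (sz p))\<^sup>2) \<le> min 1 r * (1 + (norm y)\<^sup>2)"
          using True by (simp add: p sz_def power_mult_distrib)
        have "norm (sW p * min 1 ((norm (sz p))\<^sup>2)) = sW p * min 1 ((norm (sz p))\<^sup>2)" using nn[of p] by simp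
        also have "\<dots> \<le> sW p * (min 1 r * (1 + (norm y)\<^sup>2))" by (rule mult_left_mono[OF m nn])
        also have "\<dots> = 1 / (2 * Ks) * (min 1 (fst p) * qq s (fst p) * (nd (snd p) + (norm (snd p))\<^sup>2 * nd (snd p)))"
          by (simp add: sW_def p algebra_simps)
        finally show ?thesis by (metis abs_ge_self order_trans real_norm_def)
      qed (simp add: p sW_def qq_def)
    qed
  qed measurable
qed

text \<open>Integrating the Gaussian variable first turns 1 - cos into 1 - exp (- r |\<xi>|^2 / 2),
  and \<open>Ks_scale\<close> at c = |\<xi>|^2 gives |\<xi>|^(2 s). The 2 in the denominator of
  \<open>sW\<close> compensates the symmetrised difference.\<close>

lemma stable_symbol: "(LINT p|lborel. sW p * (2 * (1 - cos (sz p \<bullet> \<xi>)))) = norm (\<xi> :: 'a::euclidean_space) powr (2 * s)"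
proof -
  interpret levy "sW :: real \<times> 'a \<Rightarrow> real" sz by (rule stable_levy)
  note [measurable] = sW_meas sz_meas
  have i: "integrable lborel (\<lambda>p::real \<times> 'a. sW p * (2 * (1 - cos (sz p \<bullet> \<xi>))))"
  proof (rule Bochner_Integration.integrable_bound)
    show "integrable lborel (\<lambda>p::real \<times> 'a. (4 + (norm \<xi>)\<^sup>2) * (sW p * min 1 ((norm (sz p))\<^sup>2)))" by (intro integrable_mult_right Wint)
    show "AE p::real \<times> 'a in lborel. norm (sW p * (2 * (1 - cos (sz p \<bullet> \<xi>)))) \<le> norm ((4 + (norm \<xi>)\<^sup>2) * (sW p * min 1 ((norm (sz p))\<^sup>2)))"
    proof (rule AE_I2)
      fix p :: "real \<times> 'a"
      define t where "t = sz p \<bullet> \<xi>"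
      have "1 - cos t = 2 * (sin (t / 2))\<^sup>2" using cos_double_sin[of "t/2"] by simp
      moreover have "(sin (t / 2))\<^sup>2 \<le> (t / 2)\<^sup>2" using power_mono[OF abs_sin_x_le_abs_x[of "t / 2"] abs_ge_zero, of 2] by (simp only: power2_abs)
      ultimately have a: "2 * (1 - cos t) \<le> t\<^sup>2" by (simp add: power_divide)
      have "\<bar>t\<bar> \<le> norm (sz p) * norm \<xi>" unfolding t_def by (rule Cauchy_Schwarz_ineq2)
      then have "t\<^sup>2 \<le> (norm (sz p) * norm \<xi>)\<^sup>2" by (metis abs_ge_zero power2_abs power_mono)
      then have b: "2 * (1 - cos t) \<le> (norm \<xi>)\<^sup>2 * (norm (sz p))\<^sup>2" using a by (simp add: power_mult_distrib mult.commute)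
      have c: "2 * (1 - cos t) \<le> 4" using cos_ge_minus_one[of t] by argo
      have "2 * (1 - cos t) \<le> (4 + (norm \<xi>)\<^sup>2) * min 1 ((norm (sz p))\<^sup>2)"
        by (rule min_one_bound[OF b c]) auto
      from mult_left_mono[OF this Wnn[of p]]
      have "sW p * (2 * (1 - cos t)) \<le> (4 + (norm \<xi>)\<^sup>2) * (sW p * min 1 ((norm (sz p))\<^sup>2))" by (simp add: mult_ac)
      moreover have "0 \<le> sW p * (2 * (1 - cos t))" using Wnn[of p] by simp
      ultimately show "norm (sW p * (2 * (1 - cos (sz p \<bullet> \<xi>)))) \<le> norm ((4 + (norm \<xi>)\<^sup>2) * (sW p * min 1 ((norm (sz p))\<^sup>2)))"
        unfolding t_def real_norm_def by linarith
    qed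
  qed measurable
  then have i2: "integrable (lborel \<Otimes>\<^sub>M lborel) (\<lambda>p::real \<times> 'a. sW p * (2 * (1 - cos (sz p \<bullet> \<xi>))))" by (simp add: lborel_prod)
  have "(LINT p|lborel. sW p * (2 * (1 - cos (sz p \<bullet> \<xi>)))) = (LINT r|lborel. LINT y|lborel. sW (r, y) * (2 * (1 - cos (sz (r, y) \<bullet> \<xi>))))"
    using lborel_pair.integral_fst'[OF i2] by (simp add: lborel_prod)
  also have "\<dots> = (LINT r|lborel. 1 / Ks * (qq s r * (1 - exp (- (r * (norm \<xi>)\<^sup>2 / 2)))))"
  proof (intro Bochner_Integration.integral_cong refl)
    fix r :: real
    show "(LINT y|lborel. sW (r, y) * (2 * (1 - cos (sz (r, y) \<bullet> \<xi>)))) = 1 / Ks * (qq s r * (1 - exp (- (r * (norm \<xi>)\<^sup>2 / 2))))"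
    proof (cases "0 < r")
      case True
      have c: "integrable lborel (\<lambda>y::'a. nd y * cos (y \<bullet> (sqrt r *\<^sub>R \<xi>)))"
      proof (rule Bochner_Integration.integrable_bound[OF nd_integrable])
        show "(\<lambda>y::'a. nd y * cos (y \<bullet> (sqrt r *\<^sub>R \<xi>))) \<in> borel_measurable lborel" using nd_meas[measurable] by measurable
      qed (auto intro!: AE_I2 simp: abs_mult mult_left_le)
      have "(LINT y|lborel. nd y * Re (1 * cis (- (0 + y \<bullet> (sqrt r *\<^sub>R \<xi>))))) = Re (1 * cis (- 0) * fourier nd (sqrt r *\<^sub>R \<xi>))"
        by (rule Re_cis_fourier[OF nd_integrable])
      then have e: "(LINT y|lborel. nd y * cos (y \<bullet> (sqrt r *\<^sub>R \<xi>))) = exp (- (r * (norm \<xi>)\<^sup>2 / 2))"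
        using True by (simp add: fourier_nd gk_def power_mult_distrib)
      have "(LINT y|lborel. sW (r, y) * (2 * (1 - cos (sz (r, y) \<bullet> \<xi>)))) = (LINT y|lborel. (qq s r / Ks) * (nd y - nd y * cos (y \<bullet> (sqrt r *\<^sub>R \<xi>))))"
        using Ks_pos by (intro Bochner_Integration.integral_cong refl) (simp add: sW_def sz_def field_simps)
      also have "\<dots> = (qq s r / Ks) * ((LINT y|lborel. nd (y::'a)) - (LINT y|lborel. nd y * cos (y \<bullet> (sqrt r *\<^sub>R \<xi>))))"
        by (simp only: integral_mult_right_zero Bochner_Integration.integral_diff[OF nd_integrable c])
      finally show ?thesis by (simp only: e nd_integral) simp
    qed (simp add: sW_def qq_def)
  qed
  also have "\<dots> = 1 / Ks * (((norm \<xi>)\<^sup>2) powr s * Ks)"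
    using Ks_scale[of "(norm \<xi>)\<^sup>2"] by (simp only: integral_mult_right_zero zero_le_power2 simp_thms)
  also have "\<dots> = norm \<xi> powr (2 * s)"
    using Ks_pos powr_powr[of "norm \<xi>" 2 s] by (simp add: powr_numeral)
  finally show ?thesis .
qed

end

section \<open>The two evolutions\<close>

lemma tf_meas: "tf \<rho> (\<eta>::'a::euclidean_space) \<alpha> \<in> borel_measurable borel"
  by (intro borel_measurable_continuous_onI C1f_cont tf_C1f)

text \<open>The rescaled kernel has unit mass, so the operator is bounded by 2 l in the supremum
  norm; after removal of the cut-off, plane waves are eigenfunctions of the convolution.\<close>

lemma (in L1curve) nonlocal_weak_flow:
  assumes j: "prob_density j" and e: "0 < \<epsilon>" and l: "0 \<le> l"
    and weak: "\<And>\<phi> T. test_fun \<phi> \<Longrightarrow> 0 \<le> T \<Longrightarrow> (LINT x|lborel. u T x * \<phi> x) = (LINT x|lborel. u0 x * \<phi> x) +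
      (LBINT \<tau>=0..T. (LINT y|lborel. u \<tau> y * (l * ((LINT z|lborel. rescale j \<epsilon> z * \<phi> (y + z)) - \<phi> y) - frechet_derivative \<phi> (at y) y)))"
  shows "weak_flow k u0 u (\<lambda>\<rho> \<eta> \<alpha> y. l * ((LINT z|lborel. rescale j \<epsilon> z * tf \<rho> \<eta> \<alpha> (y + z)) - tf \<rho> \<eta> \<alpha> y))
    (\<lambda>\<eta>. of_real l * (fourier j (\<epsilon> *\<^sub>R \<eta>) - 1))"
proof unfold_locales
  define R where "R = rescale j \<epsilon>"
  have jp: "integrable lborel j" "\<And>x. 0 \<le> j x" "(LINT x|lborel. j x) = 1" using j by (auto simp: prob_density_def)
  have Ri: "integrable lborel R" unfolding R_def rescale_eq_dil[OF e] by (rule dil_props(1)[OF jp(1) e])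
  have Rn: "0 \<le> R x" for x unfolding R_def rescale_eq_dil[OF e] by (rule dil_nonneg) (use jp e in auto)
  have R1: "(LINT x|lborel. R x) = 1"
    using dil_props(3)[OF jp(1) e] jp(2,3) Rn unfolding R_def rescale_eq_dil[OF e] by simp
  have fR: "fourier R \<eta> = fourier j (\<epsilon> *\<^sub>R \<eta>)" for \<eta> unfolding R_def rescale_eq_dil[OF e] by (rule dil_props(2)[OF jp(1) e])
  note [measurable] = tf_meas borel_measurable_integrable[OF Ri]
  note R_def[symmetric, simp]
  show "continuous_on UNIV (\<lambda>\<eta>. complex_of_real l * (fourier j (\<epsilon> *\<^sub>R \<eta>) - 1))"
    by (intro continuous_intros continuous_on_compose2[OF continuous_fourier[OF jp(1)]]) auto
  show "(\<lambda>y. l * ((LINT z|lborel. rescale j \<epsilon> z * tf \<rho> \<eta> \<alpha> (y + z)) - tf \<rho> \<eta> \<alpha> y)) \<in> borel_measurable borel" for \<rho> \<eta> \<alpha>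
    unfolding R_def[symmetric] by measurable
  fix H :: real
  obtain C where C: "0 \<le> C" "\<And>\<rho> \<eta> \<alpha>. 0 \<le> \<rho> \<Longrightarrow> \<rho> \<le> 1 \<Longrightarrow> norm \<eta> \<le> H \<Longrightarrow> SD C (tf \<rho> (\<eta>::'a) \<alpha>)" using tf_SD[of H] by blast
  have "\<bar>l * ((LINT z|lborel. R z * tf \<rho> \<eta> \<alpha> (y + z)) - tf \<rho> \<eta> \<alpha> y)\<bar> \<le> l * (2 * C)"
    if r: "0 < \<rho>" "\<rho> \<le> 1" "norm \<eta> \<le> H" for \<rho> \<alpha> y and \<eta> :: 'a
  proof -
    have b: "\<bar>tf \<rho> \<eta> \<alpha> x\<bar> \<le> C" for x using C(2)[of \<rho> \<eta> \<alpha>] r unfolding SD_def by auto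
    have i: "integrable lborel (\<lambda>z. R z * tf \<rho> \<eta> \<alpha> (y + z))" by (rule pair_int[OF Ri _ b]) measurable
    have "\<bar>LINT z|lborel. R z * tf \<rho> \<eta> \<alpha> (y + z)\<bar> \<le> (LINT z|lborel. R z * C)"
      by (rule integral_abs_bound_integral[OF i]) (use Ri Rn b in \<open>auto simp: abs_mult mult_left_mono\<close>)
    also have "\<dots> = C" using R1 by simp
    finally have "\<bar>(LINT z|lborel. R z * tf \<rho> \<eta> \<alpha> (y + z)) - tf \<rho> \<eta> \<alpha> y\<bar> \<le> 2 * C" using b[of y] by linarith
    then show ?thesis using l by (simp add: abs_mult mult_left_mono)
  qed
  then show "\<exists>B. \<forall>\<rho> \<eta> \<alpha> x. 0 < \<rho> \<longrightarrow> \<rho> \<le> 1 \<longrightarrow> norm \<eta> \<le> H \<longrightarrow>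
    \<bar>l * ((LINT z|lborel. rescale j \<epsilon> z * tf \<rho> (\<eta>::'a) \<alpha> (x + z)) - tf \<rho> \<eta> \<alpha> x)\<bar> \<le> B"
    unfolding R_def[symmetric] by blast
next
  fix r :: "nat \<Rightarrow> real" and \<eta> x :: 'a and \<alpha> :: real
  assume r: "r \<longlonglongrightarrow> 0" "\<And>n. 0 < r n" "\<And>n. r n \<le> 1"
  define R where "R = rescale j \<epsilon>"
  have jp: "integrable lborel j" using j by (auto simp: prob_density_def)
  have Ri: "integrable lborel R" unfolding R_def rescale_eq_dil[OF e] by (rule dil_props(1)[OF jp e])
  have fR: "fourier R \<eta> = fourier j (\<epsilon> *\<^sub>R \<eta>)" unfolding R_def rescale_eq_dil[OF e] by (rule dil_props(2)[OF jp e])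
  note [measurable] = tf_meas borel_measurable_integrable[OF Ri]
  obtain C where C: "\<And>\<rho> \<eta>' \<alpha>. 0 \<le> \<rho> \<Longrightarrow> \<rho> \<le> 1 \<Longrightarrow> norm \<eta>' \<le> norm \<eta> \<Longrightarrow> SD C (tf \<rho> (\<eta>'::'a) \<alpha>)" using tf_SD[of "norm \<eta>"] by blast
  have b: "\<bar>tf (r n) \<eta> \<alpha> x\<bar> \<le> C" for n x using C[of "r n" \<eta> \<alpha>] r(2,3)[of n] unfolding SD_def by auto
  have "(\<lambda>n. LINT z|lborel. R z * tf (r n) \<eta> \<alpha> (x + z)) \<longlonglongrightarrow> (LINT z|lborel. R z * cos (\<alpha> + (x + z) \<bullet> \<eta>))"
  proof (rule integral_dominated_convergence[where w="\<lambda>z. \<bar>R z\<bar> * C"])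
    show "AE z in lborel. (\<lambda>n. R z * tf (r n) \<eta> \<alpha> (x + z)) \<longlonglongrightarrow> R z * cos (\<alpha> + (x + z) \<bullet> \<eta>)"
      by (intro AE_I2 tendsto_intros tf_lim r(1))
    show "AE z in lborel. norm (R z * tf (r n) \<eta> \<alpha> (x + z)) \<le> \<bar>R z\<bar> * C" for n
      using b by (intro AE_I2) (simp add: abs_mult mult_left_mono)
  qed (use Ri in \<open>auto intro!: integrable_mult_left integrable_abs\<close>)
  then have "(\<lambda>n. l * ((LINT z|lborel. R z * tf (r n) \<eta> \<alpha> (x + z)) - tf (r n) \<eta> \<alpha> x)) \<longlonglongrightarrow>
      l * ((LINT z|lborel. R z * cos (\<alpha> + (x + z) \<bullet> \<eta>)) - cos (\<alpha> + x \<bullet> \<eta>))"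
    by (intro tendsto_intros tf_lim r(1))
  moreover have "l * ((LINT z|lborel. R z * cos (\<alpha> + (x + z) \<bullet> \<eta>)) - cos (\<alpha> + x \<bullet> \<eta>)) =
    Re (of_real l * (fourier j (\<epsilon> *\<^sub>R \<eta>) - 1) * cis (- (\<alpha> + x \<bullet> \<eta>)))"
  proof -
    have "(LINT z|lborel. R z * cos (\<alpha> + (x + z) \<bullet> \<eta>)) = (LINT z|lborel. R z * Re (1 * cis (- ((\<alpha> + x \<bullet> \<eta>) + z \<bullet> \<eta>))))"
      by (intro Bochner_Integration.integral_cong refl)
        (simp only: mult_1_left cis.simps cos_minus inner_add_left add.assoc)
    also have "\<dots> = Re (1 * cis (- (\<alpha> + x \<bullet> \<eta>)) * fourier R \<eta>)" by (rule Re_cis_fourier[OF Ri])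
    finally have "(LINT z|lborel. R z * cos (\<alpha> + (x + z) \<bullet> \<eta>)) = Re (cis (- (\<alpha> + x \<bullet> \<eta>)) * fourier j (\<epsilon> *\<^sub>R \<eta>))"
      by (simp only: fR mult_1_left)
    moreover have "cos (\<alpha> + x \<bullet> \<eta>) = Re (cis (- (\<alpha> + x \<bullet> \<eta>)))" by (simp only: cis.simps cos_minus)
    moreover have "of_real l * (fourier j (\<epsilon> *\<^sub>R \<eta>) - 1) * cis (- (\<alpha> + x \<bullet> \<eta>)) =
      l *\<^sub>R (cis (- (\<alpha> + x \<bullet> \<eta>)) * fourier j (\<epsilon> *\<^sub>R \<eta>) - cis (- (\<alpha> + x \<bullet> \<eta>)))"
      by (simp only: scaleR_conv_of_real ring_distribs mult_1_left mult.assoc mult.commute[of "cis _"])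
    ultimately show ?thesis by (simp only: scaleR_complex.simps minus_complex.simps)
  qed
  ultimately show "(\<lambda>n. l * ((LINT z|lborel. rescale j \<epsilon> z * tf (r n) \<eta> \<alpha> (x + z)) - tf (r n) \<eta> \<alpha> x)) \<longlonglongrightarrow>
      Re (of_real l * (fourier j (\<epsilon> *\<^sub>R \<eta>) - 1) * cis (- (\<alpha> + x \<bullet> \<eta>)))"
    unfolding R_def[symmetric] by simp
next
  fix \<rho> \<alpha> T :: real and \<eta> :: 'a assume "0 < \<rho>" "0 \<le> T"
  then show "(LINT x|lborel. u T x * tf \<rho> \<eta> \<alpha> x) = (LINT x|lborel. u0 x * tf \<rho> \<eta> \<alpha> x) +
    (LBINT \<tau>=0..T. (LINT y|lborel. u \<tau> y * (l * ((LINT z|lborel. rescale j \<epsilon> z * tf \<rho> \<eta> \<alpha> (y + z)) - tf \<rho> \<eta> \<alpha> y) - frechet_derivative (tf \<rho> \<eta> \<alpha>) (at y) y)))"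
    by (intro weak tf_test_fun)
qed

text \<open>The Levy representation plays both parts: it is the function \<open>g\<close> inserted
  into the weak equation, and it gives the uniform bound and the limit on plane waves.\<close>

lemma (in L1curve) frac_weak_flow:
  assumes s: "0 < s" "s < 1"
    and weak: "\<And>\<phi> g T. test_fun \<phi> \<Longrightarrow> is_frac_lap s \<phi> g \<Longrightarrow> 0 \<le> T \<Longrightarrow> (LINT x|lborel. u T x * \<phi> x) = (LINT x|lborel. u0 x * \<phi> x) +
      (LBINT \<tau>=0..T. (LINT y|lborel. u \<tau> y * (- g y - frechet_derivative \<phi> (at y) y)))"
  shows "weak_flow k u0 u (\<lambda>\<rho> \<eta> \<alpha> y. - levy.lg (sW s) sz (tf \<rho> \<eta> \<alpha>) y) (\<lambda>\<eta>. - of_real (norm \<eta> powr (2 * s)))"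
proof -
  interpret levy "sW s :: real \<times> 'a \<Rightarrow> real" sz by (rule stable_levy[OF s])
  note [measurable] = tf_meas
  show ?thesis
  proof unfold_locales
    show "continuous_on UNIV (\<lambda>\<eta>::'a. - complex_of_real (norm \<eta> powr (2 * s)))"
      using s by (intro continuous_intros continuous_on_powr') auto
    show "(\<lambda>y. - lg (tf \<rho> \<eta> \<alpha>) y) \<in> borel_measurable borel" for \<rho> \<alpha> and \<eta> :: 'a
      unfolding lg_def sd_def by measurable
  next
    fix H :: real
    obtain C where C: "\<And>\<rho> \<eta> \<alpha>. 0 \<le> \<rho> \<Longrightarrow> \<rho> \<le> 1 \<Longrightarrow> norm \<eta> \<le> H \<Longrightarrow> SD C (tf \<rho> (\<eta>::'a) \<alpha>)" using tf_SD[of H] by blast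
    show "\<exists>B. \<forall>\<rho> \<eta> \<alpha> x. 0 < \<rho> \<longrightarrow> \<rho> \<le> 1 \<longrightarrow> norm \<eta> \<le> H \<longrightarrow> \<bar>- lg (tf \<rho> \<eta> \<alpha>) x\<bar> \<le> B"
      using lg_bound[OF C tf_meas] by (intro exI[of _ "4 * C * mass"]) auto
  next
    fix r :: "nat \<Rightarrow> real" and \<eta> x :: 'a and \<alpha> :: real
    assume r: "r \<longlonglongrightarrow> 0" "\<And>n. 0 < r n" "\<And>n. r n \<le> 1"
    obtain C where C: "\<And>\<rho> \<eta>' \<alpha>. 0 \<le> \<rho> \<Longrightarrow> \<rho> \<le> 1 \<Longrightarrow> norm \<eta>' \<le> norm \<eta> \<Longrightarrow> SD C (tf \<rho> (\<eta>'::'a) \<alpha>)" using tf_SD[of "norm \<eta>"] by blast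
    have "(\<lambda>n. lg (tf (r n) \<eta> \<alpha>) x) \<longlonglongrightarrow> lg (\<lambda>x. cos (\<alpha> + x \<bullet> \<eta>)) x"
      by (rule lg_lim[OF C tf_meas tf_lim[OF r(1)]]) (use r in \<open>auto intro: less_imp_le\<close>)
    then have "(\<lambda>n. - lg (tf (r n) \<eta> \<alpha>) x) \<longlonglongrightarrow> - (cos (\<alpha> + x \<bullet> \<eta>) * norm \<eta> powr (2 * s))"
      unfolding lg_cos stable_symbol[OF s] by (rule tendsto_minus)
    moreover have "- (cos (\<alpha> + x \<bullet> \<eta>) * norm \<eta> powr (2 * s)) = Re ((- of_real (norm \<eta> powr (2 * s))) * cis (- (\<alpha> + x \<bullet> \<eta>)))"
    proof -
      have "(- of_real (norm \<eta> powr (2 * s))) * cis (- (\<alpha> + x \<bullet> \<eta>)) = (- (norm \<eta> powr (2 * s))) *\<^sub>R cis (- (\<alpha> + x \<bullet> \<eta>))"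
        by (simp only: scaleR_conv_of_real of_real_minus)
      then show ?thesis by (simp only: scaleR_complex.simps cis.simps cos_minus) simp
    qed
    ultimately show "(\<lambda>n. - lg (tf (r n) \<eta> \<alpha>) x) \<longlonglongrightarrow> Re (- of_real (norm \<eta> powr (2 * s)) * cis (- (\<alpha> + x \<bullet> \<eta>)))"
      by simp
  next
    fix \<rho> \<alpha> T :: real and \<eta> :: 'a assume r: "0 < \<rho>" "\<rho> \<le> 1" and T: "0 \<le> T"
    obtain C where "\<And>\<rho> \<eta>' \<alpha>. 0 \<le> \<rho> \<Longrightarrow> \<rho> \<le> 1 \<Longrightarrow> norm \<eta>' \<le> norm \<eta> \<Longrightarrow> SD C (tf \<rho> (\<eta>'::'a) \<alpha>)" using tf_SD[of "norm \<eta>"] by blast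
    then have S: "SD C (tf \<rho> \<eta> \<alpha>)" using r by simp
    show "(LINT x|lborel. u T x * tf \<rho> \<eta> \<alpha> x) = (LINT x|lborel. u0 x * tf \<rho> \<eta> \<alpha> x) +
      (LBINT \<tau>=0..T. (LINT y|lborel. u \<tau> y * (- lg (tf \<rho> \<eta> \<alpha>) y - frechet_derivative (tf \<rho> \<eta> \<alpha>) (at y) y)))"
      by (rule weak[OF tf_test_fun[OF r(1)] is_frac_lap_lg[OF S C1f_cont[OF tf_C1f] tf_bounded_support[OF r(1)] stable_symbol[OF s]] T])
  qed
qed

context kern
begin

lemma nonlocal_ou_curve:
  assumes e: "0 < \<epsilon>" and kk: "0 \<le> k" "k < 1" and uu: "prob_density u0" "in_L1k k u0" and curve: "L1k_curve k u0 u"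
    and weak: "\<And>\<phi> T. test_fun \<phi> \<Longrightarrow> 0 \<le> T \<Longrightarrow> (LINT x|lborel. u T x * \<phi> x) = (LINT x|lborel. u0 x * \<phi> x) +
      (LBINT \<tau>=0..T. (LINT y|lborel. u \<tau> y * (lam \<epsilon> * ((LINT z|lborel. rescale j \<epsilon> z * \<phi> (y + z)) - \<phi> y) - frechet_derivative \<phi> (at y) y)))"
  shows "ou_curve k (2 + C0) u0 u (Eps \<epsilon>)"
proof -
  interpret L1curve k u0 u by unfold_locales (use kk curve uu in auto)
  have wf: "weak_flow k u0 u (\<lambda>\<rho> \<eta> \<alpha> y. lam \<epsilon> * ((LINT z|lborel. rescale j \<epsilon> z * tf \<rho> \<eta> \<alpha> (y + z)) - tf \<rho> \<eta> \<alpha> y))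
    (\<lambda>\<eta>. of_real (lam \<epsilon>) * (fourier j (\<epsilon> *\<^sub>R \<eta>) - 1))"
    by (rule nonlocal_weak_flow[OF j e _ weak]) simp_all
  have E: "exp (LINT \<tau>|lborel. indicator {0..t} \<tau> *\<^sub>R (of_real (lam \<epsilon>) * (fourier j (\<epsilon> *\<^sub>R exp (- \<tau>) *\<^sub>R \<eta>) - 1))) = Eps \<epsilon> t \<eta>" for t \<eta>
  proof -
    have "(LINT \<tau>|lborel. indicator {0..t} \<tau> *\<^sub>R (of_real (lam \<epsilon>) * (fourier j (\<epsilon> *\<^sub>R exp (- \<tau>) *\<^sub>R \<eta>) - 1))) =
      (LINT \<tau>|lborel. - of_real (lam \<epsilon>) * (indicator {0..t} \<tau> *\<^sub>R a (exp (- \<tau>) *\<^sub>R \<epsilon> *\<^sub>R \<eta>)))"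
      by (intro Bochner_Integration.integral_cong refl) (simp add: a_def scaleR_conv_of_real algebra_simps)
    also have "\<dots> = - of_real (lam \<epsilon>) * At t (\<epsilon> *\<^sub>R \<eta>)" unfolding At_def by (rule integral_mult_right_zero)
    finally show ?thesis by (simp add: Eps_def)
  qed
  show ?thesis
  proof
    show "fourier (u t) \<xi> = fourier u0 (exp (- t) *\<^sub>R \<xi>) * Eps \<epsilon> t \<xi>" if "0 \<le> t" for t \<xi>
      using weak_flow.fourier_solution[OF wf that, of \<xi>] unfolding E .
    show "in_L1k k (u t)" if "0 \<le> t" for t using u_L1k[OF that] .
    show "1 - Re (Eps \<epsilon> t (r *\<^sub>R i)) \<le> (2 + C0) * min 1 r" if "0 \<le> t" "i \<in> Basis" "0 < r" for t i r
      by (rule Eps_mom[OF e that(3,2)])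
  qed (use kk uu Eps_gp e Eps_0 Eps_le in auto)
qed

text \<open>The integral of exp (- 2 s \<tau>) over [0, t], the scale of the stable noise
  accumulated so far; its limit is 1 / (2 s).\<close>

definition ct :: "real \<Rightarrow> real" where "ct t = (1 - exp (- (2 * s * t))) / (2 * s)"

text \<open>The lower bound 1 / 4 at time 1 is what \<open>St_integrable\<close> asks for, so after
  unit time the noise has a density.\<close>

lemma ct_bounds: "0 \<le> t \<Longrightarrow> 0 \<le> ct t" "ct t \<le> 1" "1 \<le> t \<Longrightarrow> 1 / 4 \<le> ct 1 \<and> ct 1 \<le> ct t"
proof -
  show "0 \<le> t \<Longrightarrow> 0 \<le> ct t" unfolding ct_def using s by (intro divide_nonneg_pos) auto
  have "1 - exp (- (2 * s * t)) \<le> 1 * (2 * s)" using s exp_ge_zero[of "- (2 * s * t)"] by linarith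
  then show "ct t \<le> 1" unfolding ct_def using s by (subst pos_divide_le_eq) auto
  assume t: "1 \<le> t"
  have "exp (- (2 * s * 1)) \<le> exp (- 1)" using s by simp
  also have "exp (- 1 :: real) \<le> 1 / 2" using exp_ge_add_one_self[of "1::real"] by (simp add: exp_minus field_simps)
  finally have "1 / 4 * (2 * s) \<le> 1 - exp (- (2 * s * 1))" using s by linarith
  then have a: "1 / 4 \<le> ct 1" unfolding ct_def using s by (subst pos_le_divide_eq) auto
  have "s * 1 \<le> s * t" using s t by (intro mult_left_mono) auto
  then have "ct 1 \<le> ct t" unfolding ct_def using s by (intro divide_right_mono diff_left_mono) auto
  then show "1 / 4 \<le> ct 1 \<and> ct 1 \<le> ct t" using a by simp
qed

lemma frac_ou_curve:
  assumes kk: "0 \<le> k" "k < 1" and uu: "prob_density u0" "in_L1k k u0" and curve: "L1k_curve k u0 u"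
    and weak: "\<And>\<phi> g T. test_fun \<phi> \<Longrightarrow> is_frac_lap s \<phi> g \<Longrightarrow> 0 \<le> T \<Longrightarrow> (LINT x|lborel. u T x * \<phi> x) = (LINT x|lborel. u0 x * \<phi> x) +
      (LBINT \<tau>=0..T. (LINT y|lborel. u \<tau> y * (- g y - frechet_derivative \<phi> (at y) y)))"
  shows "ou_curve k (2 + C0) u0 u (\<lambda>t. St (ct t))"
proof -
  interpret L1curve k u0 u by unfold_locales (use kk curve uu in auto)
  have s01: "0 < s" "s < 1" using s by auto
  have wf: "weak_flow k u0 u (\<lambda>\<rho> \<eta> \<alpha> y. - levy.lg (sW s) sz (tf \<rho> \<eta> \<alpha>) y) (\<lambda>\<eta>. - of_real (norm \<eta> powr (2 * s)))"
    by (rule frac_weak_flow[OF s01 weak])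
  have E: "exp (LINT \<tau>|lborel. indicator {0..t} \<tau> *\<^sub>R (- complex_of_real (norm (exp (- \<tau>) *\<^sub>R \<eta>) powr (2 * s)))) = St (ct t) \<eta>"
    if t: "0 \<le> t" for t and \<eta> :: 'a
  proof -
    have e: "norm (exp (- \<tau>) *\<^sub>R \<eta>) powr (2 * s) = norm \<eta> powr (2 * s) * exp (- (2 * s * \<tau>))" for \<tau>
      by (simp add: powr_mult exp_powr_real mult.commute)
    have I: "(LINT \<tau>|lborel. exp (- (2 * s * \<tau>)) * indicator {0..t} \<tau>) = ct t"
    proof -
      have "(LINT \<tau>|lborel. exp (- (2 * s * \<tau>)) * indicator {0..t} \<tau>) = - exp (- (2 * s * t)) / (2 * s) - (- exp (- (2 * s * 0)) / (2 * s))"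
        by (rule integral_FTC_Icc_real[OF t]) (use s in \<open>auto intro!: derivative_eq_intros continuous_intros\<close>)
      then show ?thesis by (simp add: ct_def diff_divide_distrib)
    qed
    have "(LINT \<tau>|lborel. indicator {0..t} \<tau> *\<^sub>R (- complex_of_real (norm (exp (- \<tau>) *\<^sub>R \<eta>) powr (2 * s)))) =
      (LINT \<tau>|lborel. of_real ((- (norm \<eta> powr (2 * s))) * (exp (- (2 * s * \<tau>)) * indicator {0..t} \<tau>)))"
      unfolding e by (intro Bochner_Integration.integral_cong refl) (simp add: scaleR_conv_of_real mult_ac)
    also have "\<dots> = of_real ((- (norm \<eta> powr (2 * s))) * ct t)"
      by (simp only: integral_complex_of_real integral_mult_right_zero I)
    finally show ?thesis by (simp only: St_def exp_of_real) (simp add: mult.commute)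
  qed
  show ?thesis
  proof
    show "fourier (u t) \<xi> = fourier u0 (exp (- t) *\<^sub>R \<xi>) * St (ct t) \<xi>" if "0 \<le> t" for t \<xi>
      using weak_flow.fourier_solution[OF wf that, of \<xi>] unfolding E[OF that] .
    show "in_L1k k (u t)" if "0 \<le> t" for t using u_L1k[OF that] .
    show "1 - Re (St (ct t) (r *\<^sub>R i)) \<le> (2 + C0) * min 1 r" if "0 \<le> t" "i \<in> Basis" "0 < r" for t i r
      by (rule St_mom[OF ct_bounds(1)[OF that(1)] ct_bounds(2) that(3,2)])
    show "gp (St (ct t))" if "0 \<le> t" for t by (rule St_gp[OF ct_bounds(1)[OF that]])
    show "cmod (St (ct t) \<xi>) \<le> 1" if "0 \<le> t" for t \<xi> by (rule St_le[OF ct_bounds(1)[OF that]])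
    show "St (ct t) 0 = 1" for t using s by (simp add: St_def)
  qed (use kk uu St_cont in auto)
qed

lemma nonlocal_convergence:
  assumes "0 < \<epsilon>" "ou_curve k (2 + C0) u0 u (Eps \<epsilon>)" "prob_density F" "\<And>\<xi>. fourier F \<xi> = Feps \<epsilon> \<xi>"
  shows "((\<lambda>t. L1k_norm k (\<lambda>x. u t x - F x)) \<longlongrightarrow> 0) at_top"
proof (rule ou_curve.L1k_convergence[OF assms(2,3)])
  show "fourier F \<xi> = fourier F (exp (- t) *\<^sub>R \<xi>) * Eps \<epsilon> t \<xi>" if "0 \<le> t" for t \<xi>
    unfolding assms(4) by (rule Feps_stationary[OF that])
  show "((\<lambda>t. Eps \<epsilon> t \<xi>) \<longlongrightarrow> fourier F \<xi>) at_top" for \<xi> unfolding assms(4) by (rule Eps_lim)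
qed (rule Eps_dec[OF assms(1)])

lemma frac_convergence:
  assumes ou: "ou_curve k (2 + C0) u0 u (\<lambda>t. St (ct t))" and G: "prob_density G" "\<And>\<xi>. fourier G \<xi> = St (1 / (2 * s)) \<xi>"
    and P: "\<And>x::real. 0 \<le> x \<Longrightarrow> x powr 0 * exp (- x / 4) * (1 + x\<^sup>2) ^ DIM('a) \<le> P1"
  shows "((\<lambda>t. L1k_norm k (\<lambda>x. u t x - G x)) \<longlongrightarrow> 0) at_top"
proof (rule ou_curve.L1k_convergence[OF ou G(1)])
  have St_add: "St c \<xi> * St d \<xi> = St (c + d) \<xi>" for c d and \<xi> :: 'a
    by (simp add: St_def ring_distribs flip: exp_add of_real_mult)
  show "fourier G \<xi> = fourier G (exp (- t) *\<^sub>R \<xi>) * St (ct t) \<xi>" for t \<xi>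
  proof -
    have "St (1 / (2 * s)) (exp (- t) *\<^sub>R \<xi>) = St (exp (- (2 * s * t)) / (2 * s)) \<xi>"
      by (simp add: St_def powr_mult exp_powr_real mult_ac)
    moreover have "exp (- (2 * s * t)) / (2 * s) + ct t = 1 / (2 * s)" by (simp add: ct_def flip: add_divide_distrib)
    ultimately show ?thesis unfolding G(2) by (simp only: St_add)
  qed
  show "((\<lambda>t. St (ct t) \<xi>) \<longlongrightarrow> fourier G \<xi>) at_top" for \<xi>
  proof -
    have "filterlim (\<lambda>t. 2 * s * t) at_top at_top"
      by (rule filterlim_tendsto_pos_mult_at_top[OF tendsto_const _ filterlim_ident]) (use s in simp)
    then have "((\<lambda>t. exp (- (2 * s * t))) \<longlongrightarrow> 0) at_top"
      by (intro filterlim_compose[OF exp_at_bot] filterlim_uminus_at_bot_at_top[THEN filterlim_compose])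
    then have "((\<lambda>t. ct t) \<longlongrightarrow> (1 - 0) / (2 * s)) at_top" unfolding ct_def using s by (intro tendsto_intros) auto
    then show ?thesis unfolding G(2) St_def by (intro tendsto_intros) simp
  qed
  fix \<kappa> :: real assume \<kappa>: "0 < \<kappa>"
  have c1: "1 / 4 \<le> ct 1" "0 \<le> ct 1" using ct_bounds(3)[of 1] by auto
  \<comment> \<open>The stable noise of the first unit of time has the density \<open>h\<close>, and
    what comes later is a multiplier with value 1 at 0. No atom remains, so the first multiplier can
    be taken as 0.\<close>
  have Si: "integrable lborel (St (ct 1))" by (rule St_integrable[OF P c1(1)])
  obtain h where h: "integrable lborel h" "\<And>\<xi>. fourier h \<xi> = St (ct 1) \<xi>"
    using gp_inversion[OF St_gp[OF c1(2)] Si St_cont] by metis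
  have z: "gp (\<lambda>\<xi>::'a. 0)" using gp_scale[OF gp_const, of 0] by simp
  show "\<exists>h b T. integrable lborel h \<and> 0 \<le> b \<and> (\<forall>t\<ge>T. \<exists>\<rho>1 \<rho>2. gp \<rho>1 \<and> continuous_on UNIV \<rho>1 \<and>
       gp \<rho>2 \<and> continuous_on UNIV \<rho>2 \<and> Re (\<rho>1 0) \<le> \<kappa> \<and> Re (\<rho>2 0) \<le> b \<and> (\<forall>\<xi>. St (ct t) \<xi> = \<rho>1 \<xi> + fourier h \<xi> * \<rho>2 \<xi>))"
  proof (intro exI[of _ h] exI[of _ "1::real"] conjI allI impI)
    fix t :: real assume t: "1 \<le> t"
    then have d: "0 \<le> ct t - ct 1" using ct_bounds(3) by simp
    show "\<exists>\<rho>1 \<rho>2. gp \<rho>1 \<and> continuous_on UNIV \<rho>1 \<and>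
       gp \<rho>2 \<and> continuous_on UNIV \<rho>2 \<and> Re (\<rho>1 0) \<le> \<kappa> \<and> Re (\<rho>2 0) \<le> 1 \<and> (\<forall>\<xi>. St (ct t) \<xi> = \<rho>1 \<xi> + fourier h \<xi> * \<rho>2 \<xi>)"
      by (intro exI[of _ "\<lambda>\<xi>. 0"] exI[of _ "St (ct t - ct 1)"] conjI allI z St_gp[OF d] St_cont)
        (use \<kappa> s in \<open>auto simp: h St_add intro: St_def\<close>, simp add: St_def)
  qed (use h in auto)
qed

end

section \<open>Assembly of the estimate\<close>

lemma L1k_norm_triangle:
  fixes f g h :: "'a::euclidean_space \<Rightarrow> real"
  assumes "in_L1k k f" "in_L1k k g" "in_L1k k h"
  shows "L1k_norm k (\<lambda>x. f x - h x) \<le> L1k_norm k (\<lambda>x. f x - g x) + L1k_norm k (\<lambda>x. g x - h x)"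
proof -
  have i: "integrable lborel (\<lambda>x. jbr x powr k * \<bar>a x - b x\<bar>)" if "in_L1k k a" "in_L1k k b" for a b :: "'a \<Rightarrow> real"
  proof -
    have "integrable lborel (\<lambda>x. \<bar>jbr x powr k * a x - jbr x powr k * b x\<bar>)"
      using that unfolding in_L1k_def by (intro integrable_abs Bochner_Integration.integrable_diff) auto
    then show ?thesis by (simp add: abs_mult flip: right_diff_distrib)
  qed
  have "L1k_norm k (\<lambda>x. f x - h x) \<le> (LINT x|lborel. jbr x powr k * \<bar>f x - g x\<bar> + jbr x powr k * \<bar>g x - h x\<bar>)"
    unfolding L1k_norm_def
  proof (rule integral_mono)
    show "jbr x powr k * \<bar>f x - h x\<bar> \<le> jbr x powr k * \<bar>f x - g x\<bar> + jbr x powr k * \<bar>g x - h x\<bar>" for x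
      unfolding distrib_left[symmetric] by (intro mult_left_mono) auto
  qed (use i assms in auto)
  then show ?thesis using i assms by (simp add: L1k_norm_def)
qed

lemma L1k_norm_diff_le: "in_L1k k f \<Longrightarrow> in_L1k k h \<Longrightarrow> L1k_norm k (\<lambda>x. f x - h x) \<le> L1k_norm k f + L1k_norm k h"
  using L1k_norm_triangle[of k f "\<lambda>x. 0" h] by (simp add: in_L1k_def L1k_norm_def)

lemma L1k_norm_minus: "L1k_norm k (\<lambda>x. f x - h x) = L1k_norm k (\<lambda>x. h x - f x)"
  by (simp add: L1k_norm_def abs_minus_commute)

text \<open>Both solutions are followed until each is within the target power of \<epsilon> of its
  equilibrium, which accounts for the 2 added to \<open>K\<close>. The waiting time may depend on
  everything, whereas \<open>K\<close> involves neither s nor \<epsilon> nor the data.\<close>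

lemma (in kern) small_estimate:
  assumes e: "0 < \<epsilon>" "\<epsilon> \<le> 1" "\<epsilon> \<le> (r0 \<delta> C0)\<^sup>2 / 48 / (2 * DIM('a) + \<delta>)" and k: "0 \<le> k" "k < m" "m < 1"
    and P: "\<And>x. 0 \<le> x \<Longrightarrow> x powr 0 * exp (- x / 4) * (1 + x\<^sup>2) ^ DIM('a) \<le> P1"
      "\<And>x. 0 \<le> x \<Longrightarrow> x powr (2 + \<delta>) * exp (- x / 4) * (1 + x\<^sup>2) ^ DIM('a) \<le> P2"
      "\<And>x. 0 \<le> x \<Longrightarrow> x powr \<delta> * exp (- x / 4) * (1 + x\<^sup>2) ^ DIM('a) \<le> P3"
    and u: "ou_curve k (2 + C0) u0 u (Eps \<epsilon>)" and v: "ou_curve k (2 + C0) v0 v (\<lambda>t. St (ct t))"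
    and L: "L = 2 * C0 * (P1 + P2) + r0 \<delta> C0 powr (- \<delta>) * (((2 * DIM('a) + \<delta>) / ((r0 \<delta> C0)\<^sup>2 / 48)) powr (2 * DIM('a) + \<delta>) * (1 + 1 / (r0 \<delta> C0)\<^sup>2) ^ DIM('a) + 2 * P3)"
    and K: "K = (LINT \<xi>|lborel. wt (\<xi>::'a)) / (2 * pi) ^ DIM('a) * L\<^sup>2 + unit_ball_vol (real DIM('a)) + 2 * (1 + DIM('a) * ((2 + C0) * (LINT r|lborel. min 1 r * qq m r) / cm m))"
  shows "\<exists>T>0. \<forall>t\<ge>T. L1k_norm k (\<lambda>x. u t x - v t x) \<le> (K + 2) * \<epsilon> powr ((m - k) / (m + real DIM('a) / 2) * \<delta>)"
proof -
  let ?q = "\<epsilon> powr ((m - k) / (m + real DIM('a) / 2) * \<delta>)"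
  have q: "0 < ?q" using e by simp
  have diff: "cmod (Feps \<epsilon> \<xi> - St (1 / (2 * s)) \<xi>) \<le> L * \<epsilon> powr \<delta> * wt \<xi>" for \<xi>
    unfolding L by (rule stationary_difference[OF e P])
  obtain F G where F: "prob_density F" "\<And>\<xi>. fourier F \<xi> = Feps \<epsilon> \<xi>" "in_L1k k F"
    and G: "prob_density G" "\<And>\<xi>. fourier G \<xi> = St (1 / (2 * s)) \<xi>" "in_L1k k G"
    and FG: "L1k_norm k (\<lambda>x. F x - G x) \<le> ((LINT \<xi>|lborel. wt (\<xi>::'a)) / (2 * pi) ^ DIM('a) * L\<^sup>2 + unit_ball_vol (real DIM('a)) + 2 * MM m) * ?q"
    by (rule stationary_estimate[OF e(1,2) k _ diff], rule P(1), assumption, rule that; assumption)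
  have FG: "L1k_norm k (\<lambda>x. F x - G x) \<le> K * ?q" using FG by (simp add: K MM_def)
  have "eventually (\<lambda>t. L1k_norm k (\<lambda>x. u t x - F x) < ?q) at_top"
    by (rule order_tendstoD(2)[OF nonlocal_convergence[OF e(1) u F(1,2)] q])
  moreover have "eventually (\<lambda>t. L1k_norm k (\<lambda>x. v t x - G x) < ?q) at_top"
    by (rule order_tendstoD(2)[OF frac_convergence[OF v G(1,2) P(1)] q])
  moreover have "eventually (\<lambda>t::real. 0 \<le> t) at_top" by (rule eventually_ge_at_top)
  ultimately have "eventually (\<lambda>t. L1k_norm k (\<lambda>x. u t x - v t x) \<le> (K + 2) * ?q) at_top"
  proof eventually_elim
    case (elim t)
    have ut: "in_L1k k (u t)" by (rule ou_curve.u[OF u elim(3)])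
    have vt: "in_L1k k (v t)" by (rule ou_curve.u[OF v elim(3)])
    have "L1k_norm k (\<lambda>x. u t x - v t x) \<le> L1k_norm k (\<lambda>x. u t x - F x) + L1k_norm k (\<lambda>x. F x - v t x)"
      by (rule L1k_norm_triangle[OF ut F(3) vt])
    also have "L1k_norm k (\<lambda>x. F x - v t x) \<le> L1k_norm k (\<lambda>x. F x - G x) + L1k_norm k (\<lambda>x. G x - v t x)"
      by (rule L1k_norm_triangle[OF F(3) G(3) vt])
    also have "L1k_norm k (\<lambda>x. G x - v t x) = L1k_norm k (\<lambda>x. v t x - G x)" by (rule L1k_norm_minus)
    also have "L1k_norm k (\<lambda>x. u t x - F x) + (L1k_norm k (\<lambda>x. F x - G x) + L1k_norm k (\<lambda>x. v t x - G x)) \<le> ?q + (K * ?q + ?q)"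
      using elim FG by (intro add_mono) auto
    also have "\<dots> = (K + 2) * ?q" by (simp add: algebra_simps)
    finally show ?case by simp
  qed
  then obtain T where "\<And>t. T \<le> t \<Longrightarrow> L1k_norm k (\<lambda>x. u t x - v t x) \<le> (K + 2) * ?q"
    unfolding eventually_at_top_linorder by blast
  then show ?thesis by (intro exI[of _ "max T 1"]) auto
qed

theorem theorem4p7:
  fixes J :: "real \<Rightarrow> 'a::euclidean_space \<Rightarrow> real"
    and \<delta> k m :: real and u0 v0 :: "'a \<Rightarrow> real"
  assumes "H1 J \<delta>"
    and "0 \<le> k" and "k < m" and "m < 1"
    and "prob_density u0" and "in_L1k k u0"
    and "prob_density v0" and "in_L1k k v0"
  shows "\<exists>C. \<forall>s \<in> {1/2<..<1}. \<forall>\<epsilon> \<in> {0<..1}. \<forall>u v.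
           nonlocal_sol J s \<epsilon> k u0 u \<longrightarrow> frac_sol s k v0 v \<longrightarrow>
           (\<exists>T>0. \<forall>t\<ge>T. L1k_norm k (\<lambda>x. u t x - v t x)
               \<le> C * \<epsilon> powr ((m - k) / (m + real DIM('a) / 2) * \<delta>))"
proof -
  have \<delta>: "0 < \<delta>" using assms(1) by (simp add: H1_def)
  obtain C0 where C0: "0 < C0" "\<And>s \<xi>. s \<in> {1/2<..<1} \<Longrightarrow> norm (\<xi>::'a) \<le> 1 \<Longrightarrow>
      cmod (fourier (J s) \<xi> - complex_of_real (1 - norm \<xi> powr (2 * s))) \<le> C0 * norm \<xi> powr (2 * s + \<delta>)"
    using assms(1) unfolding H1_def by blast
  have J: "prob_density (J s)" if "s \<in> {1/2<..<1}" for s using assms(1) that unfolding H1_def by blast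
  have kern: "kern s \<delta> C0 (J s)" if "s \<in> {1/2<..<1}" for s
    by unfold_locales (use that J C0 \<delta> in auto)
  obtain P1 where P1: "\<And>x::real. 0 \<le> x \<Longrightarrow> x powr 0 * exp (- x / 4) * (1 + x\<^sup>2) ^ DIM('a) \<le> P1"
    using powr_exp_bound[of 0 "DIM('a)"] by blast
  obtain P2 where P2: "\<And>x::real. 0 \<le> x \<Longrightarrow> x powr (2 + \<delta>) * exp (- x / 4) * (1 + x\<^sup>2) ^ DIM('a) \<le> P2"
    using powr_exp_bound[of "2 + \<delta>" "DIM('a)"] \<delta> by auto
  obtain P3 where P3: "\<And>x::real. 0 \<le> x \<Longrightarrow> x powr \<delta> * exp (- x / 4) * (1 + x\<^sup>2) ^ DIM('a) \<le> P3"
    using powr_exp_bound[of \<delta> "DIM('a)"] \<delta> by auto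
  define L where "L = 2 * C0 * (P1 + P2) + r0 \<delta> C0 powr (- \<delta>) * (((2 * DIM('a) + \<delta>) / ((r0 \<delta> C0)\<^sup>2 / 48)) powr (2 * DIM('a) + \<delta>) * (1 + 1 / (r0 \<delta> C0)\<^sup>2) ^ DIM('a) + 2 * P3)"
  define K where "K = (LINT \<xi>|lborel. wt (\<xi>::'a)) / (2 * pi) ^ DIM('a) * L\<^sup>2 + unit_ball_vol (real DIM('a)) + 2 * (1 + DIM('a) * ((2 + C0) * (LINT r|lborel. min 1 r * qq m r) / cm m))"
  \<comment> \<open>The bound of \<open>u_norm_bound\<close>, valid for all nonnegative times and
    free of s and \<epsilon>.\<close>
  define B where "B w = 1 + (\<Sum>i\<in>Basis. 1 + 2 * ((2 + C0) * (LINT r|lborel. min 1 r * qq k r) / cm k) + 2 * (LINT x|lborel. \<bar>x \<bullet> i\<bar> powr k * w x))" for w :: "'a \<Rightarrow> real"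
  \<comment> \<open>The threshold required by \<open>small_estimate\<close>; it is independent of s
    because \<open>r0\<close> is.\<close>
  define \<epsilon>0 where "\<epsilon>0 = (r0 \<delta> C0)\<^sup>2 / 48 / (2 * DIM('a) + \<delta>)"
  define q where "q = (m - k) / (m + real DIM('a) / 2) * \<delta>"
  \<comment> \<open>The second summand serves \<epsilon> > \<epsilon>0, where \<epsilon>^q >=
    \<epsilon>0^q and the norms of both solutions are bounded at all times; any positive T will do
    there.\<close>
  define C where "C = \<bar>K + 2\<bar> + \<bar>B u0 + B v0\<bar> / \<epsilon>0 powr q"
  have "0 < r0 \<delta> C0" using C0(1) by (simp add: r0_def)
  then have \<epsilon>0: "0 < \<epsilon>0" unfolding \<epsilon>0_def using \<delta> by (intro divide_pos_pos) (auto intro: add_nonneg_pos)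
  have q: "0 \<le> q" unfolding q_def using assms(2-4) \<delta> by simp
  have p: "0 < \<epsilon>0 powr q" using \<epsilon>0 by simp
  show ?thesis
  proof (rule exI[of _ C], intro ballI allI impI)
    fix s \<epsilon> u v
    assume s: "s \<in> {1/2<..<1}" and e: "\<epsilon> \<in> {0<..(1::real)}" and u: "nonlocal_sol J s \<epsilon> k u0 u" and v: "frac_sol s k v0 v"
    interpret kern s \<delta> C0 "J s" by (rule kern[OF s])
    have k: "0 \<le> k" "k < 1" using assms(2-4) by auto
    have U: "ou_curve k (2 + C0) u0 u (Eps \<epsilon>)"
      by (rule nonlocal_ou_curve) (use u e k assms(5,6) in \<open>auto simp: nonlocal_sol_def\<close>)
    have V: "ou_curve k (2 + C0) v0 v (\<lambda>t. St (ct t))"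
      by (rule frac_ou_curve) (use v k assms(7,8) in \<open>auto simp: frac_sol_def\<close>)
    have "\<exists>T>0. \<forall>t\<ge>T. L1k_norm k (\<lambda>x. u t x - v t x) \<le> C * \<epsilon> powr q"
    proof (cases "\<epsilon> \<le> \<epsilon>0")
      case True
      have "\<exists>T>0. \<forall>t\<ge>T. L1k_norm k (\<lambda>x. u t x - v t x) \<le> (K + 2) * \<epsilon> powr q"
        unfolding q_def by (rule small_estimate[OF _ _ True[unfolded \<epsilon>0_def] assms(2-4) P1 P2 P3 U V L_def K_def]) (use e in auto)
      moreover have "(K + 2) * \<epsilon> powr q \<le> C * \<epsilon> powr q" unfolding C_def using p by (intro mult_right_mono) (auto simp: add_increasing2)
      ultimately show ?thesis by (meson order_trans)
    next
      case False
      have "L1k_norm k (\<lambda>x. u t x - v t x) \<le> C * \<epsilon> powr q" if t: "1 \<le> t" for t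
      proof -
        have t0: "0 \<le> t" using t by simp
        have "L1k_norm k (\<lambda>x. u t x - v t x) \<le> L1k_norm k (u t) + L1k_norm k (v t)"
          by (rule L1k_norm_diff_le[OF ou_curve.u[OF U t0] ou_curve.u[OF V t0]])
        also have "\<dots> \<le> B u0 + B v0" unfolding B_def by (intro add_mono ou_curve.u_norm_bound[OF U t0] ou_curve.u_norm_bound[OF V t0])
        also have "\<dots> \<le> \<bar>B u0 + B v0\<bar> / \<epsilon>0 powr q * \<epsilon>0 powr q" using p by simp
        also have "\<dots> \<le> \<bar>B u0 + B v0\<bar> / \<epsilon>0 powr q * \<epsilon> powr q"
          using False \<epsilon>0 q p by (intro mult_left_mono powr_mono2) auto
        also have "\<dots> \<le> C * \<epsilon> powr q" unfolding C_def by (intro mult_right_mono) auto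
        finally show ?thesis .
      qed
      then show ?thesis by (intro exI[of _ 1]) auto
    qed
    then show "\<exists>T>0. \<forall>t\<ge>T. L1k_norm k (\<lambda>x. u t x - v t x) \<le> C * \<epsilon> powr ((m - k) / (m + real DIM('a) / 2) * \<delta>)"
      unfolding q_def .
  qed
qed

end
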